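(* Let $(M,g)$ be an oriented Riemannian $4$-manifold endowed with a metric connection $D$ with (totally) skew-symmetric torsion, and let $\mathcal Z_{+}$ be the positive twistor space of $(M,g)$. The Atiyah-Hitchin-Singer almost complex structure $\mathcal J_1$ on $\mathcal Z_{+}$ defined by means of $D$ is integrable if and only if the metric $g$ is anti-self-dual.
   Context: A metric connection $D$ on $TM$ (i.e. $Dg=0$) with torsion tensor $T$ has skew-symmetric torsion if the trilinear form $\mathcal T(X,Y,Z)=g(T(X,Y),Z)$ is totally skew-symmetric. Positive twistor space: let $A(TM)$ be the bundle of $g$-skew-symmetric endomorphisms of $TM$, with the connection induced by $D$, $(D_Xa)(Y)=D_X(aY)-a(D_XY)$. $\pi:\mathcal Z_{+}\to M$ is the subbundle of $A(TM)$ whose fibre at $p$ consists of all $g$-orthogonal complex structures $J$ on $T_pM$ inducing the given orientation (bases of the form $(E_1,JE_1,E_3,JE_3)$ are positively oriented). (Equivalently, under the isomorphism $\Lambda^2TM\cong A(TM)$, $a\mapsto K_a$, $g(K_aX,Y)=2g(a,X\wedge Y)$, where $g(v_1\wedge v_2,v_3\wedge v_4)=\frac12\det[g(v_i,v_j)]$ denotes the metric on $\Lambda^2TM$ equal to one half of the standard one, it is the unit sphere bundle of the bundle $\Lambda^2_{+}TM$ of self-dual $2$-vectors.) For $J\in\mathcal Z_{+}$, $p=\pi(J)$, the vertical space (tangent space of the fibre) is $\mathcal V_J=\{V\in A(T_pM): VJ+JV=0\}$. For $X\in T_pM$ the horizontal lift is $X^h_J=s_{\ast}X-D_Xs\in T_J\mathcal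 Z_{+}$, where $s$ is any local section of $\mathcal Z_{+}$ with $s(p)=J$; the horizontal space is $\mathcal H_J=\{X^h_J:X\in T_pM\}$, and $T_J\mathcal Z_{+}=\mathcal H_J\oplus\mathcal V_J$. The Atiyah-Hitchin-Singer almost complex structure $\mathcal J_1$ defined by means of $D$ is: $\mathcal J_1X^h_J=(JX)^h_J$ for $X\in T_{\pi(J)}M$, and $\mathcal J_1V=J\circ V$ for $V\in\mathcal V_J$. Integrable means that its Nijenhuis tensor vanishes identically. Let $\mathcal W:\Lambda^2TM\to\Lambda^2TM$ be the endomorphism corresponding to the Weyl conformal tensor of $g$; it preserves $\Lambda^2_{\pm}TM$, the $(\pm1)$-eigenbundles of the Hodge star operator; $\mathcal W_{\pm}$ is its restriction to $\Lambda^2_{\pm}TM$. The metric $g$ is anti-self-dual if $\mathcal W_{+}=0$. *)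

theory Defs
  imports "HOL-Analysis.Analysis" "HOL-Library.Function_Algebras"
begin

text \<open>The notion of C^k map below is meant for open sets only.\<close>

primrec Ck_on :: "nat \<Rightarrow> 'e::euclidean_space set \<Rightarrow> ('e \<Rightarrow> 'f::real_normed_vector) \<Rightarrow> bool" where
  "Ck_on 0 S f \<longleftrightarrow> continuous_on S f"
| "Ck_on (Suc k) S f \<longleftrightarrow>
     (\<forall>x\<in>S. f differentiable (at x)) \<and>
     (\<forall>v. Ck_on k S (\<lambda>x. frechet_derivative f (at x) v))"

definition smooth_on :: "'e::euclidean_space set \<Rightarrow> ('e \<Rightarrow> 'f::real_normed_vector) \<Rightarrow> bool" where
  "smooth_on S f \<longleftrightarrow> (\<forall>k. Ck_on k S f)"

text \<open>A chart is a pair of a domain and a coordinate map; an atlas is a set of charts.\<close>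

type_synonym ('a, 'e) chart = "'a set \<times> ('a \<Rightarrow> 'e)"

definition points :: "('a, 'e) chart set \<Rightarrow> 'a set" where
  "points A = \<Union>(fst ` A)"

definition smooth_manifold :: "'a topology \<Rightarrow> ('a, 'e::euclidean_space) chart set \<Rightarrow> bool" where
  "smooth_manifold X A \<longleftrightarrow>
     Hausdorff_space X \<and> second_countable X \<and> topspace X = points A \<and>
     (\<forall>(U, \<phi>)\<in>A. openin X U \<and> open (\<phi> ` U) \<and>
        homeomorphic_map (subtopology X U) (top_of_set (\<phi> ` U)) \<phi>) \<and>
     (\<forall>(U, \<phi>)\<in>A. \<forall>(V, \<psi>)\<in>A. smooth_on (\<phi> ` (U \<inter> V)) (\<psi> \<circ> inv_into U \<phi>))"

text \<open>An orientation is given by an atlas with orientation preserving transition maps.\<close>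

definition oriented_manifold :: "'a topology \<Rightarrow> ('a, real^'n) chart set \<Rightarrow> bool" where
  "oriented_manifold X A \<longleftrightarrow>
     smooth_manifold X A \<and>
     (\<forall>(U, \<phi>)\<in>A. \<forall>(V, \<psi>)\<in>A. \<forall>x\<in>\<phi> ` (U \<inter> V).
        0 < det (matrix (frechet_derivative (\<psi> \<circ> inv_into U \<phi>) (at x))))"

text \<open>
  The next notions concern a subset \<open>S\<close> of the manifold with atlas \<open>A\<close>. They are used in two cases:
  \<open>S\<close> is the whole manifold, or \<open>S\<close> is an embedded submanifold, whose smooth functions are locally
  the restrictions of smooth functions of the ambient manifold.
\<close>

definition nearby :: "('a, 'e::euclidean_space) chart set \<Rightarrow> 'a set \<Rightarrow> 'a \<Rightarrow> ('a \<Rightarrow> bool) \<Rightarrow> bool" where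
  "nearby A S p P \<longleftrightarrow>
     (\<exists>(U, \<phi>)\<in>A. p \<in> U \<and>
        (\<exists>W. open W \<and> \<phi> p \<in> W \<and> (\<forall>q\<in>S. q \<in> U \<and> \<phi> q \<in> W \<longrightarrow> P q)))"

definition smooth_near :: "('a, 'e::euclidean_space) chart set \<Rightarrow> 'a set \<Rightarrow> 'a \<Rightarrow> ('a \<Rightarrow> real) \<Rightarrow> bool" where
  "smooth_near A S p f \<longleftrightarrow>
     (\<exists>(U, \<phi>)\<in>A. p \<in> U \<and>
        (\<exists>W F. open W \<and> \<phi> p \<in> W \<and> smooth_on W F \<and>
           (\<forall>q\<in>S. q \<in> U \<and> \<phi> q \<in> W \<longrightarrow> f q = F (\<phi> q))))"

text \<open>
  Tangent vectors are derivations of the algebra of functions which are smooth near the point,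
  extended by 0 to all other functions. The Leibniz rule makes them depend on germs only (apply it
  to indicator functions), so that no quotient by equality of germs is needed.
  Addition and subtraction of tangent vectors are the pointwise operations on functions.
\<close>

type_synonym 'a tvec = "('a \<Rightarrow> real) \<Rightarrow> real"

definition fscale :: "real \<Rightarrow> ('b \<Rightarrow> real) \<Rightarrow> 'b \<Rightarrow> real" (infixr "*\<^sub>F" 75) where
  "c *\<^sub>F v = (\<lambda>x. c * v x)"

definition linear_map_on :: "('b \<Rightarrow> real) set \<Rightarrow> (('b \<Rightarrow> real) \<Rightarrow> ('c \<Rightarrow> real)) \<Rightarrow> bool" where
  "linear_map_on V f \<longleftrightarrow>
     (\<forall>x\<in>V. \<forall>y\<in>V. \<forall>a b. f (a *\<^sub>F x + b *\<^sub>F y) = a *\<^sub>F f x + b *\<^sub>F f y)"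

definition tangent_space :: "('a, 'e::euclidean_space) chart set \<Rightarrow> 'a set \<Rightarrow> 'a \<Rightarrow> 'a tvec set" where
  "tangent_space A S p = {v.
     (\<forall>f h a b. smooth_near A S p f \<and> smooth_near A S p h \<longrightarrow>
        v (\<lambda>q. a * f q + b * h q) = a * v f + b * v h) \<and>
     (\<forall>f h. smooth_near A S p f \<and> smooth_near A S p h \<longrightarrow>
        v (\<lambda>q. f q * h q) = f p * v h + h p * v f) \<and>
     (\<forall>f. \<not> smooth_near A S p f \<longrightarrow> v f = 0)}"

text \<open>Vector fields defined and smooth near \<open>p\<close>; their values away from \<open>p\<close> are arbitrary.\<close>

definition vfield_near :: "('a, 'e::euclidean_space) chart set \<Rightarrow> 'a set \<Rightarrow> 'a \<Rightarrow> ('a \<Rightarrow> 'a tvec) \<Rightarrow> bool" where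
  "vfield_near A S p X \<longleftrightarrow>
     nearby A S p (\<lambda>q. X q \<in> tangent_space A S q) \<and>
     (\<forall>f. smooth_near A S p f \<longrightarrow> smooth_near A S p (\<lambda>q. X q f))"

definition lie_bracket :: "('a, 'e::euclidean_space) chart set \<Rightarrow> 'a set \<Rightarrow>
    ('a \<Rightarrow> 'a tvec) \<Rightarrow> ('a \<Rightarrow> 'a tvec) \<Rightarrow> 'a \<Rightarrow> 'a tvec" where
  "lie_bracket A S X Y p = (\<lambda>f.
     if smooth_near A S p f then X p (\<lambda>q. Y q f) - Y p (\<lambda>q. X q f) else 0)"

definition nijenhuis :: "('a, 'e::euclidean_space) chart set \<Rightarrow> 'a set \<Rightarrow> ('a \<Rightarrow> 'a tvec \<Rightarrow> 'a tvec) \<Rightarrow>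
    ('a \<Rightarrow> 'a tvec) \<Rightarrow> ('a \<Rightarrow> 'a tvec) \<Rightarrow> 'a \<Rightarrow> 'a tvec" where
  "nijenhuis A S J X Y p =
     lie_bracket A S (\<lambda>q. J q (X q)) (\<lambda>q. J q (Y q)) p - lie_bracket A S X Y p
     - J p (lie_bracket A S (\<lambda>q. J q (X q)) Y p) - J p (lie_bracket A S X (\<lambda>q. J q (Y q)) p)"

definition integrable_acs :: "('a, 'e::euclidean_space) chart set \<Rightarrow> 'a set \<Rightarrow>
    ('a \<Rightarrow> 'a tvec \<Rightarrow> 'a tvec) \<Rightarrow> bool" where
  "integrable_acs A S J \<longleftrightarrow>
     (\<forall>p\<in>S. \<forall>X Y. vfield_near A S p X \<and> vfield_near A S p Y \<longrightarrow> nijenhuis A S J X Y p = 0)"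

type_synonym 'a atlas4 = "('a, real^4) chart set"
type_synonym 'a metric = "'a \<Rightarrow> 'a tvec \<Rightarrow> 'a tvec \<Rightarrow> real"

text \<open>\<open>D p v Y\<close> is the covariant derivative at \<open>p\<close>, in direction \<open>v\<close>, of the local vector field \<open>Y\<close>.\<close>

type_synonym 'a connection = "'a \<Rightarrow> 'a tvec \<Rightarrow> ('a \<Rightarrow> 'a tvec) \<Rightarrow> 'a tvec"

abbreviation smooth_at :: "'a atlas4 \<Rightarrow> 'a \<Rightarrow> ('a \<Rightarrow> real) \<Rightarrow> bool" where
  "smooth_at A p f \<equiv> smooth_near A (points A) p f"

abbreviation TM :: "'a atlas4 \<Rightarrow> 'a \<Rightarrow> 'a tvec set" where
  "TM A p \<equiv> tangent_space A (points A) p"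

abbreviation vfield_at :: "'a atlas4 \<Rightarrow> 'a \<Rightarrow> ('a \<Rightarrow> 'a tvec) \<Rightarrow> bool" where
  "vfield_at A p X \<equiv> vfield_near A (points A) p X"

definition riemannian_metric :: "'a atlas4 \<Rightarrow> 'a metric \<Rightarrow> bool" where
  "riemannian_metric A g \<longleftrightarrow> (\<forall>p\<in>points A.
     (\<forall>u\<in>TM A p. \<forall>v\<in>TM A p. g p u v = g p v u) \<and>
     (\<forall>u\<in>TM A p. \<forall>v\<in>TM A p. \<forall>w\<in>TM A p. \<forall>a b.
        g p (a *\<^sub>F u + b *\<^sub>F v) w = a * g p u w + b * g p v w) \<and>
     (\<forall>u\<in>TM A p. u \<noteq> 0 \<longrightarrow> 0 < g p u u) \<and>
     (\<forall>X Y. vfield_at A p X \<and> vfield_at A p Y \<longrightarrow> smooth_at A p (\<lambda>q. g q (X q) (Y q))))"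

definition connection :: "'a atlas4 \<Rightarrow> 'a connection \<Rightarrow> bool" where
  "connection A D \<longleftrightarrow> (\<forall>p\<in>points A.
     (\<forall>v\<in>TM A p. \<forall>Y. vfield_at A p Y \<longrightarrow> D p v Y \<in> TM A p) \<and>
     (\<forall>Y. vfield_at A p Y \<longrightarrow> linear_map_on (TM A p) (\<lambda>v. D p v Y)) \<and>
     (\<forall>v\<in>TM A p. \<forall>Y Z. vfield_at A p Y \<and> vfield_at A p Z \<longrightarrow>
        D p v (\<lambda>q. Y q + Z q) = D p v Y + D p v Z) \<and>
     (\<forall>v\<in>TM A p. \<forall>f Y. smooth_at A p f \<and> vfield_at A p Y \<longrightarrow>
        D p v (\<lambda>q. f q *\<^sub>F Y q) = v f *\<^sub>F Y p + f p *\<^sub>F D p v Y) \<and>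
     (\<forall>X Y. vfield_at A p X \<and> vfield_at A p Y \<longrightarrow> vfield_at A p (\<lambda>q. D q (X q) Y)))"

definition metric_connection :: "'a atlas4 \<Rightarrow> 'a metric \<Rightarrow> 'a connection \<Rightarrow> bool" where
  "metric_connection A g D \<longleftrightarrow> connection A D \<and>
     (\<forall>p\<in>points A. \<forall>v\<in>TM A p. \<forall>Y Z. vfield_at A p Y \<and> vfield_at A p Z \<longrightarrow>
        v (\<lambda>q. g q (Y q) (Z q)) = g p (D p v Y) (Z p) + g p (Y p) (D p v Z))"

definition torsion :: "'a atlas4 \<Rightarrow> 'a connection \<Rightarrow> ('a \<Rightarrow> 'a tvec) \<Rightarrow> ('a \<Rightarrow> 'a tvec) \<Rightarrow> 'a \<Rightarrow> 'a tvec" where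
  "torsion A D X Y p = D p (X p) Y - D p (Y p) X - lie_bracket A (points A) X Y p"

definition skew_symmetric_torsion :: "'a atlas4 \<Rightarrow> 'a metric \<Rightarrow> 'a connection \<Rightarrow> bool" where
  "skew_symmetric_torsion A g D \<longleftrightarrow>
     (\<forall>p\<in>points A. \<forall>X Y Z. vfield_at A p X \<and> vfield_at A p Y \<and> vfield_at A p Z \<longrightarrow>
        g p (torsion A D X Y p) (Z p) = - g p (torsion A D Y X p) (Z p) \<and>
        g p (torsion A D X Y p) (Z p) = - g p (torsion A D X Z p) (Y p) \<and>
        g p (torsion A D X Y p) (Z p) = - g p (torsion A D Z Y p) (X p))"

text \<open>The Levi-Civita connection is unique as an operator on germs of vector fields.\<close>

definition levi_civita :: "'a atlas4 \<Rightarrow> 'a metric \<Rightarrow> 'a connection" where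
  "levi_civita A g = (SOME D. metric_connection A g D \<and>
     (\<forall>p\<in>points A. \<forall>X Y. vfield_at A p X \<and> vfield_at A p Y \<longrightarrow> torsion A D X Y p = 0))"

definition basis_at :: "'a atlas4 \<Rightarrow> 'a \<Rightarrow> ('a tvec)^4 \<Rightarrow> bool" where
  "basis_at A p e \<longleftrightarrow>
     (\<forall>i. e $ i \<in> TM A p) \<and> (\<forall>v\<in>TM A p. \<exists>!c::real^4. v = (\<Sum>i\<in>UNIV. (c $ i) *\<^sub>F (e $ i)))"

text \<open>
  The entries of the matrix are the components of the vectors in the coordinates of a chart. For an
  oriented atlas the sign of the determinant does not depend on the chart.
\<close>

definition positive_basis :: "'a atlas4 \<Rightarrow> 'a \<Rightarrow> ('a tvec)^4 \<Rightarrow> bool" where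
  "positive_basis A p e \<longleftrightarrow> basis_at A p e \<and>
     (\<exists>(U, \<phi>)\<in>A. p \<in> U \<and> 0 < det ((\<chi> i j. (e $ i) (\<lambda>q. \<phi> q $ j)) :: real^4^4))"

definition orthonormal_at :: "'a atlas4 \<Rightarrow> 'a metric \<Rightarrow> 'a \<Rightarrow> ('a tvec)^4 \<Rightarrow> bool" where
  "orthonormal_at A g p e \<longleftrightarrow>
     (\<forall>i. e $ i \<in> TM A p) \<and> (\<forall>i j. g p (e $ i) (e $ j) = (if i = j then 1 else 0))"

definition curvature :: "'a atlas4 \<Rightarrow> 'a connection \<Rightarrow>
    ('a \<Rightarrow> 'a tvec) \<Rightarrow> ('a \<Rightarrow> 'a tvec) \<Rightarrow> ('a \<Rightarrow> 'a tvec) \<Rightarrow> 'a \<Rightarrow> 'a tvec" where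
  "curvature A D X Y Z p =
     D p (X p) (\<lambda>q. D q (Y q) Z) - D p (Y p) (\<lambda>q. D q (X q) Z) - D p (lie_bracket A (points A) X Y p) Z"

text \<open>\<open>g (R (x, y) z) w\<close> for vectors: the value does not depend on the extensions to fields.\<close>

definition riem :: "'a atlas4 \<Rightarrow> 'a metric \<Rightarrow> 'a \<Rightarrow> 'a tvec \<Rightarrow> 'a tvec \<Rightarrow> 'a tvec \<Rightarrow> 'a tvec \<Rightarrow> real" where
  "riem A g p x y z w = (THE r. \<exists>X Y Z.
     vfield_at A p X \<and> vfield_at A p Y \<and> vfield_at A p Z \<and> X p = x \<and> Y p = y \<and> Z p = z \<and>
     r = g p (curvature A (levi_civita A g) X Y Z p) w)"

definition ricci :: "'a atlas4 \<Rightarrow> 'a metric \<Rightarrow> 'a \<Rightarrow> 'a tvec \<Rightarrow> 'a tvec \<Rightarrow> real" where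
  "ricci A g p y z = (THE r. \<exists>e. orthonormal_at A g p e \<and>
     r = (\<Sum>i\<in>UNIV. riem A g p (e $ i) y z (e $ i)))"

definition scalar_curvature :: "'a atlas4 \<Rightarrow> 'a metric \<Rightarrow> 'a \<Rightarrow> real" where
  "scalar_curvature A g p = (THE r. \<exists>e. orthonormal_at A g p e \<and>
     r = (\<Sum>i\<in>UNIV. ricci A g p (e $ i) (e $ i)))"

text \<open>
  The constants are \<open>1 / (n - 2)\<close> and \<open>1 / ((n - 1) (n - 2))\<close> for \<open>n = 4\<close>. With the sign conventions
  above, constant curvature \<open>k\<close> means \<open>riem x y z w = k (g y z g x w - g x z g y w)\<close>.
\<close>

definition weyl :: "'a atlas4 \<Rightarrow> 'a metric \<Rightarrow> 'a \<Rightarrow> 'a tvec \<Rightarrow> 'a tvec \<Rightarrow> 'a tvec \<Rightarrow> 'a tvec \<Rightarrow> real" where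
  "weyl A g p x y z w = riem A g p x y z w
     - 1/2 * (ricci A g p y z * g p x w - ricci A g p x z * g p y w
              + g p y z * ricci A g p x w - g p x z * ricci A g p y w)
     + scalar_curvature A g p / 6 * (g p y z * g p x w - g p x z * g p y w)"

text \<open>
  As tangent vectors are functionals, the bivector \<open>u \<and> v\<close> is the functional
  \<open>(f, h) \<mapsto> u f v h - u h v f\<close>, and the second exterior power is the span of these.
\<close>

type_synonym 'a bivec = "('a \<Rightarrow> real) \<times> ('a \<Rightarrow> real) \<Rightarrow> real"

definition wedge :: "'a tvec \<Rightarrow> 'a tvec \<Rightarrow> 'a bivec" where
  "wedge u v = (\<lambda>(f, h). u f * v h - u h * v f)"

definition bivectors :: "'a atlas4 \<Rightarrow> 'a \<Rightarrow> 'a bivec set" where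
  "bivectors A p = {\<beta>. \<exists>(n::nat) x y.
     (\<forall>i<n. x i \<in> TM A p \<and> y i \<in> TM A p) \<and> \<beta> = (\<Sum>i<n. wedge (x i) (y i))}"

text \<open>Bilinear extension of \<open>(v1 \<and> v2, v3 \<and> v4) \<mapsto> det (g vi vj) / 2\<close>.\<close>

definition bivec_inner :: "'a atlas4 \<Rightarrow> 'a metric \<Rightarrow> 'a \<Rightarrow> 'a bivec \<Rightarrow> 'a bivec \<Rightarrow> real" where
  "bivec_inner A g p \<beta> \<gamma> = (THE r. \<exists>(n::nat) x y (m::nat) z w.
     (\<forall>i<n. x i \<in> TM A p \<and> y i \<in> TM A p) \<and> \<beta> = (\<Sum>i<n. wedge (x i) (y i)) \<and>
     (\<forall>j<m. z j \<in> TM A p \<and> w j \<in> TM A p) \<and> \<gamma> = (\<Sum>j<m. wedge (z j) (w j)) \<and>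
     r = (\<Sum>i<n. \<Sum>j<m. 1/2 * (g p (x i) (z j) * g p (y i) (w j) - g p (x i) (w j) * g p (y i) (z j))))"

text \<open>
  The condition for all oriented orthonormal bases also gives \<open>*(e1 \<and> e3) = e4 \<and> e2\<close> etc., since
  even permutations of a basis preserve its orientation.
\<close>

definition hodge_star :: "'a atlas4 \<Rightarrow> 'a metric \<Rightarrow> 'a \<Rightarrow> 'a bivec \<Rightarrow> 'a bivec" where
  "hodge_star A g p = (THE S. S \<in> bivectors A p \<rightarrow>\<^sub>E bivectors A p \<and> linear_map_on (bivectors A p) S \<and>
     (\<forall>e. orthonormal_at A g p e \<and> positive_basis A p e \<longrightarrow>
        S (wedge (e $ 1) (e $ 2)) = wedge (e $ 3) (e $ 4)))"

text \<open>With this order of arguments, the corresponding operator for \<open>riem\<close> is positive on round spheres.\<close>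

definition weyl_operator :: "'a atlas4 \<Rightarrow> 'a metric \<Rightarrow> 'a \<Rightarrow> 'a bivec \<Rightarrow> 'a bivec" where
  "weyl_operator A g p = (THE S. S \<in> bivectors A p \<rightarrow>\<^sub>E bivectors A p \<and> linear_map_on (bivectors A p) S \<and>
     (\<forall>x\<in>TM A p. \<forall>y\<in>TM A p. \<forall>z\<in>TM A p. \<forall>w\<in>TM A p.
        bivec_inner A g p (S (wedge x y)) (wedge z w) = weyl A g p x y w z))"

definition self_dual_bivectors :: "'a atlas4 \<Rightarrow> 'a metric \<Rightarrow> 'a \<Rightarrow> 'a bivec set" where
  "self_dual_bivectors A g p = {\<beta>\<in>bivectors A p. hodge_star A g p \<beta> = \<beta>}"

definition anti_self_dual :: "'a atlas4 \<Rightarrow> 'a metric \<Rightarrow> bool" where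
  "anti_self_dual A g \<longleftrightarrow>
     (\<forall>p\<in>points A. \<forall>\<beta>\<in>self_dual_bivectors A g p. weyl_operator A g p \<beta> = 0)"

definition endos :: "'a atlas4 \<Rightarrow> 'a \<Rightarrow> ('a tvec \<Rightarrow> 'a tvec) set" where
  "endos A p = {a \<in> TM A p \<rightarrow>\<^sub>E TM A p. linear_map_on (TM A p) a}"

definition skew_endos :: "'a atlas4 \<Rightarrow> 'a metric \<Rightarrow> 'a \<Rightarrow> ('a tvec \<Rightarrow> 'a tvec) set" where
  "skew_endos A g p = {a \<in> endos A p. \<forall>u\<in>TM A p. \<forall>v\<in>TM A p. g p (a u) v = - g p u (a v)}"

definition twistor_fibre :: "'a atlas4 \<Rightarrow> 'a metric \<Rightarrow> 'a \<Rightarrow> ('a tvec \<Rightarrow> 'a tvec) set" where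
  "twistor_fibre A g p = {J \<in> endos A p.
     (\<forall>u\<in>TM A p. J (J u) = - u) \<and>
     (\<forall>u\<in>TM A p. \<forall>v\<in>TM A p. g p (J u) (J v) = g p u v) \<and>
     (\<forall>e1\<in>TM A p. \<forall>e3\<in>TM A p. basis_at A p (vector [e1, J e1, e3, J e3]) \<longrightarrow>
        positive_basis A p (vector [e1, J e1, e3, J e3]))}"

definition twistor_space :: "'a atlas4 \<Rightarrow> 'a metric \<Rightarrow> ('a \<times> ('a tvec \<Rightarrow> 'a tvec)) set" where
  "twistor_space A g = Sigma (points A) (twistor_fibre A g)"

text \<open>
  The smooth structure of the twistor space is the one induced from the total space of the bundle of
  endomorphisms of the tangent bundle, with its bundle charts: an endomorphism is mapped to its base
  point in a chart together with its matrix with respect to the coordinate vector fields.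
\<close>

definition coord_vec :: "'a atlas4 \<Rightarrow> ('a, real^4) chart \<Rightarrow> 'a \<Rightarrow> 4 \<Rightarrow> 'a tvec" where
  "coord_vec A c p j = (\<lambda>f. if smooth_at A p f
     then frechet_derivative (f \<circ> inv_into (fst c) (snd c)) (at (snd c p)) (axis j 1) else 0)"

definition endo_matrix :: "'a atlas4 \<Rightarrow> ('a, real^4) chart \<Rightarrow> 'a \<Rightarrow> ('a tvec \<Rightarrow> 'a tvec) \<Rightarrow> real^4^4" where
  "endo_matrix A c p a = (\<chi> i j. a (coord_vec A c p j) (\<lambda>q. snd c q $ i))"

definition endo_atlas :: "'a atlas4 \<Rightarrow>
    ('a \<times> ('a tvec \<Rightarrow> 'a tvec), (real^4) \<times> (real^4^4)) chart set" where
  "endo_atlas A = (\<lambda>c. (Sigma (fst c) (endos A), \<lambda>(p, a). (snd c p, endo_matrix A c p a))) ` A"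

abbreviation smooth_at_Z :: "'a atlas4 \<Rightarrow> 'a metric \<Rightarrow> 'a \<times> ('a tvec \<Rightarrow> 'a tvec) \<Rightarrow>
    ('a \<times> ('a tvec \<Rightarrow> 'a tvec) \<Rightarrow> real) \<Rightarrow> bool" where
  "smooth_at_Z A g z f \<equiv> smooth_near (endo_atlas A) (twistor_space A g) z f"

definition vertical_space :: "'a atlas4 \<Rightarrow> 'a metric \<Rightarrow> 'a \<Rightarrow> ('a tvec \<Rightarrow> 'a tvec) \<Rightarrow> ('a tvec \<Rightarrow> 'a tvec) set" where
  "vertical_space A g p J = {V \<in> skew_endos A g p. \<forall>u\<in>TM A p. V (J u) + J (V u) = 0}"

text \<open>
  The identification of the vertical space with the tangent space of the fibre: \<open>V\<close> is the tangent
  vector at \<open>J\<close>, as a derivation, of any curve in the fibre through \<open>J\<close> with velocity \<open>V\<close>.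
\<close>

definition vertical_vector :: "'a atlas4 \<Rightarrow> 'a metric \<Rightarrow> 'a \<Rightarrow> ('a tvec \<Rightarrow> 'a tvec) \<Rightarrow> ('a tvec \<Rightarrow> 'a tvec) \<Rightarrow>
    ('a \<times> ('a tvec \<Rightarrow> 'a tvec)) tvec" where
  "vertical_vector A g p J V = (\<lambda>f. if smooth_at_Z A g (p, J) f
     then (THE d. \<exists>\<gamma>. (\<forall>t. \<gamma> t \<in> twistor_fibre A g p) \<and> \<gamma> 0 = J \<and>
        (\<forall>u\<in>TM A p. \<forall>h. smooth_at A p h \<longrightarrow> ((\<lambda>t. \<gamma> t u h) has_real_derivative V u h) (at 0)) \<and>
        ((\<lambda>t. f (p, \<gamma> t)) has_real_derivative d) (at 0))
     else 0)"

text \<open>Smoothness of a section near \<open>p\<close>: it pulls smooth functions on the twistor space back to smooth functions.\<close>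

definition local_section :: "'a atlas4 \<Rightarrow> 'a metric \<Rightarrow> 'a \<Rightarrow> ('a \<Rightarrow> 'a tvec \<Rightarrow> 'a tvec) \<Rightarrow> bool" where
  "local_section A g p s \<longleftrightarrow>
     nearby A (points A) p (\<lambda>q. s q \<in> twistor_fibre A g q) \<and>
     (\<forall>f. smooth_at_Z A g (p, s p) f \<longrightarrow> smooth_at A p (\<lambda>q. f (q, s q)))"

definition section_pushforward :: "'a atlas4 \<Rightarrow> 'a metric \<Rightarrow> 'a \<Rightarrow> ('a \<Rightarrow> 'a tvec \<Rightarrow> 'a tvec) \<Rightarrow> 'a tvec \<Rightarrow>
    ('a \<times> ('a tvec \<Rightarrow> 'a tvec)) tvec" where
  "section_pushforward A g p s v = (\<lambda>f. if smooth_at_Z A g (p, s p) f then v (\<lambda>q. f (q, s q)) else 0)"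

text \<open>The connection induced by \<open>D\<close> on endomorphisms, \<open>(D v s) (Y) = D v (s Y) - s (D v Y)\<close>.\<close>

definition section_derivative :: "'a atlas4 \<Rightarrow> 'a connection \<Rightarrow> 'a \<Rightarrow> 'a tvec \<Rightarrow>
    ('a \<Rightarrow> 'a tvec \<Rightarrow> 'a tvec) \<Rightarrow> 'a tvec \<Rightarrow> 'a tvec" where
  "section_derivative A D p v s = (\<lambda>u\<in>TM A p. THE w. \<exists>Y. vfield_at A p Y \<and> Y p = u \<and>
     w = D p v (\<lambda>q. s q (Y q)) - s p (D p v Y))"

definition horizontal_lift :: "'a atlas4 \<Rightarrow> 'a metric \<Rightarrow> 'a connection \<Rightarrow> 'a \<Rightarrow> ('a tvec \<Rightarrow> 'a tvec) \<Rightarrow> 'a tvec \<Rightarrow>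
    ('a \<times> ('a tvec \<Rightarrow> 'a tvec)) tvec" where
  "horizontal_lift A g D p J v = (THE \<xi>. \<exists>s. local_section A g p s \<and> s p = J \<and>
     \<xi> = section_pushforward A g p s v - vertical_vector A g p J (section_derivative A D p v s))"

definition ahs_structure :: "'a atlas4 \<Rightarrow> 'a metric \<Rightarrow> 'a connection \<Rightarrow> 'a \<times> ('a tvec \<Rightarrow> 'a tvec) \<Rightarrow>
    ('a \<times> ('a tvec \<Rightarrow> 'a tvec)) tvec \<Rightarrow> ('a \<times> ('a tvec \<Rightarrow> 'a tvec)) tvec" where
  "ahs_structure A g D = (\<lambda>(p, J) \<xi>. THE \<eta>. \<exists>v\<in>TM A p. \<exists>V\<in>vertical_space A g p J.
     \<xi> = horizontal_lift A g D p J v + vertical_vector A g p J V \<and>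
     \<eta> = horizontal_lift A g D p J (J v) + vertical_vector A g p J (compose (TM A p) J V))"

end

theory Submission
  imports Defs
begin

text \<open>
  Everything is computed over a chart with an oriented orthonormal frame \<open>E\<^sub>1, ..., E\<^sub>4\<close>. The endomorphisms which correspond to
  self-dual bivectors are \<open>Kop x\<close> for \<open>x \<in> \<real>\<^sup>3\<close>, with the quaternion relations, and those with \<open>|x| = 1\<close> are the
  complex structures in the twistor space (\<open>fibre_iff\<close>). Thus the twistor space is locally a product with the two-sphere.
  The connection induced by \<open>D\<close> acts on the coordinates \<open>x\<close> as \<open>d + w \<times>\<close>, for a one-form \<open>w\<close> with values in \<open>\<real>\<^sup>3\<close>
  (\<open>conn_form_Kop\<close>). A tangent vector of the twistor space consists of the horizontal lift of a vector \<open>h\<close> and of a vertical vector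
  \<open>c \<times> x\<close>, and the almost complex structure maps \<open>(h, c)\<close> to \<open>(Kop x h, x \<times> c)\<close> (\<open>T_tw_vec\<close>, \<open>ahs_tw_vec\<close>).

  Brackets of such vector fields involve the torsion and the curvature \<open>\<Omega> = dw + w \<times> w\<close> (\<open>bracket_tw_vec\<close>). In the Nijenhuis tensor
  all derivatives of \<open>h\<close> and \<open>c\<close> cancel (\<open>nijenhuis_tw_vec\<close>). The horizontal part which remains is the part of type (3,0) and (0,3)
  of the torsion three-form. It vanishes since the complex dimension is two (\<open>triple_form_type\<close>). The vertical part is the component orthogonal
  to \<open>x\<close> of \<open>\<Omega>(Kh, Kh') - \<Omega>(h, h') - x \<times> (\<Omega>(Kh, h') + \<Omega>(h, Kh'))\<close> with \<open>K = Kop x\<close>. It vanishes for all \<open>x\<close> if and only if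
  the 3 by 3 matrix \<open>B\<close>, which is \<open>\<Omega>\<close> restricted to self-dual bivectors, has no trace-free symmetric part (\<open>curv_cond_iff\<close>).

  The Levi-Civita connection is \<open>D\<close> minus half of the torsion, and the torsion three-form is the Hodge dual of a vector field
  \<open>\<theta>\<close>. The difference of the two curvatures \<open>\<Omega>\<close> is made of the derivative of \<open>\<theta>\<close> and of \<open>\<theta> \<otimes> \<theta>\<close> (\<open>sd_curv_shift\<close>); by
  invariance these cannot contribute to the trace-free symmetric part of \<open>B\<close> (\<open>curv_cond_shift\<close>). Hence integrability may be tested with the
  Levi-Civita connection. There \<open>B\<close> is the self-dual block of the Riemann tensor, whose trace-free part is \<open>\<W>\<^sub>+\<close>
  (\<open>weyl_self_dual_iff\<close>). It remains to relate the components in the frame with the operators on bivectors that define anti-self-duality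
  (\<open>asd_at\<close>).
\<close>

section \<open>Self-dual endomorphisms of Euclidean four-space\<close>

lemma det_4:
  "det (A::'a::comm_ring_1^4^4) =
    A$1$1 * (A$2$2 * (A$3$3 * A$4$4 - A$3$4 * A$4$3) - A$2$3 * (A$3$2 * A$4$4 - A$3$4 * A$4$2) + A$2$4 * (A$3$2 * A$4$3 - A$3$3 * A$4$2))
  - A$1$2 * (A$2$1 * (A$3$3 * A$4$4 - A$3$4 * A$4$3) - A$2$3 * (A$3$1 * A$4$4 - A$3$4 * A$4$1) + A$2$4 * (A$3$1 * A$4$3 - A$3$3 * A$4$1))
  + A$1$3 * (A$2$1 * (A$3$2 * A$4$4 - A$3$4 * A$4$2) - A$2$2 * (A$3$1 * A$4$4 - A$3$4 * A$4$1) + A$2$4 * (A$3$1 * A$4$2 - A$3$2 * A$4$1))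
  - A$1$4 * (A$2$1 * (A$3$2 * A$4$3 - A$3$3 * A$4$2) - A$2$2 * (A$3$1 * A$4$3 - A$3$3 * A$4$1) + A$2$3 * (A$3$1 * A$4$2 - A$3$2 * A$4$1))"
proof -
  have f1234: "finite {2::4, 3, 4}" "1 \<notin> {2::4, 3, 4}" by auto
  have f234: "finite {3::4, 4}" "2 \<notin> {3::4, 4}" by auto
  have f34: "finite {4::4}" "3 \<notin> {4::4}" by auto
  show ?thesis
    unfolding det_def UNIV_4
    unfolding sum_over_permutations_insert[OF f1234]
    unfolding sum_over_permutations_insert[OF f234]
    unfolding sum_over_permutations_insert[OF f34]
    unfolding permutes_sing
    by (simp add: sign_swap_id permutation_swap_id permutation_compose sign_compose sign_id swap_id_eq algebra_simps)
qed

lemma vector_4 [simp]: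
  "(vector [w, x, y, z] :: 'a::zero^4) $ 1 = w"
  "(vector [w, x, y, z] :: 'a::zero^4) $ 2 = x"
  "(vector [w, x, y, z] :: 'a::zero^4) $ 3 = y"
  "(vector [w, x, y, z] :: 'a::zero^4) $ 4 = z"
  by (simp_all add: vector_def)

text \<open>
  \<open>Kop x = x\<^sub>1 K\<^sub>1 + x\<^sub>2 K\<^sub>2 + x\<^sub>3 K\<^sub>3\<close>, where \<open>K\<^sub>1\<close> maps \<open>e\<^sub>1\<close> to \<open>e\<^sub>2\<close> and \<open>e\<^sub>3\<close> to \<open>e\<^sub>4\<close>, \<open>K\<^sub>2\<close> maps \<open>e\<^sub>1\<close> to \<open>e\<^sub>3\<close>
  and \<open>e\<^sub>4\<close> to \<open>e\<^sub>2\<close>, and \<open>K\<^sub>3 = K\<^sub>1 K\<^sub>2\<close>. These are the skew endomorphisms that correspond to self-dual bivectors;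
  their quaternion relations \<open>Kop_Kop\<close> are what relates the twistor fibre to the cross product of \<open>\<real>\<^sup>3\<close>.
\<close>

definition Kop :: "real^3 \<Rightarrow> real^4 \<Rightarrow> real^4" where
  "Kop x u = vector [- (x$1 * u$2) - x$2 * u$3 - x$3 * u$4, x$1 * u$1 - x$3 * u$3 + x$2 * u$4,
                     - (x$1 * u$4) + x$2 * u$1 + x$3 * u$2, x$1 * u$3 - x$2 * u$2 + x$3 * u$1]"

lemma Kop_nth [simp]:
  "Kop x u $ 1 = - (x$1 * u$2) - x$2 * u$3 - x$3 * u$4"
  "Kop x u $ 2 = x$1 * u$1 - x$3 * u$3 + x$2 * u$4"
  "Kop x u $ 3 = - (x$1 * u$4) + x$2 * u$1 + x$3 * u$2"
  "Kop x u $ 4 = x$1 * u$3 - x$2 * u$2 + x$3 * u$1"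
  by (simp_all add: Kop_def)

lemmas vec4 = vec_eq_iff forall_4 inner_vec_def sum_4
lemmas vec3 = vec_eq_iff forall_3 inner_vec_def sum_3 cross_components

lemma Kop_lin:
  "Kop (x + y) u = Kop x u + Kop y u" "Kop (x - y) u = Kop x u - Kop y u" "Kop (c *\<^sub>R x) u = c *\<^sub>R Kop x u"
  "Kop x (u + v) = Kop x u + Kop x v" "Kop x (u - v) = Kop x u - Kop x v" "Kop x (c *\<^sub>R u) = c *\<^sub>R Kop x u"
  "Kop (- x) u = - Kop x u" "Kop x (- u) = - Kop x u" "Kop 0 u = 0" "Kop x 0 = 0"
  by (simp_all add: vec4 algebra_simps)

lemma Kop_Kop: "Kop x (Kop y u) = Kop (cross3 x y) u - (x \<bullet> y) *\<^sub>R u"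
  by (simp add: vec4 vec3 algebra_simps)

lemma Kop_inner: "Kop x u \<bullet> v = - (u \<bullet> Kop x v)"
  by (simp add: vec4 algebra_simps)

lemma Kop_axis: "Kop x (axis 1 1) $ 2 = x $ 1" "Kop x (axis 1 1) $ 3 = x $ 2" "Kop x (axis 1 1) $ 4 = x $ 3"
  by (simp_all add: axis_def)

text \<open>
  Twice the self-dual part of \<open>u \<and> v\<close>, in the basis of self-dual bivectors which corresponds to \<open>Kop\<close>.
\<close>

definition Kvec :: "real^4 \<Rightarrow> real^4 \<Rightarrow> real^3" where
  "Kvec u v = (\<chi> a. Kop (axis a 1) u \<bullet> v)"

lemma Kvec_nth: "Kvec u v $ a = Kop (axis a 1) u \<bullet> v" by (simp add: Kvec_def)

text \<open>
  In terms of the six entries of the skew matrix \<open>M\<close>, the equation \<open>M\<^sup>2 = - 1\<close> forces \<open>M\<close> to be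
  \<open>s\<close> times its Hodge dual, where the Pfaffian \<open>s\<close> is \<open>1\<close> or \<open>- 1\<close>. The orientation condition excludes \<open>s = - 1\<close>;
  a self-dual skew matrix is a \<open>Kop x\<close>.
\<close>

lemma skew_square_self_dual:
  fixes M :: "real^4 \<Rightarrow> real^4"
  assumes frame_vec: "linear M" and skew: "\<And>u v. M u \<bullet> v = - (u \<bullet> M v)" and sq: "\<And>u. M (M u) = - u"
    and pos: "\<And>u v. det (vector [u, M u, v, M v] :: real^4^4) \<ge> 0"
  shows "\<exists>x. x \<bullet> x = 1 \<and> M = Kop x"
proof -
  define a where "a = M (axis 1 1) $ 2"
  define b where "b = M (axis 1 1) $ 3"
  define c where "c = M (axis 1 1) $ 4"
  define d where "d = M (axis 2 1) $ 3"
  define e where "e = M (axis 2 1) $ 4"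
  define f where "f = M (axis 3 1) $ 4"
  have ax: "u \<bullet> axis i 1 = u $ i" for u :: "real^4" and i by (simp add: inner_axis)
  have sk: "M (axis i 1) $ j = - (M (axis j 1) $ i)" for i j
    using skew[of "axis i 1" "axis j 1"] by (simp add: inner_axis inner_axis')
  have di: "M (axis i 1) $ i = 0" for i using sk[of i i] by simp
  have u4: "u = u$1 *\<^sub>R axis 1 1 + u$2 *\<^sub>R axis 2 1 + u$3 *\<^sub>R axis 3 1 + u$4 *\<^sub>R axis 4 1" for u :: "real^4"
    by (simp add: vec4 axis_def)
  have Mu: "M u = u$1 *\<^sub>R M (axis 1 1) + u$2 *\<^sub>R M (axis 2 1) + u$3 *\<^sub>R M (axis 3 1) + u$4 *\<^sub>R M (axis 4 1)" for u
    by (subst u4[of u]) (simp add: linear_add[OF frame_vec] linear_scale[OF frame_vec])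
  have M1: "M (axis 1 1) $ 1 = 0" "M (axis 1 1) $ 2 = a" "M (axis 1 1) $ 3 = b" "M (axis 1 1) $ 4 = c"
    and M2: "M (axis 2 1) $ 1 = -a" "M (axis 2 1) $ 2 = 0" "M (axis 2 1) $ 3 = d" "M (axis 2 1) $ 4 = e"
    and M3: "M (axis 3 1) $ 1 = -b" "M (axis 3 1) $ 2 = -d" "M (axis 3 1) $ 3 = 0" "M (axis 3 1) $ 4 = f"
    and M4: "M (axis 4 1) $ 1 = -c" "M (axis 4 1) $ 2 = -e" "M (axis 4 1) $ 3 = -f" "M (axis 4 1) $ 4 = 0"
    by (simp_all add: di sk[of 2 1] sk[of 3 1] sk[of 3 2] sk[of 4 1] sk[of 4 2] sk[of 4 3]
        a_def b_def c_def d_def e_def f_def)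
  have Mn: "M u $ 1 = - (u$2 * a) - u$3 * b - u$4 * c" "M u $ 2 = u$1 * a - u$3 * d - u$4 * e"
    "M u $ 3 = u$1 * b + u$2 * d - u$4 * f" "M u $ 4 = u$1 * c + u$2 * e + u$3 * f" for u
    using Mu[of u] by (simp_all add: M1 M2 M3 M4)
  have q: "M (M u) $ i = - (u $ i)" for u i using sq[of u] by simp
  have e1: "a*a + b*b + c*c = 1" using q[of "axis 1 1" 1] by (simp add: Mn axis_def)
  have e2: "a*a + d*d + e*e = 1" using q[of "axis 2 1" 2] by (simp add: Mn axis_def)
  have e3: "b*b + d*d + f*f = 1" using q[of "axis 3 1" 3] by (simp add: Mn axis_def)
  have e4: "c*c + e*e + f*f = 1" using q[of "axis 4 1" 4] by (simp add: Mn axis_def)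
  have e12: "b*d + c*e = 0" using q[of "axis 1 1" 2] by (simp add: Mn axis_def algebra_simps)
  have e13: "a*d = c*f" using q[of "axis 1 1" 3] by (simp add: Mn axis_def algebra_simps)
  have e14: "a*e + b*f = 0" using q[of "axis 1 1" 4] by (simp add: Mn axis_def algebra_simps)
  have e23: "a*b + e*f = 0" using q[of "axis 2 1" 3] by (simp add: Mn axis_def algebra_simps)
  have e24: "a*c = d*f" using q[of "axis 2 1" 4] by (simp add: Mn axis_def algebra_simps)
  have e34: "b*c + d*e = 0" using q[of "axis 3 1" 4] by (simp add: Mn axis_def algebra_simps)
  \<comment> \<open>the Pfaffian of \<open>M\<close>\<close>
  define s where "s = a*f - b*e + c*d"
  have "s * f = a*(f*f) - (b*f)*e + c*(d*f)" by (simp add: s_def algebra_simps)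
  also have "\<dots> = a * (c*c + e*e + f*f)"
  proof -
    have "b*f = - (a*e)" "d*f = a*c" using e14 e24 by linarith+
    then show ?thesis by (simp add: algebra_simps)
  qed
  finally have sa: "a = s * f" using e4 by simp
  have "s * e = (a*e)*f - b*(e*e) + c*(d*e)" by (simp add: s_def algebra_simps)
  also have "\<dots> = - b * (c*c + e*e + f*f)"
  proof -
    have "a*e = - (b*f)" "d*e = - (b*c)" using e14 e34 by linarith+
    then show ?thesis by (simp add: algebra_simps)
  qed
  finally have sb: "b = - (s * e)" using e4 by simp
  have "s * d = a*(d*f) - (b*d)*e + c*(d*d)" by (simp add: s_def algebra_simps)
  also have "\<dots> = c * (a*a + d*d + e*e)"
  proof -
    have "d*f = a*c" "b*d = - (c*e)" using e24 e12 by linarith+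
    then show ?thesis by (simp add: algebra_simps)
  qed
  finally have sc: "c = s * d" using e2 by simp
  have "s * s = a * (s * f) - b * (s * e) + c * (s * d)" by (simp add: s_def algebra_simps)
  also have "\<dots> = a*a + b*b + c*c" using sa sb sc by simp
  finally have "s * s = 1" using e1 by simp
  then consider "s = 1" | "s = -1" by (metis square_eq_1_iff)
  then show ?thesis
  proof cases
    case 1
    define x :: "real^3" where "x = vector [a, b, c]"
    have x: "x$1 = a" "x$2 = b" "x$3 = c" by (simp_all add: x_def)
    have "M = Kop x" using sa sb sc 1 by (intro ext) (simp add: vec4 Mn x algebra_simps)
    moreover have "x \<bullet> x = 1" using e1 by (simp add: vec3 x)
    ultimately show ?thesis by blast
  next
    case 2
    have p13: "det (vector [axis 1 1, M (axis 1 1), axis 3 1, M (axis 3 1)] :: real^4^4) = a*f + c*d"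
      unfolding det_4 by (simp add: Mn axis_def algebra_simps)
    have p12: "det (vector [axis 1 1, M (axis 1 1), axis 2 1, M (axis 2 1)] :: real^4^4) = c*d - b*e"
      unfolding det_4 by (simp add: Mn axis_def algebra_simps)
    have "a*f + c*d = - (a*a + c*c)" "c*d - b*e = - (b*b + c*c)" using sa sb sc 2 by auto
    then have "a*a + c*c \<le> 0" "b*b + c*c \<le> 0" using pos[of "axis 1 1" "axis 3 1"] pos[of "axis 1 1" "axis 2 1"] p13 p12 by auto
    then have ac: "a = 0" "c = 0" and "b * b \<le> 0" by (auto simp: sum_squares_le_zero_iff)
    moreover have "b = 0" using \<open>b * b \<le> 0\<close> zero_le_square[of b] by (auto simp: mult_le_0_iff)
    ultimately show ?thesis using e1 by simp
  qed
qed

text \<open>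
  The determinant is nonnegative, so that every \<open>Kop x\<close> with \<open>x \<bullet> x = 1\<close> induces the standard orientation.
\<close>

lemma det_Kop: "det (vector [u, Kop x u, v, Kop x v] :: real^4^4) =
    cross3 x (Kvec u v) \<bullet> cross3 x (Kvec u v)"
  unfolding det_4 by (simp add: vec3 Kvec_nth vec4 axis_def) algebra

text \<open>
  A skew endomorphism splits into a self-dual and an anti-self-dual part. The latter commutes with \<open>Kop x\<close>, hence
  vanishes when \<open>M\<close> anticommutes with \<open>Kop x\<close>; for the self-dual part \<open>Kop \<xi>\<close> anticommuting means \<open>\<xi> \<bullet> x = 0\<close>.
\<close>

lemma skew_anticommute:
  fixes M :: "real^4 \<Rightarrow> real^4"
  assumes frame_vec: "linear M" and skew: "\<And>u v. M u \<bullet> v = - (u \<bullet> M v)"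
    and ac: "\<And>u. M (Kop x u) + Kop x (M u) = 0" and x: "x \<bullet> x = 1"
  shows "\<exists>\<xi>. \<xi> \<bullet> x = 0 \<and> M = Kop \<xi>"
proof -
  define a where "a = M (axis 1 1) $ 2"
  define b where "b = M (axis 1 1) $ 3"
  define c where "c = M (axis 1 1) $ 4"
  define d where "d = M (axis 2 1) $ 3"
  define e where "e = M (axis 2 1) $ 4"
  define f where "f = M (axis 3 1) $ 4"
  have sk: "M (axis i 1) $ j = - (M (axis j 1) $ i)" for i j
    using skew[of "axis i 1" "axis j 1"] by (simp add: inner_axis inner_axis')
  have di: "M (axis i 1) $ i = 0" for i using sk[of i i] by simp
  have u4: "u = u$1 *\<^sub>R axis 1 1 + u$2 *\<^sub>R axis 2 1 + u$3 *\<^sub>R axis 3 1 + u$4 *\<^sub>R axis 4 1" for u :: "real^4"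
    by (simp add: vec4 axis_def)
  have Mu: "M u = u$1 *\<^sub>R M (axis 1 1) + u$2 *\<^sub>R M (axis 2 1) + u$3 *\<^sub>R M (axis 3 1) + u$4 *\<^sub>R M (axis 4 1)" for u
    by (subst u4[of u]) (simp add: linear_add[OF frame_vec] linear_scale[OF frame_vec])
  have M1: "M (axis 1 1) $ 1 = 0" "M (axis 1 1) $ 2 = a" "M (axis 1 1) $ 3 = b" "M (axis 1 1) $ 4 = c"
    and M2: "M (axis 2 1) $ 1 = -a" "M (axis 2 1) $ 2 = 0" "M (axis 2 1) $ 3 = d" "M (axis 2 1) $ 4 = e"
    and M3: "M (axis 3 1) $ 1 = -b" "M (axis 3 1) $ 2 = -d" "M (axis 3 1) $ 3 = 0" "M (axis 3 1) $ 4 = f"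
    and M4: "M (axis 4 1) $ 1 = -c" "M (axis 4 1) $ 2 = -e" "M (axis 4 1) $ 3 = -f" "M (axis 4 1) $ 4 = 0"
    by (simp_all add: di sk[of 2 1] sk[of 3 1] sk[of 3 2] sk[of 4 1] sk[of 4 2] sk[of 4 3]
        a_def b_def c_def d_def e_def f_def)
  have Mn: "M u $ 1 = - (u$2 * a) - u$3 * b - u$4 * c" "M u $ 2 = u$1 * a - u$3 * d - u$4 * e"
    "M u $ 3 = u$1 * b + u$2 * d - u$4 * f" "M u $ 4 = u$1 * c + u$2 * e + u$3 * f" for u
    using Mu[of u] by (simp_all add: M1 M2 M3 M4)
  have q: "M (Kop x u) $ i + Kop x (M u) $ i = 0" for u i using ac[of u] by (metis vector_add_component zero_index)
  define X Y Z where "X = x$1" "Y = x$2" "Z = x$3"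
  have n: "X*X + Y*Y + Z*Z = 1" using x by (simp add: vec3 X_Y_Z_def)
  have e11: "X*a + Y*b + Z*c = 0" using q[of "axis 1 1" 1] by (simp add: Mn axis_def X_Y_Z_def[symmetric] algebra_simps)
  have e22: "X*a + Z*d - Y*e = 0" using q[of "axis 2 1" 2] by (simp add: Mn axis_def X_Y_Z_def[symmetric] algebra_simps)
  have e33: "Y*b + Z*d + X*f = 0" using q[of "axis 3 1" 3] by (simp add: Mn axis_def X_Y_Z_def[symmetric] algebra_simps)
  have e44: "Z*c - Y*e + X*f = 0" using q[of "axis 4 1" 4] by (simp add: Mn axis_def X_Y_Z_def[symmetric] algebra_simps)
  have e12: "- (Y*d) - Z*e - Z*b + Y*c = 0" using q[of "axis 1 1" 2] by (simp add: Mn axis_def X_Y_Z_def[symmetric] algebra_simps)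
  have e13: "X*d - Z*f + Z*a - X*c = 0" using q[of "axis 1 1" 3] by (simp add: Mn axis_def X_Y_Z_def[symmetric] algebra_simps)
  have e14: "X*e + Y*f - Y*a + X*b = 0" using q[of "axis 1 1" 4] by (simp add: Mn axis_def X_Y_Z_def[symmetric] algebra_simps)
  have e23: "- (X*b) + Y*f - X*e - Y*a = 0" using q[of "axis 2 1" 3] by (simp add: Mn axis_def X_Y_Z_def[symmetric] algebra_simps)
  have e24: "- (X*c) + Z*f + X*d - Z*a = 0" using q[of "axis 2 1" 4] by (simp add: Mn axis_def X_Y_Z_def[symmetric] algebra_simps)
  have e34: "Y*d - Y*c - Z*e - Z*b = 0"
    using q[of "axis 3 1" 4] by (simp add: Mn axis_def X_Y_Z_def[symmetric] algebra_simps)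
  have fa: "X*(f-a) = 0" "Y*(f-a) = 0" "Z*(f-a) = 0" "X*(e+b) = 0" "Y*(e+b) = 0" "Z*(e+b) = 0"
    "X*(d-c) = 0" "Y*(d-c) = 0" "Z*(d-c) = 0"
    unfolding right_diff_distrib distrib_left
    using e11 e22 e33 e44 e12 e13 e14 e23 e24 e34 by linarith+
  have "X \<noteq> 0 \<or> Y \<noteq> 0 \<or> Z \<noteq> 0" using n by auto
  then have "f = a" "e = -b" "d = c" using fa by auto
  define \<xi> :: "real^3" where "\<xi> = vector [a, b, c]"
  have y: "\<xi>$1 = a" "\<xi>$2 = b" "\<xi>$3 = c" by (simp_all add: \<xi>_def)
  have "M = Kop \<xi>" using \<open>f = a\<close> \<open>e = -b\<close> \<open>d = c\<close> by (intro ext) (simp add: vec4 Mn y algebra_simps)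
  moreover have "\<xi> \<bullet> x = 0" using e11 by (simp add: vec3 y X_Y_Z_def mult.commute)
  ultimately show ?thesis by blast
qed

section \<open>Smooth functions on Euclidean spaces\<close>

lemma Ck_on_cong:
  fixes S :: "'e::euclidean_space set"
  assumes S: "open S"
  shows "(\<forall>x\<in>S. f x = g x) \<Longrightarrow> Ck_on k S f \<Longrightarrow> Ck_on k S g"
proof (induction k arbitrary: f g)
  case 0 then show ?case by (simp cong: continuous_on_cong)
next
  case (Suc k)
  have der: "(g has_derivative f') (at x)" if "(f has_derivative f') (at x)" "x \<in> S" for f' x
    using has_derivative_transform_within_open[OF that(1) S that(2)] Suc.prems(1) by auto
  have fr: "frechet_derivative f (at x) v = frechet_derivative g (at x) v" if "x \<in> S" for x v
  proof -
    have "(f has_derivative frechet_derivative f (at x)) (at x)"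
      using Suc.prems(2) that frechet_derivative_works by auto
    from frechet_derivative_at[OF der[OF this that]] show ?thesis by simp
  qed
  show ?case
    unfolding Ck_on.simps
  proof (intro conjI ballI allI)
    fix x assume "x \<in> S"
    then show "g differentiable (at x)"
      using Suc.prems(2) der[OF _ \<open>x \<in> S\<close>] unfolding Ck_on.simps differentiable_def by blast
  next
    fix v
    show "Ck_on k S (\<lambda>x. frechet_derivative g (at x) v)"
      using Suc.IH[of "\<lambda>x. frechet_derivative f (at x) v"] fr Suc.prems(2) by auto
  qed
qed

lemma Ck_on_subset:
  assumes "T \<subseteq> S"
  shows "Ck_on k S f \<Longrightarrow> Ck_on k T f"
  using assms by (induction k arbitrary: f) (auto intro: continuous_on_subset)

lemma Ck_on_SucI:
  fixes S :: "'e::euclidean_space set"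
  assumes S: "open S" and d: "\<And>x. x \<in> S \<Longrightarrow> (f has_derivative f' x) (at x)"
    and c: "\<And>v. Ck_on k S (\<lambda>x. f' x v)"
  shows "Ck_on (Suc k) S f"
  unfolding Ck_on.simps
proof (intro conjI ballI allI)
  fix x assume "x \<in> S" then show "f differentiable (at x)" using d by (auto simp: differentiable_def)
next
  fix v show "Ck_on k S (\<lambda>x. frechet_derivative f (at x) v)"
    by (rule Ck_on_cong[OF S _ c[of v]]) (use frechet_derivative_at[OF d] in auto)
qed

lemma Ck_on_der:
  assumes "Ck_on (Suc k) S f" "x \<in> S"
  shows "(f has_derivative frechet_derivative f (at x)) (at x)"
  using assms frechet_derivative_works by auto

lemma Ck_on_continuous:
  assumes "Ck_on k S f"
  shows "continuous_on S f"
proof (cases k)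
  case (Suc n)
  then have "\<forall>x\<in>S. f differentiable (at x)" using assms by simp
  then show ?thesis
    by (intro differentiable_imp_continuous_on differentiable_at_imp_differentiable_on) auto
qed (use assms in auto)

lemma Ck_on_SucD: "Ck_on (Suc k) S f \<Longrightarrow> Ck_on k S f"
proof (induction k arbitrary: f)
  case 0 then show ?case using Ck_on_continuous[OF 0] by simp
next
  case (Suc k) then show ?case by simp
qed

lemma Ck_on_const [simp]: "Ck_on k S (\<lambda>x. c)"
  by (induction k arbitrary: c) auto

lemma Ck_on_linear:
  assumes S: "open S" and L: "bounded_linear L"
  shows "Ck_on k S f \<Longrightarrow> Ck_on k S (\<lambda>x. L (f x))"
proof (induction k arbitrary: f)
  case 0 then show ?case using L by (auto intro: bounded_linear.continuous_on)
next
  case (Suc k)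
  show ?case
    by (rule Ck_on_SucI[OF S bounded_linear.has_derivative[OF L Ck_on_der[OF Suc.prems]]])
      (use Suc in auto)
qed

lemma Ck_on_add:
  assumes S: "open S"
  shows "Ck_on k S f \<Longrightarrow> Ck_on k S g \<Longrightarrow> Ck_on k S (\<lambda>x. f x + g x)"
proof (induction k arbitrary: f g)
  case 0 then show ?case by (auto intro: continuous_intros)
next
  case (Suc k)
  show ?case
    by (rule Ck_on_SucI[OF S has_derivative_add[OF Ck_on_der[OF Suc.prems(1)] Ck_on_der[OF Suc.prems(2)]]])
      (use Suc in auto)
qed

lemma Ck_on_sum:
  assumes S: "open S"
  shows "(\<And>i. i \<in> I \<Longrightarrow> Ck_on k S (f i)) \<Longrightarrow> Ck_on k S (\<lambda>x. \<Sum>i\<in>I. f i x)"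
  by (induction I rule: infinite_finite_induct) (auto intro: Ck_on_add[OF S])

lemma Ck_on_bilinear:
  assumes S: "open S" and P: "bounded_bilinear P"
  shows "Ck_on k S f \<Longrightarrow> Ck_on k S g \<Longrightarrow> Ck_on k S (\<lambda>x. P (f x) (g x))"
proof (induction k arbitrary: f g)
  case 0 then show ?case using bounded_bilinear.continuous_on[OF P] by auto
next
  case (Suc k)
  show ?case
    by (rule Ck_on_SucI[OF S bounded_bilinear.FDERIV[OF P Ck_on_der[OF Suc.prems(1)] Ck_on_der[OF Suc.prems(2)]]])
      (use Suc Ck_on_SucD[OF Suc.prems(1)] Ck_on_SucD[OF Suc.prems(2)] in \<open>auto intro!: Ck_on_add[OF S]\<close>)
qed

text \<open>
  The function \<open>f\<close> stays fixed in the induction: the derivative of the composition is the sum over a basis of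
  products of directional derivatives of \<open>f\<close> with functions \<open>Dg(b) \<circ> f\<close>, to which the induction hypothesis applies.
\<close>

lemma Ck_on_compose:
  fixes f :: "'e::euclidean_space \<Rightarrow> 'f::euclidean_space"
  assumes S: "open S" and T: "open T" and fS: "f ` S \<subseteq> T"
  shows "Ck_on k S f \<Longrightarrow> Ck_on k T g \<Longrightarrow> Ck_on k S (\<lambda>x. g (f x))"
proof (induction k arbitrary: g)
  case 0 then show ?case using fS by (auto intro: continuous_on_compose2)
next
  case (Suc k)
  let ?g = "\<lambda>x b. frechet_derivative g (at x) b" and ?f = "\<lambda>x b. frechet_derivative f (at x) b"
  have dg: "(g has_derivative ?g (f x)) (at (f x))" if "x \<in> S" for x
    using Ck_on_der[OF Suc.prems(2)] fS that by auto
  have "(\<Sum>b\<in>Basis. (?f x v \<bullet> b) *\<^sub>R ?g (f x) b) = ?g (f x) (?f x v)" if "x \<in> S" for x v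
  proof -
    have l: "linear (?g (f x))" using dg[OF that] has_derivative_linear by blast
    have "?g (f x) (?f x v) = ?g (f x) (\<Sum>b\<in>Basis. (?f x v \<bullet> b) *\<^sub>R b)" by (simp add: euclidean_representation)
    also have "\<dots> = (\<Sum>b\<in>Basis. (?f x v \<bullet> b) *\<^sub>R ?g (f x) b)"
      by (simp add: linear_sum[OF l] linear_scale[OF l])
    finally show ?thesis by simp
  qed
  then have d: "((\<lambda>x. g (f x)) has_derivative (\<lambda>v. \<Sum>b\<in>Basis. (?f x v \<bullet> b) *\<^sub>R ?g (f x) b)) (at x)" if "x \<in> S" for x
    using has_derivative_compose[OF Ck_on_der[OF Suc.prems(1) that] dg[OF that]] that by (simp add: o_def)
  have gc: "Ck_on k S (\<lambda>x. ?g (f x) b)" for b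
    using Suc.IH[OF Ck_on_SucD[OF Suc.prems(1)], of "\<lambda>y. ?g y b"] Suc.prems(2) by simp
  show ?case
    by (rule Ck_on_SucI[OF S d])
      (use gc Suc.IH[OF Ck_on_SucD[OF Suc.prems(1)]] Suc.prems in
        \<open>auto intro!: Ck_on_sum[OF S] Ck_on_bilinear[OF S bounded_bilinear_scaleR] Ck_on_linear[OF S bounded_linear_inner_left]\<close>)
qed

lemma Ck_on_inverse: "Ck_on k {x::real. x \<noteq> 0} inverse"
proof (induction k)
  case 0 then show ?case by (auto intro!: continuous_intros)
next
  case (Suc k)
  have o: "open {x::real. x \<noteq> 0}" by (simp add: open_Collect_neq continuous_on_const continuous_on_id)
  show ?case
    by (rule Ck_on_SucI[OF o, where f' = "\<lambda>x v. - (inverse x * v * inverse x)"])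
      (auto intro!: derivative_eq_intros Ck_on_linear[OF o bounded_linear_minus[OF bounded_linear_ident]]
         Ck_on_bilinear[OF o bounded_bilinear_mult] Suc)
qed

lemma Ck_on_sqrt: "Ck_on k {0<..} sqrt"
proof (induction k)
  case 0 then show ?case by (auto intro!: continuous_intros)
next
  case (Suc k)
  have o: "open {0::real<..}" "open {x::real. x \<noteq> 0}"
    by (auto simp add: open_Collect_neq continuous_on_const continuous_on_id)
  have i: "Ck_on k {0<..} (\<lambda>x. inverse (sqrt x))"
    by (rule Ck_on_compose[OF o _ Suc Ck_on_inverse]) auto
  have c: "Ck_on k {0<..} (\<lambda>x. inverse (sqrt x) * (v / 2))" for v
    by (rule Ck_on_bilinear[OF o(1) bounded_bilinear_mult i Ck_on_const])
  have d: "(sqrt has_derivative (\<lambda>v. inverse (sqrt x) * (v / 2))) (at x)" if "x \<in> {0<..}" for x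
    using that by (auto intro!: derivative_eq_intros simp: field_simps)
  show ?case
    by (rule Ck_on_SucI[OF o(1) d c])
qed

lemma smooth_on_subset: "smooth_on S f \<Longrightarrow> T \<subseteq> S \<Longrightarrow> smooth_on T f"
  unfolding smooth_on_def using Ck_on_subset by blast

lemma smooth_on_const [simp]: "smooth_on S (\<lambda>x. c)" by (simp add: smooth_on_def)

lemma smooth_on_der:
  "smooth_on S f \<Longrightarrow> x \<in> S \<Longrightarrow> (f has_derivative frechet_derivative f (at x)) (at x)"
  unfolding smooth_on_def using Ck_on_der by blast

lemma smooth_on_dir: "smooth_on S f \<Longrightarrow> smooth_on S (\<lambda>x. frechet_derivative f (at x) v)"
  unfolding smooth_on_def by (metis Ck_on.simps(2))

lemma smooth_on_linear: "smooth_on S f \<Longrightarrow> open S \<Longrightarrow> bounded_linear L \<Longrightarrow> smooth_on S (\<lambda>x. L (f x))"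
  unfolding smooth_on_def using Ck_on_linear by blast

lemma smooth_on_ident [simp]: "smooth_on S (\<lambda>x. x)"
  unfolding smooth_on_def
proof
  fix k show "Ck_on k S (\<lambda>x. x)" by (cases k) auto
qed

lemma smooth_on_bounded_linear: "bounded_linear L \<Longrightarrow> open S \<Longrightarrow> smooth_on S L"
  using smooth_on_linear[OF smooth_on_ident] by blast

lemma smooth_on_add: "smooth_on S f \<Longrightarrow> smooth_on S g \<Longrightarrow> open S \<Longrightarrow> smooth_on S (\<lambda>x. f x + g x)"
  unfolding smooth_on_def using Ck_on_add by blast

lemma smooth_on_bilinear:
  "smooth_on S f \<Longrightarrow> smooth_on S g \<Longrightarrow> open S \<Longrightarrow> bounded_bilinear P \<Longrightarrow> smooth_on S (\<lambda>x. P (f x) (g x))"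
  unfolding smooth_on_def using Ck_on_bilinear by blast

lemma smooth_on_compose:
  fixes f :: "'e::euclidean_space \<Rightarrow> 'f::euclidean_space"
  shows "smooth_on S f \<Longrightarrow> smooth_on T g \<Longrightarrow> open S \<Longrightarrow> open T \<Longrightarrow> (\<And>x. x \<in> S \<Longrightarrow> f x \<in> T) \<Longrightarrow> smooth_on S (\<lambda>x. g (f x))"
  unfolding smooth_on_def using Ck_on_compose[of S T f] by blast

lemma smooth_on_inverse: "smooth_on {x::real. x \<noteq> 0} inverse"
  by (simp add: smooth_on_def Ck_on_inverse)

lemma smooth_on_sqrt: "smooth_on {0<..} sqrt"
  by (simp add: smooth_on_def Ck_on_sqrt)

lemma smooth_on_continuous: "smooth_on S f \<Longrightarrow> continuous_on S f"
  unfolding smooth_on_def using Ck_on_continuous by blast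

text \<open>
  Differentiation under the integral sign turns the integrand into one of the same form with \<open>n + 1\<close> in place of \<open>n\<close>;
  the weight \<open>t ^ n\<close> is there to make the statement inductive.
\<close>

lemma Ck_on_integral:
  fixes f :: "'e::euclidean_space \<Rightarrow> real"
  assumes f: "smooth_on (ball a r) f"
  shows "Ck_on k (ball a r) (\<lambda>x. integral (cbox 0 (1::real)) (\<lambda>t. t ^ n * f (a + t *\<^sub>R (x - a))))"
  using f
proof (induction k arbitrary: f n)
  let ?B = "ball a r"
  have in_B: "a + t *\<^sub>R (x - a) \<in> ?B" if "x \<in> ?B" "t \<in> cbox 0 (1::real)" for x t
  proof -
    have "norm (t *\<^sub>R (x - a)) \<le> norm (x - a)" using that by (auto intro: mult_left_le_one_le)
    then show ?thesis using that by (auto simp: dist_norm norm_minus_commute)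
  qed
  have cont: "continuous_on (?B \<times> cbox 0 (1::real)) (\<lambda>(x, t). t ^ n * f (a + t *\<^sub>R (x - a)))"
    if "smooth_on ?B f" for f :: "'e \<Rightarrow> real" and n
    unfolding split_beta
    by (intro continuous_intros continuous_on_compose2[OF smooth_on_continuous[OF that]])
       (use in_B in auto)
  {
    case 0
    have c: "continuous_on ?B (\<lambda>x. t ^ n * f (a + t *\<^sub>R (x - a)))" if "t \<in> cbox 0 1" for t
      by (intro continuous_intros continuous_on_compose2[OF smooth_on_continuous[OF 0]]) (use in_B that in auto)
    show ?case
      using integral_continuous_on_param[OF cont[OF 0]] by simp
  next
    case (Suc k)
    let ?f' = "\<lambda>x v. frechet_derivative f (at x) v"
    let ?fx = "\<lambda>x t. \<Sum>b\<in>Basis. (t ^ Suc n * ?f' (a + t *\<^sub>R (x - a)) b) *\<^sub>R blinfun_inner_left b"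
    have fx: "blinfun_apply (?fx x t) v = t ^ Suc n * ?f' (a + t *\<^sub>R (x - a)) v"
      if "x \<in> ?B" "t \<in> cbox 0 1" for x t v
    proof -
      have l: "linear (?f' (a + t *\<^sub>R (x - a)))"
        using smooth_on_der[OF Suc.prems in_B[OF that]] has_derivative_linear by blast
      have "?f' (a + t *\<^sub>R (x - a)) v = ?f' (a + t *\<^sub>R (x - a)) (\<Sum>b\<in>Basis. (v \<bullet> b) *\<^sub>R b)"
        by (simp add: euclidean_representation)
      also have "\<dots> = (\<Sum>b\<in>Basis. (v \<bullet> b) * ?f' (a + t *\<^sub>R (x - a)) b)"
        by (simp add: linear_sum[OF l] linear_scale[OF l])
      finally show ?thesis
        by (simp add: blinfun.sum_left blinfun.scaleR_left sum_distrib_left inner_commute algebra_simps)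
    qed
    have d: "((\<lambda>x. integral (cbox 0 (1::real)) (\<lambda>t. t ^ n * f (a + t *\<^sub>R (x - a)))) has_derivative
        (\<lambda>v. integral (cbox 0 1) (\<lambda>t. t ^ Suc n * ?f' (a + t *\<^sub>R (x - a)) v))) (at x)"
      if x: "x \<in> ?B" for x
    proof -
      have "((\<lambda>x. integral (cbox 0 (1::real)) (\<lambda>t. t ^ n * f (a + t *\<^sub>R (x - a)))) has_derivative
        blinfun_apply (integral (cbox 0 1) (?fx x))) (at x within ?B)"
      proof (rule leibniz_rule)
        fix y t assume y: "y \<in> ?B" and t: "t \<in> cbox 0 (1::real)"
        have d1: "((\<lambda>y. a + t *\<^sub>R (y - a)) has_derivative (\<lambda>v. t *\<^sub>R v)) (at y)"
          by (auto intro!: derivative_eq_intros)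
        have l: "linear (?f' (a + t *\<^sub>R (y - a)))"
          using smooth_on_der[OF Suc.prems in_B[OF y t]] has_derivative_linear by blast
        have "((\<lambda>y. t ^ n * f (a + t *\<^sub>R (y - a))) has_derivative
           (\<lambda>v. t ^ n * ?f' (a + t *\<^sub>R (y - a)) (t *\<^sub>R v))) (at y)"
          by (rule has_derivative_mult_right[OF has_derivative_compose[OF d1 smooth_on_der[OF Suc.prems in_B[OF y t]]]])
        moreover have "(\<lambda>v. t ^ n * ?f' (a + t *\<^sub>R (y - a)) (t *\<^sub>R v)) = blinfun_apply (?fx y t)"
          using fx[OF y t] by (auto simp: linear_scale[OF l] fun_eq_iff)
        ultimately show "((\<lambda>y. t ^ n * f (a + t *\<^sub>R (y - a))) has_derivative blinfun_apply (?fx y t)) (at y within ?B)"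
          by (auto intro: has_derivative_at_withinI)
      next
        fix y assume y: "y \<in> ?B"
        have "continuous_on (cbox 0 1) (\<lambda>t. t ^ n * f (a + t *\<^sub>R (y - a)))"
          by (intro continuous_intros continuous_on_compose2[OF smooth_on_continuous[OF Suc.prems]])
            (use in_B y in auto)
        then show "(\<lambda>t. t ^ n * f (a + t *\<^sub>R (y - a))) integrable_on cbox 0 1"
          by (rule integrable_continuous)
      next
        have "continuous_on (?B \<times> cbox 0 (1::real)) (\<lambda>z. snd z ^ Suc n * ?f' (a + snd z *\<^sub>R (fst z - a)) b)" for b
          using cont[OF smooth_on_dir[OF Suc.prems], of "Suc n" b] by (simp add: split_beta)
        then show "continuous_on (?B \<times> cbox 0 (1::real)) (\<lambda>(x, t). ?fx x t)"
          unfolding split_beta by (intro continuous_on_sum continuous_on_scaleR continuous_on_const)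
      qed (use x in auto)
      moreover have "at x within ?B = at x" by (rule at_within_open[OF x open_ball])
      moreover have "blinfun_apply (integral (cbox 0 1) (?fx x)) =
          (\<lambda>v. integral (cbox 0 1) (\<lambda>t. t ^ Suc n * ?f' (a + t *\<^sub>R (x - a)) v))"
      proof
        fix v
        have c: "continuous_on (cbox 0 1) (\<lambda>t. t ^ Suc n * ?f' (a + t *\<^sub>R (x - a)) b)" for b
          by (intro continuous_intros continuous_on_compose2[OF smooth_on_continuous[OF smooth_on_dir[OF Suc.prems]]])
            (use in_B x in auto)
        have "?fx x integrable_on cbox 0 1"
          by (rule integrable_continuous) (intro continuous_on_sum continuous_on_scaleR c continuous_on_const)
        then have "blinfun_apply (integral (cbox 0 1) (?fx x)) v = integral (cbox 0 1) (\<lambda>t. blinfun_apply (?fx x t) v)"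
          by (rule blinfun_apply_integral)
        also have "\<dots> = integral (cbox 0 1) (\<lambda>t. t ^ Suc n * ?f' (a + t *\<^sub>R (x - a)) v)"
          by (rule integral_cong) (use fx[OF x] in auto)
        finally show "blinfun_apply (integral (cbox 0 1) (?fx x)) v =
          integral (cbox 0 1) (\<lambda>t. t ^ Suc n * ?f' (a + t *\<^sub>R (x - a)) v)" .
      qed
      ultimately show ?thesis by (simp only:)
    qed
    show ?case
      by (rule Ck_on_SucI[OF open_ball d Suc.IH[OF smooth_on_dir[OF Suc.prems]]])
  }
qed

text \<open>
  Integrate the derivative of \<open>f\<close> along the segment from \<open>a\<close> to \<open>x\<close>. This is what makes derivations of the algebra of
  smooth functions directional derivatives.
\<close>

lemma Hadamard:
  fixes f :: "'e::euclidean_space \<Rightarrow> real"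
  assumes f: "smooth_on (ball a r) f"
  obtains G where "\<And>b. smooth_on (ball a r) (G b)"
    "\<And>x. x \<in> ball a r \<Longrightarrow> f x = f a + (\<Sum>b\<in>Basis. ((x - a) \<bullet> b) * G b x)"
    "\<And>b. G b a = frechet_derivative f (at a) b"
proof
  let ?f' = "\<lambda>x v. frechet_derivative f (at x) v"
  let ?G = "\<lambda>b x. integral (cbox 0 (1::real)) (\<lambda>t. ?f' (a + t *\<^sub>R (x - a)) b)"
  show "smooth_on (ball a r) (?G b)" for b
    using Ck_on_integral[OF smooth_on_dir[OF f], of _ 0 b] by (simp add: smooth_on_def)
  show "?G b a = ?f' a b" for b by simp
  fix x assume x: "x \<in> ball a r"
  have in_B: "a + t *\<^sub>R (x - a) \<in> ball a r" if "t \<in> cbox 0 (1::real)" for t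
  proof -
    have "norm (t *\<^sub>R (x - a)) \<le> norm (x - a)" using that by (auto intro: mult_left_le_one_le)
    then show ?thesis using x by (auto simp: dist_norm norm_minus_commute)
  qed
  have "((\<lambda>t. ?f' (a + t *\<^sub>R (x - a)) (x - a)) has_integral f (a + 1 *\<^sub>R (x - a)) - f (a + 0 *\<^sub>R (x - a))) {0..1}"
  proof (rule fundamental_theorem_of_calculus)
    fix t :: real assume t: "t \<in> {0..1}"
    have d1: "((\<lambda>t. a + t *\<^sub>R (x - a)) has_derivative (\<lambda>s. s *\<^sub>R (x - a))) (at t)"
      by (auto intro!: derivative_eq_intros)
    have i: "a + t *\<^sub>R (x - a) \<in> ball a r" using in_B t by auto
    have l: "linear (?f' (a + t *\<^sub>R (x - a)))"
      using smooth_on_der[OF f i] has_derivative_linear by blast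
    show "((\<lambda>t. f (a + t *\<^sub>R (x - a))) has_vector_derivative ?f' (a + t *\<^sub>R (x - a)) (x - a)) (at t within {0..1})"
      unfolding has_vector_derivative_def
      using has_derivative_at_withinI[OF has_derivative_compose[OF d1 smooth_on_der[OF f i]]] by (simp add: linear_scale[OF l])
  qed simp
  then have "f x - f a = integral {0..1} (\<lambda>t. ?f' (a + t *\<^sub>R (x - a)) (x - a))"
    by (simp add: integral_unique)
  also have "\<dots> = integral {0..1} (\<lambda>t. \<Sum>b\<in>Basis. ((x - a) \<bullet> b) * ?f' (a + t *\<^sub>R (x - a)) b)"
  proof (rule integral_cong)
    fix t :: real assume t: "t \<in> {0..1}"
    have l: "linear (?f' (a + t *\<^sub>R (x - a)))"
      using smooth_on_der[OF f in_B] t has_derivative_linear by fastforce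
    have "?f' (a + t *\<^sub>R (x - a)) (x - a) = ?f' (a + t *\<^sub>R (x - a)) (\<Sum>b\<in>Basis. ((x - a) \<bullet> b) *\<^sub>R b)"
      by (simp only: euclidean_representation)
    also have "\<dots> = (\<Sum>b\<in>Basis. ((x - a) \<bullet> b) * ?f' (a + t *\<^sub>R (x - a)) b)"
      by (simp add: linear_sum[OF l] linear_scale[OF l])
    finally show "?f' (a + t *\<^sub>R (x - a)) (x - a) = \<dots>" .
  qed
  also have "\<dots> = (\<Sum>b\<in>Basis. integral {0..1} (\<lambda>t. ((x - a) \<bullet> b) * ?f' (a + t *\<^sub>R (x - a)) b))"
  proof (rule integral_sum)
    fix b :: 'e
    have "continuous_on {0..1} (\<lambda>t. ((x - a) \<bullet> b) * ?f' (a + t *\<^sub>R (x - a)) b)"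
      by (intro continuous_intros continuous_on_compose2[OF smooth_on_continuous[OF smooth_on_dir[OF f]]])
        (use in_B in auto)
    then show "(\<lambda>t. ((x - a) \<bullet> b) * ?f' (a + t *\<^sub>R (x - a)) b) integrable_on {0..1}"
      by (rule integrable_continuous_interval)
  qed simp
  finally show "f x = f a + (\<Sum>b\<in>Basis. ((x - a) \<bullet> b) * ?G b x)" by simp
qed

section \<open>Tangent vectors and vector fields in one coordinate system\<close>

lemma sum_fun_apply: "(\<Sum>i\<in>I. f i) x = (\<Sum>i\<in>I. f i x :: real)"
  by (induction I rule: infinite_finite_induct) auto

lemma fscale_apply [simp]: "(c *\<^sub>F v) x = c * v x" by (simp add: fscale_def)

text \<open>
  A region \<open>U\<close> of the space \<open>S\<close> on which smoothness is smoothness in terms of the single coordinate map \<open>\<kappa>\<close>. The image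
  of \<open>\<kappa>\<close> need not be open in its Euclidean space: the twistor space will have the coordinates \<open>\<phi>\<close> of the base point together
  with a point of the unit sphere in \<open>\<real>\<^sup>3\<close>. Thus all facts below apply to the base manifold and to the twistor space.
\<close>

locale chart_nbhd =
  fixes A :: "('a, 'e::euclidean_space) chart set" and S U :: "'a set" and \<kappa> :: "'a \<Rightarrow> 'k::euclidean_space"
  assumes US: "U \<subseteq> S"
    and sm_iff: "\<And>p f. p \<in> U \<Longrightarrow> smooth_near A S p f \<longleftrightarrow>
      (\<exists>W F. open W \<and> \<kappa> p \<in> W \<and> smooth_on W F \<and> (\<forall>q\<in>U. \<kappa> q \<in> W \<longrightarrow> f q = F (\<kappa> q)))"
    and nb_iff: "\<And>p P. p \<in> U \<Longrightarrow> nearby A S p P \<longleftrightarrow>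
      (\<exists>W. open W \<and> \<kappa> p \<in> W \<and> (\<forall>q\<in>U. \<kappa> q \<in> W \<longrightarrow> P q))"
begin

abbreviation "sm \<equiv> smooth_near A S"
abbreviation "nb \<equiv> nearby A S"
abbreviation "T \<equiv> tangent_space A S"
abbreviation "vf \<equiv> vfield_near A S"
abbreviation "lb \<equiv> lie_bracket A S"

definition smv :: "'a \<Rightarrow> ('a \<Rightarrow> 'm::euclidean_space) \<Rightarrow> bool" where
  "smv p h \<longleftrightarrow> (\<exists>W H. open W \<and> \<kappa> p \<in> W \<and> smooth_on W H \<and> (\<forall>q\<in>U. \<kappa> q \<in> W \<longrightarrow> h q = H (\<kappa> q)))"

lemma nb_at: "p \<in> U \<Longrightarrow> nb p P \<Longrightarrow> P p" by (auto simp: nb_iff)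

lemma nb_U: "p \<in> U \<Longrightarrow> nb p (\<lambda>q. q \<in> U)" by (auto simp: nb_iff)

lemma nb_mono: "p \<in> U \<Longrightarrow> nb p P \<Longrightarrow> (\<And>q. q \<in> U \<Longrightarrow> P q \<Longrightarrow> Q q) \<Longrightarrow> nb p Q"
  unfolding nb_iff by blast

lemma nb_all: "p \<in> U \<Longrightarrow> (\<And>q. q \<in> U \<Longrightarrow> Q q) \<Longrightarrow> nb p Q"
  unfolding nb_iff by blast

lemma nb_conj: assumes "p \<in> U" "nb p P" "nb p Q" shows "nb p (\<lambda>q. P q \<and> Q q)"
proof -
  obtain W V where "open W" "\<kappa> p \<in> W" "\<forall>q\<in>U. \<kappa> q \<in> W \<longrightarrow> P q" "open V" "\<kappa> p \<in> V" "\<forall>q\<in>U. \<kappa> q \<in> V \<longrightarrow> Q q"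
    using assms(2,3) unfolding nb_iff[OF assms(1)] by blast
  then show ?thesis unfolding nb_iff[OF assms(1)] by (intro exI[of _ "W \<inter> V"]) auto
qed

lemma nb_mono2: "p \<in> U \<Longrightarrow> nb p P \<Longrightarrow> nb p Q \<Longrightarrow> (\<And>q. q \<in> U \<Longrightarrow> P q \<Longrightarrow> Q q \<Longrightarrow> R q) \<Longrightarrow> nb p R"
  using nb_mono[OF _ nb_conj, of p P Q R] by blast

lemma nb_nb: assumes "p \<in> U" "nb p P" shows "nb p (\<lambda>q. nb q P)"
proof -
  obtain W where "open W" "\<kappa> p \<in> W" "\<forall>q\<in>U. \<kappa> q \<in> W \<longrightarrow> P q"
    using assms(2) unfolding nb_iff[OF assms(1)] by blast
  then show ?thesis unfolding nb_iff[OF assms(1)] by (intro exI[of _ "W"]) (auto simp: nb_iff)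
qed

lemma nb_ball: assumes "p \<in> U" "finite I" "\<And>i. i \<in> I \<Longrightarrow> nb p (P i)" shows "nb p (\<lambda>q. \<forall>i\<in>I. P i q)"
  using assms(2,3)
proof (induction I)
  case empty then show ?case by (auto intro: nb_all assms(1))
next
  case (insert i I) then show ?case
    using nb_conj[OF assms(1), of "P i" "\<lambda>q. \<forall>i\<in>I. P i q"] by simp
qed

lemma sm_smv: "p \<in> U \<Longrightarrow> sm p f \<longleftrightarrow> smv p f"
  unfolding smv_def by (rule sm_iff)

lemma smv_const [simp]: "smv p (\<lambda>q. c)"
  unfolding smv_def by (intro exI[of _ UNIV] exI[of _ "\<lambda>q. c"]) auto

lemma smv_kappa: "smv p \<kappa>"
  unfolding smv_def by (intro exI[of _ UNIV] exI[of _ "\<lambda>q. q"]) auto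

lemma smv_compose:
  assumes "smv p h" "open V" "h p \<in> V" "smooth_on V G" "p \<in> U"
  shows "smv p (\<lambda>q. G (h q))"
proof -
  obtain W H where W: "open W" "\<kappa> p \<in> W" "smooth_on W H" "\<forall>q\<in>U. \<kappa> q \<in> W \<longrightarrow> h q = H (\<kappa> q)"
    using assms(1) unfolding smv_def by blast
  have o: "open (W \<inter> H -` V)"
    using continuous_open_preimage[OF smooth_on_continuous[OF W(3)] W(1) assms(2)] by simp
  have "smooth_on (W \<inter> H -` V) (\<lambda>x. G (H x))"
    by (rule smooth_on_compose[OF smooth_on_subset[OF W(3)] assms(4) o assms(2)]) auto
  moreover have "\<kappa> p \<in> W \<inter> H -` V" using W assms(3,5) by auto
  ultimately show ?thesis unfolding smv_def using o W(4)
    by (intro exI[of _ "W \<inter> H -` V"] exI[of _ "\<lambda>x. G (H x)"]) auto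
qed

lemma smv_rep2:
  assumes "smv p h" "smv p k"
  obtains W H K where "open W" "\<kappa> p \<in> W" "smooth_on W H" "smooth_on W K"
    "\<forall>q\<in>U. \<kappa> q \<in> W \<longrightarrow> h q = H (\<kappa> q)" "\<forall>q\<in>U. \<kappa> q \<in> W \<longrightarrow> k q = K (\<kappa> q)"
proof -
  obtain W H where W: "open W" "\<kappa> p \<in> W" "smooth_on W H" "\<forall>q\<in>U. \<kappa> q \<in> W \<longrightarrow> h q = H (\<kappa> q)"
    using assms(1) unfolding smv_def by blast
  obtain V K where V: "open V" "\<kappa> p \<in> V" "smooth_on V K" "\<forall>q\<in>U. \<kappa> q \<in> V \<longrightarrow> k q = K (\<kappa> q)"
    using assms(2) unfolding smv_def by blast
  show ?thesis
    by (rule that[OF open_Int[OF W(1) V(1)] _ smooth_on_subset[OF W(3)] smooth_on_subset[OF V(3)]])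
      (use W V in auto)
qed

lemma smv_bilinear:
  assumes "smv p h" "smv p k" "bounded_bilinear P"
  shows "smv p (\<lambda>q. P (h q) (k q))"
proof -
  obtain W H K where W: "open W" "\<kappa> p \<in> W" "smooth_on W H" "smooth_on W K"
    "\<forall>q\<in>U. \<kappa> q \<in> W \<longrightarrow> h q = H (\<kappa> q)" "\<forall>q\<in>U. \<kappa> q \<in> W \<longrightarrow> k q = K (\<kappa> q)" by (rule smv_rep2[OF assms(1,2)])
  show ?thesis unfolding smv_def
    by (intro exI[of _ W] exI[of _ "\<lambda>x. P (H x) (K x)"]) (use W assms(3) smooth_on_bilinear in auto)
qed

lemma smv_add: assumes "smv p h" "smv p k" shows "smv p (\<lambda>q. h q + k q)"
proof -
  obtain W H K where W: "open W" "\<kappa> p \<in> W" "smooth_on W H" "smooth_on W K"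
    "\<forall>q\<in>U. \<kappa> q \<in> W \<longrightarrow> h q = H (\<kappa> q)" "\<forall>q\<in>U. \<kappa> q \<in> W \<longrightarrow> k q = K (\<kappa> q)" by (rule smv_rep2[OF assms(1,2)])
  show ?thesis unfolding smv_def
    by (intro exI[of _ W] exI[of _ "\<lambda>x. H x + K x"]) (use W smooth_on_add in auto)
qed

lemma smv_linear: assumes "smv p h" "bounded_linear L" shows "smv p (\<lambda>q. L (h q))"
proof -
  obtain W H where W: "open W" "\<kappa> p \<in> W" "smooth_on W H"
    "\<forall>q\<in>U. \<kappa> q \<in> W \<longrightarrow> h q = H (\<kappa> q)" by (rule smv_rep2[OF assms(1,1)])
  show ?thesis unfolding smv_def
    by (intro exI[of _ W] exI[of _ "\<lambda>x. L (H x)"]) (use W assms(2) smooth_on_linear in auto)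
qed

lemma smv_sum: "(\<And>i. i \<in> I \<Longrightarrow> smv p (h i)) \<Longrightarrow> smv p (\<lambda>q. \<Sum>i\<in>I. h i q)"
  by (induction I rule: infinite_finite_induct) (auto intro: smv_add)

lemma smv_nb: assumes "p \<in> U" "smv p f" shows "nb p (\<lambda>q. smv q f)"
proof -
  obtain W H where W: "open W" "\<kappa> p \<in> W" "smooth_on W H" "\<forall>q\<in>U. \<kappa> q \<in> W \<longrightarrow> f q = H (\<kappa> q)"
    using assms(2) unfolding smv_def by blast
  then show ?thesis unfolding nb_iff[OF assms(1)] smv_def by (intro exI[of _ W]) blast
qed

lemma smv_cong: assumes "p \<in> U" "nb p (\<lambda>q. f q = h q)" "smv p f" shows "smv p h"
proof -
  obtain W H where W: "open W" "\<kappa> p \<in> W" "smooth_on W H" "\<forall>q\<in>U. \<kappa> q \<in> W \<longrightarrow> f q = H (\<kappa> q)"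
    using assms(3) unfolding smv_def by blast
  obtain V where V: "open V" "\<kappa> p \<in> V" "\<forall>q\<in>U. \<kappa> q \<in> V \<longrightarrow> f q = h q"
    using assms(2) unfolding nb_iff[OF assms(1)] by blast
  show ?thesis unfolding smv_def
    by (intro exI[of _ "W \<inter> V"] exI[of _ H]) (use W V smooth_on_subset[of W H "W \<inter> V"] in auto)
qed

lemma smv_componentsI:
  assumes "\<And>b. b \<in> Basis \<Longrightarrow> smv p (\<lambda>q. h q \<bullet> b)"
  shows "smv p h"
proof -
  have "smv p (\<lambda>q. \<Sum>b\<in>Basis. (h q \<bullet> b) *\<^sub>R b)"
    by (intro smv_sum smv_linear[OF assms bounded_linear_scaleR_left])
  then show ?thesis by (simp add: euclidean_representation)
qed

lemma smv_inner: "smv p h \<Longrightarrow> smv p (\<lambda>q. h q \<bullet> b)"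
  by (rule smv_linear[OF _ bounded_linear_inner_left])

lemma smv_Pair: assumes "smv p h" "smv p k" shows "smv p (\<lambda>q. (h q, k q))"
proof -
  have "smv p (\<lambda>q. (h q, 0) + (0, k q))"
    by (intro smv_add smv_linear[OF assms(1)] smv_linear[OF assms(2)])
      (auto intro!: bounded_linear_Pair bounded_linear_zero bounded_linear_ident)
  then show ?thesis by simp
qed

lemma sm_const [simp]: "p \<in> U \<Longrightarrow> sm p (\<lambda>q. c)" by (simp add: sm_smv)
lemma sm_add: "p \<in> U \<Longrightarrow> sm p f \<Longrightarrow> sm p h \<Longrightarrow> sm p (\<lambda>q. f q + h q)"
  by (simp add: sm_smv smv_add)
lemma sm_mult: "p \<in> U \<Longrightarrow> sm p f \<Longrightarrow> sm p h \<Longrightarrow> sm p (\<lambda>q. f q * h q)"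
  by (simp add: sm_smv smv_bilinear[OF _ _ bounded_bilinear_mult])
lemma sm_minus: "p \<in> U \<Longrightarrow> sm p f \<Longrightarrow> sm p (\<lambda>q. - f q)"
  by (simp add: sm_smv smv_linear[OF _ bounded_linear_minus[OF bounded_linear_ident]])
lemma sm_diff: "p \<in> U \<Longrightarrow> sm p f \<Longrightarrow> sm p h \<Longrightarrow> sm p (\<lambda>q. f q - h q)"
  using sm_add[OF _ _ sm_minus, of p f h] by simp
lemma sm_sum: "p \<in> U \<Longrightarrow> (\<And>i. i \<in> I \<Longrightarrow> sm p (f i)) \<Longrightarrow> sm p (\<lambda>q. \<Sum>i\<in>I. f i q)"
  by (simp add: sm_smv smv_sum)
lemma sm_cong: "p \<in> U \<Longrightarrow> nb p (\<lambda>q. f q = h q) \<Longrightarrow> sm p f \<Longrightarrow> sm p h"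
  using smv_cong by (simp add: sm_smv)
lemma sm_nb: "p \<in> U \<Longrightarrow> sm p f \<Longrightarrow> nb p (\<lambda>q. sm q f)"
  using nb_mono[OF _ smv_nb, of p f "\<lambda>q. sm q f"] by (simp add: sm_smv)
lemma sm_kappa: "p \<in> U \<Longrightarrow> sm p (\<lambda>q. \<kappa> q \<bullet> b)"
  by (simp add: sm_smv smv_inner smv_kappa)
lemma sm_inverse: "p \<in> U \<Longrightarrow> sm p f \<Longrightarrow> f p \<noteq> 0 \<Longrightarrow> sm p (\<lambda>q. inverse (f q))"
  unfolding sm_smv using smv_compose[OF _ _ _ smooth_on_inverse, of p f]
  by (simp add: open_Collect_neq continuous_on_const continuous_on_id)
lemma sm_sqrt: "p \<in> U \<Longrightarrow> sm p f \<Longrightarrow> f p > 0 \<Longrightarrow> sm p (\<lambda>q. sqrt (f q))"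
  unfolding sm_smv using smv_compose[OF _ _ _ smooth_on_sqrt, of p f] by simp

lemmas sm_intros = sm_const sm_add sm_mult sm_minus sm_diff sm_sum

lemma T_lin: "v \<in> T p \<Longrightarrow> sm p f \<Longrightarrow> sm p h \<Longrightarrow> v (\<lambda>q. a * f q + b * h q) = a * v f + b * v h"
  unfolding tangent_space_def by blast
lemma T_prod: "v \<in> T p \<Longrightarrow> sm p f \<Longrightarrow> sm p h \<Longrightarrow> v (\<lambda>q. f q * h q) = f p * v h + h p * v f"
  unfolding tangent_space_def by blast
lemma T_nsm: "v \<in> T p \<Longrightarrow> \<not> sm p f \<Longrightarrow> v f = 0"
  unfolding tangent_space_def by blast

lemma T_const: assumes "p \<in> U" "v \<in> T p" shows "v (\<lambda>q. c) = 0"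
proof -
  have "v (\<lambda>q. 1) = 0" using T_prod[OF assms(2) sm_const sm_const, of 1 1] assms(1) by simp
  then show ?thesis using T_lin[OF assms(2) sm_const sm_const, of c 1 0 1] assms(1) by simp
qed

lemma T_add: "p \<in> U \<Longrightarrow> v \<in> T p \<Longrightarrow> sm p f \<Longrightarrow> sm p h \<Longrightarrow> v (\<lambda>q. f q + h q) = v f + v h"
  using T_lin[of v p f h 1 1] by simp
lemma T_diff: "p \<in> U \<Longrightarrow> v \<in> T p \<Longrightarrow> sm p f \<Longrightarrow> sm p h \<Longrightarrow> v (\<lambda>q. f q - h q) = v f - v h"
  using T_lin[of v p f h 1 "-1"] by simp
lemma T_cmult: "p \<in> U \<Longrightarrow> v \<in> T p \<Longrightarrow> sm p f \<Longrightarrow> v (\<lambda>q. c * f q) = c * v f"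
  using T_lin[of v p f f c 0] by simp
lemma T_minus: "p \<in> U \<Longrightarrow> v \<in> T p \<Longrightarrow> sm p f \<Longrightarrow> v (\<lambda>q. - f q) = - v f"
  using T_cmult[of p v f "-1"] by simp
lemma T_sum: assumes p: "p \<in> U" and v: "v \<in> T p" and f: "\<And>i. i \<in> I \<Longrightarrow> sm p (f i)"
  shows "v (\<lambda>q. \<Sum>i\<in>I. f i q) = (\<Sum>i\<in>I. v (f i))"
  using f
proof (induction I rule: infinite_finite_induct)
  case (insert i I)
  then have "v (\<lambda>q. f i q + (\<Sum>i\<in>I. f i q)) = v (f i) + v (\<lambda>q. \<Sum>i\<in>I. f i q)"
    by (intro T_add[OF p v] sm_sum[OF p]) auto
  then show ?case using insert by simp
qed (simp_all add: T_const[OF p v])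

text \<open>
  Applying the Leibniz rule to the indicator function \<open>\<eta>\<close> of a neighbourhood gives \<open>v \<eta> = 0\<close>, and
  \<open>\<eta> f = \<eta> h\<close> then gives \<open>v f = v h\<close>.
\<close>

lemma T_cong: assumes "p \<in> U" "v \<in> T p" "nb p (\<lambda>q. f q = h q)" shows "v f = v h"
proof (cases "sm p f")
  case False
  have "nb p (\<lambda>q. h q = f q)" by (rule nb_mono[OF assms(1) assms(3)]) simp
  then have "\<not> sm p h" using False sm_cong[OF assms(1)] by blast
  then show ?thesis using False T_nsm[OF assms(2)] by simp
next
  case True
  then have sh: "sm p h" using sm_cong assms by blast
  obtain V where V: "open V" "\<kappa> p \<in> V" "\<forall>q\<in>U. \<kappa> q \<in> V \<longrightarrow> f q = h q"
    using assms(3) unfolding nb_iff[OF assms(1)] by blast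
  define \<eta> :: "'a \<Rightarrow> real" where "\<eta> q = (if q \<in> U \<and> \<kappa> q \<in> V then 1 else 0)" for q
  have "nb p (\<lambda>q. 1 = \<eta> q)" unfolding nb_iff[OF assms(1)] using V by (intro exI[of _ V]) (auto simp: \<eta>_def)
  then have sc: "sm p \<eta>" using sm_cong[OF assms(1) _ sm_const[OF assms(1)]] by blast
  have c1: "\<eta> p = 1" using V assms(1) by (simp add: \<eta>_def)
  have "(\<lambda>q. \<eta> q * \<eta> q) = \<eta>" by (auto simp: \<eta>_def)
  then have vc: "v \<eta> = 0" using T_prod[OF assms(2) sc sc] c1 by simp
  have "(\<lambda>q. \<eta> q * f q) = (\<lambda>q. \<eta> q * h q)" using V by (auto simp: \<eta>_def)
  then show ?thesis using T_prod[OF assms(2) sc True] T_prod[OF assms(2) sc sh] c1 vc by simp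
qed

lemma T_vadd: "v \<in> T p \<Longrightarrow> w \<in> T p \<Longrightarrow> v + w \<in> T p"
  unfolding tangent_space_def by (simp add: algebra_simps)
lemma T_vscale: "v \<in> T p \<Longrightarrow> c *\<^sub>F v \<in> T p"
  unfolding tangent_space_def by (simp add: algebra_simps)
lemma T_vzero: "0 \<in> T p"
  unfolding tangent_space_def by simp
lemma T_vuminus: "v \<in> T p \<Longrightarrow> - v \<in> T p"
  using T_vscale[of v p "-1"] by (simp add: fscale_def fun_Compl_def)
lemma T_vdiff: "v \<in> T p \<Longrightarrow> w \<in> T p \<Longrightarrow> v - w \<in> T p"
  using T_vadd[OF _ T_vuminus, of v p w] by simp
lemma T_vsum: "(\<And>i. i \<in> I \<Longrightarrow> v i \<in> T p) \<Longrightarrow> (\<Sum>i\<in>I. v i) \<in> T p"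
  by (induction I rule: infinite_finite_induct) (auto intro: T_vadd T_vzero)

lemmas T_intros = T_vadd T_vscale T_vzero T_vuminus T_vdiff T_vsum

definition vel :: "'a tvec \<Rightarrow> 'k" where "vel v = (\<Sum>b\<in>Basis. v (\<lambda>q. \<kappa> q \<bullet> b) *\<^sub>R b)"

text \<open>
  The functional \<open>v\<close> is the directional derivative along \<open>Y\<close> in the coordinates \<open>\<kappa>\<close>. When \<open>\<kappa> ` U\<close> is not open, a vector
  \<open>Y\<close> that does not point along the image may admit no such \<open>v\<close>.
\<close>

definition is_dir :: "'a \<Rightarrow> 'k \<Rightarrow> 'a tvec \<Rightarrow> bool" where
  "is_dir p Y v \<longleftrightarrow> (\<forall>f. \<not> sm p f \<longrightarrow> v f = 0) \<and>
     (\<forall>f W F. open W \<and> \<kappa> p \<in> W \<and> smooth_on W F \<and> (\<forall>q\<in>U. \<kappa> q \<in> W \<longrightarrow> f q = F (\<kappa> q)) \<longrightarrow>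
        v f = frechet_derivative F (at (\<kappa> p)) Y)"

lemma is_dirD: "is_dir p Y v \<Longrightarrow> open W \<Longrightarrow> \<kappa> p \<in> W \<Longrightarrow> smooth_on W F \<Longrightarrow>
    (\<forall>q\<in>U. \<kappa> q \<in> W \<longrightarrow> f q = F (\<kappa> q)) \<Longrightarrow> v f = frechet_derivative F (at (\<kappa> p)) Y"
  unfolding is_dir_def by blast

lemma vel_inner: "b \<in> Basis \<Longrightarrow> vel v \<bullet> b = v (\<lambda>q. \<kappa> q \<bullet> b)"
  unfolding vel_def by simp

lemma linear_frechet: "smooth_on W F \<Longrightarrow> y \<in> W \<Longrightarrow> linear (frechet_derivative F (at y))"
  using smooth_on_der has_derivative_linear by blast

lemma frechet_expand: "smooth_on W F \<Longrightarrow> y \<in> W \<Longrightarrow>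
   frechet_derivative F (at y) Y = (\<Sum>b\<in>Basis. (Y \<bullet> b) *\<^sub>R frechet_derivative F (at y) b)"
  using linear_frechet[of W F y] linear_sum[of "frechet_derivative F (at y)" "\<lambda>b. (Y \<bullet> b) *\<^sub>R b" Basis]
  by (simp add: euclidean_representation linear_scale)

text \<open>
  By Hadamard's lemma \<open>f\<close> is locally a constant plus a sum of products of smooth functions, one factor being a coordinate
  that vanishes at \<open>p\<close>; the Leibniz rule does the rest.
\<close>

lemma T_is_dir: assumes p: "p \<in> U" and v: "v \<in> T p" shows "is_dir p (vel v) v"
  unfolding is_dir_def
proof (intro conjI allI impI)
  fix f assume "\<not> sm p f" then show "v f = 0" using T_nsm v by blast
next
  fix f W and F :: "'k \<Rightarrow> real" assume A: "open W \<and> \<kappa> p \<in> W \<and> smooth_on W F \<and> (\<forall>q\<in>U. \<kappa> q \<in> W \<longrightarrow> f q = F (\<kappa> q))"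
  then obtain r where r: "r > 0" "ball (\<kappa> p) r \<subseteq> W" using open_contains_ball by blast
  have "smooth_on (ball (\<kappa> p) r) F" using A r smooth_on_subset by blast
  from Hadamard[OF this] obtain G where G: "\<And>b. smooth_on (ball (\<kappa> p) r) (G b)"
    "\<And>x. x \<in> ball (\<kappa> p) r \<Longrightarrow> F x = F (\<kappa> p) + (\<Sum>b\<in>Basis. ((x - \<kappa> p) \<bullet> b) * G b x)"
    "\<And>b. G b (\<kappa> p) = frechet_derivative F (at (\<kappa> p)) b" by metis
  have sG: "sm p (\<lambda>q. G b (\<kappa> q))" for b
    unfolding sm_smv[OF p] by (rule smv_compose[OF smv_kappa open_ball _ G(1) p]) (use r in auto)
  have sk: "sm p (\<lambda>q. (\<kappa> q - \<kappa> p) \<bullet> b)" for b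
    using sm_diff[OF p sm_kappa[OF p] sm_const[OF p], of b "\<kappa> p \<bullet> b"] by (simp add: inner_diff_left)
  have vk: "v (\<lambda>q. (\<kappa> q - \<kappa> p) \<bullet> b) = v (\<lambda>q. \<kappa> q \<bullet> b)" for b
    using T_diff[OF p v sm_kappa[OF p] sm_const[OF p], of b "\<kappa> p \<bullet> b"] T_const[OF p v]
    by (simp add: inner_diff_left)
  have "nb p (\<lambda>q. f q = F (\<kappa> p) + (\<Sum>b\<in>Basis. ((\<kappa> q - \<kappa> p) \<bullet> b) * G b (\<kappa> q)))"
    unfolding nb_iff[OF p]
  proof (intro exI[of _ "ball (\<kappa> p) r"] conjI ballI impI)
    fix q assume q: "q \<in> U" "\<kappa> q \<in> ball (\<kappa> p) r"
    then have "f q = F (\<kappa> q)" using A r by blast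
    then show "f q = F (\<kappa> p) + (\<Sum>b\<in>Basis. ((\<kappa> q - \<kappa> p) \<bullet> b) * G b (\<kappa> q))"
      using G(2)[OF q(2)] by (rule trans)
  qed (use r in auto)
  then have "v f = v (\<lambda>q. F (\<kappa> p) + (\<Sum>b\<in>Basis. ((\<kappa> q - \<kappa> p) \<bullet> b) * G b (\<kappa> q)))"
    by (rule T_cong[OF p v])
  also have "\<dots> = (\<Sum>b\<in>Basis. v (\<lambda>q. ((\<kappa> q - \<kappa> p) \<bullet> b) * G b (\<kappa> q)))"
    by (simp add: T_add[OF p v] T_const[OF p v] T_sum[OF p v] sm_intros p sG sk)
  also have "\<dots> = (\<Sum>b\<in>Basis. v (\<lambda>q. \<kappa> q \<bullet> b) * G b (\<kappa> p))"
    by (rule sum.cong) (auto simp: T_prod[OF v sk sG] vk)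
  also have "\<dots> = frechet_derivative F (at (\<kappa> p)) (vel v)"
    using frechet_expand[of W F "\<kappa> p" "vel v"] A G(3) by (simp add: vel_inner)
  finally show "v f = frechet_derivative F (at (\<kappa> p)) (vel v)" .
qed

lemma frechet_kappa: "frechet_derivative (\<lambda>x. x \<bullet> b) (at y) = (\<lambda>x. x \<bullet> b)"
  using frechet_derivative_at[OF bounded_linear_imp_has_derivative[OF bounded_linear_inner_left]] by metis

lemma is_dir_vel: assumes "is_dir p Y v" shows "vel v = Y"
proof (rule euclidean_eqI)
  fix b :: 'k assume b: "b \<in> Basis"
  have "v (\<lambda>q. \<kappa> q \<bullet> b) = frechet_derivative (\<lambda>x. x \<bullet> b) (at (\<kappa> p)) Y"
    by (rule is_dirD[OF assms, of UNIV]) (auto intro: smooth_on_bounded_linear bounded_linear_inner_left)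
  then show "vel v \<bullet> b = Y \<bullet> b" using b by (simp add: vel_inner frechet_kappa)
qed

lemma is_dir_unique: assumes p: "p \<in> U" and "is_dir p Y v" "is_dir p Y w" shows "v = w"
proof
  fix f show "v f = w f"
  proof (cases "sm p f")
    case True
    then obtain W F where "open W \<and> \<kappa> p \<in> W \<and> smooth_on W F \<and> (\<forall>q\<in>U. \<kappa> q \<in> W \<longrightarrow> f q = F (\<kappa> q))"
      unfolding sm_iff[OF p] by blast
    then show ?thesis using is_dirD[OF assms(2)] is_dirD[OF assms(3)] by metis
  qed (use assms in \<open>auto simp: is_dir_def\<close>)
qed

lemma T_eqI: assumes "p \<in> U" "v \<in> T p" "w \<in> T p" "\<And>b. b \<in> Basis \<Longrightarrow> v (\<lambda>q. \<kappa> q \<bullet> b) = w (\<lambda>q. \<kappa> q \<bullet> b)"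
  shows "v = w"
proof -
  have "vel v = vel w" unfolding vel_def using assms(4) by simp
  then show ?thesis using is_dir_unique[OF assms(1)] T_is_dir[OF assms(1)] assms(2,3) by metis
qed

lemma is_dir_T: assumes p: "p \<in> U" and d: "is_dir p Y v" shows "v \<in> T p"
  unfolding tangent_space_def mem_Collect_eq
proof (intro conjI allI impI)
  fix f h a b assume "sm p f \<and> sm p h"
  then have "smv p f" "smv p h" by (auto simp: sm_smv p)
  from this obtain W F H where W: "open W" "\<kappa> p \<in> W" "smooth_on W F" "smooth_on W H"
    "\<forall>q\<in>U. \<kappa> q \<in> W \<longrightarrow> f q = F (\<kappa> q)" "\<forall>q\<in>U. \<kappa> q \<in> W \<longrightarrow> h q = H (\<kappa> q)" by (rule smv_rep2)
  note dF = smooth_on_der[OF W(3) W(2)] and dH = smooth_on_der[OF W(4) W(2)]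
  have vf: "v f = frechet_derivative F (at (\<kappa> p)) Y" by (rule is_dirD[OF d W(1-3) W(5)])
  have vh: "v h = frechet_derivative H (at (\<kappa> p)) Y" by (rule is_dirD[OF d W(1,2,4) W(6)])
  have "smooth_on W (\<lambda>x. a * F x + b * H x)"
    using W by (intro smooth_on_add smooth_on_linear[OF _ _ bounded_linear_mult_right]) auto
  then have "v (\<lambda>q. a * f q + b * h q) = frechet_derivative (\<lambda>x. a * F x + b * H x) (at (\<kappa> p)) Y"
    by (rule is_dirD[OF d W(1,2)]) (use W in auto)
  also have "(\<lambda>y. a * frechet_derivative F (at (\<kappa> p)) y + b * frechet_derivative H (at (\<kappa> p)) y) = frechet_derivative (\<lambda>x. a * F x + b * H x) (at (\<kappa> p))"
    by (rule frechet_derivative_at) (intro has_derivative_add has_derivative_mult_right dF dH)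
  from this[symmetric] have "frechet_derivative (\<lambda>x. a * F x + b * H x) (at (\<kappa> p)) Y = a * v f + b * v h"
    by (simp add: vf vh)
  finally show "v (\<lambda>q. a * f q + b * h q) = a * v f + b * v h" .
next
  fix f h assume "sm p f \<and> sm p h"
  then have "smv p f" "smv p h" by (auto simp: sm_smv p)
  from this obtain W F H where W: "open W" "\<kappa> p \<in> W" "smooth_on W F" "smooth_on W H"
    "\<forall>q\<in>U. \<kappa> q \<in> W \<longrightarrow> f q = F (\<kappa> q)" "\<forall>q\<in>U. \<kappa> q \<in> W \<longrightarrow> h q = H (\<kappa> q)" by (rule smv_rep2)
  note dF = smooth_on_der[OF W(3) W(2)] and dH = smooth_on_der[OF W(4) W(2)]
  have vf: "v f = frechet_derivative F (at (\<kappa> p)) Y" by (rule is_dirD[OF d W(1-3) W(5)])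
  have vh: "v h = frechet_derivative H (at (\<kappa> p)) Y" by (rule is_dirD[OF d W(1,2,4) W(6)])
  have "smooth_on W (\<lambda>x. F x * H x)"
    using W by (intro smooth_on_bilinear[OF _ _ _ bounded_bilinear_mult]) auto
  then have "v (\<lambda>q. f q * h q) = frechet_derivative (\<lambda>x. F x * H x) (at (\<kappa> p)) Y"
    by (rule is_dirD[OF d W(1,2)]) (use W in auto)
  also have "(\<lambda>y. F (\<kappa> p) * frechet_derivative H (at (\<kappa> p)) y + frechet_derivative F (at (\<kappa> p)) y * H (\<kappa> p)) = frechet_derivative (\<lambda>x. F x * H x) (at (\<kappa> p))"
    by (rule frechet_derivative_at) (intro has_derivative_mult dF dH)
  from this[symmetric] have "frechet_derivative (\<lambda>x. F x * H x) (at (\<kappa> p)) Y = f p * v h + h p * v f"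
    using W p by (simp add: vf vh)
  finally show "v (\<lambda>q. f q * h q) = f p * v h + h p * v f" .
next
  fix f assume "\<not> sm p f" then show "v f = 0" using d by (auto simp: is_dir_def)
qed

text \<open>
  Vector-valued smooth maps \<open>h\<close> are differentiated along \<open>v\<close> by components, and \<open>T_is_dir\<close> reduces the claim to the chain
  rule for Frechet derivatives.
\<close>

lemma T_chain:
  fixes G :: "'m::euclidean_space \<Rightarrow> real"
  assumes p: "p \<in> U" and v: "v \<in> T p" and h: "smv p h" and V: "open V" "h p \<in> V" "smooth_on V G"
  shows "v (\<lambda>q. G (h q)) = frechet_derivative G (at (h p)) (\<Sum>b\<in>Basis. v (\<lambda>q. h q \<bullet> b) *\<^sub>R b)"
proof -
  obtain W H where W: "open W" "\<kappa> p \<in> W" "smooth_on W H" "\<forall>q\<in>U. \<kappa> q \<in> W \<longrightarrow> h q = H (\<kappa> q)"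
    using h unfolding smv_def by blast
  have o: "open (W \<inter> H -` V)"
    using continuous_open_preimage[OF smooth_on_continuous[OF W(3)] W(1) V(1)] by simp
  have s: "smooth_on (W \<inter> H -` V) (\<lambda>x. G (H x))"
    by (rule smooth_on_compose[OF smooth_on_subset[OF W(3)] V(3) o V(1)]) auto
  have hp: "h p = H (\<kappa> p)" using W p by auto
  have i: "\<kappa> p \<in> W \<inter> H -` V" using W V hp by auto
  note d = T_is_dir[OF p v]
  have "v (\<lambda>q. h q \<bullet> b) = frechet_derivative H (at (\<kappa> p)) (vel v) \<bullet> b" for b
  proof -
    have "smooth_on W (\<lambda>x. H x \<bullet> b)" by (rule smooth_on_linear[OF W(3,1) bounded_linear_inner_left])
    then have "v (\<lambda>q. h q \<bullet> b) = frechet_derivative (\<lambda>x. H x \<bullet> b) (at (\<kappa> p)) (vel v)"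
      by (rule is_dirD[OF d W(1,2)]) (use W in auto)
    also have "(\<lambda>y. frechet_derivative H (at (\<kappa> p)) y \<bullet> b) = frechet_derivative (\<lambda>x. H x \<bullet> b) (at (\<kappa> p))"
      by (rule frechet_derivative_at) (intro has_derivative_inner_left smooth_on_der[OF W(3) W(2)])
    from this[symmetric] have "frechet_derivative (\<lambda>x. H x \<bullet> b) (at (\<kappa> p)) (vel v) = frechet_derivative H (at (\<kappa> p)) (vel v) \<bullet> b"
      by simp
    finally show ?thesis .
  qed
  then have e: "(\<Sum>b\<in>Basis. v (\<lambda>q. h q \<bullet> b) *\<^sub>R b) = frechet_derivative H (at (\<kappa> p)) (vel v)"
    by (simp add: euclidean_representation)
  have "v (\<lambda>q. G (h q)) = frechet_derivative (\<lambda>x. G (H x)) (at (\<kappa> p)) (vel v)"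
    by (rule is_dirD[OF d o i s]) (use W in auto)
  also have "(\<lambda>y. frechet_derivative G (at (H (\<kappa> p))) (frechet_derivative H (at (\<kappa> p)) y)) = frechet_derivative (\<lambda>x. G (H x)) (at (\<kappa> p))"
    by (rule frechet_derivative_at, rule has_derivative_compose[OF smooth_on_der[OF W(3) W(2)] smooth_on_der[OF V(3)]])
      (use V hp in auto)
  from this[symmetric] have "frechet_derivative (\<lambda>x. G (H x)) (at (\<kappa> p)) (vel v) = frechet_derivative G (at (h p)) (frechet_derivative H (at (\<kappa> p)) (vel v))"
    by (simp add: hp)
  finally show ?thesis by (simp add: e)
qed

text \<open>
  For fields only the coordinate functions have to be tested, because \<open>X f\<close> is expressed by them and by the partial
  derivatives of a coordinate representation of \<open>f\<close>.
\<close>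

lemma vf_iff: assumes p: "p \<in> U"
  shows "vf p X \<longleftrightarrow> nb p (\<lambda>q. X q \<in> T q) \<and> (\<forall>b\<in>Basis. sm p (\<lambda>q. X q (\<lambda>r. \<kappa> r \<bullet> b)))"
proof
  assume "vf p X" then show "nb p (\<lambda>q. X q \<in> T q) \<and> (\<forall>b\<in>Basis. sm p (\<lambda>q. X q (\<lambda>r. \<kappa> r \<bullet> b)))"
    unfolding vfield_near_def using sm_kappa[OF p] by blast
next
  assume R: "nb p (\<lambda>q. X q \<in> T q) \<and> (\<forall>b\<in>Basis. sm p (\<lambda>q. X q (\<lambda>r. \<kappa> r \<bullet> b)))"
  show "vf p X" unfolding vfield_near_def
  proof (intro conjI allI impI)
    show "nb p (\<lambda>q. X q \<in> T q)" using R by blast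
    fix f assume "sm p f"
    then obtain W F where W: "open W" "\<kappa> p \<in> W" "smooth_on W F" "\<forall>q\<in>U. \<kappa> q \<in> W \<longrightarrow> f q = F (\<kappa> q)"
      unfolding sm_iff[OF p] by blast
    have "nb p (\<lambda>q. \<kappa> q \<in> W)" unfolding nb_iff[OF p] using W by blast
    then have "nb p (\<lambda>q. (\<Sum>b\<in>Basis. X q (\<lambda>r. \<kappa> r \<bullet> b) * frechet_derivative F (at (\<kappa> q)) b) = X q f)"
    proof (rule nb_mono2[OF p _ conjunct1[OF R]])
      fix q assume q: "q \<in> U" "\<kappa> q \<in> W" "X q \<in> T q"
      have "X q f = frechet_derivative F (at (\<kappa> q)) (vel (X q))"
        by (rule is_dirD[OF T_is_dir[OF q(1,3)] W(1) q(2) W(3,4)])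
      then show "(\<Sum>b\<in>Basis. X q (\<lambda>r. \<kappa> r \<bullet> b) * frechet_derivative F (at (\<kappa> q)) b) = X q f"
        using frechet_expand[OF W(3) q(2), of "vel (X q)"] by (simp add: vel_inner)
    qed
    moreover have "sm p (\<lambda>q. \<Sum>b\<in>Basis. X q (\<lambda>r. \<kappa> r \<bullet> b) * frechet_derivative F (at (\<kappa> q)) b)"
    proof (intro sm_sum sm_mult p)
      fix b :: 'k assume "b \<in> Basis" then show "sm p (\<lambda>q. X q (\<lambda>r. \<kappa> r \<bullet> b))" using R by blast
      show "sm p (\<lambda>q. frechet_derivative F (at (\<kappa> q)) b)"
        unfolding sm_smv[OF p] by (rule smv_compose[OF smv_kappa W(1,2) smooth_on_dir[OF W(3)] p])
    qed
    ultimately show "sm p (\<lambda>q. X q f)" by (rule sm_cong[OF p])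
  qed
qed

lemma vf_sm: "vf p X \<Longrightarrow> sm p f \<Longrightarrow> sm p (\<lambda>q. X q f)" unfolding vfield_near_def by blast
lemma vf_nbT: "vf p X \<Longrightarrow> nb p (\<lambda>q. X q \<in> T q)" unfolding vfield_near_def by blast
lemma vf_T: "p \<in> U \<Longrightarrow> vf p X \<Longrightarrow> X p \<in> T p" using nb_at vf_nbT by blast

lemma vf_nb: assumes p: "p \<in> U" and X: "vf p X" shows "nb p (\<lambda>q. vf q X)"
proof -
  have "nb p (\<lambda>q. \<forall>b\<in>Basis. sm q (\<lambda>q. X q (\<lambda>r. \<kappa> r \<bullet> b)))"
    by (rule nb_ball[OF p]) (use X sm_nb[OF p] vf_iff[OF p] in auto)
  from nb_mono2[OF p this nb_nb[OF p vf_nbT[OF X]]] show ?thesis by (auto simp: vf_iff)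
qed

lemma vf_cong: assumes p: "p \<in> U" and X: "vf p X" and n: "nb p (\<lambda>q. X q = Y q)" shows "vf p Y"
  unfolding vfield_near_def
proof (intro conjI allI impI)
  show "nb p (\<lambda>q. Y q \<in> T q)" by (rule nb_mono2[OF p n vf_nbT[OF X]]) simp
  fix f assume "sm p f"
  then show "sm p (\<lambda>q. Y q f)" using sm_cong[OF p nb_mono[OF p n]] vf_sm[OF X] by (metis (mono_tags, lifting))
qed

lemma vf_add: assumes p: "p \<in> U" and X: "vf p X" "vf p Y" shows "vf p (\<lambda>q. X q + Y q)"
  unfolding vfield_near_def
proof (intro conjI allI impI)
  show "nb p (\<lambda>q. X q + Y q \<in> T q)" by (rule nb_mono2[OF p vf_nbT[OF X(1)] vf_nbT[OF X(2)]]) (rule T_vadd)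
  fix f assume "sm p f"
  then show "sm p (\<lambda>q. (X q + Y q) f)" using vf_sm X sm_add[OF p] by simp
qed

lemma vf_scale: assumes p: "p \<in> U" and X: "sm p f" "vf p Y" shows "vf p (\<lambda>q. f q *\<^sub>F Y q)"
  unfolding vfield_near_def
proof (intro conjI allI impI)
  show "nb p (\<lambda>q. f q *\<^sub>F Y q \<in> T q)" by (rule nb_mono[OF p vf_nbT[OF X(2)]]) (rule T_vscale)
  fix h assume "sm p h"
  then show "sm p (\<lambda>q. (f q *\<^sub>F Y q) h)" using vf_sm X sm_mult[OF p] by simp
qed

lemma vf_zero: assumes p: "p \<in> U" shows "vf p (\<lambda>q. 0)"
  unfolding vfield_near_def using p by (auto intro: nb_all T_vzero)

lemma vf_sum: assumes p: "p \<in> U" shows "(\<And>i. i \<in> I \<Longrightarrow> vf p (Y i)) \<Longrightarrow> vf p (\<lambda>q. \<Sum>i\<in>I. Y i q)"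
  by (induction I rule: infinite_finite_induct) (auto intro: vf_add vf_zero p)

lemma vf_diff: assumes p: "p \<in> U" and X: "vf p X" "vf p Y" shows "vf p (\<lambda>q. X q - Y q)"
proof -
  have "vf p (\<lambda>q. X q + (-1) *\<^sub>F Y q)" by (intro vf_add vf_scale p X sm_const)
  then show ?thesis by (simp add: fscale_def fun_diff_def plus_fun_def)
qed

lemma lb_apply: "sm p f \<Longrightarrow> lb X Y p f = X p (\<lambda>q. Y q f) - Y p (\<lambda>q. X q f)"
  by (simp add: lie_bracket_def)

lemma lb_anti: "lb X Y p = - lb Y X p"
  by (auto simp: lie_bracket_def fun_eq_iff)

lemma lb_T: assumes p: "p \<in> U" and X: "vf p X" and Y: "vf p Y" shows "lb X Y p \<in> T p"
proof -
  note XT = vf_T[OF p X] and YT = vf_T[OF p Y]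
  have l: "Z p (\<lambda>q. V q (\<lambda>r. a * f r + b * h r)) = a * Z p (\<lambda>q. V q f) + b * Z p (\<lambda>q. V q h)"
    if "vf p Z" "vf p V" "sm p f" "sm p h" for Z V f h a b
  proof -
    have "nb p (\<lambda>q. (sm q f \<and> sm q h) \<and> V q \<in> T q)"
      by (intro nb_conj p sm_nb that vf_nbT)
    then have "nb p (\<lambda>q. V q (\<lambda>r. a * f r + b * h r) = a * V q f + b * V q h)"
      by (rule nb_mono[OF p]) (auto intro: T_lin)
    from T_cong[OF p vf_T[OF p that(1)] this] show ?thesis
      by (simp add: T_lin[OF vf_T[OF p that(1)]] vf_sm that)
  qed
  have m: "Z p (\<lambda>q. V q (\<lambda>r. f r * h r)) = f p * Z p (\<lambda>q. V q h) + V p h * Z p f + (h p * Z p (\<lambda>q. V q f) + V p f * Z p h)"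
    if "vf p Z" "vf p V" "sm p f" "sm p h" for Z V f h
  proof -
    have "nb p (\<lambda>q. (sm q f \<and> sm q h) \<and> V q \<in> T q)"
      by (intro nb_conj p sm_nb that vf_nbT)
    then have "nb p (\<lambda>q. V q (\<lambda>r. f r * h r) = f q * V q h + h q * V q f)"
      by (rule nb_mono[OF p]) (auto intro: T_prod)
    from T_cong[OF p vf_T[OF p that(1)] this] show ?thesis
      by (simp add: T_add[OF p vf_T[OF p that(1)]] T_prod[OF vf_T[OF p that(1)]] sm_mult[OF p] vf_sm that)
  qed
  show ?thesis unfolding tangent_space_def mem_Collect_eq
  proof (intro conjI allI impI)
    fix f h a b assume "sm p f \<and> sm p h"
    then have s: "sm p f" "sm p h" by auto
    have s3: "sm p (\<lambda>q. a * f q + b * h q)" by (intro sm_intros p s)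
    show "lb X Y p (\<lambda>q. a * f q + b * h q) = a * lb X Y p f + b * lb X Y p h"
      by (simp add: lb_apply s s3 l[OF X Y s] l[OF Y X s] algebra_simps)
  next
    fix f h assume "sm p f \<and> sm p h"
    then have s: "sm p f" "sm p h" by auto
    have s3: "sm p (\<lambda>q. f q * h q)" by (intro sm_intros p s)
    show "lb X Y p (\<lambda>q. f q * h q) = f p * lb X Y p h + h p * lb X Y p f"
      by (simp add: lb_apply s s3 m[OF X Y s] m[OF Y X s] algebra_simps)
  next
    fix f assume "\<not> sm p f" then show "lb X Y p f = 0" by (simp add: lie_bracket_def)
  qed
qed

lemma lb_vf: assumes p: "p \<in> U" and X: "vf p X" and Y: "vf p Y" shows "vf p (lb X Y)"
  unfolding vf_iff[OF p]
proof (intro conjI ballI)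
  show "nb p (\<lambda>q. lb X Y q \<in> T q)"
    by (rule nb_mono2[OF p vf_nb[OF p X] vf_nb[OF p Y]]) (rule lb_T)
  fix b :: 'k
  have "sm p (\<lambda>q. X q (\<lambda>r. Y r (\<lambda>r. \<kappa> r \<bullet> b)) - Y q (\<lambda>r. X r (\<lambda>r. \<kappa> r \<bullet> b)))"
    by (intro sm_diff p vf_sm[OF X] vf_sm[OF Y] sm_kappa)
  then show "sm p (\<lambda>q. lb X Y q (\<lambda>r. \<kappa> r \<bullet> b))"
    by (rule sm_cong[OF p nb_all[OF p], rotated]) (simp add: lb_apply sm_kappa)
qed

lemma lb_cong: assumes p: "p \<in> U" and "vf p X" "vf p Y" "nb p (\<lambda>q. X q = X' q)" "nb p (\<lambda>q. Y q = Y' q)"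
  shows "lb X Y p = lb X' Y' p"
proof
  fix f
  have e: "X p = X' p" "Y p = Y' p" using nb_at[OF p] assms(4,5) by auto
  have "X p (\<lambda>q. Y q f) = X p (\<lambda>q. Y' q f)"
    by (rule T_cong[OF p vf_T[OF p assms(2)] nb_mono[OF p assms(5)]]) simp
  moreover have "Y p (\<lambda>q. X q f) = Y p (\<lambda>q. X' q f)"
    by (rule T_cong[OF p vf_T[OF p assms(3)] nb_mono[OF p assms(4)]]) simp
  ultimately show "lb X Y p f = lb X' Y' p f" by (simp add: lie_bracket_def e)
qed

lemma lb_add_right: assumes p: "p \<in> U" and X: "vf p X" and Y: "vf p Y" and Z: "vf p Z"
  shows "lb X (\<lambda>q. Y q + Z q) p = lb X Y p + lb X Z p"
proof
  fix f show "lb X (\<lambda>q. Y q + Z q) p f = (lb X Y p + lb X Z p) f"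
    by (cases "sm p f") (auto simp: lie_bracket_def T_add[OF p vf_T[OF p X]] vf_sm Y Z)
qed

lemma lb_scale_right: assumes p: "p \<in> U" and X: "vf p X" and Y: "vf p Y" and a: "sm p a"
  shows "lb X (\<lambda>q. a q *\<^sub>F Y q) p = a p *\<^sub>F lb X Y p + X p a *\<^sub>F Y p"
proof
  fix f
  show "lb X (\<lambda>q. a q *\<^sub>F Y q) p f = (a p *\<^sub>F lb X Y p + X p a *\<^sub>F Y p) f"
  proof (cases "sm p f")
    case True
    then show ?thesis
      by (simp add: lb_apply T_prod[OF vf_T[OF p X] a vf_sm[OF Y True]] algebra_simps)
  next
    case False
    then show ?thesis using T_nsm[OF vf_T[OF p Y] False] by (simp add: lie_bracket_def)
  qed
qed

lemma lb_jacobi: assumes p: "p \<in> U" and X: "vf p X" and Y: "vf p Y" and Z: "vf p Z"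
  shows "lb X (lb Y Z) p + lb Y (lb Z X) p + lb Z (lb X Y) p = 0"
proof
  fix f
  show "(lb X (lb Y Z) p + lb Y (lb Z X) p + lb Z (lb X Y) p) f = 0 f"
  proof (cases "sm p f")
    case True
    have e: "V p (\<lambda>q. lb P Q q f) = V p (\<lambda>q. P q (\<lambda>r. Q r f)) - V p (\<lambda>q. Q q (\<lambda>r. P r f))"
      if "vf p V" "vf p P" "vf p Q" for V P Q
    proof -
      have "nb p (\<lambda>q. lb P Q q f = P q (\<lambda>r. Q r f) - Q q (\<lambda>r. P r f))"
        by (rule nb_mono[OF p sm_nb[OF p True]]) (simp add: lb_apply)
      from T_cong[OF p vf_T[OF p that(1)] this] show ?thesis
        by (simp add: T_diff[OF p vf_T[OF p that(1)]] vf_sm that True)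
    qed
    show ?thesis
      by (simp add: lb_apply True vf_sm X Y Z e)
  next
    case False then show ?thesis by (simp add: lie_bracket_def)
  qed
qed

end

section \<open>Charts of an oriented manifold\<close>

context
  fixes X :: "'a topology" and A :: "('a, real^'n) chart set"
  assumes oriented: "oriented_manifold X A"
begin

lemma chart_homeo: "(U, \<phi>) \<in> A \<Longrightarrow> openin X U \<and> open (\<phi> ` U) \<and> homeomorphic_map (subtopology X U) (top_of_set (\<phi> ` U)) \<phi>"
  using oriented unfolding oriented_manifold_def smooth_manifold_def by blast

lemma chart_inj: assumes "(U, \<phi>) \<in> A" shows "inj_on \<phi> U"
proof -
  have "topspace (subtopology X U) = U" using chart_homeo[OF assms] openin_subset by fastforce
  then show ?thesis using homeomorphic_imp_injective_map chart_homeo[OF assms] by metis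
qed

lemma chart_open_Int: assumes c: "(U, \<phi>) \<in> A" "(V, \<psi>) \<in> A" shows "open (\<phi> ` (U \<inter> V))"
proof -
  have "openin (subtopology X U) (U \<inter> V)"
    using openin_subtopology_Int2 chart_homeo[OF c(2)] by blast
  then have "openin (top_of_set (\<phi> ` U)) (\<phi> ` (U \<inter> V))"
    using homeomorphic_imp_open_map chart_homeo[OF c(1)] unfolding open_map_def by blast
  then show ?thesis using chart_homeo[OF c(1)] openin_open_trans by blast
qed

lemma chart_trans: "(U, \<phi>) \<in> A \<Longrightarrow> (V, \<psi>) \<in> A \<Longrightarrow> smooth_on (\<phi> ` (U \<inter> V)) (\<psi> \<circ> inv_into U \<phi>)"
  using oriented unfolding oriented_manifold_def smooth_manifold_def by blast

lemma chart_trans_det: "(U, \<phi>) \<in> A \<Longrightarrow> (V, \<psi>) \<in> A \<Longrightarrow> q \<in> U \<Longrightarrow> q \<in> V \<Longrightarrow>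
   0 < det (matrix (frechet_derivative (\<psi> \<circ> inv_into U \<phi>) (at (\<phi> q))))"
  using oriented unfolding oriented_manifold_def by blast

lemma chart_pull:
  assumes c: "(U, \<phi>) \<in> A" "(V, \<psi>) \<in> A" and p: "p \<in> U" "p \<in> V" and W: "open W" "\<psi> p \<in> W"
  obtains W' where "open W'" "\<phi> p \<in> W'" "W' \<subseteq> \<phi> ` (U \<inter> V)" "\<forall>y\<in>W'. (\<psi> \<circ> inv_into U \<phi>) y \<in> W"
    "\<forall>q\<in>U. \<phi> q \<in> W' \<longrightarrow> q \<in> V \<and> \<psi> q \<in> W \<and> \<psi> q = (\<psi> \<circ> inv_into U \<phi>) (\<phi> q)"
proof
  let ?h = "\<psi> \<circ> inv_into U \<phi>" and ?W = "\<phi> ` (U \<inter> V) \<inter> (\<psi> \<circ> inv_into U \<phi>) -` W"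
  have h: "?h (\<phi> q) = \<psi> q" if "q \<in> U" for q using that chart_inj[OF c(1)] by simp
  show "open ?W"
    by (rule continuous_open_preimage[OF smooth_on_continuous[OF chart_trans[OF c]] chart_open_Int[OF c] W(1)])
  show "\<phi> p \<in> ?W" using p W h by auto
  show "\<forall>q\<in>U. \<phi> q \<in> ?W \<longrightarrow> q \<in> V \<and> \<psi> q \<in> W \<and> \<psi> q = ?h (\<phi> q)"
    using h chart_inj[OF c(1)] by (auto simp: inj_on_def)
qed auto

text \<open>
  Smoothness near a point may be witnessed by any chart of the atlas; the transition maps transport it to the chart \<open>\<phi>\<close>.
\<close>

lemma chart_is_nbhd: assumes c: "(U, \<phi>) \<in> A" shows "chart_nbhd A (points A) U \<phi>"
proof
  show US: "U \<subseteq> points A" using c unfolding points_def by force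
  fix p assume p: "p \<in> U"
  show "smooth_near A (points A) p f \<longleftrightarrow>
      (\<exists>W F. open W \<and> \<phi> p \<in> W \<and> smooth_on W F \<and> (\<forall>q\<in>U. \<phi> q \<in> W \<longrightarrow> f q = F (\<phi> q)))" (is "?L \<longleftrightarrow> ?R") for f
  proof
    assume ?L
    then obtain V \<psi> W F where V: "(V, \<psi>) \<in> A" "p \<in> V" and W: "open W" "\<psi> p \<in> W" "smooth_on W F"
      "\<forall>q\<in>points A. q \<in> V \<and> \<psi> q \<in> W \<longrightarrow> f q = F (\<psi> q)"
      unfolding smooth_near_def by blast
    obtain W' where W': "open W'" "\<phi> p \<in> W'" "W' \<subseteq> \<phi> ` (U \<inter> V)" "\<forall>y\<in>W'. (\<psi> \<circ> inv_into U \<phi>) y \<in> W"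
      "\<forall>q\<in>U. \<phi> q \<in> W' \<longrightarrow> q \<in> V \<and> \<psi> q \<in> W \<and> \<psi> q = (\<psi> \<circ> inv_into U \<phi>) (\<phi> q)"
      by (rule chart_pull[OF c V(1) p V(2) W(1,2)])
    have "smooth_on W' (\<lambda>y. F ((\<psi> \<circ> inv_into U \<phi>) y))"
      by (rule smooth_on_compose[OF smooth_on_subset[OF chart_trans[OF c V(1)] W'(3)] W(3) W'(1) W(1)]) (use W'(4) in blast)
    moreover have "f q = F ((\<psi> \<circ> inv_into U \<phi>) (\<phi> q))" if "q \<in> U" "\<phi> q \<in> W'" for q
    proof -
      have "q \<in> points A" using that US by blast
      then have "f q = F (\<psi> q)" using W(4) W'(5) that by blast
      moreover have "\<psi> q = (\<psi> \<circ> inv_into U \<phi>) (\<phi> q)" using W'(5) that by blast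
      ultimately show ?thesis by simp
    qed
    ultimately show ?R using W'(1,2) by blast
  next
    assume ?R then show ?L unfolding smooth_near_def using c p by blast
  qed
  show "nearby A (points A) p P \<longleftrightarrow>
      (\<exists>W. open W \<and> \<phi> p \<in> W \<and> (\<forall>q\<in>U. \<phi> q \<in> W \<longrightarrow> P q))" (is "?L \<longleftrightarrow> ?R") for P
  proof
    assume ?L
    then obtain V \<psi> W where V: "(V, \<psi>) \<in> A" "p \<in> V" and W: "open W" "\<psi> p \<in> W"
      "\<forall>q\<in>points A. q \<in> V \<and> \<psi> q \<in> W \<longrightarrow> P q"
      unfolding nearby_def by blast
    obtain W' where W': "open W'" "\<phi> p \<in> W'" "W' \<subseteq> \<phi> ` (U \<inter> V)" "\<forall>y\<in>W'. (\<psi> \<circ> inv_into U \<phi>) y \<in> W"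
      "\<forall>q\<in>U. \<phi> q \<in> W' \<longrightarrow> q \<in> V \<and> \<psi> q \<in> W \<and> \<psi> q = (\<psi> \<circ> inv_into U \<phi>) (\<phi> q)"
      by (rule chart_pull[OF c V(1) p V(2) W(1,2)])
    show ?R using W'(1,2,5) W(3) US by (intro exI[of _ W']) blast
  next
    assume ?R then show ?L unfolding nearby_def using c p by blast
  qed
qed

end

text \<open>
  The locales from here to \<open>framed_levi_civita\<close> fix a chart, then a metric, an orthonormal frame over the chart, and a
  metric connection. All computations take place over such a chart; as the theorem is a statement about each point of the
  manifold separately, nothing has to be glued.
\<close>

locale oriented_chart =
  fixes X :: "'a topology" and A :: "('a, real^4) chart set" and U :: "'a set" and \<phi> :: "'a \<Rightarrow> real^4"
  assumes oriented: "oriented_manifold X A" and ch: "(U, \<phi>) \<in> A"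

sublocale oriented_chart \<subseteq> chart_nbhd A "points A" U \<phi>
  by (rule chart_is_nbhd[OF oriented ch])

context oriented_chart
begin

abbreviation dd :: "4 \<Rightarrow> 'a \<Rightarrow> 'a tvec" where "dd j q \<equiv> coord_vec A (U, \<phi>) q j"

lemma pts: "q \<in> U \<Longrightarrow> q \<in> points A" using US by blast

lemma Basis4: "b \<in> Basis \<Longrightarrow> \<exists>i. b = axis i (1::real)" unfolding Basis_vec_def by auto

lemma sm_phi: "q \<in> U \<Longrightarrow> sm q (\<lambda>r. \<phi> r $ i)"
  using sm_kappa[of q "axis i 1"] by (simp add: inner_axis)

lemma open_img: "open (\<phi> ` U)" using chart_homeo[OF oriented ch] by blast

lemma inv_phi: "q \<in> U \<Longrightarrow> inv_into U \<phi> (\<phi> q) = q" using chart_inj[OF oriented ch] by simp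

lemma is_dir_dd: assumes q: "q \<in> U" shows "is_dir q (axis j 1) (dd j q)"
  unfolding is_dir_def
proof (intro conjI allI impI)
  fix f assume "\<not> sm q f" then show "dd j q f = 0" by (simp add: coord_vec_def)
next
  fix f W and F :: "real^4 \<Rightarrow> real" assume W: "open W \<and> \<phi> q \<in> W \<and> smooth_on W F \<and> (\<forall>q\<in>U. \<phi> q \<in> W \<longrightarrow> f q = F (\<phi> q))"
  then have s: "sm q f" unfolding sm_iff[OF q] by blast
  have d: "(F has_derivative frechet_derivative F (at (\<phi> q))) (at (\<phi> q))"
    using smooth_on_der W by blast
  have "((f \<circ> inv_into U \<phi>) has_derivative frechet_derivative F (at (\<phi> q))) (at (\<phi> q))"
    by (rule has_derivative_transform_within_open[OF d, of "W \<inter> \<phi> ` U"])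
      (use W q open_img inv_phi in auto)
  from frechet_derivative_at[OF this] show "dd j q f = frechet_derivative F (at (\<phi> q)) (axis j 1)"
    using s by (simp add: coord_vec_def)
qed

lemma dd_T: "q \<in> U \<Longrightarrow> dd j q \<in> T q" using is_dir_T is_dir_dd by blast

lemma dd_phi: assumes "q \<in> U" shows "dd j q (\<lambda>r. \<phi> r $ i) = (if i = j then 1 else 0)"
proof -
  have "dd j q (\<lambda>r. \<phi> r $ i) = vel (dd j q) \<bullet> axis i 1" by (subst vel_inner) (auto simp: inner_axis)
  then show ?thesis unfolding is_dir_vel[OF is_dir_dd[OF assms]] by (simp add: inner_axis_axis)
qed

lemma T_eqI4: assumes "q \<in> U" "v \<in> T q" "w \<in> T q" "\<And>i. v (\<lambda>r. \<phi> r $ i) = w (\<lambda>r. \<phi> r $ i)"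
  shows "v = w"
  by (rule T_eqI[OF assms(1-3)]) (use assms(4) in \<open>auto dest!: Basis4 simp: inner_axis\<close>)

lemma T_expand: assumes "q \<in> U" "v \<in> T q" shows "v = (\<Sum>j\<in>UNIV. v (\<lambda>r. \<phi> r $ j) *\<^sub>F dd j q)"
  by (rule T_eqI4[OF assms]) (auto intro!: T_intros dd_T assms(1) simp: sum_fun_apply dd_phi assms(1) if_distrib[of "\<lambda>x. _ * x"] cong: if_cong)

lemma ball_Basis4: "(\<forall>b\<in>(Basis::(real^4) set). P b) \<longleftrightarrow> (\<forall>i. P (axis i 1))"
  unfolding Basis_vec_def by auto

lemma vf_iff4: "q \<in> U \<Longrightarrow> vf q Y \<longleftrightarrow> nb q (\<lambda>r. Y r \<in> T r) \<and> (\<forall>i. sm q (\<lambda>r. Y r (\<lambda>r. \<phi> r $ i)))"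
  unfolding vf_iff ball_Basis4 by (simp add: inner_axis)

lemma dd_vf: assumes q: "q \<in> U" shows "vf q (dd j)"
  unfolding vf_iff4[OF q]
proof (intro conjI allI)
  show "nb q (\<lambda>r. dd j r \<in> T r)" by (rule nb_all[OF q dd_T])
  fix i
  show "sm q (\<lambda>r. dd j r (\<lambda>r. \<phi> r $ i))"
    by (rule sm_cong[OF q nb_all[OF q] sm_const[OF q]]) (rule dd_phi[symmetric])
qed

end

section \<open>Oriented orthonormal frames\<close>

locale riemannian_chart = oriented_chart +
  fixes g :: "'a metric"
  assumes rm: "riemannian_metric A g"
begin

lemma g_sym: "p \<in> points A \<Longrightarrow> u \<in> T p \<Longrightarrow> v \<in> T p \<Longrightarrow> g p u v = g p v u"
  using rm unfolding riemannian_metric_def by blast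
lemma g_lin: "p \<in> points A \<Longrightarrow> u \<in> T p \<Longrightarrow> v \<in> T p \<Longrightarrow> w \<in> T p \<Longrightarrow>
    g p (a *\<^sub>F u + b *\<^sub>F v) w = a * g p u w + b * g p v w"
  using rm unfolding riemannian_metric_def by blast
lemma g_pos: "p \<in> points A \<Longrightarrow> u \<in> T p \<Longrightarrow> u \<noteq> 0 \<Longrightarrow> 0 < g p u u"
  using rm unfolding riemannian_metric_def by blast
lemma g_sm: "p \<in> points A \<Longrightarrow> vf p Y \<Longrightarrow> vf p Z \<Longrightarrow> sm p (\<lambda>q. g q (Y q) (Z q))"
  using rm unfolding riemannian_metric_def by blast

lemma fscale_1: "1 *\<^sub>F v = v" by (simp add: fun_eq_iff)
lemma fscale_0: "0 *\<^sub>F v = 0" by (simp add: fun_eq_iff)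

lemma g_add: "p \<in> points A \<Longrightarrow> u \<in> T p \<Longrightarrow> v \<in> T p \<Longrightarrow> w \<in> T p \<Longrightarrow> g p (u + v) w = g p u w + g p v w"
  using g_lin[of p u v w 1 1] by (simp add: fscale_1)
lemma g_scale: "p \<in> points A \<Longrightarrow> u \<in> T p \<Longrightarrow> w \<in> T p \<Longrightarrow> g p (a *\<^sub>F u) w = a * g p u w"
  using g_lin[of p u u w a 0] by (simp add: fscale_0)
lemma g_zero: "p \<in> points A \<Longrightarrow> w \<in> T p \<Longrightarrow> g p 0 w = 0"
  using g_scale[of p w w 0] by (simp add: fscale_0)
lemma g_diff: "p \<in> points A \<Longrightarrow> u \<in> T p \<Longrightarrow> v \<in> T p \<Longrightarrow> w \<in> T p \<Longrightarrow> g p (u - v) w = g p u w - g p v w"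
  using g_lin[of p u v w 1 "-1"] by (simp add: fscale_def fun_diff_def plus_fun_def)
lemma g_uminus: "p \<in> points A \<Longrightarrow> u \<in> T p \<Longrightarrow> w \<in> T p \<Longrightarrow> g p (- u) w = - g p u w"
  using g_scale[of p u w "-1"] by (simp add: fscale_def fun_Compl_def)
lemma g_sum: assumes "p \<in> points A" "\<And>i. i \<in> I \<Longrightarrow> u i \<in> T p" "w \<in> T p"
  shows "g p (\<Sum>i\<in>I. u i) w = (\<Sum>i\<in>I. g p (u i) w)"
  using assms(2)
proof (induction I rule: infinite_finite_induct)
  case (insert i I)
  have "g p (u i + (\<Sum>i\<in>I. u i)) w = g p (u i) w + g p (\<Sum>i\<in>I. u i) w"
    by (rule g_add) (use insert assms in \<open>auto intro: T_vsum\<close>)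
  moreover have "g p (\<Sum>i\<in>I. u i) w = (\<Sum>i\<in>I. g p (u i) w)" using insert by blast
  ultimately show ?case by (simp only: sum.insert[OF insert(1,2)])
qed (simp_all add: g_zero assms)
lemma g_scale_r: "p \<in> points A \<Longrightarrow> u \<in> T p \<Longrightarrow> w \<in> T p \<Longrightarrow> g p w (a *\<^sub>F u) = a * g p w u"
  using g_scale g_sym by (metis T_vscale)
lemma g_sum_r: assumes "p \<in> points A" "\<And>i. i \<in> I \<Longrightarrow> u i \<in> T p" "w \<in> T p"
  shows "g p w (\<Sum>i\<in>I. u i) = (\<Sum>i\<in>I. g p w (u i))"
proof -
  have "g p w (\<Sum>i\<in>I. u i) = g p (\<Sum>i\<in>I. u i) w" by (intro g_sym assms T_vsum)
  also have "\<dots> = (\<Sum>i\<in>I. g p (u i) w)" by (rule g_sum[OF assms])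
  also have "\<dots> = (\<Sum>i\<in>I. g p w (u i))" by (intro sum.cong refl g_sym assms)
  finally show ?thesis .
qed

text \<open>
  Invariant of the Gram-Schmidt process applied to the coordinate fields with index in \<open>I\<close>. By the third clause
  the matrix of the frame in coordinates is triangular, which makes its determinant positive; the last clause says that the
  frame spans no less than the coordinate fields, in the form in which it yields \<open>E_complete\<close>.
\<close>

definition partial_frame :: "4 set \<Rightarrow> (4 \<Rightarrow> 'a \<Rightarrow> 'a tvec) \<Rightarrow> bool" where
  "partial_frame I E \<longleftrightarrow> (\<forall>q\<in>U. (\<forall>i\<in>I. vf q (E i)) \<and> (\<forall>i\<in>I. \<forall>j\<in>I. g q (E i q) (E j q) = (if i = j then 1 else 0)) \<and>
     (\<forall>i\<in>I. \<forall>k. k \<notin> I \<longrightarrow> E i q (\<lambda>r. \<phi> r $ k) = 0) \<and>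
     (\<forall>u\<in>T q. (\<forall>i\<in>I. g q (E i q) u = 0) \<longrightarrow> (\<forall>i\<in>I. g q (dd i q) u = 0)))"

lemma gram_schmidt_step: assumes E: "partial_frame I E" and j: "j \<notin> I"
  shows "\<exists>F. partial_frame (insert j I) (E(j := F)) \<and> (\<forall>q\<in>U. F q (\<lambda>r. \<phi> r $ j) > 0)"
proof -
  have Evf: "vf q (E i)" if "q \<in> U" "i \<in> I" for q i using E that unfolding partial_frame_def by blast
  have ET: "E i q \<in> T q" if "q \<in> U" "i \<in> I" for q i using vf_T Evf that by blast
  have EE: "g q (E i q) (E k q) = (if i = k then 1 else 0)" if "q \<in> U" "i \<in> I" "k \<in> I" for q i k
    using E that unfolding partial_frame_def by blast
  have Ek: "E i q (\<lambda>r. \<phi> r $ k) = 0" if "q \<in> U" "i \<in> I" "k \<notin> I" for q i k using E that unfolding partial_frame_def by blast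
  \<comment> \<open>the orthogonal projection of the next coordinate field, and its normalisation\<close>
  define Y where "Y q = dd j q - (\<Sum>i\<in>I. g q (dd j q) (E i q) *\<^sub>F E i q)" for q
  define N where "N q = g q (Y q) (Y q)" for q
  define F where "F q = inverse (sqrt (N q)) *\<^sub>F Y q" for q
  have Yvf: "vf q Y" if q: "q \<in> U" for q unfolding Y_def
    by (intro vf_diff vf_sum vf_scale q dd_vf g_sm pts Evf)
  have YT: "Y q \<in> T q" if "q \<in> U" for q using vf_T Yvf that by blast
  have Yk: "Y q (\<lambda>r. \<phi> r $ k) = (if k = j then 1 else 0)" if "q \<in> U" "k \<notin> I" for q k
    using that by (simp add: Y_def sum_fun_apply dd_phi Ek)
  have "Y q \<noteq> 0" if "q \<in> U" for q using Yk[OF that j] by auto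
  then have N: "N q > 0" if "q \<in> U" for q unfolding N_def using g_pos pts YT that by blast
  have Fvf: "vf q F" if q: "q \<in> U" for q
  proof -
    have "sm q N" unfolding N_def by (intro g_sm pts q Yvf)
    from sm_inverse[OF q sm_sqrt[OF q this N[OF q]]] have "sm q (\<lambda>q. inverse (sqrt (N q)))" using N[OF q] by simp
    then show ?thesis unfolding F_def by (intro vf_scale q Yvf)
  qed
  have FT: "F q \<in> T q" if "q \<in> U" for q using vf_T Fvf that by blast
  have YE: "g q (Y q) (E i q) = 0" if q: "q \<in> U" and i: "i \<in> I" for q i
  proof -
    have fI: "finite I" by simp
    have "g q (Y q) (E i q) = g q (dd j q) (E i q) - (\<Sum>k\<in>I. g q (dd j q) (E k q) * g q (E k q) (E i q))"
      unfolding Y_def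
      by (subst g_diff, use q i in \<open>auto intro!: pts dd_T ET T_intros\<close>)
         (subst g_sum, use q i in \<open>auto intro!: pts dd_T ET T_intros sum.cong simp: g_scale pts ET\<close>)
    also have "(\<Sum>k\<in>I. g q (dd j q) (E k q) * g q (E k q) (E i q)) = (\<Sum>k\<in>I. if k = i then g q (dd j q) (E i q) else 0)"
      by (rule sum.cong) (use q i in \<open>auto simp: EE\<close>)
    finally show ?thesis using i by simp
  qed
  have FE: "g q (F q) (E i q) = 0" if "q \<in> U" "i \<in> I" for q i
    using that by (simp add: F_def g_scale pts YT ET YE)
  have FF: "g q (F q) (F q) = 1" if "q \<in> U" for q
  proof -
    have "g q (F q) (F q) = inverse (sqrt (N q)) * (inverse (sqrt (N q)) * N q)"
      using that by (simp add: F_def g_scale g_scale_r pts YT T_vscale N_def[symmetric])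
    also have "\<dots> = N q / (sqrt (N q) * sqrt (N q))" by (simp add: field_simps)
    finally show ?thesis using N[OF that] by simp
  qed
  have EF: "g q (E i q) (F q) = 0" if "q \<in> U" "i \<in> I" for q i
    using g_sym[OF pts[OF that(1)] ET[OF that] FT[OF that(1)]] FE[OF that] by simp
  have ddj: "g q (dd j q) u = 0" if q: "q \<in> U" and u: "u \<in> T q" "\<forall>i\<in>I. g q (E i q) u = 0" "g q (F q) u = 0" for q u
  proof -
    have "g q (Y q) u = 0" using u(3) N[OF q] by (simp add: F_def g_scale pts q YT u)
    moreover have "g q (Y q) u = g q (dd j q) u - (\<Sum>k\<in>I. g q (dd j q) (E k q) * g q (E k q) u)"
      unfolding Y_def
      by (subst g_diff, use q u in \<open>auto intro!: pts dd_T ET T_intros\<close>)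
         (subst g_sum, use q u in \<open>auto intro!: pts dd_T ET T_intros sum.cong simp: g_scale pts ET\<close>)
    ultimately show ?thesis using u(2) by simp
  qed
  have c: "E(j := F) = (\<lambda>i. if i = j then F else E i)" by auto
  have "partial_frame (insert j I) (E(j := F))"
    unfolding partial_frame_def
  proof (intro ballI conjI allI impI)
    fix q i assume q: "q \<in> U" and i: "i \<in> insert j I"
    show "vf q ((E(j := F)) i)" using q i j Fvf Evf by auto
    fix k
    show "(E(j := F)) i q (\<lambda>r. \<phi> r $ k) = 0" if "k \<notin> insert j I"
      using that q i j Yk Ek by (auto simp: F_def)
  next
    fix q i k assume q: "q \<in> U" and i: "i \<in> insert j I" "k \<in> insert j I"
    show "g q ((E(j := F)) i q) ((E(j := F)) k q) = (if i = k then 1 else 0)"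
      using q i j FF FE EF EE by auto
  next
    fix q u i assume q: "q \<in> U" and u: "u \<in> T q" "\<forall>i\<in>insert j I. g q ((E(j := F)) i q) u = 0" and i: "i \<in> insert j I"
    have 1: "g q (F q) u = 0" using u(2) by simp
    have 2: "\<forall>i\<in>I. g q (E i q) u = 0" using u(2) j by (metis fun_upd_other insert_iff)
    show "g q (dd i q) u = 0"
    proof (cases "i = j")
      case True then show ?thesis using ddj[OF q u(1) 2 1] by simp
    next
      case False
      then show ?thesis using E q u(1) 2 i unfolding partial_frame_def by blast
    qed
  qed
  moreover have "F q (\<lambda>r. \<phi> r $ j) > 0" if "q \<in> U" for q using Yk[OF that j] N[OF that] by (simp add: F_def)
  ultimately show ?thesis by blast
qed

lemma frame_ex: "\<exists>E. \<forall>q\<in>U. (\<forall>i. vf q (E i)) \<and> (\<forall>i j. g q (E i q) (E j q) = (if i = j then 1 else 0)) \<and>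
    (\<forall>u\<in>T q. (\<forall>i. g q (E i q) u = 0) \<longrightarrow> u = 0) \<and> 0 < det ((\<chi> i j. E i q (\<lambda>r. \<phi> r $ j)) :: real^4^4)"
proof -
  have "partial_frame {} (\<lambda>_ _. 0)" by (simp add: partial_frame_def)
  from gram_schmidt_step[OF this, of 1] obtain E1 where 1: "partial_frame {1} E1" "\<forall>q\<in>U. E1 1 q (\<lambda>r. \<phi> r $ 1) > 0"
    by (metis empty_iff fun_upd_same)
  from gram_schmidt_step[OF 1(1), of 2] obtain F2 where F2: "partial_frame {2,1} (E1(2 := F2))" "\<forall>q\<in>U. F2 q (\<lambda>r. \<phi> r $ 2) > 0" by auto
  from gram_schmidt_step[OF F2(1), of 3] obtain F3 where F3: "partial_frame {3,2,1} (E1(2 := F2, 3 := F3))" "\<forall>q\<in>U. F3 q (\<lambda>r. \<phi> r $ 3) > 0" by auto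
  from gram_schmidt_step[OF F3(1), of 4] obtain F4 where F4: "partial_frame {4,3,2,1} (E1(2 := F2, 3 := F3, 4 := F4))" "\<forall>q\<in>U. F4 q (\<lambda>r. \<phi> r $ 4) > 0" by auto
  define E where "E = E1(2 := F2, 3 := F3, 4 := F4)"
  have u: "{4,3,2,1} = (UNIV :: 4 set)" using UNIV_4 by auto
  have E: "partial_frame UNIV E" using F4(1) u by (simp add: E_def)
  show ?thesis
  proof (intro exI[of _ E] ballI conjI)
    fix q assume q: "q \<in> U"
    show "\<forall>i. vf q (E i)" "\<forall>i j. g q (E i q) (E j q) = (if i = j then 1 else 0)" using E q unfolding partial_frame_def by blast+
    fix u assume u: "u \<in> T q"
    show "(\<forall>i. g q (E i q) u = 0) \<longrightarrow> u = 0"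
    proof
      assume "\<forall>i. g q (E i q) u = 0"
      then have d: "g q (dd i q) u = 0" for i using E q u unfolding partial_frame_def by blast
      have "g q u u = g q (\<Sum>j\<in>UNIV. u (\<lambda>r. \<phi> r $ j) *\<^sub>F dd j q) u"
        by (rule arg_cong[OF T_expand[OF q u], of "\<lambda>v. g q v u"])
      also have "\<dots> = 0" by (subst g_sum) (auto intro!: pts q dd_T T_intros u simp: g_scale pts q dd_T u d)
      finally show "u = 0" using g_pos[OF pts[OF q] u] by auto
    qed
  next
    fix q assume q: "q \<in> U"
    have z1: "E 1 q (\<lambda>r. \<phi> r $ k) = 0" if "k \<in> {2,3,4}" for k
      using 1(1) q that unfolding partial_frame_def E_def by auto
    have z2: "E 2 q (\<lambda>r. \<phi> r $ k) = 0" if "k \<in> {3,4}" for k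
      using F2(1) q that unfolding partial_frame_def E_def by auto
    have z3: "E 3 q (\<lambda>r. \<phi> r $ k) = 0" if "k \<in> {4}" for k
      using F3(1) q that unfolding partial_frame_def E_def by auto
    have pp: "E 1 q (\<lambda>r. \<phi> r $ 1) > 0" "E 2 q (\<lambda>r. \<phi> r $ 2) > 0" "E 3 q (\<lambda>r. \<phi> r $ 3) > 0" "E 4 q (\<lambda>r. \<phi> r $ 4) > 0"
      using 1(2) F2(2) F3(2) F4(2) q unfolding E_def by auto
    show "0 < det ((\<chi> i j. E i q (\<lambda>r. \<phi> r $ j)) :: real^4^4)"
      unfolding det_4 using pp by (simp add: z1 z2 z3)
  qed
qed

end

locale framed_chart = riemannian_chart +
  fixes E :: "4 \<Rightarrow> 'a \<Rightarrow> 'a tvec"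
  assumes E_vf: "\<And>q i. q \<in> U \<Longrightarrow> vfield_near A (points A) q (E i)"
    and E_on: "\<And>q i j. q \<in> U \<Longrightarrow> g q (E i q) (E j q) = (if i = j then 1 else 0)"
    and E_complete: "\<And>q u. q \<in> U \<Longrightarrow> u \<in> tangent_space A (points A) q \<Longrightarrow> (\<And>i. g q (E i q) u = 0) \<Longrightarrow> u = 0"
    and E_det: "\<And>q. q \<in> U \<Longrightarrow> 0 < det ((\<chi> i j. E i q (\<lambda>r. \<phi> r $ j)) :: real^4^4)"

lemma framed_chart_ex:
  assumes "oriented_manifold X A" "riemannian_metric A g" "p \<in> points A"
  obtains U \<phi> E where "framed_chart X A U \<phi> g E" "p \<in> U"
proof -
  obtain U \<phi> where c: "(U, \<phi>) \<in> A" "p \<in> U" using assms(3) unfolding points_def by force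
  interpret riemannian_chart X A U \<phi> g by unfold_locales (use assms c in auto)
  obtain E where "\<forall>q\<in>U. (\<forall>i. vf q (E i)) \<and> (\<forall>i j. g q (E i q) (E j q) = (if i = j then 1 else 0)) \<and>
    (\<forall>u\<in>T q. (\<forall>i. g q (E i q) u = 0) \<longrightarrow> u = 0) \<and> 0 < det ((\<chi> i j. E i q (\<lambda>r. \<phi> r $ j)) :: real^4^4)"
    using frame_ex by (rule exE)
  then have "framed_chart X A U \<phi> g E" by unfold_locales auto
  then show ?thesis using that c by blast
qed

context framed_chart
begin

text \<open>
  The components with respect to the frame; \<open>frame_vec\<close> is the inverse map. They identify each tangent space with
  \<open>\<real>\<^sup>4\<close> isometrically and in an orientation preserving way.
\<close>

definition coords :: "'a \<Rightarrow> 'a tvec \<Rightarrow> real^4" where "coords q v = (\<chi> i. g q v (E i q))"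
definition frame_vec :: "'a \<Rightarrow> real^4 \<Rightarrow> 'a tvec" where "frame_vec q u = (\<Sum>i\<in>UNIV. u $ i *\<^sub>F E i q)"

lemma E_T: "q \<in> U \<Longrightarrow> E i q \<in> T q" using vf_T E_vf by blast
lemma frame_vec_T: "q \<in> U \<Longrightarrow> frame_vec q u \<in> T q" unfolding frame_vec_def by (intro T_intros E_T)

lemma coords_add: "q \<in> U \<Longrightarrow> u \<in> T q \<Longrightarrow> v \<in> T q \<Longrightarrow> coords q (u + v) = coords q u + coords q v"
  by (simp add: coords_def vec_eq_iff g_add pts E_T)
lemma coords_diff: "q \<in> U \<Longrightarrow> u \<in> T q \<Longrightarrow> v \<in> T q \<Longrightarrow> coords q (u - v) = coords q u - coords q v"
  by (simp add: coords_def vec_eq_iff g_diff pts E_T)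
lemma coords_scale: "q \<in> U \<Longrightarrow> u \<in> T q \<Longrightarrow> coords q (c *\<^sub>F u) = c *\<^sub>R coords q u"
  by (simp add: coords_def vec_eq_iff g_scale pts E_T)
lemma coords_uminus: "q \<in> U \<Longrightarrow> u \<in> T q \<Longrightarrow> coords q (- u) = - coords q u"
  by (simp add: coords_def vec_eq_iff g_uminus pts E_T)
lemma coords_zero: "q \<in> U \<Longrightarrow> coords q 0 = 0"
  by (simp add: coords_def vec_eq_iff g_zero pts E_T)
lemma coords_sum: "q \<in> U \<Longrightarrow> (\<And>i. i \<in> I \<Longrightarrow> u i \<in> T q) \<Longrightarrow> coords q (\<Sum>i\<in>I. u i) = (\<Sum>i\<in>I. coords q (u i))"
  by (simp add: coords_def vec_eq_iff g_sum pts E_T)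
lemma coords_E: "q \<in> U \<Longrightarrow> coords q (E i q) = axis i 1"
  by (simp add: coords_def vec_eq_iff E_on axis_def)
lemma coords_lin: "q \<in> U \<Longrightarrow> coords q (frame_vec q u) = u"
  unfolding frame_vec_def by (simp add: coords_sum coords_scale coords_E E_T T_intros) (simp add: vec_eq_iff axis_def if_distrib cong: if_cong)
lemma frame_vec_coords: assumes q: "q \<in> U" and v: "v \<in> T q" shows "frame_vec q (coords q v) = v"
proof -
  have "frame_vec q (coords q v) - v = 0"
  proof (rule E_complete[OF q])
    show d: "frame_vec q (coords q v) - v \<in> T q" by (intro T_intros frame_vec_T q v)
    fix i
    have "coords q (frame_vec q (coords q v) - v) = 0" by (simp add: coords_diff coords_lin frame_vec_T q v)
    then have "g q (frame_vec q (coords q v) - v) (E i q) = 0" by (simp add: coords_def vec_eq_iff)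
    then show "g q (E i q) (frame_vec q (coords q v) - v) = 0" using g_sym[OF pts[OF q] d E_T[OF q]] by simp
  qed
  then show ?thesis by simp
qed
lemma frame_vec_add: "frame_vec q (u + v) = frame_vec q u + frame_vec q v"
  by (simp add: frame_vec_def fun_eq_iff sum_fun_apply sum.distrib algebra_simps)
lemma frame_vec_diff: "frame_vec q (u - v) = frame_vec q u - frame_vec q v"
  by (simp add: frame_vec_def fun_eq_iff sum_fun_apply sum_subtractf algebra_simps)
lemma frame_vec_scale: "frame_vec q (c *\<^sub>R v) = c *\<^sub>F frame_vec q v"
  by (simp add: frame_vec_def fun_eq_iff sum_fun_apply sum_distrib_left algebra_simps)
lemma frame_vec_uminus: "frame_vec q (- v) = - frame_vec q v"
  by (simp add: frame_vec_def fun_eq_iff sum_fun_apply sum_negf)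
lemma frame_vec_axis: "frame_vec q (axis i 1) = E i q"
  by (simp add: frame_vec_def fun_eq_iff sum_fun_apply axis_def if_distrib[of "\<lambda>x. x * _"] cong: if_cong)
lemma coords_inj: "q \<in> U \<Longrightarrow> u \<in> T q \<Longrightarrow> v \<in> T q \<Longrightarrow> coords q u = coords q v \<Longrightarrow> u = v"
  using frame_vec_coords by metis
lemma g_coords: assumes q: "q \<in> U" and v: "v \<in> T q" and w: "w \<in> T q" shows "g q v w = coords q v \<bullet> coords q w"
proof -
  have "g q v w = g q v (frame_vec q (coords q w))" by (simp add: frame_vec_coords q w)
  also have "\<dots> = (\<Sum>i\<in>UNIV. coords q w $ i * g q v (E i q))"
    unfolding frame_vec_def by (subst g_sum_r) (auto intro!: pts q v T_intros E_T simp: g_scale_r pts q v E_T)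
  also have "\<dots> = coords q v \<bullet> coords q w" by (simp add: inner_vec_def coords_def mult.commute)
  finally show ?thesis .
qed
lemma coords_sm: "q \<in> U \<Longrightarrow> vf q Y \<Longrightarrow> sm q (\<lambda>r. coords r (Y r) $ i)"
  by (simp add: coords_def g_sm pts E_vf)
lemma frame_vec_vf: "q \<in> U \<Longrightarrow> (\<And>i. sm q (\<lambda>r. u r $ i)) \<Longrightarrow> vf q (\<lambda>r. frame_vec r (u r))"
  unfolding frame_vec_def by (intro vf_sum vf_scale E_vf)
lemma frame_vec_const_vf: "q \<in> U \<Longrightarrow> vf q (\<lambda>r. frame_vec r u)"
  by (intro frame_vec_vf sm_const)
lemma vf_ext: "q \<in> U \<Longrightarrow> v \<in> T q \<Longrightarrow> \<exists>Y. vf q Y \<and> Y q = v"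
  using frame_vec_const_vf[of q "coords q v"] frame_vec_coords by blast
lemma orthonormal_iff: "q \<in> U \<Longrightarrow> orthonormal_at A g q e \<longleftrightarrow>
    (\<forall>i. e $ i \<in> T q) \<and> (\<forall>i j. coords q (e $ i) \<bullet> coords q (e $ j) = (if i = j then 1 else 0))"
  unfolding orthonormal_at_def by (auto simp: g_coords)

definition frame_mat :: "'a \<Rightarrow> ('a tvec)^4 \<Rightarrow> real^4^4" where "frame_mat q e = (\<chi> i. coords q (e $ i))"

lemma coords_lincomb: assumes "q \<in> U" "\<forall>i. e $ i \<in> T q"
  shows "coords q (\<Sum>i\<in>UNIV. (c $ i) *\<^sub>F (e $ i)) = transpose (frame_mat q e) *v c"
  using assms by (simp add: coords_sum T_intros coords_scale) (simp add: vec_eq_iff matrix_vector_mult_def transpose_def frame_mat_def vector_matrix_mult_def mult.commute)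

lemma basis_at_iff: assumes q: "q \<in> U"
  shows "basis_at A q e \<longleftrightarrow> (\<forall>i. e $ i \<in> T q) \<and> det (frame_mat q e) \<noteq> 0"
proof (cases "\<forall>i. e $ i \<in> T q")
  case True
  let ?M = "transpose (frame_mat q e)"
  have iff: "v = (\<Sum>i\<in>UNIV. (c $ i) *\<^sub>F (e $ i)) \<longleftrightarrow> ?M *v c = coords q v" if v: "v \<in> T q" for v c
  proof -
    have "(\<Sum>i\<in>UNIV. (c $ i) *\<^sub>F (e $ i)) \<in> T q" using True by (intro T_intros) blast
    then have "v = (\<Sum>i\<in>UNIV. (c $ i) *\<^sub>F (e $ i)) \<longleftrightarrow> coords q (\<Sum>i\<in>UNIV. (c $ i) *\<^sub>F (e $ i)) = coords q v"
      using coords_inj[OF q _ v] by auto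
    then show ?thesis by (simp only: coords_lincomb[OF q True])
  qed
  have "basis_at A q e \<longleftrightarrow> (\<forall>v\<in>T q. \<exists>!c. v = (\<Sum>i\<in>UNIV. (c $ i) *\<^sub>F (e $ i)))"
    unfolding basis_at_def using True by blast
  also have "\<dots> \<longleftrightarrow> (\<forall>v\<in>T q. \<exists>!c. ?M *v c = coords q v)"
    by (rule ball_cong[OF refl]) (simp only: iff)
  also have "\<dots> \<longleftrightarrow> (\<forall>y. \<exists>!c. ?M *v c = y)"
  proof (intro iffI ballI allI)
    fix y assume H: "\<forall>v\<in>T q. \<exists>!c. ?M *v c = coords q v"
    show "\<exists>!c. ?M *v c = y" using bspec[OF H frame_vec_T[OF q, of y]] by (simp only: coords_lin[OF q])
  next
    fix v assume H: "\<forall>y. \<exists>!c. ?M *v c = y"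
    show "\<exists>!c. ?M *v c = coords q v" using H by (rule spec)
  qed
  also have "\<dots> \<longleftrightarrow> det ?M \<noteq> 0"
  proof
    assume a: "\<forall>y. \<exists>!c. ?M *v c = y"
    have "\<forall>x. ?M *v x = 0 \<longrightarrow> x = 0" using a by (metis matrix_vector_mult_0_right)
    then show "det ?M \<noteq> 0" using matrix_left_invertible_ker invertible_left_inverse invertible_det_nz by metis
  next
    assume "det ?M \<noteq> 0"
    then obtain N where N: "?M ** N = mat 1" "N ** ?M = mat 1" using invertible_det_nz invertible_def by metis
    show "\<forall>y. \<exists>!c. ?M *v c = y"
    proof
      fix y show "\<exists>!c. ?M *v c = y"
        by (rule ex1I[of _ "N *v y"]) (metis N matrix_vector_mul_assoc matrix_vector_mul_lid)+
    qed
  qed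
  finally show ?thesis using True by simp
qed (auto simp: basis_at_def)

text \<open>
  The matrix of the basis in a chart \<open>\<psi>\<close> is the product of the matrix in the frame, the matrix of the frame in the chart
  \<open>\<phi>\<close> and the Jacobian of the transition map. The last two have positive determinant, by the choice of the frame and
  by the orientation of the manifold.
\<close>

lemma positive_basis_iff: assumes q: "q \<in> U"
  shows "positive_basis A q e \<longleftrightarrow> (\<forall>i. e $ i \<in> T q) \<and> 0 < det (frame_mat q e)"
proof (cases "\<forall>i. e $ i \<in> T q")
  case True
  have key: "0 < det ((\<chi> i j. (e $ i) (\<lambda>q. \<psi> q $ j)) :: real^4^4) \<longleftrightarrow> 0 < det (frame_mat q e)"
    if V: "(V, \<psi>) \<in> A" "q \<in> V" for V \<psi>
  proof -
    let ?h = "\<psi> \<circ> inv_into U \<phi>"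
    let ?f = "frechet_derivative ?h (at (\<phi> q))"
    interpret V: oriented_chart X A V \<psi> by unfold_locales (use oriented V in auto)
    note o = chart_open_Int[OF oriented ch V(1)] and s = chart_trans[OF oriented ch V(1)]
    have i: "\<phi> q \<in> \<phi> ` (U \<inter> V)" using q V by auto
    have a: "v (\<lambda>r. \<psi> r $ j) = (\<Sum>k\<in>UNIV. v (\<lambda>r. \<phi> r $ k) * matrix ?f $ j $ k)" if v: "v \<in> T q" for v j
    proof -
      have sj: "smooth_on (\<phi> ` (U \<inter> V)) (\<lambda>y. ?h y $ j)"
        using smooth_on_linear[OF s o bounded_linear_vec_nth] .
      have d1: "v (\<lambda>r. \<psi> r $ j) = frechet_derivative (\<lambda>y. ?h y $ j) (at (\<phi> q)) (vel v)"
        by (rule is_dirD[OF T_is_dir[OF q v] o i sj]) (use chart_inj[OF oriented ch] in \<open>auto\<close>)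
      have d2: "frechet_derivative (\<lambda>y. ?h y $ j) (at (\<phi> q)) = (\<lambda>y. ?f y $ j)"
        by (rule frechet_derivative_at[symmetric])
          (rule bounded_linear.has_derivative[OF bounded_linear_vec_nth smooth_on_der[OF s i]])
      have d3: "?f (vel v) = matrix ?f *v vel v"
        using fun_cong[OF matrix_vector_mul(2)[OF linear_frechet[OF s i]], of "vel v"] by simp
      have "v (\<lambda>r. \<psi> r $ j) = (matrix ?f *v vel v) $ j" unfolding d1 d2 d3 ..
      also have "(matrix ?f *v vel v) $ j = (\<Sum>k\<in>UNIV. v (\<lambda>r. \<phi> r $ k) * matrix ?f $ j $ k)"
      proof -
        have "vel v $ k = v (\<lambda>r. \<phi> r $ k)" for k
          using vel_inner[of "axis k 1" v] by (simp add: inner_axis)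
        then show ?thesis by (simp add: matrix_vector_mult_def mult.commute)
      qed
      finally show ?thesis .
    qed
    have b: "v (\<lambda>r. \<phi> r $ k) = (\<Sum>l\<in>UNIV. coords q v $ l * E l q (\<lambda>r. \<phi> r $ k))" if v: "v \<in> T q" for v k
      using arg_cong[OF frame_vec_coords[OF q v], of "\<lambda>v. v (\<lambda>r. \<phi> r $ k)"] by (simp add: frame_vec_def sum_fun_apply)
    have e1: "((\<chi> i j. (e $ i) (\<lambda>q. \<psi> q $ j)) :: real^4^4) = (\<chi> i k. (e $ i) (\<lambda>q. \<phi> q $ k)) ** transpose (matrix ?f)"
      using a True by (simp add: vec_eq_iff matrix_matrix_mult_def transpose_def)
    have e2: "((\<chi> i k. (e $ i) (\<lambda>q. \<phi> q $ k)) :: real^4^4) = frame_mat q e ** (\<chi> i j. E i q (\<lambda>r. \<phi> r $ j))"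
      using b True by (simp add: vec_eq_iff matrix_matrix_mult_def frame_mat_def)
    show ?thesis unfolding e1 e2 det_mul det_transpose
      using E_det[OF q] chart_trans_det[OF oriented ch V(1) q V(2)] by (simp add: zero_less_mult_iff)
  qed
  have ex: "\<exists>(V, \<psi>)\<in>A. q \<in> V" using ch q by auto
  have "(\<exists>(V, \<psi>)\<in>A. q \<in> V \<and> 0 < det ((\<chi> i j. (e $ i) (\<lambda>q. \<psi> q $ j)) :: real^4^4)) \<longleftrightarrow> 0 < det (frame_mat q e)"
    using key ex by fast
  then show ?thesis unfolding positive_basis_def using basis_at_iff[OF q] True by auto
qed (auto simp: positive_basis_def basis_at_def)

end

section \<open>The twistor fibre as a two-sphere\<close>

context framed_chart
begin

text \<open>
  The self-dual endomorphism with coordinates \<open>x\<close> in the frame; \<open>sd_coords\<close> recovers \<open>x\<close> from its values on \<open>E 1\<close>.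
\<close>

definition sd_endo :: "'a \<Rightarrow> real^3 \<Rightarrow> ('a tvec \<Rightarrow> 'a tvec)" where
  "sd_endo q x = (\<lambda>v\<in>T q. frame_vec q (Kop x (coords q v)))"

definition sd_coords :: "'a \<Rightarrow> ('a tvec \<Rightarrow> 'a tvec) \<Rightarrow> real^3" where
  "sd_coords q a = vector [coords q (a (E 1 q)) $ 2, coords q (a (E 1 q)) $ 3, coords q (a (E 1 q)) $ 4]"

lemma sd_endo_apply: "v \<in> T q \<Longrightarrow> sd_endo q x v = frame_vec q (Kop x (coords q v))" by (simp add: sd_endo_def)
lemma sd_endo_T: "q \<in> U \<Longrightarrow> v \<in> T q \<Longrightarrow> sd_endo q x v \<in> T q" by (simp add: sd_endo_apply frame_vec_T)
lemma coords_sd_endo: "q \<in> U \<Longrightarrow> v \<in> T q \<Longrightarrow> coords q (sd_endo q x v) = Kop x (coords q v)" by (simp add: sd_endo_apply coords_lin)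
lemma sd_endo_lin: "q \<in> U \<Longrightarrow> sd_endo q x (frame_vec q u) = frame_vec q (Kop x u)" by (simp add: sd_endo_apply frame_vec_T coords_lin)

lemma sd_endo_endos: "q \<in> U \<Longrightarrow> sd_endo q x \<in> endos A q"
  unfolding endos_def
  by (auto simp: sd_endo_def frame_vec_T linear_map_on_def T_vadd T_vscale coords_add coords_scale Kop_lin frame_vec_add frame_vec_scale)

lemma sd_coords_sd_endo: "q \<in> U \<Longrightarrow> sd_coords q (sd_endo q x) = x"
  by (simp add: sd_coords_def coords_sd_endo E_T coords_E Kop_axis vec_eq_iff forall_3 del: Kop_nth)

lemma endos_T: "a \<in> endos A q \<Longrightarrow> v \<in> T q \<Longrightarrow> a v \<in> T q" unfolding endos_def by auto

lemma endos_lin: assumes "a \<in> endos A q" "u \<in> T q" "v \<in> T q"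
  shows "a (u + v) = a u + a v" "a (c *\<^sub>F u) = c *\<^sub>F a u" "a (b *\<^sub>F u + c *\<^sub>F v) = b *\<^sub>F a u + c *\<^sub>F a v"
proof -
  have l: "a (b *\<^sub>F x + c *\<^sub>F y) = b *\<^sub>F a x + c *\<^sub>F a y" if "x \<in> T q" "y \<in> T q" for b c x y
    using assms(1) that unfolding endos_def linear_map_on_def by blast
  show "a (b *\<^sub>F u + c *\<^sub>F v) = b *\<^sub>F a u + c *\<^sub>F a v" by (rule l[OF assms(2,3)])
  show "a (u + v) = a u + a v" using l[OF assms(2,3), of 1 1] by (simp add: fscale_1)
  show "a (c *\<^sub>F u) = c *\<^sub>F a u" using l[OF assms(2,2), of c 0] by (simp add: fscale_0)
qed

lemma endos_sum: assumes "a \<in> endos A q" "\<And>i. i \<in> I \<Longrightarrow> u i \<in> T q"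
  shows "finite I \<Longrightarrow> a (\<Sum>i\<in>I. c i *\<^sub>F u i) = (\<Sum>i\<in>I. c i *\<^sub>F a (u i))"
  using assms(2)
proof (induction I rule: infinite_finite_induct)
  case empty
  have "a (0 *\<^sub>F 0) = 0 *\<^sub>F a 0" using endos_lin(2)[OF assms(1) T_vzero T_vzero] .
  then show ?case by (simp only: sum.empty fscale_0)
next
  case (insert i I)
  have "a (c i *\<^sub>F u i + (\<Sum>i\<in>I. c i *\<^sub>F u i)) = a (c i *\<^sub>F u i) + a (\<Sum>i\<in>I. c i *\<^sub>F u i)"
    by (rule endos_lin(1)[OF assms(1)]) (use insert in \<open>auto intro!: T_intros\<close>)
  moreover have "a (c i *\<^sub>F u i) = c i *\<^sub>F a (u i)" using endos_lin(2)[OF assms(1)] insert by blast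
  moreover have "a (\<Sum>i\<in>I. c i *\<^sub>F u i) = (\<Sum>i\<in>I. c i *\<^sub>F a (u i))" using insert by blast
  ultimately show ?case by (simp only: sum.insert[OF insert(1,2)])
qed simp

lemma endos_scale: "a \<in> endos A q \<Longrightarrow> u \<in> T q \<Longrightarrow> a (c *\<^sub>F u) = c *\<^sub>F a u"
  using endos_lin(2) by blast

lemma endo_linear: assumes q: "q \<in> U" and a: "a \<in> endos A q" shows "linear (\<lambda>u. coords q (a (frame_vec q u)))"
  by (rule linearI) (simp_all add: frame_vec_add frame_vec_scale endos_lin(1)[OF a] endos_scale[OF a] frame_vec_T q coords_add coords_scale endos_T[OF a])

lemma endo_eq_sd_endo: assumes q: "q \<in> U" and a: "a \<in> endos A q" and "(\<lambda>u. coords q (a (frame_vec q u))) = Kop x"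
  shows "a = sd_endo q x"
proof
  fix v show "a v = sd_endo q x v"
  proof (cases "v \<in> T q")
    case True
    have "coords q (a v) = Kop x (coords q v)" using fun_cong[OF assms(3), of "coords q v"] frame_vec_coords[OF q True] by simp
    then show ?thesis using frame_vec_coords[OF q endos_T[OF a True]] sd_endo_apply[OF True] by metis
  next
    case False
    then show ?thesis using a unfolding sd_endo_def endos_def by (auto simp: PiE_def extensional_def)
  qed
qed

lemma frame_mat_vector: "frame_mat q (vector [a, b, c, d]) = vector [coords q a, coords q b, coords q c, coords q d]"
  by (simp add: frame_mat_def vec_eq_iff[where 'b=4] forall_4)

text \<open>
  The fibre of the twistor space is a two-sphere. An orthogonal complex structure is a skew endomorphism with square
  \<open>- 1\<close>, so \<open>skew_square_self_dual\<close> applies; conversely \<open>det_Kop\<close> gives the orientation condition.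
\<close>

lemma fibre_iff: assumes q: "q \<in> U"
  shows "J \<in> twistor_fibre A g q \<longleftrightarrow> (\<exists>x. x \<bullet> x = 1 \<and> J = sd_endo q x)"
proof
  assume J: "J \<in> twistor_fibre A g q"
  have e: "J \<in> endos A q" and sq: "\<And>u. u \<in> T q \<Longrightarrow> J (J u) = - u"
    and og: "\<And>u v. u \<in> T q \<Longrightarrow> v \<in> T q \<Longrightarrow> g q (J u) (J v) = g q u v"
    and or: "\<And>e1 e3. e1 \<in> T q \<Longrightarrow> e3 \<in> T q \<Longrightarrow> basis_at A q (vector [e1, J e1, e3, J e3]) \<Longrightarrow>
        positive_basis A q (vector [e1, J e1, e3, J e3])"
    using J unfolding twistor_fibre_def by auto
  let ?M = "\<lambda>u. coords q (J (frame_vec q u))"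
  have JM: "J (frame_vec q u) = frame_vec q (?M u)" for u using frame_vec_coords[OF q endos_T[OF e frame_vec_T[OF q]]] by simp
  have MM: "?M (?M u) = - u" for u
    using sq[OF frame_vec_T[OF q, of u]] by (simp add: JM[symmetric] coords_uminus q frame_vec_T coords_lin)
  have "?M u \<bullet> v = - (u \<bullet> ?M v)" for u v
  proof -
    have i: "?M u \<bullet> ?M v = u \<bullet> v" for u v
      using og[OF frame_vec_T[OF q, of u] frame_vec_T[OF q, of v]] by (simp add: g_coords q frame_vec_T endos_T[OF e] coords_lin)
    have "?M u \<bullet> v = ?M (?M u) \<bullet> ?M v" by (rule i[symmetric])
    then show ?thesis by (simp add: MM)
  qed
  moreover have "det (vector [u, ?M u, v, ?M v] :: real^4^4) \<ge> 0" for u v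
  proof (rule ccontr)
    let ?e = "vector [frame_vec q u, J (frame_vec q u), frame_vec q v, J (frame_vec q v)] :: ('a tvec)^4"
    assume "\<not> det (vector [u, ?M u, v, ?M v] :: real^4^4) \<ge> 0"
    then have d: "det (frame_mat q ?e) < 0" by (simp add: frame_mat_vector coords_lin q)
    have "\<forall>i. ?e $ i \<in> T q" by (simp add: forall_4 frame_vec_T q endos_T[OF e])
    then have "positive_basis A q ?e"
      using or[OF frame_vec_T[OF q] frame_vec_T[OF q]] basis_at_iff[OF q] d by auto
    then show False using positive_basis_iff[OF q] d by auto
  qed
  ultimately obtain x where "x \<bullet> x = 1" "?M = Kop x"
    using skew_square_self_dual[OF endo_linear[OF q e]] MM by blast
  then show "\<exists>x. x \<bullet> x = 1 \<and> J = sd_endo q x" using endo_eq_sd_endo[OF q e] by blast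
next
  assume "\<exists>x. x \<bullet> x = 1 \<and> J = sd_endo q x"
  then obtain x where x: "x \<bullet> x = 1" and J: "J = sd_endo q x" by blast
  have KK: "Kop x (Kop x u) = - u" for u by (simp add: Kop_Kop x Kop_lin)
  show "J \<in> twistor_fibre A g q"
    unfolding twistor_fibre_def mem_Collect_eq
  proof (intro conjI ballI impI)
    show "J \<in> endos A q" using J sd_endo_endos q by simp
    fix u assume u: "u \<in> T q"
    show "J (J u) = - u" using frame_vec_coords[OF q u]
      by (simp add: J sd_endo_apply[OF u] sd_endo_lin q KK frame_vec_uminus)
    fix v assume v: "v \<in> T q"
    show "g q (J u) (J v) = g q u v"
      by (simp add: J g_coords q u v sd_endo_T coords_sd_endo) (simp add: Kop_inner KK)
    assume "basis_at A q (vector [u, J u, v, J v])"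
    then have d: "\<forall>i. (vector [u, J u, v, J v] :: ('a tvec)^4) $ i \<in> T q" "det (frame_mat q (vector [u, J u, v, J v])) \<noteq> 0"
      using basis_at_iff[OF q] by auto
    then show "positive_basis A q (vector [u, J u, v, J v])"
      unfolding positive_basis_iff[OF q] frame_mat_vector J coords_sd_endo[OF q u] coords_sd_endo[OF q v] det_Kop
      using inner_ge_zero less_le by metis
  qed
qed

lemma sd_endo_fibre: "q \<in> U \<Longrightarrow> x \<bullet> x = 1 \<Longrightarrow> sd_endo q x \<in> twistor_fibre A g q" using fibre_iff by blast
lemma fibre_sd_coords: "q \<in> U \<Longrightarrow> J \<in> twistor_fibre A g q \<Longrightarrow> sd_coords q J \<bullet> sd_coords q J = 1 \<and> J = sd_endo q (sd_coords q J)"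
  using fibre_iff sd_coords_sd_endo by metis

lemma vertical_iff: assumes q: "q \<in> U" and x: "x \<bullet> x = 1"
  shows "V \<in> vertical_space A g q (sd_endo q x) \<longleftrightarrow> (\<exists>\<xi>. \<xi> \<bullet> x = 0 \<and> V = sd_endo q \<xi>)"
proof
  assume V: "V \<in> vertical_space A g q (sd_endo q x)"
  have e: "V \<in> endos A q" and sk: "\<And>u v. u \<in> T q \<Longrightarrow> v \<in> T q \<Longrightarrow> g q (V u) v = - g q u (V v)"
    and ac: "\<And>u. u \<in> T q \<Longrightarrow> V (sd_endo q x u) + sd_endo q x (V u) = 0"
    using V unfolding vertical_space_def skew_endos_def by auto
  let ?M = "\<lambda>u. coords q (V (frame_vec q u))"
  have JM: "V (frame_vec q u) = frame_vec q (?M u)" for u using frame_vec_coords[OF q endos_T[OF e frame_vec_T[OF q]]] by simp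
  have 1: "?M u \<bullet> v = - (u \<bullet> ?M v)" for u v
    using sk[OF frame_vec_T[OF q, of u] frame_vec_T[OF q, of v]] by (simp add: g_coords q frame_vec_T endos_T[OF e] coords_lin)
  have 2: "?M (Kop x u) + Kop x (?M u) = 0" for u
  proof -
    have "coords q (V (sd_endo q x (frame_vec q u)) + sd_endo q x (V (frame_vec q u))) = coords q 0" using ac[OF frame_vec_T[OF q]] by simp
    then show ?thesis by (simp add: sd_endo_lin q coords_add endos_T[OF e] frame_vec_T sd_endo_T coords_sd_endo coords_zero)
  qed
  obtain \<xi> where "\<xi> \<bullet> x = 0" "?M = Kop \<xi>"
    using skew_anticommute[OF endo_linear[OF q e] 1 2 x] by blast
  then show "\<exists>\<xi>. \<xi> \<bullet> x = 0 \<and> V = sd_endo q \<xi>" using endo_eq_sd_endo[OF q e] by blast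
next
  assume "\<exists>\<xi>. \<xi> \<bullet> x = 0 \<and> V = sd_endo q \<xi>"
  then obtain \<xi> where y: "\<xi> \<bullet> x = 0" and V: "V = sd_endo q \<xi>" by blast
  show "V \<in> vertical_space A g q (sd_endo q x)"
    unfolding vertical_space_def skew_endos_def mem_Collect_eq
  proof (intro conjI ballI)
    show "V \<in> endos A q" using V sd_endo_endos q by simp
    fix u v assume u: "u \<in> T q" and v: "v \<in> T q"
    show "g q (V u) v = - g q u (V v)" by (simp add: V g_coords q u v sd_endo_T coords_sd_endo Kop_inner)
  next
    fix u assume u: "u \<in> T q"
    have "Kop \<xi> (Kop x w) + Kop x (Kop \<xi> w) = 0" for w
      using y cross_skew[of \<xi> x] by (simp add: Kop_Kop Kop_lin inner_commute[of x])
    then have "frame_vec q (Kop \<xi> (Kop x (coords q u))) + frame_vec q (Kop x (Kop \<xi> (coords q u))) = 0"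
      by (simp add: frame_vec_add[symmetric]) (simp add: frame_vec_def fscale_0)
    then show "V (sd_endo q x u) + sd_endo q x (V u) = 0"
      by (simp add: V sd_endo_apply[OF u] sd_endo_lin q)
  qed
qed

lemma compose_sd_endo: assumes q: "q \<in> U" and y: "\<xi> \<bullet> x = 0"
  shows "compose (T q) (sd_endo q x) (sd_endo q \<xi>) = sd_endo q (cross3 x \<xi>)"
proof
  fix v show "compose (T q) (sd_endo q x) (sd_endo q \<xi>) v = sd_endo q (cross3 x \<xi>) v"
    using y by (cases "v \<in> T q") (simp_all add: compose_def sd_endo_apply[of v] sd_endo_lin q Kop_Kop inner_commute, simp add: sd_endo_def)
qed

end

section \<open>Coordinates on the twistor space\<close>

context chart_nbhd
begin

lemma smv_open: assumes p: "p \<in> U" and h: "smv p h" and W: "open W" "h p \<in> W" shows "nb p (\<lambda>q. h q \<in> W)"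
proof -
  obtain V H where V: "open V" "\<kappa> p \<in> V" "smooth_on V H" "\<forall>q\<in>U. \<kappa> q \<in> V \<longrightarrow> h q = H (\<kappa> q)"
    using h unfolding smv_def by blast
  have "open (V \<inter> H -` W)"
    using continuous_open_preimage[OF smooth_on_continuous[OF V(3)] V(1) W(1)] by simp
  moreover have "\<kappa> p \<in> V \<inter> H -` W" using V p W by auto
  moreover have "\<forall>q\<in>U. \<kappa> q \<in> V \<inter> H -` W \<longrightarrow> h q \<in> W" using V(4) by auto
  ultimately show ?thesis unfolding nb_iff[OF p] by blast
qed

lemma smv_vecI:
  fixes h :: "'a \<Rightarrow> 'm::euclidean_space ^ 'n"
  assumes "\<And>i. smv p (\<lambda>q. h q $ i)"
  shows "smv p h"
proof (rule smv_componentsI)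
  fix b :: "'m^'n" assume "b \<in> Basis"
  then obtain i u where b: "b = axis i u" unfolding Basis_vec_def by auto
  have "smv p (\<lambda>q. h q $ i \<bullet> u)" by (rule smv_inner[OF assms])
  then show "smv p (\<lambda>q. h q \<bullet> b)" by (simp add: b inner_axis)
qed

text \<open>
  Functions of the base point are regarded as functions on a product with a Euclidean space, the model of an endomorphism
  bundle; \<open>single_nbhd\<close> then makes the calculus of smooth maps available on the product.
\<close>

lemma prod_rep: assumes "smv p h"
  shows "\<exists>W H. open W \<and> (\<kappa> p, x :: 'n::euclidean_space) \<in> W \<and> smooth_on W H \<and>
    (\<forall>z\<in>U \<times> UNIV. (\<kappa> (fst z), snd z) \<in> W \<longrightarrow> h (fst z) = H (\<kappa> (fst z), snd z))"
proof -
  obtain V H where V: "open V" "\<kappa> p \<in> V" "smooth_on V H" "\<forall>q\<in>U. \<kappa> q \<in> V \<longrightarrow> h q = H (\<kappa> q)"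
    using assms unfolding smv_def by blast
  have o: "open (V \<times> (UNIV :: 'n set))" using V(1) by (simp add: open_Times)
  have "smooth_on (V \<times> (UNIV :: 'n set)) (\<lambda>z. H (fst z))"
    by (rule smooth_on_compose[OF smooth_on_bounded_linear[OF bounded_linear_fst o] V(3) o V(1)]) auto
  then show ?thesis using o V by (intro exI[of _ "V \<times> UNIV"] exI[of _ "\<lambda>z. H (fst z)"]) auto
qed

lemma prod_nb: assumes "p \<in> U" "nb p P"
  shows "\<exists>W. open W \<and> (\<kappa> p, x :: 'n::euclidean_space) \<in> W \<and>
    (\<forall>z\<in>U \<times> UNIV. (\<kappa> (fst z), snd z) \<in> W \<longrightarrow> P (fst z))"
proof -
  obtain V where V: "open V" "\<kappa> p \<in> V" "\<forall>q\<in>U. \<kappa> q \<in> V \<longrightarrow> P q"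
    using assms unfolding nb_iff[OF assms(1)] by blast
  then show ?thesis by (intro exI[of _ "V \<times> UNIV"]) (auto simp: open_Times)
qed

end

lemma single_nbhd: "chart_nbhd {(U, \<kappa>)} U U \<kappa>"
  by unfold_locales (auto simp: smooth_near_def nearby_def)

lemma Kop_expand: "Kop x u $ l = (\<Sum>m\<in>UNIV. u $ m * Kop x (axis m 1) $ l)"
proof -
  have "\<forall>l. Kop x u $ l = (\<Sum>m\<in>UNIV. u $ m * Kop x (axis m 1) $ l)"
    by (simp add: forall_4 sum_4 axis_def algebra_simps)
  then show ?thesis by blast
qed

lemma Kop_expand_left: "Kop x u = (\<Sum>a\<in>UNIV. x $ a *\<^sub>R Kop (axis a 1) u)"
  by (simp add: vec_eq_iff[where 'b=4] forall_4 sum_3 axis_def algebra_simps)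

context framed_chart
begin

definition UZ :: "('a \<times> ('a tvec \<Rightarrow> 'a tvec)) set" where "UZ = Sigma U (twistor_fibre A g)"
definition \<kappa>Z :: "'a \<times> ('a tvec \<Rightarrow> 'a tvec) \<Rightarrow> (real^4) \<times> (real^3)" where
  "\<kappa>Z z = (\<phi> (fst z), sd_coords (fst z) (snd z))"

lemma UZ_iff: "(q, J) \<in> UZ \<longleftrightarrow> q \<in> U \<and> (\<exists>x. x \<bullet> x = 1 \<and> J = sd_endo q x)"
  unfolding UZ_def using fibre_iff by auto

lemma sd_endo_UZ: "q \<in> U \<Longrightarrow> x \<bullet> x = 1 \<Longrightarrow> (q, sd_endo q x) \<in> UZ" using UZ_iff by blast

lemma endo_mat_smooth:
  assumes V: "(V, \<psi>) \<in> A" "q0 \<in> V" and q0: "q0 \<in> U"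
  defines "h \<equiv> \<lambda>z. (\<psi> (fst z), endo_matrix A (V, \<psi>) (fst z) (sd_endo (fst z) (snd z)))"
  shows "\<exists>W H. open W \<and> (\<phi> q0, x) \<in> W \<and> smooth_on W H \<and>
    (\<forall>z\<in>U \<times> UNIV. (\<phi> (fst z), snd z) \<in> W \<longrightarrow> fst z \<in> V \<and> h z = H (\<phi> (fst z), snd z))"
proof -
  interpret P: chart_nbhd "{(U \<times> (UNIV::(real^3) set), \<lambda>z. (\<phi> (fst z), snd z))}" "U \<times> UNIV" "U \<times> UNIV" "\<lambda>z. (\<phi> (fst z), snd z)"
    by (rule single_nbhd)
  interpret V: oriented_chart X A V \<psi> by unfold_locales (use oriented V in auto)
  have up: "P.smv (q0, x) (\<lambda>z. f (fst z))" if "smv q0 f" for f :: "'a \<Rightarrow> 'm::euclidean_space" and x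
    unfolding P.smv_def using prod_rep[OF that, of x] by simp
  have q0P: "(q0, x) \<in> U \<times> UNIV" using q0 by simp
  define mat :: "3 \<Rightarrow> 'a \<Rightarrow> real^4^4" where
    "mat a q = (\<chi> i j. \<Sum>l\<in>UNIV. Kop (axis a 1) (coords q (V.dd j q)) $ l * E l q (\<lambda>r. \<psi> r $ i))" for a q
  have "sm q0 (\<lambda>q. mat a q $ i $ j)" for a i j
    unfolding mat_def vec_lambda_beta
    by (subst Kop_expand) (intro sm_sum sm_mult sm_const q0 coords_sm V.dd_vf V vf_sm[OF E_vf] V.sm_phi)
  then have smat: "smv q0 (mat a)" for a
    by (intro smv_vecI) (simp add: sm_smv[OF q0])
  have spsi: "smv q0 \<psi>" by (intro smv_vecI) (simp add: sm_smv[OF q0, symmetric] V.sm_phi V)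
  have sx: "P.smv (q0, x) (\<lambda>z. snd z $ a)" for a
    by (rule P.smv_linear[OF P.smv_kappa, of "\<lambda>w. snd w $ a", simplified])
      (auto intro!: bounded_linear_compose[OF bounded_linear_vec_nth] bounded_linear_snd)
  have sh: "P.smv (q0, x) (\<lambda>z. (\<psi> (fst z), \<Sum>a\<in>UNIV. snd z $ a *\<^sub>R mat a (fst z)))"
    by (intro P.smv_Pair P.smv_sum P.smv_bilinear[OF _ _ bounded_bilinear_scaleR] up sx smat spsi)
  have e: "(\<psi> q, \<Sum>a\<in>UNIV. y $ a *\<^sub>R mat a q) = h (q, y)" if "q \<in> U" "q \<in> V" for q y
  proof -
    have "(sd_endo q y (V.dd j q)) (\<lambda>r. \<psi> r $ i) = (\<Sum>a\<in>UNIV. y $ a * (mat a q $ i $ j))" for i j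
    proof -
      have "(sd_endo q y (V.dd j q)) (\<lambda>r. \<psi> r $ i) = (\<Sum>l\<in>UNIV. Kop y (coords q (V.dd j q)) $ l * E l q (\<lambda>r. \<psi> r $ i))"
        using that by (simp add: sd_endo_apply V.dd_T frame_vec_def sum_fun_apply)
      also have "\<dots> = (\<Sum>l\<in>UNIV. \<Sum>a\<in>UNIV. y $ a * (Kop (axis a 1) (coords q (V.dd j q)) $ l * E l q (\<lambda>r. \<psi> r $ i)))"
        by (subst Kop_expand_left) (simp add: sum_distrib_right mult.assoc)
      also have "\<dots> = (\<Sum>a\<in>UNIV. \<Sum>l\<in>UNIV. y $ a * (Kop (axis a 1) (coords q (V.dd j q)) $ l * E l q (\<lambda>r. \<psi> r $ i)))"
        by (rule sum.swap)
      finally show ?thesis by (simp add: mat_def sum_distrib_left)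
    qed
    then show ?thesis by (simp add: h_def endo_matrix_def vec_eq_iff)
  qed
  have nV: "P.nb (q0, x) (\<lambda>z. fst z \<in> V)"
    unfolding P.nb_iff[OF q0P] using prod_nb[OF q0 V.nb_U[OF V(2)], of x] by simp
  have "P.nb (q0, x) (\<lambda>z. (\<psi> (fst z), \<Sum>a\<in>UNIV. snd z $ a *\<^sub>R mat a (fst z)) = h z)"
    by (rule P.nb_mono[OF q0P nV]) (use e in auto)
  then have "P.smv (q0, x) h" by (rule P.smv_cong[OF q0P _ sh])
  then obtain W H where W: "open W" "(\<phi> q0, x) \<in> W" "smooth_on W H"
    "\<forall>z\<in>U \<times> UNIV. (\<phi> (fst z), snd z) \<in> W \<longrightarrow> h z = H (\<phi> (fst z), snd z)"
    unfolding P.smv_def by auto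
  obtain W' where W': "open W'" "(\<phi> q0, x) \<in> W'" "\<forall>z\<in>U \<times> UNIV. (\<phi> (fst z), snd z) \<in> W' \<longrightarrow> fst z \<in> V"
    using nV unfolding P.nb_iff[OF q0P] by auto
  show ?thesis
    by (intro exI[of _ "W \<inter> W'"] exI[of _ H]) (use W W' smooth_on_subset[OF W(3), of "W \<inter> W'"] in auto)
qed

text \<open>
  A formula for \<open>sd_coords\<close> in terms of the matrix of the endomorphism in the chart. It is defined for all matrices
  and is linear in them, hence is smooth on the ambient bundle of endomorphisms.
\<close>

definition sd_coords_of_matrix :: "'a \<times> (real^4^4) \<Rightarrow> real^3" where
  "sd_coords_of_matrix z = vector (map (\<lambda>k. \<Sum>i\<in>UNIV. \<Sum>j\<in>UNIV. snd z $ i $ j * (E 1 (fst z) (\<lambda>r. \<phi> r $ j) * coords (fst z) (dd i (fst z)) $ k)) [2, 3, 4])"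

lemma sd_coords_of_endo_matrix: assumes q: "q \<in> U" and J: "J \<in> endos A q"
  shows "sd_coords_of_matrix (q, endo_matrix A (U, \<phi>) q J) = sd_coords q J"
proof -
  have "J (E 1 q) = J (\<Sum>j\<in>UNIV. E 1 q (\<lambda>r. \<phi> r $ j) *\<^sub>F dd j q)"
    using T_expand[OF q E_T[OF q, of 1]] by (rule arg_cong)
  also have "\<dots> = (\<Sum>j\<in>UNIV. E 1 q (\<lambda>r. \<phi> r $ j) *\<^sub>F J (dd j q))"
    by (rule endos_sum[OF J]) (auto simp: dd_T q)
  finally have e1: "J (E 1 q) = (\<Sum>j\<in>UNIV. E 1 q (\<lambda>r. \<phi> r $ j) *\<^sub>F J (dd j q))" .
  have e2: "coords q (J (dd j q)) = (\<Sum>i\<in>UNIV. endo_matrix A (U, \<phi>) q J $ i $ j *\<^sub>R coords q (dd i q))" for j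
  proof -
    have "coords q (J (dd j q)) = coords q (\<Sum>i\<in>UNIV. J (dd j q) (\<lambda>r. \<phi> r $ i) *\<^sub>F dd i q)"
      using T_expand[OF q endos_T[OF J dd_T[OF q]], of j] by (rule arg_cong)
    also have "\<dots> = (\<Sum>i\<in>UNIV. J (dd j q) (\<lambda>r. \<phi> r $ i) *\<^sub>R coords q (dd i q))"
      by (simp add: coords_sum T_intros dd_T q coords_scale)
    finally show ?thesis by (simp add: endo_matrix_def)
  qed
  have "coords q (J (E 1 q)) $ k = (\<Sum>i\<in>UNIV. \<Sum>j\<in>UNIV. endo_matrix A (U, \<phi>) q J $ i $ j * (E 1 q (\<lambda>r. \<phi> r $ j) * coords q (dd i q) $ k))" for k
  proof -
    have "coords q (J (E 1 q)) $ k = (\<Sum>j\<in>UNIV. E 1 q (\<lambda>r. \<phi> r $ j) * coords q (J (dd j q)) $ k)"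
      unfolding e1 by (simp add: coords_sum T_intros endos_T[OF J] dd_T q coords_scale)
    also have "\<dots> = (\<Sum>j\<in>UNIV. \<Sum>i\<in>UNIV. endo_matrix A (U, \<phi>) q J $ i $ j * (E 1 q (\<lambda>r. \<phi> r $ j) * coords q (dd i q) $ k))"
      unfolding e2 by (simp add: sum_distrib_left mult.assoc mult.left_commute)
    finally show ?thesis by (subst sum.swap)
  qed
  then show ?thesis by (simp add: sd_coords_of_matrix_def sd_coords_def)
qed

lemma sd_coords_of_matrix_smooth:
  assumes q0: "q0 \<in> U"
  shows "\<exists>W H. open W \<and> (\<phi> q0, m) \<in> W \<and> smooth_on W H \<and>
    (\<forall>z\<in>U \<times> UNIV. (\<phi> (fst z), snd z) \<in> W \<longrightarrow> (\<phi> (fst z), sd_coords_of_matrix z) = H (\<phi> (fst z), snd z))"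
proof -
  interpret P: chart_nbhd "{(U \<times> (UNIV::(real^4^4) set), \<lambda>z. (\<phi> (fst z), snd z))}" "U \<times> UNIV" "U \<times> UNIV" "\<lambda>z. (\<phi> (fst z), snd z)"
    by (rule single_nbhd)
  have up: "P.smv (q0, x) (\<lambda>z. f (fst z))" if "smv q0 f" for f :: "'a \<Rightarrow> 'm::euclidean_space" and x
    unfolding P.smv_def using prod_rep[OF that, of x] by simp
  have sx: "P.smv (q0, m) (\<lambda>z. snd z $ i $ j)" for i j
    by (rule P.smv_linear[OF P.smv_kappa, of "\<lambda>w. snd w $ i $ j", simplified])
      (auto intro!: bounded_linear_compose[OF bounded_linear_vec_nth] bounded_linear_snd)
  have c: "P.smv (q0, m) (\<lambda>z. E 1 (fst z) (\<lambda>r. \<phi> r $ j) * coords (fst z) (dd i (fst z)) $ k)" for i j k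
  proof -
    have "sm q0 (\<lambda>q. E 1 q (\<lambda>r. \<phi> r $ j) * coords q (dd i q) $ k)"
      by (intro sm_mult q0 coords_sm dd_vf vf_sm[OF E_vf] sm_phi)
    then show ?thesis by (intro up) (simp add: sm_smv[OF q0])
  qed
  have s: "P.smv (q0, m) (\<lambda>z. \<Sum>i\<in>UNIV. \<Sum>j\<in>UNIV. snd z $ i $ j * (E 1 (fst z) (\<lambda>r. \<phi> r $ j) * coords (fst z) (dd i (fst z)) $ k))" for k
    by (intro P.smv_sum P.smv_bilinear[OF _ _ bounded_bilinear_mult, OF sx c])
  have "P.smv (q0, m) (\<lambda>z. sd_coords_of_matrix z $ a)" for a
    using exhaust_3[of a] s by (auto simp: sd_coords_of_matrix_def)
  then have "P.smv (q0, m) (\<lambda>z. (\<phi> (fst z), sd_coords_of_matrix z))"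
    by (intro P.smv_Pair P.smv_vecI up smv_kappa)
  then show ?thesis unfolding P.smv_def by auto
qed

text \<open>
  The smooth structure of the twistor space is induced from the bundle of endomorphisms. Therefore two smooth comparison maps
  are needed: from \<open>\<kappa>Z\<close> to every bundle chart (\<open>endo_mat_smooth\<close>) and from the bundle chart over \<open>\<phi>\<close>
  back to \<open>\<kappa>Z\<close> (\<open>sd_coords_of_matrix_smooth\<close>).
\<close>

lemma Z_nbhd: "chart_nbhd (endo_atlas A) (twistor_space A g) UZ \<kappa>Z"
proof
  show UZS: "UZ \<subseteq> twistor_space A g" unfolding UZ_def twistor_space_def using US by auto
  fix p assume p: "p \<in> UZ"
  obtain q0 J0 where pq: "p = (q0, J0)" by (cases p)
  define x0 where "x0 = sd_coords q0 J0"
  have q0: "q0 \<in> U" and x0: "x0 \<bullet> x0 = 1" and J0: "J0 = sd_endo q0 x0"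
    using p fibre_sd_coords unfolding pq UZ_def x0_def by auto
  have kp: "\<kappa>Z p = (\<phi> q0, x0)" by (simp add: \<kappa>Z_def pq x0_def)
  let ?ch = "\<lambda>c z. (snd c (fst z), endo_matrix A c (fst z) (snd z))"
  have atl: "c' \<in> endo_atlas A \<longleftrightarrow> (\<exists>V \<psi>. (V, \<psi>) \<in> A \<and> c' = (Sigma V (endos A), ?ch (V, \<psi>)))" for c'
    unfolding endo_atlas_def case_prod_unfold image_iff by (simp add: Bex_def)
  have dec: "fst z \<in> U \<and> snd z \<in> endos A (fst z) \<and> snd z = sd_endo (fst z) (snd (\<kappa>Z z)) \<and> fst (\<kappa>Z z) = \<phi> (fst z)" if "z \<in> UZ" for z
    using that fibre_sd_coords unfolding UZ_def \<kappa>Z_def by (auto simp: twistor_fibre_def)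
  have A1: "\<exists>W' H. open W' \<and> \<kappa>Z p \<in> W' \<and> smooth_on W' H \<and> (\<forall>y\<in>W'. H y \<in> W) \<and>
      (\<forall>z\<in>UZ. \<kappa>Z z \<in> W' \<longrightarrow> fst z \<in> V \<and> ?ch (V, \<psi>) z = H (\<kappa>Z z))"
    if V: "(V, \<psi>) \<in> A" "q0 \<in> V" and W: "open W" "?ch (V, \<psi>) p \<in> W" for V \<psi> W
  proof -
    obtain W1 H where H: "open W1" "(\<phi> q0, x0) \<in> W1" "smooth_on W1 H"
      "\<forall>z\<in>U \<times> UNIV. (\<phi> (fst z), snd z) \<in> W1 \<longrightarrow> fst z \<in> V \<and> (\<psi> (fst z), endo_matrix A (V, \<psi>) (fst z) (sd_endo (fst z) (snd z))) = H (\<phi> (fst z), snd z)"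
      using endo_mat_smooth[OF V q0, of x0] by blast
    have Hz: "fst z \<in> V \<and> ?ch (V, \<psi>) z = H (\<kappa>Z z)" if "z \<in> UZ" "\<kappa>Z z \<in> W1" for z
      using H(4)[rule_format, of "(fst z, snd (\<kappa>Z z))"] dec[OF that(1)] that(2) by (metis UNIV_I fst_conv mem_Times_iff prod.collapse snd_conv)
    have "open (W1 \<inter> H -` W)"
      using continuous_open_preimage[OF smooth_on_continuous[OF H(3)] H(1) W(1)] .
    moreover have "\<kappa>Z p \<in> W1 \<inter> H -` W" using Hz[OF p] H(2) W(2) by (simp add: kp)
    ultimately show ?thesis using Hz smooth_on_subset[OF H(3), of "W1 \<inter> H -` W"]
      by (intro exI[of _ "W1 \<inter> H -` W"] exI[of _ H]) auto
  qed
  have A2: "\<exists>W' H. open W' \<and> ?ch (U, \<phi>) p \<in> W' \<and> smooth_on W' H \<and> (\<forall>y\<in>W'. H y \<in> W) \<and>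
      (\<forall>z\<in>twistor_space A g. z \<in> Sigma U (endos A) \<and> ?ch (U, \<phi>) z \<in> W' \<longrightarrow> z \<in> UZ \<and> \<kappa>Z z = H (?ch (U, \<phi>) z))"
    if W: "open W" "\<kappa>Z p \<in> W" for W
  proof -
    let ?m = "endo_matrix A (U, \<phi>) q0 J0"
    obtain W1 H where H: "open W1" "(\<phi> q0, ?m) \<in> W1" "smooth_on W1 H"
      "\<forall>z\<in>U \<times> UNIV. (\<phi> (fst z), snd z) \<in> W1 \<longrightarrow> (\<phi> (fst z), sd_coords_of_matrix z) = H (\<phi> (fst z), snd z)"
      using sd_coords_of_matrix_smooth[OF q0, of ?m] by blast
    have Hz: "z \<in> UZ \<and> \<kappa>Z z = H (?ch (U, \<phi>) z)" if "z \<in> twistor_space A g" "z \<in> Sigma U (endos A)" "?ch (U, \<phi>) z \<in> W1" for z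
    proof -
      obtain q J where z: "z = (q, J)" by (cases z)
      show ?thesis using H(4)[rule_format, of "(q, endo_matrix A (U, \<phi>) q J)"] that sd_coords_of_endo_matrix[of q J]
        by (auto simp: z \<kappa>Z_def UZ_def twistor_space_def)
    qed
    have pe: "p \<in> twistor_space A g" "p \<in> Sigma U (endos A)" using p UZS dec[OF p] by (auto simp: pq)
    have "open (W1 \<inter> H -` W)"
      using continuous_open_preimage[OF smooth_on_continuous[OF H(3)] H(1) W(1)] .
    moreover have "?ch (U, \<phi>) p \<in> W1 \<inter> H -` W" using Hz[OF pe] H(2) W(2) by (simp add: pq)
    ultimately show ?thesis using Hz smooth_on_subset[OF H(3), of "W1 \<inter> H -` W"]
      by (intro exI[of _ "W1 \<inter> H -` W"] exI[of _ H]) blast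
  qed
  have chU: "(Sigma U (endos A), ?ch (U, \<phi>)) \<in> endo_atlas A" unfolding atl using ch by blast
  have pU: "p \<in> Sigma U (endos A)" using dec[OF p] by (auto simp: pq)
  show "smooth_near (endo_atlas A) (twistor_space A g) p f \<longleftrightarrow>
      (\<exists>W F. open W \<and> \<kappa>Z p \<in> W \<and> smooth_on W F \<and> (\<forall>q\<in>UZ. \<kappa>Z q \<in> W \<longrightarrow> f q = F (\<kappa>Z q)))" (is "?L \<longleftrightarrow> ?R") for f
  proof
    assume ?L
    then obtain C where C: "C \<in> endo_atlas A" "p \<in> fst C"
      "\<exists>W F. open W \<and> snd C p \<in> W \<and> smooth_on W F \<and> (\<forall>q\<in>twistor_space A g. q \<in> fst C \<and> snd C q \<in> W \<longrightarrow> f q = F (snd C q))"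
      unfolding smooth_near_def by (auto simp: case_prod_unfold)
    from C(1) obtain V \<psi> where V: "(V, \<psi>) \<in> A" "C = (Sigma V (endos A), ?ch (V, \<psi>))" unfolding atl by blast
    from C(3) obtain W F where W: "open W" "?ch (V, \<psi>) p \<in> W" "smooth_on W F"
      "\<forall>q\<in>twistor_space A g. q \<in> Sigma V (endos A) \<and> ?ch (V, \<psi>) q \<in> W \<longrightarrow> f q = F (?ch (V, \<psi>) q)"
      unfolding V(2) by auto
    have "q0 \<in> V" using C(2) by (simp add: V(2) pq)
    from A1[OF V(1) this W(1,2)] obtain W' H where H: "open W'" "\<kappa>Z p \<in> W'" "smooth_on W' H" "\<forall>y\<in>W'. H y \<in> W"
      "\<forall>z\<in>UZ. \<kappa>Z z \<in> W' \<longrightarrow> fst z \<in> V \<and> ?ch (V, \<psi>) z = H (\<kappa>Z z)" by blast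
    have "smooth_on W' (\<lambda>y. F (H y))"
      by (rule smooth_on_compose[OF H(3) W(3) H(1) W(1)]) (use H(4) in blast)
    moreover have "f z = F (H (\<kappa>Z z))" if z: "z \<in> UZ" "\<kappa>Z z \<in> W'" for z
    proof -
      have "z \<in> Sigma V (endos A)" using H(5) z dec[OF z(1)] by (metis mem_Sigma_iff prod.collapse)
      moreover have "?ch (V, \<psi>) z = H (\<kappa>Z z)" "H (\<kappa>Z z) \<in> W" using H(4,5) z by blast+
      moreover have "z \<in> twistor_space A g" using UZS z(1) by blast
      ultimately have "f z = F (?ch (V, \<psi>) z)" using W(4) by simp
      then show ?thesis using \<open>?ch (V, \<psi>) z = H (\<kappa>Z z)\<close> by simp
    qed
    ultimately show ?R using H(1,2) by blast
  next
    assume ?R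
    then obtain W F where W: "open W" "\<kappa>Z p \<in> W" "smooth_on W F" "\<forall>q\<in>UZ. \<kappa>Z q \<in> W \<longrightarrow> f q = F (\<kappa>Z q)" by blast
    from A2[OF W(1,2)] obtain W' H where H: "open W'" "?ch (U, \<phi>) p \<in> W'" "smooth_on W' H" "\<forall>y\<in>W'. H y \<in> W"
      "\<forall>z\<in>twistor_space A g. z \<in> Sigma U (endos A) \<and> ?ch (U, \<phi>) z \<in> W' \<longrightarrow> z \<in> UZ \<and> \<kappa>Z z = H (?ch (U, \<phi>) z)" by blast
    have "smooth_on W' (\<lambda>y. F (H y))"
      by (rule smooth_on_compose[OF H(3) W(3) H(1) W(1)]) (use H(4) in blast)
    moreover have "\<forall>z\<in>twistor_space A g. z \<in> Sigma U (endos A) \<and> ?ch (U, \<phi>) z \<in> W' \<longrightarrow> f z = F (H (?ch (U, \<phi>) z))"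
      using H(4,5) W(4) by metis
    ultimately show ?L unfolding smooth_near_def using chU pU H(1,2)
      by (intro bexI[OF _ chU]) auto
  qed
  show "nearby (endo_atlas A) (twistor_space A g) p P \<longleftrightarrow>
      (\<exists>W. open W \<and> \<kappa>Z p \<in> W \<and> (\<forall>q\<in>UZ. \<kappa>Z q \<in> W \<longrightarrow> P q))" (is "?L \<longleftrightarrow> ?R") for P
  proof
    assume ?L
    then obtain C where C: "C \<in> endo_atlas A" "p \<in> fst C"
      "\<exists>W. open W \<and> snd C p \<in> W \<and> (\<forall>q\<in>twistor_space A g. q \<in> fst C \<and> snd C q \<in> W \<longrightarrow> P q)"
      unfolding nearby_def by (auto simp: case_prod_unfold)
    from C(1) obtain V \<psi> where V: "(V, \<psi>) \<in> A" "C = (Sigma V (endos A), ?ch (V, \<psi>))" unfolding atl by blast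
    from C(3) obtain W where W: "open W" "?ch (V, \<psi>) p \<in> W"
      "\<forall>q\<in>twistor_space A g. q \<in> Sigma V (endos A) \<and> ?ch (V, \<psi>) q \<in> W \<longrightarrow> P q"
      unfolding V(2) by auto
    have "q0 \<in> V" using C(2) by (simp add: V(2) pq)
    from A1[OF V(1) this W(1,2)] obtain W' H where H: "open W'" "\<kappa>Z p \<in> W'" "smooth_on W' H" "\<forall>y\<in>W'. H y \<in> W"
      "\<forall>z\<in>UZ. \<kappa>Z z \<in> W' \<longrightarrow> fst z \<in> V \<and> ?ch (V, \<psi>) z = H (\<kappa>Z z)" by blast
    have "P z" if z: "z \<in> UZ" "\<kappa>Z z \<in> W'" for z
    proof -
      have "z \<in> Sigma V (endos A)" using H(5) z dec[OF z(1)] by (metis mem_Sigma_iff prod.collapse)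
      moreover have "?ch (V, \<psi>) z = H (\<kappa>Z z)" "H (\<kappa>Z z) \<in> W" using H(4,5) z by blast+
      moreover have "z \<in> twistor_space A g" using UZS z(1) by blast
      ultimately show ?thesis using W(3) by simp
    qed
    then show ?R using H(1,2) by blast
  next
    assume ?R
    then obtain W where W: "open W" "\<kappa>Z p \<in> W" "\<forall>q\<in>UZ. \<kappa>Z q \<in> W \<longrightarrow> P q" by blast
    from A2[OF W(1,2)] obtain W' H where H: "open W'" "?ch (U, \<phi>) p \<in> W'" "smooth_on W' H" "\<forall>y\<in>W'. H y \<in> W"
      "\<forall>z\<in>twistor_space A g. z \<in> Sigma U (endos A) \<and> ?ch (U, \<phi>) z \<in> W' \<longrightarrow> z \<in> UZ \<and> \<kappa>Z z = H (?ch (U, \<phi>) z)" by blast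
    then have "\<forall>z\<in>twistor_space A g. z \<in> Sigma U (endos A) \<and> ?ch (U, \<phi>) z \<in> W' \<longrightarrow> P z"
      using W(3) by metis
    then show ?L unfolding nearby_def using chU pU H(1,2)
      by (intro bexI[OF _ chU]) auto
  qed
qed

end

sublocale framed_chart \<subseteq> Z: chart_nbhd "endo_atlas A" "twistor_space A g" UZ \<kappa>Z
  by (rule Z_nbhd)

section \<open>Connection forms\<close>

text \<open>
  The commutator with a skew \<open>M\<close> acts on self-dual endomorphisms as the cross product with twice the self-dual part of \<open>M\<close>;
  the anti-self-dual part of \<open>M\<close> commutes with them.
\<close>

lemma skew_commutator:
  fixes M :: "real^4 \<Rightarrow> real^4"
  assumes frame_vec: "linear M" and skew: "\<And>u v. M u \<bullet> v = - (u \<bullet> M v)"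
  shows "M (Kop x u) - Kop x (M u) = Kop (cross3 (vector [M (axis 1 1) $ 2 + M (axis 3 1) $ 4,
     M (axis 1 1) $ 3 + M (axis 4 1) $ 2, M (axis 1 1) $ 4 + M (axis 2 1) $ 3]) x) u"
proof -
  define a where "a = M (axis 1 1) $ 2"
  define b where "b = M (axis 1 1) $ 3"
  define c where "c = M (axis 1 1) $ 4"
  define d where "d = M (axis 2 1) $ 3"
  define e where "e = M (axis 2 1) $ 4"
  define f where "f = M (axis 3 1) $ 4"
  have sk: "M (axis i 1) $ j = - (M (axis j 1) $ i)" for i j
    using skew[of "axis i 1" "axis j 1"] by (simp add: inner_axis inner_axis')
  have di: "M (axis i 1) $ i = 0" for i using sk[of i i] by simp
  have u4: "u = u$1 *\<^sub>R axis 1 1 + u$2 *\<^sub>R axis 2 1 + u$3 *\<^sub>R axis 3 1 + u$4 *\<^sub>R axis 4 1" for u :: "real^4"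
    by (simp add: vec4 axis_def)
  have Mu: "M u = u$1 *\<^sub>R M (axis 1 1) + u$2 *\<^sub>R M (axis 2 1) + u$3 *\<^sub>R M (axis 3 1) + u$4 *\<^sub>R M (axis 4 1)" for u
    by (subst u4[of u]) (simp add: linear_add[OF frame_vec] linear_scale[OF frame_vec])
  have M1: "M (axis 1 1) $ 1 = 0" "M (axis 1 1) $ 2 = a" "M (axis 1 1) $ 3 = b" "M (axis 1 1) $ 4 = c"
    and M2: "M (axis 2 1) $ 1 = -a" "M (axis 2 1) $ 2 = 0" "M (axis 2 1) $ 3 = d" "M (axis 2 1) $ 4 = e"
    and M3: "M (axis 3 1) $ 1 = -b" "M (axis 3 1) $ 2 = -d" "M (axis 3 1) $ 3 = 0" "M (axis 3 1) $ 4 = f"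
    and M4: "M (axis 4 1) $ 1 = -c" "M (axis 4 1) $ 2 = -e" "M (axis 4 1) $ 3 = -f" "M (axis 4 1) $ 4 = 0"
    by (simp_all add: di sk[of 2 1] sk[of 3 1] sk[of 3 2] sk[of 4 1] sk[of 4 2] sk[of 4 3]
        a_def b_def c_def d_def e_def f_def)
  have Mn: "M u $ 1 = - (u$2 * a) - u$3 * b - u$4 * c" "M u $ 2 = u$1 * a - u$3 * d - u$4 * e"
    "M u $ 3 = u$1 * b + u$2 * d - u$4 * f" "M u $ 4 = u$1 * c + u$2 * e + u$3 * f" for u
    using Mu[of u] by (simp_all add: M1 M2 M3 M4)
  show ?thesis
    by (simp add: vec_eq_iff[where 'b=4] forall_4 Mn axis_def cross_components algebra_simps)
qed

locale framed_connection = framed_chart +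
  fixes D :: "'a connection"
  assumes mc: "metric_connection A g D"
begin

lemma conn: "connection A D" using mc unfolding metric_connection_def by blast

lemma D_T: "q \<in> U \<Longrightarrow> v \<in> T q \<Longrightarrow> vf q Y \<Longrightarrow> D q v Y \<in> T q"
  using conn pts unfolding connection_def by blast
lemma D_linv: "q \<in> U \<Longrightarrow> u \<in> T q \<Longrightarrow> v \<in> T q \<Longrightarrow> vf q Y \<Longrightarrow> D q (a *\<^sub>F u + b *\<^sub>F v) Y = a *\<^sub>F D q u Y + b *\<^sub>F D q v Y"
  using conn pts unfolding connection_def linear_map_on_def by blast
lemma D_add: "q \<in> U \<Longrightarrow> v \<in> T q \<Longrightarrow> vf q Y \<Longrightarrow> vf q Z \<Longrightarrow> D q v (\<lambda>r. Y r + Z r) = D q v Y + D q v Z"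
  using conn pts unfolding connection_def by blast
lemma D_leib: "q \<in> U \<Longrightarrow> v \<in> T q \<Longrightarrow> sm q f \<Longrightarrow> vf q Y \<Longrightarrow> D q v (\<lambda>r. f r *\<^sub>F Y r) = v f *\<^sub>F Y q + f q *\<^sub>F D q v Y"
  using conn pts unfolding connection_def by blast
lemma D_vf: "q \<in> U \<Longrightarrow> vf q Y \<Longrightarrow> vf q Z \<Longrightarrow> vf q (\<lambda>r. D r (Y r) Z)"
  using conn pts unfolding connection_def by blast
lemma D_metric: "q \<in> U \<Longrightarrow> v \<in> T q \<Longrightarrow> vf q Y \<Longrightarrow> vf q Z \<Longrightarrow>
   v (\<lambda>r. g r (Y r) (Z r)) = g q (D q v Y) (Z q) + g q (Y q) (D q v Z)"
  using mc pts unfolding metric_connection_def by blast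

lemma D_cong: assumes q: "q \<in> U" and v: "v \<in> T q" and Y: "vf q Y" and n: "nb q (\<lambda>r. Y r = Y' r)"
  shows "D q v Y = D q v Y'"
proof -
  obtain V where V: "open V" "\<phi> q \<in> V" "\<forall>r\<in>U. \<phi> r \<in> V \<longrightarrow> Y r = Y' r"
    using n unfolding nb_iff[OF q] by blast
  define \<eta> :: "'a \<Rightarrow> real" where "\<eta> r = (if r \<in> U \<and> \<phi> r \<in> V then 1 else 0)" for r
  have n1: "nb q (\<lambda>r. 1 = \<eta> r)" unfolding nb_iff[OF q] using V by (intro exI[of _ V]) (auto simp: \<eta>_def)
  then have sc: "sm q \<eta>" using sm_cong[OF q _ sm_const[OF q]] by blast
  have c1: "\<eta> q = 1" using V q by (simp add: \<eta>_def)
  have v0: "v \<eta> = 0" using T_cong[OF q v n1] T_const[OF q v] by simp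
  have "(\<lambda>r. \<eta> r *\<^sub>F Y r) = (\<lambda>r. \<eta> r *\<^sub>F Y' r)" using V by (auto simp: \<eta>_def fscale_0)
  then show ?thesis using D_leib[OF q v sc Y] D_leib[OF q v sc vf_cong[OF q Y n]] c1 v0
    by (simp add: fscale_0 fscale_1)
qed

lemma D_zero: assumes q: "q \<in> U" and v: "v \<in> T q" shows "D q v (\<lambda>r. 0) = 0"
proof -
  have "D q v (\<lambda>r. 0 *\<^sub>F 0) = v (\<lambda>r. 0) *\<^sub>F 0 + 0 *\<^sub>F D q v (\<lambda>r. 0)"
    by (rule D_leib[OF q v sm_const[OF q] vf_zero[OF q]])
  then show ?thesis by (simp only: fscale_0 T_const[OF q v] add_0)
qed

lemma D_sum: assumes q: "q \<in> U" and v: "v \<in> T q" and Y: "\<And>i. i \<in> I \<Longrightarrow> vf q (Y i)" and I: "finite I"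
  shows "D q v (\<lambda>r. \<Sum>i\<in>I. Y i r) = (\<Sum>i\<in>I. D q v (Y i))"
  using I Y
proof (induction I)
  case empty then show ?case using D_zero[OF q v] by (simp only: sum.empty)
next
  case (insert i I)
  have "D q v (\<lambda>r. Y i r + (\<Sum>i\<in>I. Y i r)) = D q v (Y i) + D q v (\<lambda>r. \<Sum>i\<in>I. Y i r)"
    by (rule D_add[OF q v]) (use insert in \<open>auto intro!: vf_sum q\<close>)
  moreover have "D q v (\<lambda>r. \<Sum>i\<in>I. Y i r) = (\<Sum>i\<in>I. D q v (Y i))" using insert by blast
  ultimately show ?case by (simp only: sum.insert[OF insert(1,2)])
qed

text \<open>
  The connection form with respect to the frame: \<open>D = d + conn_form\<close> in components (\<open>coords_D\<close>), and \<open>conn_form q v\<close> is skew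
  because \<open>D\<close> is metric.
\<close>

definition conn_form :: "'a \<Rightarrow> 'a tvec \<Rightarrow> real^4 \<Rightarrow> real^4" where
  "conn_form q v u = (\<Sum>j\<in>UNIV. u $ j *\<^sub>R coords q (D q v (E j)))"

lemma coords_D_lin: assumes q: "q \<in> U" and v: "v \<in> T q" and f: "\<And>i. sm q (\<lambda>r. f r $ i)"
  shows "coords q (D q v (\<lambda>r. frame_vec r (f r))) = (\<chi> i. v (\<lambda>r. f r $ i)) + conn_form q v (f q)"
proof -
  have "D q v (\<lambda>r. frame_vec r (f r)) = (\<Sum>i\<in>UNIV. v (\<lambda>r. f r $ i) *\<^sub>F E i q + f q $ i *\<^sub>F D q v (E i))"
    unfolding frame_vec_def
    by (subst D_sum[OF q v]) (auto intro!: vf_scale q f E_vf sum.cong D_leib v)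
  then have "coords q (D q v (\<lambda>r. frame_vec r (f r))) = (\<Sum>i\<in>UNIV. v (\<lambda>r. f r $ i) *\<^sub>R axis i 1 + f q $ i *\<^sub>R coords q (D q v (E i)))"
    using q v by (simp add: coords_sum coords_add coords_scale T_intros E_T D_T E_vf coords_E)
  also have "\<dots> = (\<Sum>i\<in>UNIV. v (\<lambda>r. f r $ i) *\<^sub>R axis i 1) + conn_form q v (f q)"
    by (simp add: sum.distrib conn_form_def)
  also have "(\<Sum>i\<in>UNIV. v (\<lambda>r. f r $ i) *\<^sub>R axis i 1) = (\<chi> i. v (\<lambda>r. f r $ i))"
    by (simp add: vec_eq_iff axis_def if_distrib[of "\<lambda>x. _ * x"] cong: if_cong)
  finally show ?thesis .
qed

lemma coords_D: assumes q: "q \<in> U" and v: "v \<in> T q" and Y: "vf q Y"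
  shows "coords q (D q v Y) = (\<chi> i. v (\<lambda>r. coords r (Y r) $ i)) + conn_form q v (coords q (Y q))"
proof -
  have "nb q (\<lambda>r. Y r = frame_vec r (coords r (Y r)))"
    by (rule nb_mono[OF q vf_nbT[OF Y]]) (simp add: frame_vec_coords)
  then have "D q v Y = D q v (\<lambda>r. frame_vec r (coords r (Y r)))" by (rule D_cong[OF q v Y])
  then show ?thesis using coords_D_lin[OF q v coords_sm[OF q Y]] by simp
qed

lemma conn_form_linear: "linear (conn_form q v)"
  by (rule linearI) (simp_all add: conn_form_def scaleR_left_distrib sum.distrib scaleR_sum_right)

lemma conn_form_axis: "conn_form q v (axis j 1) = coords q (D q v (E j))"
  by (simp add: conn_form_def axis_def if_distrib[of "\<lambda>x. x *\<^sub>R _"] cong: if_cong)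

lemma conn_form_skew_axis: assumes q: "q \<in> U" and v: "v \<in> T q"
  shows "conn_form q v (axis i 1) $ j = - (conn_form q v (axis j 1) $ i)"
proof -
  have "v (\<lambda>r. g r (E i r) (E j r)) = v (\<lambda>r. if i = j then 1 else 0)"
    by (rule T_cong[OF q v nb_all[OF q]]) (rule E_on)
  then have "v (\<lambda>r. g r (E i r) (E j r)) = 0" using T_const[OF q v] by simp
  then have "g q (D q v (E i)) (E j q) + g q (E i q) (D q v (E j)) = 0"
    using D_metric[OF q v E_vf[OF q] E_vf[OF q], of i j] by simp
  then have "coords q (D q v (E i)) \<bullet> coords q (E j q) + coords q (E i q) \<bullet> coords q (D q v (E j)) = 0"
    by (simp add: g_coords q E_T D_T v E_vf)
  then show ?thesis by (simp add: conn_form_axis coords_E q inner_axis inner_axis')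
qed

lemma conn_form_skew: assumes q: "q \<in> U" and v: "v \<in> T q"
  shows "conn_form q v u \<bullet> w = - (u \<bullet> conn_form q v w)"
proof -
  have 1: "conn_form q v u $ j = (\<Sum>i\<in>UNIV. u $ i * conn_form q v (axis i 1) $ j)" for u j
    by (simp add: conn_form_def[of q v u] conn_form_axis)
  have "conn_form q v u \<bullet> w = (\<Sum>j\<in>UNIV. \<Sum>i\<in>UNIV. u $ i * conn_form q v (axis i 1) $ j * w $ j)"
    by (simp add: inner_vec_def 1[of u] sum_distrib_right)
  also have "\<dots> = (\<Sum>j\<in>UNIV. \<Sum>i\<in>UNIV. - (u $ i * (w $ j * conn_form q v (axis j 1) $ i)))"
  proof (intro sum.cong refl)
    fix i j show "u $ i * conn_form q v (axis i 1) $ j * w $ j = - (u $ i * (w $ j * conn_form q v (axis j 1) $ i))"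
      unfolding conn_form_skew_axis[OF q v, of i j] by simp
  qed
  also have "\<dots> = (\<Sum>i\<in>UNIV. \<Sum>j\<in>UNIV. - (u $ i * (w $ j * conn_form q v (axis j 1) $ i)))"
    by (rule sum.swap)
  also have "\<dots> = - (u \<bullet> conn_form q v w)"
    by (simp add: inner_vec_def 1[of w] sum_distrib_left sum_negf)
  finally show ?thesis .
qed

text \<open>
  Connection form of the bundle of self-dual endomorphisms, with values in \<open>\<real>\<^sup>3\<close> regarded as the Lie algebra of
  rotations: by \<open>conn_form_Kop\<close> the induced connection is \<open>d + sd_form \<times>\<close> on the coordinates \<open>x\<close> of \<open>Kop x\<close>.
\<close>

definition sd_form :: "'a \<Rightarrow> 'a tvec \<Rightarrow> real^3" where
  "sd_form q v = vector [conn_form q v (axis 1 1) $ 2 + conn_form q v (axis 3 1) $ 4,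
     conn_form q v (axis 1 1) $ 3 + conn_form q v (axis 4 1) $ 2, conn_form q v (axis 1 1) $ 4 + conn_form q v (axis 2 1) $ 3]"

lemma conn_form_Kop: "q \<in> U \<Longrightarrow> v \<in> T q \<Longrightarrow> conn_form q v (Kop x u) = Kop x (conn_form q v u) + Kop (cross3 (sd_form q v) x) u"
  using skew_commutator[OF conn_form_linear conn_form_skew, of q v x u] unfolding sd_form_def by (metis diff_eq_eq add.commute)

lemma conn_form_linv: assumes "q \<in> U" "u \<in> T q" "v \<in> T q"
  shows "conn_form q (a *\<^sub>F u + b *\<^sub>F v) w = a *\<^sub>R conn_form q u w + b *\<^sub>R conn_form q v w"
  using assms by (simp add: conn_form_def D_linv E_vf coords_add coords_scale T_intros D_T scaleR_sum_right sum.distrib[symmetric] scaleR_right_distrib mult.commute)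

lemma sd_form_linv: assumes "q \<in> U" "u \<in> T q" "v \<in> T q"
  shows "sd_form q (a *\<^sub>F u + b *\<^sub>F v) = a *\<^sub>R sd_form q u + b *\<^sub>R sd_form q v"
  using assms by (simp add: sd_form_def conn_form_linv vec_eq_iff[where 'b=3] forall_3 algebra_simps)

section \<open>Vertical vectors\<close>

lemma kappaZ_endo: "q \<in> U \<Longrightarrow> \<kappa>Z (q, sd_endo q x) = (\<phi> q, x)" by (simp add: \<kappa>Z_def sd_coords_sd_endo)

lemma fibre_endos: "J \<in> twistor_fibre A g q \<Longrightarrow> J \<in> endos A q" unfolding twistor_fibre_def by blast

lemma coords_coord: assumes q: "q \<in> U" and v: "v \<in> T q"
  shows "coords q v = (\<Sum>i\<in>UNIV. v (\<lambda>r. \<phi> r $ i) *\<^sub>R coords q (dd i q))"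
proof -
  have "coords q v = coords q (\<Sum>i\<in>UNIV. v (\<lambda>r. \<phi> r $ i) *\<^sub>F dd i q)" using T_expand[OF q v] by (rule arg_cong)
  then show ?thesis using q by (simp add: coords_sum T_intros dd_T coords_scale)
qed

lemma curve_sd_coords: assumes q: "q \<in> U" and fib: "\<And>t. \<gamma> t \<in> twistor_fibre A g q"
  and der: "\<And>u h. u \<in> T q \<Longrightarrow> sm q h \<Longrightarrow> ((\<lambda>t. \<gamma> t u h) has_real_derivative sd_endo q \<xi> u h) (at 0)"
shows "((\<lambda>t. sd_coords q (\<gamma> t)) has_vector_derivative \<xi>) (at 0)"
proof -
  have d: "((\<lambda>t. coords q (\<gamma> t (E 1 q)) $ k) has_real_derivative coords q (sd_endo q \<xi> (E 1 q)) $ k) (at 0)" for k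
  proof -
    have e: "coords q v $ k = (\<Sum>i\<in>UNIV. v (\<lambda>r. \<phi> r $ i) * coords q (dd i q) $ k)" if "v \<in> T q" for v
      unfolding coords_coord[OF q that] by simp
    have "((\<lambda>t. \<Sum>i\<in>UNIV. \<gamma> t (E 1 q) (\<lambda>r. \<phi> r $ i) * coords q (dd i q) $ k) has_real_derivative
        (\<Sum>i\<in>UNIV. sd_endo q \<xi> (E 1 q) (\<lambda>r. \<phi> r $ i) * coords q (dd i q) $ k)) (at 0)"
      by (intro DERIV_sum DERIV_cmult_right der E_T q sm_phi)
    then show ?thesis
      by (simp add: e sd_endo_T q E_T endos_T[OF fibre_endos[OF fib]])
  qed
  have d3: "((\<lambda>t. sd_coords q (\<gamma> t) $ a) has_real_derivative \<xi> $ a) (at 0)" for a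
    using exhaust_3[of a] d[of 2] d[of 3] d[of 4] by (auto simp: sd_coords_def coords_sd_endo q E_T coords_E Kop_axis simp del: Kop_nth)
  have "((\<lambda>t. \<Sum>a\<in>UNIV. sd_coords q (\<gamma> t) $ a *\<^sub>R axis a (1::real)) has_vector_derivative (\<Sum>a\<in>UNIV. \<xi> $ a *\<^sub>R axis a 1)) (at 0)"
    using has_vector_derivative_scaleR[OF d3 has_vector_derivative_const]
    by (intro has_vector_derivative_sum) simp
  moreover have "(\<Sum>a\<in>UNIV. y $ a *\<^sub>R axis a (1::real)) = y" for y :: "real^3"
    by (simp add: vec_eq_iff axis_def if_distrib[of "\<lambda>x. _ * x"] cong: if_cong)
  ultimately show ?thesis by simp
qed

text \<open>
  In coordinates any admissible curve in the fibre has velocity \<open>(0, \<xi>)\<close> (\<open>curve_sd_coords\<close>), so the derivative in the definition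
  of \<open>vertical_vector\<close> does not depend on the curve. A curve exists: project \<open>x + t \<xi>\<close> radially to the sphere.
\<close>

lemma vertical_dir: assumes q: "q \<in> U" and x: "x \<bullet> x = 1" and y: "\<xi> \<bullet> x = 0"
  shows "Z.is_dir (q, sd_endo q x) (0, \<xi>) (vertical_vector A g q (sd_endo q x) (sd_endo q \<xi>))"
  unfolding Z.is_dir_def
proof (intro conjI allI impI)
  fix f assume "\<not> Z.sm (q, sd_endo q x) f"
  then show "vertical_vector A g q (sd_endo q x) (sd_endo q \<xi>) f = 0" by (simp add: vertical_vector_def)
next
  fix f W and F :: "(real^4) \<times> (real^3) \<Rightarrow> real"
  assume W: "open W \<and> \<kappa>Z (q, sd_endo q x) \<in> W \<and> smooth_on W F \<and> (\<forall>z\<in>UZ. \<kappa>Z z \<in> W \<longrightarrow> f z = F (\<kappa>Z z))"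
  have zU: "(q, sd_endo q x) \<in> UZ" by (rule sd_endo_UZ[OF q x])
  have sm: "Z.sm (q, sd_endo q x) f" unfolding Z.sm_iff[OF zU] using W by blast
  have W1: "open W" "(\<phi> q, x) \<in> W" "smooth_on W F" using W kappaZ_endo[OF q] by auto
  let ?F = "frechet_derivative F (at (\<phi> q, x))"
  have core: "((\<lambda>t. f (q, \<gamma> t)) has_real_derivative ?F (0, \<xi>)) (at 0)"
    if fib: "\<forall>t. \<gamma> t \<in> twistor_fibre A g q" and g0: "\<gamma> 0 = sd_endo q x"
      and der: "\<forall>u\<in>T q. \<forall>h. sm q h \<longrightarrow> ((\<lambda>t. \<gamma> t u h) has_real_derivative sd_endo q \<xi> u h) (at 0)" for \<gamma>
  proof -
    let ?c = "\<lambda>t. sd_coords q (\<gamma> t)"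
    have c: "(?c has_vector_derivative \<xi>) (at 0)" by (rule curve_sd_coords[OF q]) (use fib der in auto)
    have c0: "?c 0 = x" using g0 sd_coords_sd_endo[OF q] by simp
    have d: "((\<lambda>t. (\<phi> q, ?c t)) has_derivative (\<lambda>s. (0, s *\<^sub>R \<xi>))) (at 0)"
      using c unfolding has_vector_derivative_def by (intro has_derivative_Pair has_derivative_const)
    have dF: "(F has_derivative ?F) (at (\<phi> q, ?c 0))" using smooth_on_der[OF W1(3,2)] c0 by simp
    have "((\<lambda>t. F (\<phi> q, ?c t)) has_derivative (\<lambda>s. ?F (0, s *\<^sub>R \<xi>))) (at 0)"
      by (rule has_derivative_compose[OF d dF])
    moreover have "?F (0, s *\<^sub>R \<xi>) = s * ?F (0, \<xi>)" for s
      using linear_scale[OF Z.linear_frechet[OF W1(3,2)], of s "(0, \<xi>)"] by simp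
    ultimately have dd: "((\<lambda>t. F (\<phi> q, ?c t)) has_derivative (\<lambda>s. ?F (0, \<xi>) * s)) (at 0)"
      by (simp add: mult.commute)
    have "isCont (\<lambda>t. (\<phi> q, ?c t)) 0" using has_derivative_continuous[OF d] by simp
    then have "\<forall>\<^sub>F t in at 0. (\<phi> q, ?c t) \<in> W"
      unfolding isCont_def using topological_tendstoD W1 c0 by metis
    then have "\<forall>\<^sub>F t in at 0. F (\<phi> q, ?c t) = f (q, \<gamma> t)"
    proof (rule eventually_mono)
      fix t assume t: "(\<phi> q, ?c t) \<in> W"
      have "(q, \<gamma> t) \<in> UZ" using fib q by (simp add: UZ_def)
      then show "F (\<phi> q, ?c t) = f (q, \<gamma> t)" using W t by (simp add: \<kappa>Z_def)
    qed
    then have "((\<lambda>t. f (q, \<gamma> t)) has_derivative (\<lambda>s. ?F (0, \<xi>) * s)) (at 0)"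
      by (rule has_derivative_transform_eventually[OF dd]) (use W zU g0 c0 kappaZ_endo[OF q] in auto)
    then show ?thesis by (simp add: has_field_derivative_def)
  qed
  \<comment> \<open>the radial projection of \<open>x + t *\<^sub>R \<xi>\<close> has the factor \<open>rr t\<close>, with derivative 0 at 0\<close>
  define k where "k = \<xi> \<bullet> \<xi>"
  define rr where "rr t = 1 / sqrt (1 + t * t * k)" for t
  define \<gamma> where "\<gamma> t = sd_endo q (rr t *\<^sub>R (x + t *\<^sub>R \<xi>))" for t
  have kp: "1 + t * t * k > 0" for t
    using mult_nonneg_nonneg[OF zero_le_square[of t], of k] by (simp add: k_def add_pos_nonneg)
  have n1: "(rr t *\<^sub>R (x + t *\<^sub>R \<xi>)) \<bullet> (rr t *\<^sub>R (x + t *\<^sub>R \<xi>)) = 1" for t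
  proof -
    have "(x + t *\<^sub>R \<xi>) \<bullet> (x + t *\<^sub>R \<xi>) = 1 + t * t * k"
      using x y inner_commute[of x \<xi>] by (simp add: inner_add_left inner_add_right k_def)
    moreover have "rr t * rr t = 1 / (1 + t * t * k)" using kp[of t] by (simp add: rr_def)
    moreover have "(rr t *\<^sub>R (x + t *\<^sub>R \<xi>)) \<bullet> (rr t *\<^sub>R (x + t *\<^sub>R \<xi>)) = (rr t * rr t) * ((x + t *\<^sub>R \<xi>) \<bullet> (x + t *\<^sub>R \<xi>))"
      by (simp add: mult.assoc)
    ultimately show ?thesis using kp[of t] by simp
  qed
  have fib: "\<forall>t. \<gamma> t \<in> twistor_fibre A g q" unfolding \<gamma>_def using sd_endo_fibre[OF q n1] by blast
  have g0: "\<gamma> 0 = sd_endo q x" by (simp add: \<gamma>_def rr_def)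
  have drr: "(rr has_real_derivative 0) (at 0)"
    unfolding rr_def by (auto intro!: derivative_eq_intros)
  have der: "\<forall>u\<in>T q. \<forall>h. sm q h \<longrightarrow> ((\<lambda>t. \<gamma> t u h) has_real_derivative sd_endo q \<xi> u h) (at 0)"
  proof (intro ballI allI impI)
    fix u h assume u: "u \<in> T q" and h: "sm q h"
    have e: "\<gamma> t u h = rr t * (frame_vec q (Kop x (coords q u)) h + t * frame_vec q (Kop \<xi> (coords q u)) h)" for t
      by (simp add: \<gamma>_def sd_endo_apply[OF u] Kop_lin frame_vec_add frame_vec_scale)
    have r0: "rr 0 = 1" by (simp add: rr_def)
    show "((\<lambda>t. \<gamma> t u h) has_real_derivative sd_endo q \<xi> u h) (at 0)"
      unfolding e sd_endo_apply[OF u] by (auto intro!: derivative_eq_intros drr simp: r0)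
  qed
  have "vertical_vector A g q (sd_endo q x) (sd_endo q \<xi>) f = (THE d. \<exists>\<gamma>. (\<forall>t. \<gamma> t \<in> twistor_fibre A g q) \<and> \<gamma> 0 = sd_endo q x \<and>
        (\<forall>u\<in>T q. \<forall>h. sm q h \<longrightarrow> ((\<lambda>t. \<gamma> t u h) has_real_derivative sd_endo q \<xi> u h) (at 0)) \<and>
        ((\<lambda>t. f (q, \<gamma> t)) has_real_derivative d) (at 0))"
    using sm by (simp add: vertical_vector_def)
  also have "\<dots> = ?F (0, \<xi>)"
    by (rule the_equality) (use fib g0 der core DERIV_unique in blast)+
  finally show "vertical_vector A g q (sd_endo q x) (sd_endo q \<xi>) f = frechet_derivative F (at (\<kappa>Z (q, sd_endo q x))) (0, \<xi>)"
    by (simp add: kappaZ_endo q)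
qed

end

section \<open>Horizontal lifts and vector fields on the twistor space\<close>

lemma linear_expand: fixes f :: "real^'n \<Rightarrow> 'b::real_vector"
  assumes "linear f" shows "f h = (\<Sum>k\<in>UNIV. h $ k *\<^sub>R f (axis k 1))"
proof -
  have "(\<Sum>k\<in>UNIV. h $ k *\<^sub>R axis k (1::real)) = h"
    by (simp add: vec_eq_iff axis_def if_distrib[of "\<lambda>x. _ * x"] cong: if_cong)
  then have "f h = f (\<Sum>k\<in>UNIV. h $ k *\<^sub>R axis k (1::real))" by simp
  then show ?thesis by (simp add: linear_sum[OF assms] linear_scale[OF assms])
qed

context chart_nbhd
begin

lemma vel_add: "vel (v + w) = vel v + vel w"
  by (simp add: vel_def scaleR_left_distrib sum.distrib)
lemma vel_scale: "vel (c *\<^sub>F v) = c *\<^sub>R vel v"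
  by (simp add: vel_def scaleR_sum_right)

lemma is_dir_add: assumes "p \<in> U" "is_dir p Y v" "is_dir p Y' w" shows "is_dir p (Y + Y') (v + w)"
  using T_is_dir[OF assms(1) T_vadd[OF is_dir_T[OF assms(1,2)] is_dir_T[OF assms(1,3)]]]
    is_dir_vel[OF assms(2)] is_dir_vel[OF assms(3)] by (simp add: vel_add)
lemma is_dir_scale: assumes "p \<in> U" "is_dir p Y v" shows "is_dir p (c *\<^sub>R Y) (c *\<^sub>F v)"
  using T_is_dir[OF assms(1) T_vscale[OF is_dir_T[OF assms(1,2)]], of c] is_dir_vel[OF assms(2)] by (simp add: vel_scale)
lemma is_dir_diff: assumes "p \<in> U" "is_dir p Y v" "is_dir p Y' w" shows "is_dir p (Y - Y') (v - w)"
proof -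
  have e: "v - w = v + (-1) *\<^sub>F w" by (simp add: fun_eq_iff)
  show ?thesis unfolding e using is_dir_add[OF assms(1,2) is_dir_scale[OF assms(1,3)], of "-1"] by simp
qed

text \<open>
  Derivative of a map with values in some \<open>\<real>\<^sup>n\<close> along a tangent vector, by components; \<open>smc\<close> is smoothness by components.
\<close>

definition dv :: "'a tvec \<Rightarrow> ('a \<Rightarrow> real^'n) \<Rightarrow> real^'n" where "dv v h = (\<chi> i. v (\<lambda>q. h q $ i))"

lemma dv_nth [simp]: "dv v h $ i = v (\<lambda>q. h q $ i)" by (simp add: dv_def)

definition smc :: "'a \<Rightarrow> ('a \<Rightarrow> real^'n) \<Rightarrow> bool" where "smc p h \<longleftrightarrow> (\<forall>i. sm p (\<lambda>q. h q $ i))"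

lemma smcD: "smc p h \<Longrightarrow> sm p (\<lambda>q. h q $ i)" by (simp add: smc_def)

lemma smc_smv: "p \<in> U \<Longrightarrow> smc p h \<Longrightarrow> smv p h" by (intro smv_vecI) (simp add: smc_def sm_smv)

lemma smc_const: "p \<in> U \<Longrightarrow> smc p (\<lambda>q. c)" by (simp add: smc_def)
lemma smc_add: "p \<in> U \<Longrightarrow> smc p h \<Longrightarrow> smc p k \<Longrightarrow> smc p (\<lambda>q. h q + k q)" by (simp add: smc_def sm_add)
lemma smc_diff: "p \<in> U \<Longrightarrow> smc p h \<Longrightarrow> smc p k \<Longrightarrow> smc p (\<lambda>q. h q - k q)" by (simp add: smc_def sm_diff)
lemma smc_scale: "p \<in> U \<Longrightarrow> sm p f \<Longrightarrow> smc p k \<Longrightarrow> smc p (\<lambda>q. f q *\<^sub>R k q)" by (simp add: smc_def sm_mult)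
lemma smc_sum: "p \<in> U \<Longrightarrow> (\<And>i. i \<in> I \<Longrightarrow> smc p (h i)) \<Longrightarrow> smc p (\<lambda>q. \<Sum>i\<in>I. h i q)" by (simp add: smc_def sm_sum)
lemma smc_Kop: "p \<in> U \<Longrightarrow> smc p x \<Longrightarrow> smc p u \<Longrightarrow> smc p (\<lambda>q. Kop (x q) (u q))"
  unfolding smc_def forall_4 Kop_nth by (intro conjI sm_intros) blast+
lemma smc_cross: "p \<in> U \<Longrightarrow> smc p x \<Longrightarrow> smc p u \<Longrightarrow> smc p (\<lambda>q. cross3 (x q) (u q))"
  unfolding smc_def forall_3 cross_components by (intro conjI sm_intros) blast+

lemma dv_const: "p \<in> U \<Longrightarrow> v \<in> T p \<Longrightarrow> dv v (\<lambda>q. c) = 0" by (simp add: vec_eq_iff T_const)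
lemma dv_add: "p \<in> U \<Longrightarrow> v \<in> T p \<Longrightarrow> smc p h \<Longrightarrow> smc p k \<Longrightarrow> dv v (\<lambda>q. h q + k q) = dv v h + dv v k"
  by (simp add: vec_eq_iff T_add[of p v] smcD)
lemma dv_diff: "p \<in> U \<Longrightarrow> v \<in> T p \<Longrightarrow> smc p h \<Longrightarrow> smc p k \<Longrightarrow> dv v (\<lambda>q. h q - k q) = dv v h - dv v k"
  by (simp add: vec_eq_iff T_diff[of p v] smcD)
lemma dv_scale: "p \<in> U \<Longrightarrow> v \<in> T p \<Longrightarrow> sm p f \<Longrightarrow> smc p k \<Longrightarrow> dv v (\<lambda>q. f q *\<^sub>R k q) = v f *\<^sub>R k p + f p *\<^sub>R dv v k"
  by (simp add: vec_eq_iff T_prod[of v p f] smcD algebra_simps)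
lemma dv_sum: "p \<in> U \<Longrightarrow> v \<in> T p \<Longrightarrow> (\<And>i. i \<in> I \<Longrightarrow> smc p (h i)) \<Longrightarrow> dv v (\<lambda>q. \<Sum>i\<in>I. h i q) = (\<Sum>i\<in>I. dv v (h i))"
  by (simp add: vec_eq_iff T_sum[of p v] smcD)
lemma dv_cong: assumes p: "p \<in> U" and v: "v \<in> T p" and n: "nb p (\<lambda>q. h q = k q)" shows "dv v h = dv v k"
  unfolding vec_eq_iff dv_nth
proof
  fix i show "v (\<lambda>q. h q $ i) = v (\<lambda>q. k q $ i)" by (rule T_cong[OF p v nb_mono[OF p n]]) simp
qed
lemma smc_cong: assumes p: "p \<in> U" and n: "nb p (\<lambda>q. h q = k q)" and h: "smc p h" shows "smc p k"
  unfolding smc_def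
proof
  fix i show "sm p (\<lambda>q. k q $ i)" by (rule sm_cong[OF p nb_mono[OF p n] smcD[OF h]]) simp
qed
lemma dv_Kop: assumes p: "p \<in> U" and v: "v \<in> T p" and x: "smc p x" and u: "smc p u"
  shows "dv v (\<lambda>q. Kop (x q) (u q)) = Kop (dv v x) (u p) + Kop (x p) (dv v u)"
proof -
  note s = smcD[OF x] smcD[OF u]
  have P: "v (\<lambda>q. x q $ a * u q $ i) = x p $ a * v (\<lambda>q. u q $ i) + u p $ i * v (\<lambda>q. x q $ a)" for a i
    by (rule T_prod[OF v s])
  have m: "sm p (\<lambda>q. x q $ a * u q $ i)" for a i by (intro sm_mult p s)
  show ?thesis
    by (simp add: vec_eq_iff[where 'b=4] forall_4 T_add[OF p v] T_diff[OF p v] T_minus[OF p v] sm_add[OF p] sm_diff[OF p] sm_minus[OF p] m P)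
qed
lemma dv_cross: assumes p: "p \<in> U" and v: "v \<in> T p" and x: "smc p x" and u: "smc p u"
  shows "dv v (\<lambda>q. cross3 (x q) (u q)) = cross3 (dv v x) (u p) + cross3 (x p) (dv v u)"
proof -
  note s = smcD[OF x] smcD[OF u]
  have P: "v (\<lambda>q. x q $ a * u q $ i) = x p $ a * v (\<lambda>q. u q $ i) + u p $ i * v (\<lambda>q. x q $ a)" for a i
    by (rule T_prod[OF v s])
  have P': "v (\<lambda>q. u q $ i * x q $ a) = x p $ a * v (\<lambda>q. u q $ i) + u p $ i * v (\<lambda>q. x q $ a)" for a i
    using P by (simp add: mult.commute)
  have m: "sm p (\<lambda>q. x q $ a * u q $ i)" "sm p (\<lambda>q. u q $ i * x q $ a)" for a i by (intro sm_mult p s)+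
  show ?thesis
    by (simp add: vec_eq_iff[where 'b=3] forall_3 cross_components T_diff[OF p v] m P P')
qed
lemma T_inner: assumes p: "p \<in> U" and v: "v \<in> T p" and x: "smc p x" and u: "smc p u"
  shows "v (\<lambda>q. x q \<bullet> u q) = dv v x \<bullet> u p + x p \<bullet> dv v u"
proof -
  have "v (\<lambda>q. x q \<bullet> u q) = (\<Sum>i\<in>UNIV. v (\<lambda>q. x q $ i * u q $ i))"
    unfolding inner_vec_def inner_real_def by (rule T_sum[OF p v]) (intro sm_mult p smcD x u)
  also have "\<dots> = (\<Sum>i\<in>UNIV. x p $ i * v (\<lambda>q. u q $ i) + u p $ i * v (\<lambda>q. x q $ i))"
    by (simp add: T_prod[OF v smcD[OF x] smcD[OF u]])
  finally show ?thesis by (simp add: inner_vec_def sum.distrib mult.commute)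
qed

end

context framed_connection
begin

abbreviation xz :: "'a \<times> ('a tvec \<Rightarrow> 'a tvec) \<Rightarrow> real^3" where "xz z \<equiv> sd_coords (fst z) (snd z)"

lemma vel_nth: "vel u $ i = u (\<lambda>r. \<phi> r $ i)"
  using vel_inner[of "axis i 1" u] by (simp add: inner_axis)

lemma UZ_D: "z \<in> UZ \<Longrightarrow> fst z \<in> U \<and> xz z \<bullet> xz z = 1 \<and> snd z = sd_endo (fst z) (xz z)"
  using fibre_sd_coords unfolding UZ_def by auto

lemma Z_smc_xz: "z \<in> UZ \<Longrightarrow> Z.smc z xz"
  unfolding Z.smc_def
proof
  fix i assume z: "z \<in> UZ"
  show "Z.sm z (\<lambda>q. xz q $ i)" using Z.sm_kappa[OF z, of "(0, axis i 1)"] by (simp add: \<kappa>Z_def inner_axis)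
qed

lemma Z_pull: assumes z: "z \<in> UZ" and f: "sm (fst z) f" shows "Z.sm z (\<lambda>z. f (fst z))"
proof -
  have q: "fst z \<in> U" using UZ_D[OF z] by blast
  obtain V F where V: "open V" "\<phi> (fst z) \<in> V" "smooth_on V F" "\<forall>r\<in>U. \<phi> r \<in> V \<longrightarrow> f r = F (\<phi> r)"
    using f unfolding sm_iff[OF q] by blast
  have o: "open (V \<times> (UNIV :: (real^3) set))" using V(1) by (simp add: open_Times)
  have "smooth_on (V \<times> (UNIV :: (real^3) set)) (\<lambda>z. F (fst z))"
    by (rule smooth_on_compose[OF smooth_on_bounded_linear[OF bounded_linear_fst o] V(3) o V(1)]) auto
  then show ?thesis unfolding Z.sm_iff[OF z] using o V UZ_D
    by (intro exI[of _ "V \<times> UNIV"] exI[of _ "\<lambda>z. F (fst z)"]) (auto simp: \<kappa>Z_def)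
qed

lemma Z_dir_pull: assumes z: "z \<in> UZ" and d: "Z.is_dir z (vel u, \<xi>) \<zeta>" and u: "u \<in> T (fst z)" and f: "sm (fst z) f"
  shows "\<zeta> (\<lambda>z. f (fst z)) = u f"
proof -
  have q: "fst z \<in> U" using UZ_D[OF z] by blast
  obtain V F where V: "open V" "\<phi> (fst z) \<in> V" "smooth_on V F" "\<forall>r\<in>U. \<phi> r \<in> V \<longrightarrow> f r = F (\<phi> r)"
    using f unfolding sm_iff[OF q] by blast
  have o: "open (V \<times> (UNIV :: (real^3) set))" using V(1) by (simp add: open_Times)
  have s: "smooth_on (V \<times> (UNIV :: (real^3) set)) (\<lambda>z. F (fst z))"
    by (rule smooth_on_compose[OF smooth_on_bounded_linear[OF bounded_linear_fst o] V(3) o V(1)]) auto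
  have "\<zeta> (\<lambda>z. f (fst z)) = frechet_derivative (\<lambda>z. F (fst z)) (at (\<kappa>Z z)) (vel u, \<xi>)"
    by (rule Z.is_dirD[OF d o _ s]) (use V UZ_D in \<open>auto simp: \<kappa>Z_def\<close>)
  also have "frechet_derivative (\<lambda>z. F (fst z)) (at (\<kappa>Z z)) = (\<lambda>w. frechet_derivative F (at (fst (\<kappa>Z z))) (fst w))"
    by (rule frechet_derivative_at[symmetric], rule has_derivative_compose[OF has_derivative_fst[OF has_derivative_ident] smooth_on_der[OF V(3)]])
      (use V in \<open>simp add: \<kappa>Z_def\<close>)
  finally have "\<zeta> (\<lambda>z. f (fst z)) = frechet_derivative F (at (\<phi> (fst z))) (vel u)" by (simp add: \<kappa>Z_def)
  also have "\<dots> = u f" by (rule is_dirD[OF T_is_dir[OF q u] V, symmetric])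
  finally show ?thesis .
qed

lemma Z_dir_xz: assumes z: "z \<in> UZ" and d: "Z.is_dir z (y, \<xi>) \<zeta>" shows "Z.dv \<zeta> xz = \<xi>"
proof -
  have "(0, axis i 1) \<in> (Basis :: ((real^4) \<times> (real^3)) set)" for i by (simp add: Basis_prod_def)
  then have "\<zeta> (\<lambda>z. xz z $ i) = \<xi> $ i" for i
    using Z.vel_inner[of "(0, axis i 1)" \<zeta>] Z.is_dir_vel[OF d] by (simp add: \<kappa>Z_def inner_axis)
  then show ?thesis by (simp add: vec_eq_iff)
qed

lemma section_sigma:
  assumes q: "q \<in> U" and ls: "local_section A g q s" and s0: "s q = sd_endo q x"
  defines "\<sigma> \<equiv> \<lambda>r. sd_coords r (s r)"
  shows "nb q (\<lambda>r. s r = sd_endo r (\<sigma> r) \<and> \<sigma> r \<bullet> \<sigma> r = 1)" "smc q \<sigma>" "\<sigma> q = x" "x \<bullet> x = 1"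
proof -
  have n: "nb q (\<lambda>r. s r \<in> twistor_fibre A g r)" using ls unfolding local_section_def by blast
  show "nb q (\<lambda>r. s r = sd_endo r (\<sigma> r) \<and> \<sigma> r \<bullet> \<sigma> r = 1)"
    by (rule nb_mono[OF q n]) (use fibre_sd_coords in \<open>auto simp: \<sigma>_def\<close>)
  from nb_at[OF q this] show "\<sigma> q = x" "x \<bullet> x = 1" using s0 sd_coords_sd_endo[OF q] by (auto simp: \<sigma>_def)
  have z: "(q, s q) \<in> UZ" using nb_at[OF q n] q by (simp add: UZ_def)
  show "smc q \<sigma>" unfolding smc_def
  proof
    fix i
    have "Z.sm (q, s q) (\<lambda>z. xz z $ i)" using Z.smcD[OF Z_smc_xz[OF z]] .
    then have "sm q (\<lambda>r. xz (r, s r) $ i)" using ls unfolding local_section_def by blast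
    then show "sm q (\<lambda>r. \<sigma> r $ i)" by (simp add: \<sigma>_def)
  qed
qed

lemma pushforward_dir:
  assumes q: "q \<in> U" and ls: "local_section A g q s" and s0: "s q = sd_endo q x" and v: "v \<in> T q"
  shows "Z.is_dir (q, sd_endo q x) (vel v, dv v (\<lambda>r. sd_coords r (s r))) (section_pushforward A g q s v)"
  unfolding Z.is_dir_def
proof (intro conjI allI impI)
  fix f assume "\<not> Z.sm (q, sd_endo q x) f"
  then show "section_pushforward A g q s v f = 0" by (simp add: section_pushforward_def s0)
next
  let ?\<sigma> = "\<lambda>r. sd_coords r (s r)"
  note S = section_sigma[OF q ls s0]
  fix f W and F :: "(real^4) \<times> (real^3) \<Rightarrow> real"
  assume W: "open W \<and> \<kappa>Z (q, sd_endo q x) \<in> W \<and> smooth_on W F \<and> (\<forall>z\<in>UZ. \<kappa>Z z \<in> W \<longrightarrow> f z = F (\<kappa>Z z))"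
  have zU: "(q, sd_endo q x) \<in> UZ" by (rule sd_endo_UZ[OF q S(4)])
  have sm: "Z.sm (q, sd_endo q x) f" unfolding Z.sm_iff[OF zU] using W by blast
  have W1: "open W" "(\<phi> q, x) \<in> W" "smooth_on W F" using W kappaZ_endo[OF q] by auto
  have sv: "smv q (\<lambda>r. (\<phi> r, ?\<sigma> r))" by (intro smv_Pair smv_kappa smc_smv q S(2))
  have W2: "(\<phi> q, ?\<sigma> q) \<in> W" using W1 S(3) by simp
  have "nb q (\<lambda>r. (\<phi> r, ?\<sigma> r) \<in> W)" by (rule smv_open[OF q sv W1(1) W2])
  then have n: "nb q (\<lambda>r. f (r, s r) = F (\<phi> r, ?\<sigma> r))"
  proof (rule nb_mono2[OF q _ S(1)])
    fix r assume r: "r \<in> U" "(\<phi> r, ?\<sigma> r) \<in> W" "s r = sd_endo r (?\<sigma> r) \<and> ?\<sigma> r \<bullet> ?\<sigma> r = 1"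
    then have "(r, s r) \<in> UZ" using sd_endo_UZ by metis
    then show "f (r, s r) = F (\<phi> r, ?\<sigma> r)" using W r(2) by (simp add: \<kappa>Z_def)
  qed
  have "(\<Sum>b\<in>Basis. v (\<lambda>r. (\<phi> r, ?\<sigma> r) \<bullet> b) *\<^sub>R b) = (vel v, dv v ?\<sigma>)"
  proof (rule euclidean_eqI)
    fix b :: "(real^4) \<times> (real^3)" assume b: "b \<in> Basis"
    then have "(\<Sum>b\<in>Basis. v (\<lambda>r. (\<phi> r, ?\<sigma> r) \<bullet> b) *\<^sub>R b) \<bullet> b = v (\<lambda>r. (\<phi> r, ?\<sigma> r) \<bullet> b)" by simp
    also have "\<dots> = (vel v, dv v ?\<sigma>) \<bullet> b"
    proof -
      consider i where "b = (axis i 1, 0)" | a where "b = (0, axis a 1)"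
        using b unfolding Basis_prod_def Basis_vec_def by auto
      then show ?thesis by cases (simp_all add: inner_axis vel_nth)
    qed
    finally show "(\<Sum>b\<in>Basis. v (\<lambda>r. (\<phi> r, ?\<sigma> r) \<bullet> b) *\<^sub>R b) \<bullet> b = (vel v, dv v ?\<sigma>) \<bullet> b" .
  qed
  then show "section_pushforward A g q s v f = frechet_derivative F (at (\<kappa>Z (q, sd_endo q x))) (vel v, dv v ?\<sigma>)"
    using sm T_cong[OF q v n] T_chain[OF q v sv W1(1) W2 W1(3)] S(3) by (simp add: section_pushforward_def s0 kappaZ_endo q)
qed

text \<open>
  In the frame a section is \<open>Kop \<sigma>\<close>, and the Leibniz rule together with \<open>conn_form_Kop\<close> gives the derivative
  \<open>d\<sigma> + sd_form \<times> \<sigma>\<close>, whatever field \<open>Y\<close> is used to compute it.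
\<close>

lemma section_derivative_eq:
  assumes q: "q \<in> U" and ls: "local_section A g q s" and s0: "s q = sd_endo q x" and v: "v \<in> T q"
  shows "section_derivative A D q v s = sd_endo q (dv v (\<lambda>r. sd_coords r (s r)) + cross3 (sd_form q v) x)"
proof -
  let ?\<sigma> = "\<lambda>r. sd_coords r (s r)"
  note S = section_sigma[OF q ls s0]
  have key: "D q v (\<lambda>r. s r (Y r)) - s q (D q v Y) = sd_endo q (dv v ?\<sigma> + cross3 (sd_form q v) x) (Y q)" if Y: "vf q Y" for Y
  proof -
    have YT: "Y q \<in> T q" by (rule vf_T[OF q Y])
    have sY: "smc q (\<lambda>r. coords r (Y r))" by (simp add: smc_def coords_sm q Y)
    let ?f = "\<lambda>r. Kop (?\<sigma> r) (coords r (Y r))"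
    have sf: "smc q ?f" by (intro smc_Kop q S(2) sY)
    have lv: "vf q (\<lambda>r. frame_vec r (?f r))" by (intro frame_vec_vf q smcD sf)
    have "nb q (\<lambda>r. frame_vec r (?f r) = s r (Y r))"
    proof (rule nb_mono2[OF q S(1) vf_nbT[OF Y]])
      fix r assume "r \<in> U" "s r = sd_endo r (?\<sigma> r) \<and> ?\<sigma> r \<bullet> ?\<sigma> r = 1" "Y r \<in> T r"
      then show "frame_vec r (?f r) = s r (Y r)" using sd_endo_apply by metis
    qed
    then have "D q v (\<lambda>r. s r (Y r)) = D q v (\<lambda>r. frame_vec r (?f r))" by (rule D_cong[OF q v lv, symmetric])
    then have c1: "coords q (D q v (\<lambda>r. s r (Y r))) = dv v ?f + conn_form q v (?f q)"
      using coords_D_lin[OF q v smcD[OF sf]] by (simp add: dv_def)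
    have t1: "D q v (\<lambda>r. s r (Y r)) \<in> T q"
      using \<open>D q v (\<lambda>r. s r (Y r)) = _\<close> D_T[OF q v lv] by simp
    have t2: "D q v Y \<in> T q" by (rule D_T[OF q v Y])
    have c2: "coords q (s q (D q v Y)) = Kop x (dv v (\<lambda>r. coords r (Y r)) + conn_form q v (coords q (Y q)))"
      by (simp add: s0 coords_sd_endo q t2 coords_D v Y dv_def)
    have t3: "s q (D q v Y) \<in> T q" by (simp add: s0 sd_endo_T q t2)
    show ?thesis
    proof (rule coords_inj[OF q T_vdiff[OF t1 t3] sd_endo_T[OF q YT]])
      show "coords q (D q v (\<lambda>r. s r (Y r)) - s q (D q v Y)) = coords q (sd_endo q (dv v ?\<sigma> + cross3 (sd_form q v) x) (Y q))"
        by (simp add: coords_diff q t1 t3 c1 c2 dv_Kop[OF q v S(2) sY] S(3) conn_form_Kop v coords_sd_endo YT Kop_lin)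
    qed
  qed
  show ?thesis
  proof
    fix u
    show "section_derivative A D q v s u = sd_endo q (dv v ?\<sigma> + cross3 (sd_form q v) x) u"
    proof (cases "u \<in> T q")
      case True
      have "section_derivative A D q v s u = (THE w. \<exists>Y. vf q Y \<and> Y q = u \<and> w = D q v (\<lambda>r. s r (Y r)) - s q (D q v Y))"
        using True by (simp add: section_derivative_def)
      also have "\<dots> = sd_endo q (dv v ?\<sigma> + cross3 (sd_form q v) x) u"
        by (rule the_equality) (use vf_ext[OF q True] key in metis)+
      finally show ?thesis .
    qed (simp add: section_derivative_def sd_endo_def)
  qed
qed

lemma const_section: assumes q: "q \<in> U" and x: "x \<bullet> x = 1" shows "local_section A g q (\<lambda>r. sd_endo r x)"
  unfolding local_section_def
proof (intro conjI allI impI)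
  show "nb q (\<lambda>r. sd_endo r x \<in> twistor_fibre A g r)" by (rule nb_all[OF q sd_endo_fibre[OF _ x]])
  fix f assume "Z.sm (q, sd_endo q x) f"
  then obtain W F where W: "open W" "\<kappa>Z (q, sd_endo q x) \<in> W" "smooth_on W F" "\<forall>z\<in>UZ. \<kappa>Z z \<in> W \<longrightarrow> f z = F (\<kappa>Z z)"
    unfolding Z.sm_iff[OF sd_endo_UZ[OF q x]] by blast
  have W2: "(\<phi> q, x) \<in> W" using W kappaZ_endo[OF q] by simp
  have sv: "smv q (\<lambda>r. (\<phi> r, x))" by (intro smv_Pair smv_kappa smv_const)
  have "nb q (\<lambda>r. (\<phi> r, x) \<in> W)" by (rule smv_open[OF q sv W(1) W2])
  then have n: "nb q (\<lambda>r. F (\<phi> r, x) = f (r, sd_endo r x))"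
    by (rule nb_mono[OF q]) (use W(4) sd_endo_UZ[OF _ x] kappaZ_endo in auto)
  have "sm q (\<lambda>r. F (\<phi> r, x))" unfolding sm_smv[OF q] by (rule smv_compose[OF sv W(1) W2 W(3) q])
  then show "sm q (\<lambda>r. f (r, sd_endo r x))" by (rule sm_cong[OF q n])
qed

text \<open>
  The derivative of the section cancels between the push-forward and the covariant derivative, so the horizontal lift does not
  depend on the section; the section with constant coordinates shows that it exists.
\<close>

lemma horizontal_dir: assumes q: "q \<in> U" and x: "x \<bullet> x = 1" and v: "v \<in> T q"
  shows "Z.is_dir (q, sd_endo q x) (vel v, - cross3 (sd_form q v) x) (horizontal_lift A g D q (sd_endo q x) v)"
proof -
  have z: "(q, sd_endo q x) \<in> UZ" by (rule sd_endo_UZ[OF q x])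
  have key: "Z.is_dir (q, sd_endo q x) (vel v, - cross3 (sd_form q v) x)
      (section_pushforward A g q s v - vertical_vector A g q (sd_endo q x) (section_derivative A D q v s))"
    if s: "local_section A g q s" "s q = sd_endo q x" for s
  proof -
    let ?\<sigma> = "\<lambda>r. sd_coords r (s r)"
    note S = section_sigma[OF q s]
    have "nb q (\<lambda>r. ?\<sigma> r \<bullet> ?\<sigma> r = 1)" by (rule nb_mono[OF q S(1)]) simp
    from T_cong[OF q v this] have "v (\<lambda>r. ?\<sigma> r \<bullet> ?\<sigma> r) = 0" by (simp only: T_const[OF q v])
    then have "dv v ?\<sigma> \<bullet> x = 0" using T_inner[OF q v S(2) S(2)] S(3) by (simp add: inner_commute)
    then have "(dv v ?\<sigma> + cross3 (sd_form q v) x) \<bullet> x = 0" by (simp add: inner_add_left dot_cross_self)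
    from Z.is_dir_diff[OF z pushforward_dir[OF q s v] vertical_dir[OF q x this]]
    show ?thesis unfolding section_derivative_eq[OF q s v] by simp
  qed
  have "horizontal_lift A g D q (sd_endo q x) v = section_pushforward A g q (\<lambda>r. sd_endo r x) v - vertical_vector A g q (sd_endo q x) (section_derivative A D q v (\<lambda>r. sd_endo r x))"
    unfolding horizontal_lift_def
    by (rule the_equality) (use const_section[OF q x] key Z.is_dir_unique[OF z] in blast)+
  then show ?thesis using key[OF const_section[OF q x]] by simp
qed

definition sd_op :: "'a \<Rightarrow> real^4 \<Rightarrow> real^3" where "sd_op q h = sd_form q (frame_vec q h)"

lemma sd_op_linear: "q \<in> U \<Longrightarrow> linear (sd_op q)"
  using sd_form_linv[of q "frame_vec q _" "frame_vec q _" 1 1] sd_form_linv[of q "frame_vec q _" "frame_vec q _" _ 0]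
  by (intro linearI) (simp_all add: sd_op_def frame_vec_add frame_vec_scale frame_vec_T fscale_1 fscale_0)

lemma sd_op_expand: "q \<in> U \<Longrightarrow> sd_op q h = (\<Sum>k\<in>UNIV. h $ k *\<^sub>R sd_form q (E k q))"
  using linear_expand[OF sd_op_linear, of q h] by (simp add: sd_op_def frame_vec_axis)

lemma sd_form_E_smc: assumes q: "q \<in> U" shows "smc q (\<lambda>r. sd_form r (E k r))"
proof -
  have "sm q (\<lambda>r. conn_form r (E k r) (axis j 1) $ i)" for i j
    unfolding conn_form_axis by (intro coords_sm q D_vf E_vf)
  then show ?thesis unfolding smc_def forall_3 sd_form_def vector_3 by (intro conjI sm_add q)
qed

text \<open>
  The horizontal lift of the vector with components \<open>h\<close> plus the vertical vector \<open>c \<times> x\<close>. Writing vertical vectors in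
  this way lets \<open>c\<close> range over all of \<open>\<real>\<^sup>3\<close>, so that fields on the twistor space are given by arbitrary smooth maps
  \<open>h\<close> and \<open>c\<close>; the component of \<open>c\<close> along \<open>x\<close> is redundant.
\<close>

definition tw_vec :: "'a \<times> ('a tvec \<Rightarrow> 'a tvec) \<Rightarrow> real^4 \<Rightarrow> real^3 \<Rightarrow> ('a \<times> ('a tvec \<Rightarrow> 'a tvec)) tvec" where
  "tw_vec z h c = horizontal_lift A g D (fst z) (snd z) (frame_vec (fst z) h) + vertical_vector A g (fst z) (snd z) (sd_endo (fst z) (cross3 c (xz z)))"

lemma tw_vec_dir: assumes z: "z \<in> UZ"
  shows "Z.is_dir z (vel (frame_vec (fst z) h), cross3 (c - sd_op (fst z) h) (xz z)) (tw_vec z h c)"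
proof -
  obtain q J where zz: "z = (q, J)" by (cases z)
  have q: "q \<in> U" and x: "sd_coords q J \<bullet> sd_coords q J = 1" and J: "J = sd_endo q (sd_coords q J)" using UZ_D[OF z] zz by auto
  have y: "cross3 c (sd_coords q J) \<bullet> sd_coords q J = 0" by (simp add: dot_cross_self)
  have z': "(q, sd_endo q (sd_coords q J)) \<in> UZ" using z zz J by simp
  have "Z.is_dir (q, sd_endo q (sd_coords q J)) ((vel (frame_vec q h), - cross3 (sd_form q (frame_vec q h)) (sd_coords q J)) + (0, cross3 c (sd_coords q J)))
     (horizontal_lift A g D q (sd_endo q (sd_coords q J)) (frame_vec q h) + vertical_vector A g q (sd_endo q (sd_coords q J)) (sd_endo q (cross3 c (sd_coords q J))))"
    by (rule Z.is_dir_add[OF z' horizontal_dir[OF q x frame_vec_T[OF q]] vertical_dir[OF q x y]])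
  then show ?thesis using J by (simp add: tw_vec_def zz sd_op_def Cross3.left_diff_distrib)
qed

lemma tw_vec_T: "z \<in> UZ \<Longrightarrow> tw_vec z h c \<in> Z.T z" using Z.is_dir_T tw_vec_dir by blast

lemma tw_vec_pull: "z \<in> UZ \<Longrightarrow> sm (fst z) f \<Longrightarrow> tw_vec z h c (\<lambda>z. f (fst z)) = frame_vec (fst z) h f"
  using Z_dir_pull[OF _ tw_vec_dir frame_vec_T] UZ_D by blast
lemma tw_vec_xz: "z \<in> UZ \<Longrightarrow> Z.dv (tw_vec z h c) xz = cross3 (c - sd_op (fst z) h) (xz z)"
  using Z_dir_xz tw_vec_dir by blast

lemma double_cross: assumes "x \<bullet> x = 1" "\<nu> \<bullet> x = 0" shows "cross3 (cross3 x \<nu>) x = \<nu>"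
  using assms Lagrange[of x x \<nu>] cross_skew[of "cross3 x \<nu>" x] by (simp add: inner_commute)

text \<open>
  Smooth formulas for a choice of \<open>h\<close> and \<open>c\<close> in \<open>tw_vec\<close>; this \<open>c\<close> is orthogonal to \<open>x\<close>.
\<close>

definition hor_part :: "'a \<times> ('a tvec \<Rightarrow> 'a tvec) \<Rightarrow> ('a \<times> ('a tvec \<Rightarrow> 'a tvec)) tvec \<Rightarrow> real^4" where
  "hor_part z \<zeta> = (\<Sum>i\<in>UNIV. \<zeta> (\<lambda>z. \<phi> (fst z) $ i) *\<^sub>R coords (fst z) (dd i (fst z)))"
definition ver_part :: "'a \<times> ('a tvec \<Rightarrow> 'a tvec) \<Rightarrow> ('a \<times> ('a tvec \<Rightarrow> 'a tvec)) tvec \<Rightarrow> real^3" where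
  "ver_part z \<zeta> = cross3 (xz z) (Z.dv \<zeta> xz + cross3 (sd_op (fst z) (hor_part z \<zeta>)) (xz z))"

lemma Z_phi: "\<zeta> (\<lambda>z. \<kappa>Z z \<bullet> (axis i 1, 0)) = \<zeta> (\<lambda>z. \<phi> (fst z) $ i)"
  by (simp add: \<kappa>Z_def inner_axis)

lemma Basis43: assumes "b \<in> (Basis :: ((real^4) \<times> (real^3)) set)"
  obtains i where "b = (axis i 1, 0)" | a where "b = (0, axis a 1)"
  using assms unfolding Basis_prod_def Basis_vec_def by auto

text \<open>
  Differentiating \<open>x \<bullet> x = 1\<close> shows that the \<open>x\<close>-component of a tangent vector is orthogonal to \<open>x\<close>; it can
  therefore be written as a cross product with \<open>x\<close>.
\<close>

lemma T_tw_vec: assumes z: "z \<in> UZ" and \<zeta>: "\<zeta> \<in> Z.T z" shows "\<zeta> = tw_vec z (hor_part z \<zeta>) (ver_part z \<zeta>)"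
proof -
  have q: "fst z \<in> U" and x: "xz z \<bullet> xz z = 1" using UZ_D[OF z] by auto
  have "Z.nb z (\<lambda>z. xz z \<bullet> xz z = 1)" by (rule Z.nb_all[OF z]) (use UZ_D in blast)
  from Z.T_cong[OF z \<zeta> this] have "\<zeta> (\<lambda>z. xz z \<bullet> xz z) = 0" by (simp only: Z.T_const[OF z \<zeta>])
  then have o: "Z.dv \<zeta> xz \<bullet> xz z = 0" using Z.T_inner[OF z \<zeta> Z_smc_xz[OF z] Z_smc_xz[OF z]] by (simp add: inner_commute)
  let ?w = "sd_op (fst z) (hor_part z \<zeta>)"
  have "cross3 (ver_part z \<zeta> - ?w) (xz z) = Z.dv \<zeta> xz"
    unfolding ver_part_def Cross3.left_diff_distrib
    by (subst double_cross[OF x]) (simp_all add: inner_add_left o dot_cross_self)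
  then have e2: "Z.dv (tw_vec z (hor_part z \<zeta>) (ver_part z \<zeta>)) xz = Z.dv \<zeta> xz" by (simp add: tw_vec_xz z)
  have e: "hor_part z \<zeta> = coords (fst z) (\<Sum>i\<in>UNIV. \<zeta> (\<lambda>z. \<phi> (fst z) $ i) *\<^sub>F dd i (fst z))"
    by (simp add: hor_part_def coords_sum T_intros dd_T q coords_scale)
  have l: "frame_vec (fst z) (hor_part z \<zeta>) = (\<Sum>i\<in>UNIV. \<zeta> (\<lambda>z. \<phi> (fst z) $ i) *\<^sub>F dd i (fst z))"
    unfolding e by (intro frame_vec_coords q T_intros dd_T)
  have e1: "tw_vec z (hor_part z \<zeta>) (ver_part z \<zeta>) (\<lambda>z. \<phi> (fst z) $ i) = \<zeta> (\<lambda>z. \<phi> (fst z) $ i)" for i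
    using tw_vec_pull[OF z sm_phi[OF q]]
    by (simp add: l sum_fun_apply dd_phi q if_distrib[of "\<lambda>x. _ * x"] cong: if_cong)
  show ?thesis
  proof (rule Z.T_eqI[OF z \<zeta> tw_vec_T[OF z]])
    fix b :: "(real^4) \<times> (real^3)" assume "b \<in> Basis"
    then show "\<zeta> (\<lambda>z. \<kappa>Z z \<bullet> b) = tw_vec z (hor_part z \<zeta>) (ver_part z \<zeta>) (\<lambda>z. \<kappa>Z z \<bullet> b)"
    proof (cases rule: Basis43)
      case (1 i) then show ?thesis by (simp only: Z_phi e1)
    next
      case (2 a)
      have e3: "\<zeta> (\<lambda>z. \<kappa>Z z \<bullet> b) = Z.dv \<zeta> xz $ a" for \<zeta> by (simp add: 2 \<kappa>Z_def inner_axis)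
      then show ?thesis by (simp only: e3 e2)
    qed
  qed
qed

lemma tw_vec_eq_iff: assumes z: "z \<in> UZ" shows "tw_vec z h c = tw_vec z h' c' \<longleftrightarrow> h = h' \<and> cross3 c (xz z) = cross3 c' (xz z)"
proof
  have q: "fst z \<in> U" using UZ_D[OF z] by auto
  assume a: "tw_vec z h c = tw_vec z h' c'"
  have "frame_vec (fst z) h = frame_vec (fst z) h'"
  proof (rule T_eqI4[OF q frame_vec_T[OF q] frame_vec_T[OF q]])
    fix i show "frame_vec (fst z) h (\<lambda>r. \<phi> r $ i) = frame_vec (fst z) h' (\<lambda>r. \<phi> r $ i)"
      using tw_vec_pull[OF z sm_phi[OF q], of h c i] tw_vec_pull[OF z sm_phi[OF q], of h' c' i] a by simp
  qed
  then have h: "h = h'" using coords_lin[OF q] by metis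
  moreover have "cross3 c (xz z) = cross3 c' (xz z)"
    using tw_vec_xz[OF z, of h c] tw_vec_xz[OF z, of h' c'] a h by (simp add: Cross3.left_diff_distrib)
  ultimately show "h = h' \<and> cross3 c (xz z) = cross3 c' (xz z)" by blast
qed (simp add: tw_vec_def)

text \<open>
  On vertical vectors \<open>Kop x \<circ> Kop (c \<times> x) = Kop (x \<times> (c \<times> x)) = Kop ((x \<times> c) \<times> x)\<close>.
\<close>

lemma ahs_tw_vec: assumes z: "z \<in> UZ"
  shows "ahs_structure A g D z (tw_vec z h c) = tw_vec z (Kop (xz z) h) (cross3 (xz z) c)"
proof -
  obtain q J where zz: "z = (q, J)" by (cases z)
  let ?x = "sd_coords q J"
  have q: "q \<in> U" and x: "?x \<bullet> ?x = 1" and J: "J = sd_endo q ?x" using UZ_D[OF z] zz by auto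
  have vs: "V \<in> vertical_space A g q J \<longleftrightarrow> (\<exists>\<xi>. \<xi> \<bullet> ?x = 0 \<and> V = sd_endo q \<xi>)" for V
    using vertical_iff[OF q x] J by simp
  let ?P = "\<lambda>\<eta>. \<exists>v\<in>T q. \<exists>V\<in>vertical_space A g q J.
     tw_vec z h c = horizontal_lift A g D q J v + vertical_vector A g q J V \<and>
     \<eta> = horizontal_lift A g D q J (J v) + vertical_vector A g q J (compose (T q) J V)"
  have f: "tw_vec z h' c' = horizontal_lift A g D q J (frame_vec q h') + vertical_vector A g q J (sd_endo q (cross3 c' ?x))" for h' c'
    by (simp add: tw_vec_def zz)
  have Jl: "J (frame_vec q h') = frame_vec q (Kop ?x h')" for h' using J sd_endo_lin[OF q, of ?x h'] by simp
  have Jc: "compose (T q) J (sd_endo q \<xi>) = sd_endo q (cross3 ?x \<xi>)" if "\<xi> \<bullet> ?x = 0" for \<xi>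
    using compose_sd_endo[OF q that] J by simp
  have xx: "cross3 ?x (cross3 c' ?x) = cross3 (cross3 ?x c') ?x" for c'
    by (simp add: vec3 algebra_simps)
  have "(THE \<eta>. ?P \<eta>) = tw_vec z (Kop ?x h) (cross3 ?x c)"
  proof (rule the_equality)
    have o: "cross3 c ?x \<bullet> ?x = 0" by (simp add: dot_cross_self)
    show "?P (tw_vec z (Kop ?x h) (cross3 ?x c))"
      by (rule bexI[OF _ frame_vec_T[OF q, of h]], rule bexI[of _ "sd_endo q (cross3 c ?x)"])
        (use o in \<open>auto simp: f Jl Jc xx vs\<close>)
  next
    fix \<eta> assume "?P \<eta>"
    then obtain v V where v: "v \<in> T q" and V: "V \<in> vertical_space A g q J"
      and e0: "tw_vec z h c = horizontal_lift A g D q J v + vertical_vector A g q J V"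
      and \<eta>0: "\<eta> = horizontal_lift A g D q J (J v) + vertical_vector A g q J (compose (T q) J V)"
      by blast
    from V obtain \<xi> where y: "\<xi> \<bullet> ?x = 0" and VV: "V = sd_endo q \<xi>" unfolding vs by blast
    note e = e0[unfolded VV] and \<eta> = \<eta>0[unfolded VV]
    define h' where "h' = coords q v"
    define c' where "c' = cross3 ?x \<xi>"
    have v': "v = frame_vec q h'" using frame_vec_coords[OF q v] by (simp add: h'_def)
    have y': "\<xi> = cross3 c' ?x" using double_cross[OF x y] by (simp add: c'_def)
    have "tw_vec z h c = tw_vec z h' c'" using e f[of h' c'] v' y' by metis
    then have "h = h'" "cross3 c ?x = cross3 c' ?x" using tw_vec_eq_iff[OF z] zz by auto
    moreover have "\<eta> = tw_vec z (Kop ?x h') (cross3 ?x c')"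
      unfolding \<eta> v' Jl Jc[OF y] f using xx[of c'] y' by simp
    ultimately show "\<eta> = tw_vec z (Kop ?x h) (cross3 ?x c)" using xx[of c] xx[of c'] by (simp add: f)
  qed
  then show ?thesis by (simp add: ahs_structure_def zz)
qed

lemma Z_pull_smc: "z \<in> UZ \<Longrightarrow> smc (fst z) f \<Longrightarrow> Z.smc z (\<lambda>z. f (fst z))"
  unfolding smc_def Z.smc_def using Z_pull by blast

lemma Z_smc_sd_op: assumes z: "z \<in> UZ" and h: "Z.smc z h" shows "Z.smc z (\<lambda>z. sd_op (fst z) (h z))"
proof -
  have q: "fst z \<in> U" using UZ_D[OF z] by auto
  have s: "Z.smc z (\<lambda>z. \<Sum>k\<in>UNIV. h z $ k *\<^sub>R sd_form (fst z) (E k (fst z)))"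
    by (intro Z.smc_sum Z.smc_scale z Z.smcD[OF h] Z_pull_smc[of z "\<lambda>q. sd_form q (E _ q)"] sd_form_E_smc q)
  have n: "Z.nb z (\<lambda>z. (\<Sum>k\<in>UNIV. h z $ k *\<^sub>R sd_form (fst z) (E k (fst z))) = sd_op (fst z) (h z))"
    by (rule Z.nb_all[OF z]) (use sd_op_expand UZ_D in simp)
  show ?thesis by (rule Z.smc_cong[OF z n s])
qed

lemma tw_vec_vf: assumes z: "z \<in> UZ" and h: "Z.smc z h" and c: "Z.smc z c"
  shows "Z.vf z (\<lambda>z. tw_vec z (h z) (c z))"
  unfolding Z.vf_iff[OF z]
proof (intro conjI ballI)
  have q: "fst z \<in> U" using UZ_D[OF z] by auto
  show "Z.nb z (\<lambda>z. tw_vec z (h z) (c z) \<in> Z.T z)" by (rule Z.nb_all[OF z tw_vec_T])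
  fix b :: "(real^4) \<times> (real^3)" assume "b \<in> Basis"
  then show "Z.sm z (\<lambda>z. tw_vec z (h z) (c z) (\<lambda>r. \<kappa>Z r \<bullet> b))"
  proof (cases rule: Basis43)
    case (1 i)
    have s: "Z.sm z (\<lambda>z. \<Sum>k\<in>UNIV. h z $ k * E k (fst z) (\<lambda>r. \<phi> r $ i))"
      by (intro Z.sm_sum Z.sm_mult z Z.smcD[OF h] Z_pull[of z "\<lambda>q. E _ q (\<lambda>r. \<phi> r $ i)"] vf_sm[OF E_vf] q sm_phi)
    have n: "Z.nb z (\<lambda>z. (\<Sum>k\<in>UNIV. h z $ k * E k (fst z) (\<lambda>r. \<phi> r $ i)) = tw_vec z (h z) (c z) (\<lambda>r. \<kappa>Z r \<bullet> b))"
    proof (rule Z.nb_all[OF z])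
      fix z assume z: "z \<in> UZ"
      then have "fst z \<in> U" using UZ_D by blast
      from tw_vec_pull[OF z sm_phi[OF this]]
      show "(\<Sum>k\<in>UNIV. h z $ k * E k (fst z) (\<lambda>r. \<phi> r $ i)) = tw_vec z (h z) (c z) (\<lambda>r. \<kappa>Z r \<bullet> b)"
        unfolding 1 Z_phi by (simp add: frame_vec_def sum_fun_apply)
    qed
    show ?thesis by (rule Z.sm_cong[OF z n s])
  next
    case (2 a)
    have "Z.smc z (\<lambda>z. cross3 (c z - sd_op (fst z) (h z)) (xz z))"
      by (intro Z.smc_cross Z.smc_diff z c Z_smc_sd_op h Z_smc_xz)
    then have s: "Z.sm z (\<lambda>z. cross3 (c z - sd_op (fst z) (h z)) (xz z) $ a)" by (rule Z.smcD)
    have n: "Z.nb z (\<lambda>z. cross3 (c z - sd_op (fst z) (h z)) (xz z) $ a = tw_vec z (h z) (c z) (\<lambda>r. \<kappa>Z r \<bullet> b))"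
    proof (rule Z.nb_all[OF z])
      fix z assume z: "z \<in> UZ"
      show "cross3 (c z - sd_op (fst z) (h z)) (xz z) $ a = tw_vec z (h z) (c z) (\<lambda>r. \<kappa>Z r \<bullet> b)"
        using arg_cong[OF tw_vec_xz[OF z], of "\<lambda>y. y $ a"] by (simp add: 2 \<kappa>Z_def inner_axis)
    qed
    show ?thesis by (rule Z.sm_cong[OF z n s])
  qed
qed

lemma vf_tw_vec: assumes z: "z \<in> UZ" and Y: "Z.vf z Y"
  obtains h c where "Z.smc z h" "Z.smc z c" "Z.nb z (\<lambda>z. tw_vec z (h z) (c z) = Y z)"
proof
  have q: "fst z \<in> U" using UZ_D[OF z] by auto
  show sh: "Z.smc z (\<lambda>z. hor_part z (Y z))" unfolding hor_part_def
    by (intro Z.smc_sum Z.smc_scale z Z_pull_smc[of z "\<lambda>q. coords q (dd _ q)"] Z.vf_sm[OF Y] Z_pull sm_phi q)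
      (simp add: smc_def coords_sm dd_vf q)
  have "Z.smc z (\<lambda>z. Z.dv (Y z) xz)"
    unfolding Z.smc_def by (simp add: Z.vf_sm[OF Y] Z.smcD[OF Z_smc_xz[OF z]])
  then show "Z.smc z (\<lambda>z. ver_part z (Y z))" unfolding ver_part_def
    by (intro Z.smc_cross Z.smc_add z Z_smc_xz Z_smc_sd_op sh)
  show "Z.nb z (\<lambda>z. tw_vec z (hor_part z (Y z)) (ver_part z (Y z)) = Y z)"
    by (rule Z.nb_mono[OF z Z.vf_nbT[OF Y]]) (use T_tw_vec in metis)
qed

end

section \<open>Algebra of the Nijenhuis tensor\<close>

lemma alternating_components:
  fixes \<tau> :: "real^4 \<Rightarrow> real^4 \<Rightarrow> real^4"
  assumes l1: "\<And>v. linear (\<lambda>u. \<tau> u v)" and l2: "\<And>u. linear (\<tau> u)"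
    and s1: "\<And>u v w. \<tau> u v \<bullet> w = - (\<tau> v u \<bullet> w)" and s2: "\<And>u v w. \<tau> u v \<bullet> w = - (\<tau> u w \<bullet> v)"
  defines "a \<equiv> \<tau> (axis 2 1) (axis 3 1) $ 4" and "b \<equiv> \<tau> (axis 1 1) (axis 3 1) $ 4"
    and "c \<equiv> \<tau> (axis 1 1) (axis 2 1) $ 4" and "d \<equiv> \<tau> (axis 1 1) (axis 2 1) $ 3"
  shows "\<tau> u v $ 1 = d * (u$2 * v$3 - u$3 * v$2) + c * (u$2 * v$4 - u$4 * v$2) + b * (u$3 * v$4 - u$4 * v$3)"
    "\<tau> u v $ 2 = - d * (u$1 * v$3 - u$3 * v$1) - c * (u$1 * v$4 - u$4 * v$1) + a * (u$3 * v$4 - u$4 * v$3)"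
    "\<tau> u v $ 3 = d * (u$1 * v$2 - u$2 * v$1) - b * (u$1 * v$4 - u$4 * v$1) - a * (u$2 * v$4 - u$4 * v$2)"
    "\<tau> u v $ 4 = c * (u$1 * v$2 - u$2 * v$1) + b * (u$1 * v$3 - u$3 * v$1) + a * (u$2 * v$3 - u$3 * v$2)"
proof -
  define t where "t i j k = \<tau> (axis i 1) (axis j 1) $ k" for i j k
  have t1: "t i j k = - t j i k" for i j k using s1[of "axis i 1" "axis j 1" "axis k 1"] by (simp add: t_def inner_axis)
  have t2: "t i j k = - t i k j" for i j k using s2[of "axis i 1" "axis j 1" "axis k 1"] by (simp add: t_def inner_axis)
  have t0: "t i i k = 0" "t i k k = 0" "t k i k = 0" for i k
    using t1[of i i k] t2[of i k k] t1[of k i k] t2[of i k k] by auto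
  have abcd: "a = t 2 3 4" "b = t 1 3 4" "c = t 1 2 4" "d = t 1 2 3" by (simp_all add: t_def a_def b_def c_def d_def)
  have tv: "t 2 3 4 = a" "t 2 4 3 = -a" "t 3 2 4 = -a" "t 3 4 2 = a" "t 4 2 3 = a" "t 4 3 2 = -a"
    "t 1 3 4 = b" "t 1 4 3 = -b" "t 3 1 4 = -b" "t 3 4 1 = b" "t 4 1 3 = b" "t 4 3 1 = -b"
    "t 1 2 4 = c" "t 1 4 2 = -c" "t 2 1 4 = -c" "t 2 4 1 = c" "t 4 1 2 = c" "t 4 2 1 = -c"
    "t 1 2 3 = d" "t 1 3 2 = -d" "t 2 1 3 = -d" "t 2 3 1 = d" "t 3 1 2 = d" "t 3 2 1 = -d"
    unfolding abcd
    using t1[of 2 4 3] t1[of 3 2 4] t1[of 3 4 2] t1[of 4 2 3] t1[of 4 3 2] t2[of 2 4 3] t2[of 3 4 2] t2[of 4 3 2]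
      t1[of 1 4 3] t1[of 3 1 4] t1[of 3 4 1] t1[of 4 1 3] t1[of 4 3 1] t2[of 1 4 3] t2[of 3 4 1] t2[of 4 3 1]
      t1[of 1 4 2] t1[of 2 1 4] t1[of 2 4 1] t1[of 4 1 2] t1[of 4 2 1] t2[of 1 4 2] t2[of 2 4 1] t2[of 4 2 1]
      t1[of 1 3 2] t1[of 2 1 3] t1[of 2 3 1] t1[of 3 1 2] t1[of 3 2 1] t2[of 1 3 2] t2[of 2 3 1] t2[of 3 2 1]
    by linarith+
  have ex: "\<tau> u v = (\<Sum>i\<in>UNIV. \<Sum>j\<in>UNIV. (u $ i * v $ j) *\<^sub>R \<tau> (axis i 1) (axis j 1))"
  proof -
    have "\<tau> u v = (\<Sum>i\<in>UNIV. u $ i *\<^sub>R \<tau> (axis i 1) v)" by (rule linear_expand[OF l1])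
    also have "\<dots> = (\<Sum>i\<in>UNIV. u $ i *\<^sub>R (\<Sum>j\<in>UNIV. v $ j *\<^sub>R \<tau> (axis i 1) (axis j 1)))"
      by (intro sum.cong refl arg_cong[of _ _ "\<lambda>y. _ *\<^sub>R y"] linear_expand[OF l2])
    finally show ?thesis by (simp add: scaleR_sum_right)
  qed
  have exn: "\<tau> u v $ k = (\<Sum>i\<in>UNIV. \<Sum>j\<in>UNIV. u $ i * v $ j * t i j k)" for k
    unfolding ex by (simp add: t_def)
  show "\<tau> u v $ 1 = d * (u$2 * v$3 - u$3 * v$2) + c * (u$2 * v$4 - u$4 * v$2) + b * (u$3 * v$4 - u$4 * v$3)"
    "\<tau> u v $ 2 = - d * (u$1 * v$3 - u$3 * v$1) - c * (u$1 * v$4 - u$4 * v$1) + a * (u$3 * v$4 - u$4 * v$3)"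
    "\<tau> u v $ 3 = d * (u$1 * v$2 - u$2 * v$1) - b * (u$1 * v$4 - u$4 * v$1) - a * (u$2 * v$4 - u$4 * v$2)"
    "\<tau> u v $ 4 = c * (u$1 * v$2 - u$2 * v$1) + b * (u$1 * v$3 - u$3 * v$1) + a * (u$2 * v$3 - u$3 * v$2)"
    unfolding exn by (simp_all add: sum_4 t0 tv algebra_simps)
qed

text \<open>
  The left-hand side is four times the part of type (3,0) and (0,3) of the three-form \<open>\<tau>\<close> with respect to the complex structure
  \<open>Kop x\<close>. It vanishes because the complex dimension is two. For the torsion this is where total skew-symmetry enters.
\<close>

lemma triple_form_type:
  fixes \<tau> :: "real^4 \<Rightarrow> real^4 \<Rightarrow> real^4"
  assumes l1: "\<And>v. linear (\<lambda>u. \<tau> u v)" and l2: "\<And>u. linear (\<tau> u)"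
    and s1: "\<And>u v w. \<tau> u v \<bullet> w = - (\<tau> v u \<bullet> w)" and s2: "\<And>u v w. \<tau> u v \<bullet> w = - (\<tau> u w \<bullet> v)"
    and x: "x \<bullet> x = 1"
  shows "\<tau> u v - \<tau> (Kop x u) (Kop x v) + Kop x (\<tau> (Kop x u) v) + Kop x (\<tau> u (Kop x v)) = 0"
proof -
  define a b c d where abcd: "a = \<tau> (axis 2 1) (axis 3 1) $ 4" "b = \<tau> (axis 1 1) (axis 3 1) $ 4"
    "c = \<tau> (axis 1 1) (axis 2 1) $ 4" "d = \<tau> (axis 1 1) (axis 2 1) $ 3"
  note tn = alternating_components[OF l1 l2 s1 s2, folded abcd]
  \<comment> \<open>homogeneous of degree two in \<open>x\<close>, hence an identity of polynomials\<close>
  have "(x \<bullet> x) *\<^sub>R \<tau> u v - \<tau> (Kop x u) (Kop x v) + Kop x (\<tau> (Kop x u) v) + Kop x (\<tau> u (Kop x v)) = 0"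
    by (simp add: vec_eq_iff[where 'b=4] forall_4 tn inner_vec_def sum_3) (simp add: algebra_simps)
  then show ?thesis using x by simp
qed

text \<open>
  The vertical components \<open>C1\<close>, ..., \<open>C4\<close> are those of the four brackets in the Nijenhuis tensor of \<open>tw_vec h c\<close> and
  \<open>tw_vec h' c'\<close>. Here \<open>a, a', b, b'\<close> stand for the connection form at \<open>K h, K h', h, h'\<close>, the \<open>d\<close>'s for derivatives of \<open>c\<close>
  and \<open>c'\<close>, and the \<open>o\<close>'s for the curvature. Up to multiples of \<open>x\<close> everything except the curvature cancels.
\<close>

lemma vertical_identity:
  fixes x c c' a a' b b' d1 d2 d3 d4 o1 o2 o3 o4 :: "real^3"
  assumes x: "x \<bullet> x = 1"
  defines "C1 \<equiv> (cross3 (cross3 (cross3 x c - a) x) c' + cross3 x d1) - (cross3 (cross3 (cross3 x c' - a') x) c + cross3 x d2)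
      - cross3 (cross3 x c) (cross3 x c') + cross3 a (cross3 x c') - cross3 a' (cross3 x c) - o1"
    and "C2 \<equiv> d3 - d4 - cross3 c c' + cross3 b c' - cross3 b' c - o2"
    and "C3 \<equiv> d1 - (cross3 (cross3 (c' - b') x) c + cross3 x d4) - cross3 (cross3 x c) c' + cross3 a c' - cross3 b' (cross3 x c) - o3"
    and "C4 \<equiv> (cross3 (cross3 (c - b) x) c' + cross3 x d3) - d2 - cross3 c (cross3 x c') + cross3 b (cross3 x c') - cross3 a' c - o4"
  shows "cross3 (C1 - C2 - cross3 x C3 - cross3 x C4) x = - cross3 (o1 - o2 - cross3 x (o3 + o4)) x"
proof -
  \<comment> \<open>\<open>P\<close> projects to the line of \<open>x\<close>, which the product with \<open>x\<close> annihilates\<close>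
  define P where "P y = y + cross3 x (cross3 x y)" for y
  have Pe: "P y = (x \<bullet> y) *\<^sub>R x" for y using Lagrange[of x x y] x by (simp add: P_def)
  have P0: "cross3 (P y) x = 0" for y unfolding Pe by (simp add: cross_mult_left)
  have dc: "cross3 (cross3 x c) x = c - (x \<bullet> c) *\<^sub>R x" for c
    using Lagrange[of x x c] cross_skew[of "cross3 x c" x] x by simp
  have e: "C1 - C2 - cross3 x C3 - cross3 x C4 = - (o1 - o2 - cross3 x (o3 + o4))
     + P (d4 - d3) + P (cross3 b' c) - P (cross3 b c') + 3 *\<^sub>R P (cross3 c c') - (x \<bullet> cross3 c c') *\<^sub>R x"
    unfolding C1_def C2_def C3_def C4_def P_def Cross3.left_diff_distrib dc
    by (simp add: vec_eq_iff[where 'b=3] forall_3 cross_components inner_vec_def sum_3) (simp add: algebra_simps)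
  show ?thesis unfolding e
    by (simp add: cross_add_left Cross3.left_diff_distrib cross_mult_left P0)
qed

text \<open>
  Let \<open>B\<close> be the matrix of the two-form \<open>W\<close> restricted to self-dual bivectors, with rows \<open>B1, B2, B3\<close>. The condition says that the
  symmetric part of \<open>B\<close> is a multiple of the identity.
\<close>

definition curv_cond :: "(4 \<Rightarrow> 4 \<Rightarrow> real^3) \<Rightarrow> bool" where
  "curv_cond W \<longleftrightarrow> (let B1 = W 1 2 + W 3 4; B2 = W 1 3 + W 4 2; B3 = W 1 4 + W 2 3 in
     B1 $ 1 = B2 $ 2 \<and> B2 $ 2 = B3 $ 3 \<and> B1 $ 2 + B2 $ 1 = 0 \<and> B1 $ 3 + B3 $ 1 = 0 \<and> B2 $ 3 + B3 $ 2 = 0)"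

text \<open>
  The left-hand side is the vertical part of the Nijenhuis tensor. It is linear in the curvature form. The restriction to anti-self-dual
  bivectors drops out of it, since these are invariant under \<open>Kop x\<close>. A multiple of the identity and a skew
  matrix also drop out of the restriction \<open>B\<close> to self-dual bivectors; the vectors \<open>x = e\<^sub>1, e\<^sub>2, e\<^sub>3\<close> already show that nothing else does.
\<close>

lemma curv_cond_iff:
  fixes sd_curv :: "real^4 \<Rightarrow> real^4 \<Rightarrow> real^3"
  assumes l1: "\<And>v. linear (\<lambda>u. sd_curv u v)" and l2: "\<And>u. linear (sd_curv u)" and sk: "\<And>u v. sd_curv u v = - sd_curv v u"
  shows "(\<forall>x. x \<bullet> x = 1 \<longrightarrow> (\<forall>u v. cross3 (sd_curv (Kop x u) (Kop x v) - sd_curv u v - cross3 x (sd_curv (Kop x u) v + sd_curv u (Kop x v))) x = 0))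
    \<longleftrightarrow> curv_cond (\<lambda>i j. sd_curv (axis i 1) (axis j 1))" (is "?L \<longleftrightarrow> ?R")
proof -
  define W where "W i j = sd_curv (axis i 1) (axis j 1)" for i j
  have Wsk: "W i j = - W j i" for i j unfolding W_def by (rule sk)
  have W0: "W i i = 0" for i using Wsk[of i i] by (simp add: vec_eq_iff)
  have ex: "sd_curv u v = (\<Sum>i\<in>UNIV. \<Sum>j\<in>UNIV. (u $ i * v $ j) *\<^sub>R W i j)" for u v
  proof -
    have "sd_curv u v = (\<Sum>i\<in>UNIV. u $ i *\<^sub>R sd_curv (axis i 1) v)" by (rule linear_expand[OF l1])
    also have "\<dots> = (\<Sum>i\<in>UNIV. u $ i *\<^sub>R (\<Sum>j\<in>UNIV. v $ j *\<^sub>R sd_curv (axis i 1) (axis j 1)))"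
      by (intro sum.cong refl arg_cong[of _ _ "\<lambda>y. _ *\<^sub>R y"] linear_expand[OF l2])
    finally show ?thesis by (simp add: scaleR_sum_right W_def)
  qed
  have W': "W 2 1 = - W 1 2" "W 3 1 = - W 1 3" "W 4 1 = - W 1 4" "W 3 2 = - W 2 3" "W 2 4 = - W 4 2" "W 4 3 = - W 3 4"
    by (rule Wsk)+
  have on: "sd_curv u v $ k = W 1 2 $ k * (u$1 * v$2 - u$2 * v$1) + W 1 3 $ k * (u$1 * v$3 - u$3 * v$1) + W 1 4 $ k * (u$1 * v$4 - u$4 * v$1)
     + W 3 4 $ k * (u$3 * v$4 - u$4 * v$3) + W 4 2 $ k * (u$4 * v$2 - u$2 * v$4) + W 2 3 $ k * (u$2 * v$3 - u$3 * v$2)" for u v k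
    unfolding ex[of u v] by (simp add: sum_4 W0 W' algebra_simps)
  \<comment> \<open>the values on the standard self-dual and anti-self-dual bivectors\<close>
  define p m where "p = (\<lambda>b::3. (if b = 1 then W 1 2 + W 3 4 else if b = 2 then W 1 3 + W 4 2 else W 1 4 + W 2 3))"
    and "m = (\<lambda>b::3. (if b = 1 then W 1 2 - W 3 4 else if b = 2 then W 1 3 - W 4 2 else W 1 4 - W 2 3))"
  have pm: "p 1 = W 1 2 + W 3 4" "p 2 = W 1 3 + W 4 2" "p 3 = W 1 4 + W 2 3" by (simp_all add: p_def m_def)
  have cc: "?R \<longleftrightarrow> p 1 $ 1 = p 2 $ 2 \<and> p 2 $ 2 = p 3 $ 3 \<and> p 1 $ 2 + p 2 $ 1 = 0 \<and> p 1 $ 3 + p 3 $ 1 = 0 \<and> p 2 $ 3 + p 3 $ 2 = 0"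
    by (simp add: curv_cond_def Let_def pm W_def)
  have ax: "axis a 1 \<bullet> (axis a 1 :: real^3) = 1" for a by (simp add: inner_axis_axis)
  show ?thesis
  proof
    assume L: ?L
    have L1: "cross3 (sd_curv (Kop x u) (Kop x v) - sd_curv u v - cross3 x (sd_curv (Kop x u) v + sd_curv u (Kop x v))) x $ k = 0"
      if "x \<bullet> x = 1" for x u v k using L that by simp
    have 1: "- p 2 $ 2 + p 3 $ 3 = 0"
      using L1[OF ax, of 1 "axis 1 1" "axis 3 1" 3] by (simp add: cross_components on axis_def pm)
    have 2: "p 2 $ 3 + p 3 $ 2 = 0"
      using L1[OF ax, of 1 "axis 1 1" "axis 3 1" 2] by (simp add: cross_components on axis_def pm)
    have 3: "p 1 $ 3 + p 3 $ 1 = 0"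
      using L1[OF ax, of 2 "axis 1 1" "axis 4 1" 3] by (simp add: cross_components on axis_def pm)
    have 4: "p 1 $ 1 - p 3 $ 3 = 0"
      using L1[OF ax, of 2 "axis 1 1" "axis 4 1" 1] by (simp add: cross_components on axis_def pm)
    have 5: "p 1 $ 2 + p 2 $ 1 = 0"
      using L1[OF ax, of 3 "axis 1 1" "axis 2 1" 1] by (simp add: cross_components on axis_def pm)
    show ?R unfolding cc using 1 2 3 4 5 by auto
  next
    assume R: ?R
    \<comment> \<open>in this direction \<open>p\<close> is multiplication by \<open>l\<close> plus the cross product with \<open>c\<close>\<close>
    define l where "l = p 1 $ 1"
    define c :: "real^3" where "c = vector [p 2 $ 3, p 3 $ 1, p 1 $ 2]"
    have pv: "p 1 $ 1 = l" "p 2 $ 2 = l" "p 3 $ 3 = l" "p 2 $ 3 = c $ 1" "p 3 $ 2 = - c $ 1"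
      "p 3 $ 1 = c $ 2" "p 1 $ 3 = - c $ 2" "p 1 $ 2 = c $ 3" "p 2 $ 1 = - c $ 3"
      using R unfolding cc by (auto simp: l_def c_def)
    \<comment> \<open>twice the anti-self-dual part of \<open>u \<and> v\<close>; \<open>s\<close> is the self-dual one\<close>
    define t where "t u v = (vector [(u$1 * v$2 - u$2 * v$1) - (u$3 * v$4 - u$4 * v$3),
       (u$1 * v$3 - u$3 * v$1) - (u$4 * v$2 - u$2 * v$4), (u$1 * v$4 - u$4 * v$1) - (u$2 * v$3 - u$3 * v$2)] :: real^3)" for u v :: "real^4"
    define Am where "Am y = (\<Sum>b\<in>UNIV. y $ b *\<^sub>R m b)" for y :: "real^3"
    define s where "s u v = Kvec u v" for u v
    have sn: "s u v $ 1 = (u$1 * v$2 - u$2 * v$1) + (u$3 * v$4 - u$4 * v$3)"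
      "s u v $ 2 = (u$1 * v$3 - u$3 * v$1) + (u$4 * v$2 - u$2 * v$4)"
      "s u v $ 3 = (u$1 * v$4 - u$4 * v$1) + (u$2 * v$3 - u$3 * v$2)" for u v
      by (simp_all add: s_def Kvec_nth inner_vec_def sum_4 axis_def algebra_simps)
    have tn: "t u v $ 1 = (u$1 * v$2 - u$2 * v$1) - (u$3 * v$4 - u$4 * v$3)"
      "t u v $ 2 = (u$1 * v$3 - u$3 * v$1) - (u$4 * v$2 - u$2 * v$4)"
      "t u v $ 3 = (u$1 * v$4 - u$4 * v$1) - (u$2 * v$3 - u$3 * v$2)" for u v by (simp_all add: t_def)
    have Amn: "Am y $ k = y $ 1 * m 1 $ k + y $ 2 * m 2 $ k + y $ 3 * m 3 $ k" for y k by (simp add: Am_def sum_3)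
    have O1: "2 *\<^sub>R sd_curv u v = (\<Sum>b\<in>UNIV. s u v $ b *\<^sub>R p b) + Am (t u v)" for u v
      by (simp add: vec_eq_iff[where 'b=3] on sum_3 sn tn Am_def p_def m_def algebra_simps)
    have O2: "(\<Sum>b\<in>UNIV. y $ b *\<^sub>R p b) = l *\<^sub>R y + cross3 c y" for y
      by (simp add: vec_eq_iff[where 'b=3] forall_3 sum_3 cross_components pv algebra_simps)
    have O: "2 *\<^sub>R sd_curv u v = l *\<^sub>R s u v + cross3 c (s u v) + Am (t u v)" for u v
      unfolding O1 O2 ..
    show ?L
    proof (intro allI impI)
      fix x :: "real^3" and u v assume x: "x \<bullet> x = 1"
      have s1: "s (Kop x u) (Kop x v) = (2 * (x \<bullet> s u v)) *\<^sub>R x - (x \<bullet> x) *\<^sub>R s u v"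
        by (simp add: vec_eq_iff[where 'b=3] forall_3 sn inner_vec_def sum_3) (simp add: algebra_simps)
      have s2: "s (Kop x u) v + s u (Kop x v) = 2 *\<^sub>R cross3 x (s u v)"
        by (simp add: vec_eq_iff[where 'b=3] forall_3 sn cross_components) (simp add: algebra_simps)
      have t1: "t (Kop x u) (Kop x v) = (x \<bullet> x) *\<^sub>R t u v"
        by (simp add: vec_eq_iff[where 'b=3] forall_3 tn inner_vec_def sum_3) (simp add: algebra_simps)
      have t2: "t (Kop x u) v + t u (Kop x v) = 0"
        by (simp add: vec_eq_iff[where 'b=3] forall_3 tn) (simp add: algebra_simps)
      have A0: "Am (t (Kop x u) v) + Am (t u (Kop x v)) = 0"
      proof -
        have "Am (t (Kop x u) v) + Am (t u (Kop x v)) = Am (t (Kop x u) v + t u (Kop x v))"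
          by (simp add: Am_def sum.distrib[symmetric] scaleR_left_distrib)
        then show ?thesis unfolding t2 by (simp add: Am_def)
      qed
      let ?s = "s u v"
      have o12: "2 *\<^sub>R (sd_curv (Kop x u) (Kop x v) - sd_curv u v) = 2 *\<^sub>R (l *\<^sub>R ((x \<bullet> ?s) *\<^sub>R x - ?s) + cross3 c ((x \<bullet> ?s) *\<^sub>R x - ?s))"
        unfolding scaleR_right_diff_distrib O s1 t1 x
        by (simp add: vec_eq_iff[where 'b=3] forall_3 cross_components algebra_simps)
      have o34: "2 *\<^sub>R (sd_curv (Kop x u) v + sd_curv u (Kop x v)) = 2 *\<^sub>R (l *\<^sub>R cross3 x ?s + cross3 c (cross3 x ?s))"
      proof -
        have "2 *\<^sub>R (sd_curv (Kop x u) v + sd_curv u (Kop x v)) = l *\<^sub>R (s (Kop x u) v + s u (Kop x v)) + cross3 c (s (Kop x u) v + s u (Kop x v)) + (Am (t (Kop x u) v) + Am (t u (Kop x v)))"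
          by (simp add: scaleR_right_distrib O cross_add_right)
        then show ?thesis unfolding s2 A0 by (simp add: cross_mult_right scaleR_right_distrib)
      qed
      define y where "y = (x \<bullet> ?s) *\<^sub>R x - ?s"
      have yx: "y \<bullet> x = 0" using x by (simp add: y_def inner_diff_left inner_commute[of ?s x])
      have y2: "cross3 x (cross3 x ?s) = y" using Lagrange[of x x ?s] x by (simp add: y_def)
      have Q: "sd_curv (Kop x u) (Kop x v) - sd_curv u v - cross3 x (sd_curv (Kop x u) v + sd_curv u (Kop x v)) =
        l *\<^sub>R y + cross3 c y - cross3 x (l *\<^sub>R cross3 x ?s + cross3 c (cross3 x ?s))"
        using o12 o34 by (simp add: y_def)
      have Q2: "cross3 x (cross3 c (cross3 x ?s)) = - ((c \<bullet> x) *\<^sub>R cross3 x ?s)"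
        by (simp add: Lagrange[of c] cross_mult_right Cross3.right_diff_distrib)
      have Q3: "cross3 (cross3 x ?s) x = - y" using y2 cross_skew[of "cross3 x ?s" x] by simp
      have Q4: "cross3 (cross3 c y) x = (c \<bullet> x) *\<^sub>R y - (y \<bullet> x) *\<^sub>R c"
        using Lagrange[of x c y] cross_skew[of "cross3 c y" x] by (simp add: inner_commute)
      show "cross3 (sd_curv (Kop x u) (Kop x v) - sd_curv u v - cross3 x (sd_curv (Kop x u) v + sd_curv u (Kop x v))) x = 0"
        unfolding Q by (simp add: cross_add_right cross_add_left cross_mult_right cross_mult_left y2 Q2 Q3 Q4 yx)
    qed
  qed
qed

section \<open>Brackets of vector fields on the twistor space\<close>

context framed_connection
begin

definition frame_brk :: "'a \<Rightarrow> real^4 \<Rightarrow> real^4 \<Rightarrow> real^4" where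
  "frame_brk q u v = coords q (lb (\<lambda>r. frame_vec r u) (\<lambda>r. frame_vec r v) q)"

text \<open>
  The curvature \<open>dw (u, v) + w u \<times> w v\<close> of the connection \<open>d + w \<times>\<close> on self-dual endomorphisms, evaluated on constant combinations of the frame.
\<close>

definition sd_curv :: "'a \<Rightarrow> real^4 \<Rightarrow> real^4 \<Rightarrow> real^3" where
  "sd_curv q u v = dv (frame_vec q u) (\<lambda>r. sd_op r v) - dv (frame_vec q v) (\<lambda>r. sd_op r u) + cross3 (sd_op q u) (sd_op q v) - sd_op q (frame_brk q u v)"

lemma sd_op_smc: assumes q: "q \<in> U" shows "smc q (\<lambda>r. sd_op r u)"
proof -
  have "smc q (\<lambda>r. \<Sum>k\<in>UNIV. u $ k *\<^sub>R sd_form r (E k r))"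
    by (intro smc_sum smc_scale q sm_const sd_form_E_smc)
  then show ?thesis by (rule smc_cong[OF q nb_all[OF q], rotated]) (simp add: sd_op_expand)
qed

lemma sd_op_simps: "q \<in> U \<Longrightarrow> sd_op q (u + v) = sd_op q u + sd_op q v" "q \<in> U \<Longrightarrow> sd_op q (u - v) = sd_op q u - sd_op q v"
  "q \<in> U \<Longrightarrow> sd_op q (c *\<^sub>R u) = c *\<^sub>R sd_op q u"
  using linear_add[OF sd_op_linear] linear_diff[OF sd_op_linear] linear_scale[OF sd_op_linear] by blast+

lemma dv_vadd: "dv (v + w) h = dv v h + dv w h" by (simp add: vec_eq_iff)
lemma dv_vscale: "dv (c *\<^sub>F v) h = c *\<^sub>R dv v h" by (simp add: vec_eq_iff)

lemma frame_brk_sk: assumes q: "q \<in> U" shows "frame_brk q u v = - frame_brk q v u"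
  unfolding frame_brk_def by (subst lb_anti) (rule coords_uminus[OF q lb_T[OF q frame_vec_const_vf[OF q] frame_vec_const_vf[OF q]]])

lemma frame_brk_linear: assumes q: "q \<in> U" shows "linear (frame_brk q u)"
proof (rule linearI)
  note L = frame_vec_const_vf[OF q]
  have LT: "lb (\<lambda>r. frame_vec r u) (\<lambda>r. frame_vec r v) q \<in> T q" for u v by (rule lb_T[OF q L L])
  fix v w c
  show "frame_brk q u (v + w) = frame_brk q u v + frame_brk q u w"
    by (simp add: frame_brk_def frame_vec_add lb_add_right[OF q L L L] coords_add q LT)
  have "lb (\<lambda>r. frame_vec r u) (\<lambda>r. c *\<^sub>F frame_vec r v) q = c *\<^sub>F lb (\<lambda>r. frame_vec r u) (\<lambda>r. frame_vec r v) q"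
    using lb_scale_right[OF q L[of u] L[of v] sm_const[OF q, of c]] T_const[OF q frame_vec_T[OF q, of u], of c]
    by (simp add: fscale_0)
  then show "frame_brk q u (c *\<^sub>R v) = c *\<^sub>R frame_brk q u v"
    by (simp add: frame_brk_def frame_vec_scale coords_scale q LT)
qed

lemma sd_curv_sk: "q \<in> U \<Longrightarrow> sd_curv q u v = - sd_curv q v u"
  unfolding sd_curv_def using frame_brk_sk[of q u v] cross_skew[of "sd_op q u" "sd_op q v"] linear_neg[OF sd_op_linear, of q "frame_brk q v u"] by simp

lemma sd_curv_linear: assumes q: "q \<in> U" shows "linear (sd_curv q u)"
proof (rule linearI)
  fix v w c
  have n: "nb q P" if "\<And>r. r \<in> U \<Longrightarrow> P r" for P by (rule nb_all[OF q that])
  have 1: "dv (frame_vec q u) (\<lambda>r. sd_op r (v + w)) = dv (frame_vec q u) (\<lambda>r. sd_op r v) + dv (frame_vec q u) (\<lambda>r. sd_op r w)"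
    using dv_cong[OF q frame_vec_T[OF q] n, of "\<lambda>r. sd_op r (v + w)" "\<lambda>r. sd_op r v + sd_op r w"]
    by (simp add: sd_op_simps dv_add[OF q frame_vec_T[OF q] sd_op_smc[OF q] sd_op_smc[OF q]])
  show "sd_curv q u (v + w) = sd_curv q u v + sd_curv q u w"
    by (simp add: sd_curv_def 1 frame_vec_add dv_vadd sd_op_simps q linear_add[OF frame_brk_linear[OF q]] cross_add_right)
  have 2: "dv (frame_vec q u) (\<lambda>r. sd_op r (c *\<^sub>R v)) = c *\<^sub>R dv (frame_vec q u) (\<lambda>r. sd_op r v)"
    using dv_cong[OF q frame_vec_T[OF q] n, of "\<lambda>r. sd_op r (c *\<^sub>R v)" "\<lambda>r. c *\<^sub>R sd_op r v"]
    by (simp add: sd_op_simps dv_scale[OF q frame_vec_T[OF q] sm_const[OF q] sd_op_smc[OF q]] T_const[OF q frame_vec_T[OF q]])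
  show "sd_curv q u (c *\<^sub>R v) = c *\<^sub>R sd_curv q u v"
    by (simp add: sd_curv_def 2 frame_vec_scale dv_vscale sd_op_simps q linear_scale[OF frame_brk_linear[OF q]] cross_mult_right algebra_simps)
qed

lemma sd_curv_linear_left: assumes q: "q \<in> U" shows "linear (\<lambda>u. sd_curv q u v)"
proof -
  have "(\<lambda>u. sd_curv q u v) = (\<lambda>u. - sd_curv q v u)" using sd_curv_sk[OF q] by blast
  then show ?thesis using linear_compose_neg[OF sd_curv_linear[OF q]] by simp
qed

lemma lb_lin: "q \<in> U \<Longrightarrow> lb (\<lambda>r. frame_vec r u) (\<lambda>r. frame_vec r v) q = frame_vec q (frame_brk q u v)"
  unfolding frame_brk_def by (rule frame_vec_coords[symmetric]) (auto intro: lb_T frame_vec_const_vf)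

lemma dv_sd_op: assumes z: "z \<in> UZ" and \<zeta>: "\<zeta> = tw_vec z k d" and h: "Z.smc z h"
  shows "Z.dv \<zeta> (\<lambda>z. sd_op (fst z) (h z)) = sd_op (fst z) (Z.dv \<zeta> h) + dv (frame_vec (fst z) k) (\<lambda>r. sd_op r (h z))"
proof -
  let ?q = "fst z"
  have q: "?q \<in> U" using UZ_D[OF z] by blast
  have \<zeta>T: "\<zeta> \<in> Z.T z" unfolding \<zeta> by (rule tw_vec_T[OF z])
  have "Z.dv \<zeta> (\<lambda>z. sd_op (fst z) (h z)) = Z.dv \<zeta> (\<lambda>z. \<Sum>i\<in>UNIV. h z $ i *\<^sub>R sd_form (fst z) (E i (fst z)))"
    by (rule Z.dv_cong[OF z \<zeta>T Z.nb_all[OF z]]) (use sd_op_expand UZ_D in blast)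
  also have "\<dots> = (\<Sum>i\<in>UNIV. Z.dv \<zeta> (\<lambda>z. h z $ i *\<^sub>R sd_form (fst z) (E i (fst z))))"
    by (rule Z.dv_sum[OF z \<zeta>T]) (intro Z.smc_scale z Z.smcD[OF h] Z_pull_smc[of z "\<lambda>q. sd_form q (E _ q)"] sd_form_E_smc q)
  also have "\<dots> = (\<Sum>i\<in>UNIV. \<zeta> (\<lambda>z. h z $ i) *\<^sub>R sd_form ?q (E i ?q) + h z $ i *\<^sub>R dv (frame_vec ?q k) (\<lambda>r. sd_form r (E i r)))"
  proof (rule sum.cong[OF refl])
    fix i
    have s: "Z.smc z (\<lambda>z. sd_form (fst z) (E i (fst z)))"
      by (intro Z_pull_smc[of z "\<lambda>q. sd_form q (E _ q)"] z sd_form_E_smc q)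
    have "Z.dv \<zeta> (\<lambda>z. sd_form (fst z) (E i (fst z))) = dv (frame_vec ?q k) (\<lambda>r. sd_form r (E i r))"
      unfolding vec_eq_iff Z.dv_nth dv_nth \<zeta>
      using tw_vec_pull[OF z smcD[OF sd_form_E_smc[OF q]], of k d i] by blast
    then show "Z.dv \<zeta> (\<lambda>z. h z $ i *\<^sub>R sd_form (fst z) (E i (fst z))) = \<zeta> (\<lambda>z. h z $ i) *\<^sub>R sd_form ?q (E i ?q) + h z $ i *\<^sub>R dv (frame_vec ?q k) (\<lambda>r. sd_form r (E i r))"
      by (subst Z.dv_scale[OF z \<zeta>T Z.smcD[OF h] s]) simp
  qed
  also have "\<dots> = sd_op ?q (Z.dv \<zeta> h) + (\<Sum>i\<in>UNIV. h z $ i *\<^sub>R dv (frame_vec ?q k) (\<lambda>r. sd_form r (E i r)))"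
    by (simp add: sum.distrib sd_op_expand q)
  also have "(\<Sum>i\<in>UNIV. h z $ i *\<^sub>R dv (frame_vec ?q k) (\<lambda>r. sd_form r (E i r))) = dv (frame_vec ?q k) (\<lambda>r. \<Sum>i\<in>UNIV. h z $ i *\<^sub>R sd_form r (E i r))"
    by (subst dv_sum[OF q frame_vec_T[OF q]])
      (auto intro!: smc_scale q sm_const sd_form_E_smc simp: dv_scale[OF q frame_vec_T[OF q] sm_const[OF q] sd_form_E_smc[OF q]] T_const[OF q frame_vec_T[OF q]])
  also have "\<dots> = dv (frame_vec ?q k) (\<lambda>r. sd_op r (h z))"
    by (rule dv_cong[OF q frame_vec_T[OF q] nb_all[OF q]]) (simp add: sd_op_expand)
  finally show ?thesis .
qed

lemma dv_lin_phi: assumes z: "z \<in> UZ" and \<zeta>: "\<zeta> = tw_vec z k d" and h: "Z.smc z h"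
  shows "\<zeta> (\<lambda>z. frame_vec (fst z) (h z) (\<lambda>r. \<phi> r $ j)) = frame_vec (fst z) (Z.dv \<zeta> h) (\<lambda>r. \<phi> r $ j) + frame_vec (fst z) k (\<lambda>r. frame_vec r (h z) (\<lambda>r. \<phi> r $ j))"
proof -
  let ?q = "fst z" and ?e = "\<lambda>i q. E i q (\<lambda>r. \<phi> r $ j)"
  have q: "?q \<in> U" using UZ_D[OF z] by blast
  have \<zeta>T: "\<zeta> \<in> Z.T z" unfolding \<zeta> by (rule tw_vec_T[OF z])
  have se: "sm ?q (?e i)" for i by (intro vf_sm[OF E_vf] q sm_phi)
  have sz: "Z.sm z (\<lambda>z. ?e i (fst z))" for i by (rule Z_pull[OF z se])
  have "\<zeta> (\<lambda>z. frame_vec (fst z) (h z) (\<lambda>r. \<phi> r $ j)) = \<zeta> (\<lambda>z. \<Sum>i\<in>UNIV. h z $ i * ?e i (fst z))"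
    by (simp add: frame_vec_def sum_fun_apply)
  also have "\<dots> = (\<Sum>i\<in>UNIV. \<zeta> (\<lambda>z. h z $ i * ?e i (fst z)))"
    by (rule Z.T_sum[OF z \<zeta>T]) (intro Z.sm_mult z Z.smcD[OF h] sz)
  also have "\<dots> = (\<Sum>i\<in>UNIV. h z $ i * frame_vec ?q k (?e i) + ?e i ?q * \<zeta> (\<lambda>z. h z $ i))"
  proof (rule sum.cong[OF refl])
    fix i
    have "\<zeta> (\<lambda>z. ?e i (fst z)) = frame_vec ?q k (?e i)" unfolding \<zeta> by (rule tw_vec_pull[OF z se])
    then show "\<zeta> (\<lambda>z. h z $ i * ?e i (fst z)) = h z $ i * frame_vec ?q k (?e i) + ?e i ?q * \<zeta> (\<lambda>z. h z $ i)"
      by (subst Z.T_prod[OF \<zeta>T Z.smcD[OF h] sz]) simp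
  qed
  also have "\<dots> = (\<Sum>i\<in>UNIV. h z $ i * frame_vec ?q k (?e i)) + frame_vec ?q (Z.dv \<zeta> h) (\<lambda>r. \<phi> r $ j)"
    by (simp add: sum.distrib frame_vec_def sum_fun_apply mult.commute)
  also have "(\<Sum>i\<in>UNIV. h z $ i * frame_vec ?q k (?e i)) = frame_vec ?q k (\<lambda>r. \<Sum>i\<in>UNIV. h z $ i * ?e i r)"
    by (subst T_sum[OF q frame_vec_T[OF q]]) (auto intro!: sm_mult q sm_const se simp: T_cmult[OF q frame_vec_T[OF q] se])
  also have "(\<lambda>r. \<Sum>i\<in>UNIV. h z $ i * ?e i r) = (\<lambda>r. frame_vec r (h z) (\<lambda>r. \<phi> r $ j))"
    by (simp add: frame_vec_def sum_fun_apply)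
  finally show ?thesis by simp
qed

text \<open>
  The bracket is determined by its action on the coordinates \<open>\<phi>\<close> and \<open>x\<close>. On \<open>\<phi>\<close> one finds the bracket of the
  projections; the field acts on \<open>x\<close> by \<open>(c - w h) \<times> x\<close>, and the commutator of two such infinitesimal rotations is given
  by the Jacobi identity of the cross product. The derivatives of \<open>w\<close> combine to the curvature.
\<close>

lemma bracket_tw_vec:
  assumes z: "z \<in> UZ" and h: "Z.smc z h" and c: "Z.smc z c" and h': "Z.smc z h'" and c': "Z.smc z c'"
  defines "Y1 \<equiv> \<lambda>z. tw_vec z (h z) (c z)" and "Y2 \<equiv> \<lambda>z. tw_vec z (h' z) (c' z)"
  shows "Z.lb Y1 Y2 z = tw_vec z
     (Z.dv (Y1 z) h' - Z.dv (Y2 z) h + frame_brk (fst z) (h z) (h' z))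
     (Z.dv (Y1 z) c' - Z.dv (Y2 z) c - cross3 (c z) (c' z) + cross3 (sd_op (fst z) (h z)) (c' z)
        - cross3 (sd_op (fst z) (h' z)) (c z) - sd_curv (fst z) (h z) (h' z))" (is "_ = tw_vec z ?H ?C")
proof -
  let ?q = "fst z"
  have q: "?q \<in> U" using UZ_D[OF z] by blast
  have Xv: "Z.vf z Y1" "Z.vf z Y2" unfolding Y1_def Y2_def by (intro tw_vec_vf z h c h' c')+
  have XT: "Y1 z \<in> Z.T z" "Y2 z \<in> Z.T z" using Z.vf_T[OF z] Xv by blast+
  have Xz: "Y1 z = tw_vec z (h z) (c z)" "Y2 z = tw_vec z (h' z) (c' z)" by (simp_all add: Y1_def Y2_def)
  show ?thesis
  proof (rule Z.T_eqI[OF z Z.lb_T[OF z Xv] tw_vec_T[OF z]])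
    fix b :: "(real^4) \<times> (real^3)" assume b: "b \<in> Basis"
    have sb: "Z.sm z (\<lambda>z. \<kappa>Z z \<bullet> b)" by (rule Z.sm_kappa[OF z])
    from b show "Z.lb Y1 Y2 z (\<lambda>z. \<kappa>Z z \<bullet> b) = tw_vec z ?H ?C (\<lambda>z. \<kappa>Z z \<bullet> b)"
    proof (cases rule: Basis43)
      case (1 j)
      let ?f = "\<lambda>r. \<phi> r $ j"
      have e: "(\<lambda>z. \<kappa>Z z \<bullet> b) = (\<lambda>z. ?f (fst z))" by (simp add: 1 \<kappa>Z_def inner_axis)
      have in1: "\<zeta> (\<lambda>w. tw_vec w (k w) (d w) (\<lambda>z. ?f (fst z))) = \<zeta> (\<lambda>w. frame_vec (fst w) (k w) ?f)" if "\<zeta> \<in> Z.T z" for \<zeta> k d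
        by (rule Z.T_cong[OF z that Z.nb_all[OF z]]) (use tw_vec_pull[OF _ sm_phi] UZ_D in blast)
      have "Z.lb Y1 Y2 z (\<lambda>z. ?f (fst z)) = Y1 z (\<lambda>w. frame_vec (fst w) (h' w) ?f) - Y2 z (\<lambda>w. frame_vec (fst w) (h w) ?f)"
      proof -
        have "Y1 z (\<lambda>w. Y2 w (\<lambda>z. ?f (fst z))) = Y1 z (\<lambda>w. frame_vec (fst w) (h' w) ?f)"
          using in1[OF XT(1), of h' c'] unfolding Y2_def .
        moreover have "Y2 z (\<lambda>w. Y1 w (\<lambda>z. ?f (fst z))) = Y2 z (\<lambda>w. frame_vec (fst w) (h w) ?f)"
          using in1[OF XT(2), of h c] unfolding Y1_def .
        ultimately show ?thesis using sb unfolding e by (simp only: Z.lb_apply)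
      qed
      also have "\<dots> = frame_vec ?q (Z.dv (Y1 z) h') ?f + frame_vec ?q (h z) (\<lambda>r. frame_vec r (h' z) ?f)
         - (frame_vec ?q (Z.dv (Y2 z) h) ?f + frame_vec ?q (h' z) (\<lambda>r. frame_vec r (h z) ?f))"
        by (simp add: dv_lin_phi[OF z Xz(1) h'] dv_lin_phi[OF z Xz(2) h])
      also have "\<dots> = frame_vec ?q (Z.dv (Y1 z) h') ?f - frame_vec ?q (Z.dv (Y2 z) h) ?f + lb (\<lambda>r. frame_vec r (h z)) (\<lambda>r. frame_vec r (h' z)) ?q ?f"
        by (simp add: lb_apply sm_phi q)
      also have "\<dots> = frame_vec ?q ?H ?f" by (simp add: lb_lin q frame_vec_add frame_vec_diff)
      also have "\<dots> = tw_vec z ?H ?C (\<lambda>z. ?f (fst z))" by (rule tw_vec_pull[OF z sm_phi[OF q], symmetric])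
      finally show ?thesis unfolding e .
    next
      case (2 a)
      have e: "(\<lambda>z. \<kappa>Z z \<bullet> b) = (\<lambda>z. xz z $ a)" by (simp add: 2 \<kappa>Z_def inner_axis)
      have in2: "\<zeta> (\<lambda>w. tw_vec w (k w) (d w) (\<lambda>z. xz z $ a)) = Z.dv \<zeta> (\<lambda>w. cross3 (d w - sd_op (fst w) (k w)) (xz w)) $ a"
        if "\<zeta> \<in> Z.T z" for \<zeta> k d
        unfolding Z.dv_nth
      proof (rule Z.T_cong[OF z that Z.nb_all[OF z]])
        fix w assume "w \<in> UZ"
        from arg_cong[OF tw_vec_xz[OF this, of "k w" "d w"], of "\<lambda>y. y $ a"]
        show "tw_vec w (k w) (d w) (\<lambda>z. xz z $ a) = cross3 (d w - sd_op (fst w) (k w)) (xz w) $ a" by simp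
      qed
      let ?x = "xz z" and ?w = "sd_op ?q (h z)" and ?w' = "sd_op ?q (h' z)"
      let ?dw' = "sd_op ?q (Z.dv (Y1 z) h') + dv (frame_vec ?q (h z)) (\<lambda>r. sd_op r (h' z))"
        and ?dw = "sd_op ?q (Z.dv (Y2 z) h) + dv (frame_vec ?q (h' z)) (\<lambda>r. sd_op r (h z))"
      have d1: "Z.dv (Y1 z) (\<lambda>w. cross3 (c' w - sd_op (fst w) (h' w)) (xz w)) =
        cross3 (Z.dv (Y1 z) c' - ?dw') ?x + cross3 (c' z - ?w') (cross3 (c z - ?w) ?x)"
        by (simp add: Z.dv_cross[OF z XT(1)] Z.smc_diff z c' Z_smc_sd_op h' Z_smc_xz Z.dv_diff[OF z XT(1)] dv_sd_op[OF z Xz(1) h'] Xz(1)[symmetric] tw_vec_xz[OF z, of "h z" "c z", folded Xz(1)])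
      have d2: "Z.dv (Y2 z) (\<lambda>w. cross3 (c w - sd_op (fst w) (h w)) (xz w)) =
        cross3 (Z.dv (Y2 z) c - ?dw) ?x + cross3 (c z - ?w) (cross3 (c' z - ?w') ?x)"
        by (simp add: Z.dv_cross[OF z XT(2)] Z.smc_diff z c Z_smc_sd_op h Z_smc_xz Z.dv_diff[OF z XT(2)] dv_sd_op[OF z Xz(2) h] Xz(2)[symmetric] tw_vec_xz[OF z, of "h' z" "c' z", folded Xz(2)])
      have J: "cross3 a' (cross3 a ?x) - cross3 a (cross3 a' ?x) = cross3 (cross3 a' a) ?x" for a a'
        by (simp add: vec_eq_iff[where 'b=3] forall_3 cross_components algebra_simps)
      have "Z.lb Y1 Y2 z (\<lambda>z. xz z $ a) = (Z.dv (Y1 z) (\<lambda>w. cross3 (c' w - sd_op (fst w) (h' w)) (xz w))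
         - Z.dv (Y2 z) (\<lambda>w. cross3 (c w - sd_op (fst w) (h w)) (xz w))) $ a"
      proof -
        have "Y1 z (\<lambda>w. Y2 w (\<lambda>z. xz z $ a)) = Z.dv (Y1 z) (\<lambda>w. cross3 (c' w - sd_op (fst w) (h' w)) (xz w)) $ a"
          using in2[OF XT(1), of h' c'] unfolding Y2_def .
        moreover have "Y2 z (\<lambda>w. Y1 w (\<lambda>z. xz z $ a)) = Z.dv (Y2 z) (\<lambda>w. cross3 (c w - sd_op (fst w) (h w)) (xz w)) $ a"
          using in2[OF XT(2), of h c] unfolding Y1_def .
        ultimately show ?thesis using sb unfolding e by (simp only: Z.lb_apply vector_minus_component)
      qed
      also have "\<dots> = cross3 (?C - sd_op ?q ?H) ?x $ a"
      proof -
        have "Z.dv (Y1 z) (\<lambda>w. cross3 (c' w - sd_op (fst w) (h' w)) (xz w)) - Z.dv (Y2 z) (\<lambda>w. cross3 (c w - sd_op (fst w) (h w)) (xz w))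
          = cross3 (Z.dv (Y1 z) c' - ?dw') ?x - cross3 (Z.dv (Y2 z) c - ?dw) ?x + cross3 (cross3 (c' z - ?w') (c z - ?w)) ?x"
          unfolding d1 d2 J[symmetric] by simp
        also have "\<dots> = cross3 ((Z.dv (Y1 z) c' - ?dw') - (Z.dv (Y2 z) c - ?dw) + cross3 (c' z - ?w') (c z - ?w)) ?x"
          by (simp add: cross_add_left Cross3.left_diff_distrib)
        also have "(Z.dv (Y1 z) c' - ?dw') - (Z.dv (Y2 z) c - ?dw) + cross3 (c' z - ?w') (c z - ?w) = ?C - sd_op ?q ?H"
          unfolding sd_curv_def
          by (simp add: sd_op_simps q Cross3.left_diff_distrib Cross3.right_diff_distrib
             cross_skew[of "c' z" "c z"] cross_skew[of "c' z" "?w"] cross_skew[of ?w' ?w])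
        finally show ?thesis by simp
      qed
      also have "\<dots> = tw_vec z ?H ?C (\<lambda>z. xz z $ a)"
        using arg_cong[OF tw_vec_xz[OF z, of ?H ?C], of "\<lambda>y. y $ a"] by simp
      finally show ?thesis unfolding e .
    qed
  qed
qed

end

section \<open>The Nijenhuis tensor\<close>

text \<open>
  The horizontal components \<open>H1\<close>, ..., \<open>H4\<close> of the four brackets in the Nijenhuis tensor, written with the
  connection form \<open>omega\<close> and the torsion. The commutator of \<open>omega\<close> with \<open>K\<close> cancels against the motion of \<open>x\<close> under
  horizontal transport, and only the torsion survives.
\<close>

lemma horizontal_identity:
  fixes omega torsion_form frame_brk :: "real^4 \<Rightarrow> real^4 \<Rightarrow> real^4" and w :: "real^4 \<Rightarrow> real^3"
    and x c c' :: "real^3" and h h' e1 e2 e3 e4 :: "real^4"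
  assumes x: "x \<bullet> x = 1"
    and b: "\<And>u v. frame_brk u v = omega u v - omega v u - torsion_form u v"
    and o: "\<And>u v. omega u (Kop x v) = Kop x (omega u v) + Kop (cross3 (w u) x) v"
  defines "K \<equiv> Kop x"
  defines "H1 \<equiv> (Kop (cross3 (cross3 x c - w (K h)) x) h' + K e1) - (Kop (cross3 (cross3 x c' - w (K h')) x) h + K e2) + frame_brk (K h) (K h')"
    and "H2 \<equiv> e3 - e4 + frame_brk h h'"
    and "H3 \<equiv> e1 - (Kop (cross3 (c' - w h') x) h + K e4) + frame_brk (K h) h'"
    and "H4 \<equiv> (Kop (cross3 (c - w h) x) h' + K e3) - e2 + frame_brk h (K h')"
  shows "H1 - H2 - K H3 - K H4 = torsion_form h h' - torsion_form (K h) (K h') + K (torsion_form (K h) h') + K (torsion_form h (K h'))"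
proof -
  have KK: "Kop x (Kop x v) = - v" for v by (simp add: Kop_Kop x Kop_lin)
  have Kc: "Kop x (Kop (cross3 c x) v) = Kop (cross3 (cross3 x c) x) v" for c v
  proof -
    have "cross3 x (cross3 c x) = cross3 (cross3 x c) x" by (simp add: vec3 algebra_simps)
    then show ?thesis by (simp add: Kop_Kop dot_cross_self)
  qed
  show ?thesis
    unfolding H1_def H2_def H3_def H4_def K_def b o Cross3.left_diff_distrib Kop_lin KK Kc by simp
qed

context framed_connection
begin

lemma vel_diff: "vel (v - w) = vel v - vel w"
  by (simp add: vel_def scaleR_left_diff_distrib sum_subtractf)

lemma tw_vec_diff: assumes z: "z \<in> UZ" shows "tw_vec z h c - tw_vec z h' c' = tw_vec z (h - h') (c - c')"
proof (rule Z.is_dir_unique[OF z Z.is_dir_diff[OF z tw_vec_dir[OF z] tw_vec_dir[OF z]]])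
  have q: "fst z \<in> U" using UZ_D[OF z] by blast
  have "cross3 (c - c' - (sd_op (fst z) h - sd_op (fst z) h')) (xz z) =
     cross3 (c - sd_op (fst z) h) (xz z) - cross3 (c' - sd_op (fst z) h') (xz z)"
    by (simp add: Cross3.left_diff_distrib)
  then show "Z.is_dir z ((vel (frame_vec (fst z) h), cross3 (c - sd_op (fst z) h) (xz z)) - (vel (frame_vec (fst z) h'), cross3 (c' - sd_op (fst z) h') (xz z))) (tw_vec z (h - h') (c - c'))"
    using tw_vec_dir[OF z, of "h - h'" "c - c'"] by (simp add: frame_vec_diff vel_diff sd_op_simps q)
qed

definition torsion_form :: "'a \<Rightarrow> real^4 \<Rightarrow> real^4 \<Rightarrow> real^4" where
  "torsion_form q u v = coords q (torsion A D (\<lambda>r. frame_vec r u) (\<lambda>r. frame_vec r v) q)"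

lemma frame_brk_eq: assumes q: "q \<in> U"
  shows "frame_brk q u v = conn_form q (frame_vec q u) v - conn_form q (frame_vec q v) u - torsion_form q u v"
proof -
  note L = frame_vec_const_vf[OF q] and LT = frame_vec_T[OF q]
  have D: "D q (frame_vec q u) (\<lambda>r. frame_vec r v) \<in> T q" for u v by (rule D_T[OF q LT L])
  have c: "coords q (D q (frame_vec q u) (\<lambda>r. frame_vec r v)) = conn_form q (frame_vec q u) v" for u v
    using coords_D_lin[OF q LT, of "\<lambda>r. v" u] by (simp add: q T_const[OF q LT] vec_eq_iff)
  show ?thesis
    unfolding torsion_form_def torsion_def frame_brk_def
    by (simp add: coords_diff q D lb_T[OF q L L] T_vdiff c)
qed

definition nij_ver :: "'a \<Rightarrow> real^3 \<Rightarrow> real^4 \<Rightarrow> real^4 \<Rightarrow> real^3" where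
  "nij_ver q x u v = sd_curv q (Kop x u) (Kop x v) - sd_curv q u v - cross3 x (sd_curv q (Kop x u) v + sd_curv q u (Kop x v))"

definition nij_hor :: "'a \<Rightarrow> real^3 \<Rightarrow> real^4 \<Rightarrow> real^4 \<Rightarrow> real^4" where
  "nij_hor q x u v = torsion_form q u v - torsion_form q (Kop x u) (Kop x v) + Kop x (torsion_form q (Kop x u) v) + Kop x (torsion_form q u (Kop x v))"

abbreviation nij where "nij \<equiv> nijenhuis (endo_atlas A) (twistor_space A g) (ahs_structure A g D)"

text \<open>
  The almost complex structure turns the pair \<open>(h, c)\<close> into \<open>(Kop x h, x \<times> c)\<close>, so all four brackets are instances of
  \<open>bracket_tw_vec\<close>. The vertical part is stated through \<open>C \<times> x\<close>, since \<open>C\<close> itself is determined only up to multiples of \<open>x\<close>.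
\<close>

lemma nijenhuis_tw_vec:
  assumes z: "z \<in> UZ" and h: "Z.smc z h" and c: "Z.smc z c" and h': "Z.smc z h'" and c': "Z.smc z c'"
    and n: "Z.nb z (\<lambda>w. tw_vec w (h w) (c w) = Y w)" and n': "Z.nb z (\<lambda>w. tw_vec w (h' w) (c' w) = Y' w)"
  shows "\<exists>C. nij Y Y' z = tw_vec z (nij_hor (fst z) (xz z) (h z) (h' z)) C \<and>
     cross3 C (xz z) = - cross3 (nij_ver (fst z) (xz z) (h z) (h' z)) (xz z)"
proof -
  let ?q = "fst z" and ?x = "xz z" and ?J = "ahs_structure A g D"
  have q: "?q \<in> U" and x: "?x \<bullet> ?x = 1" using UZ_D[OF z] by auto
  note sx = Z_smc_xz[OF z]
  define jh where "jh w = Kop (xz w) (h w)" for w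
  define jc where "jc w = cross3 (xz w) (c w)" for w
  define jh' where "jh' w = Kop (xz w) (h' w)" for w
  define jc' where "jc' w = cross3 (xz w) (c' w)" for w
  have sj: "Z.smc z jh" "Z.smc z jc" "Z.smc z jh'" "Z.smc z jc'"
    unfolding jh_def[abs_def] jc_def[abs_def] jh'_def[abs_def] jc'_def[abs_def]
    by (intro Z.smc_Kop Z.smc_cross z sx h c h' c')+
  have nj: "Z.nb z (\<lambda>w. tw_vec w (jh w) (jc w) = ?J w (Y w))"
    by (rule Z.nb_mono[OF z n]) (metis ahs_tw_vec jh_def jc_def)
  have nj': "Z.nb z (\<lambda>w. tw_vec w (jh' w) (jc' w) = ?J w (Y' w))"
    by (rule Z.nb_mono[OF z n']) (metis ahs_tw_vec jh'_def jc'_def)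
  let ?X = "\<lambda>w. tw_vec w (h w) (c w)" and ?X' = "\<lambda>w. tw_vec w (h' w) (c' w)"
    and ?JX = "\<lambda>w. tw_vec w (jh w) (jc w)" and ?JX' = "\<lambda>w. tw_vec w (jh' w) (jc' w)"
  note V = tw_vec_vf[OF z h c] tw_vec_vf[OF z h' c'] tw_vec_vf[OF z sj(1,2)] tw_vec_vf[OF z sj(3,4)]
  note VT = Z.vf_T[OF z V(1)] Z.vf_T[OF z V(2)] Z.vf_T[OF z V(3)] Z.vf_T[OF z V(4)]
  have N: "nij Y Y' z = Z.lb ?JX ?JX' z - Z.lb ?X ?X' z - ?J z (Z.lb ?JX ?X' z) - ?J z (Z.lb ?X ?JX' z)"
    unfolding nijenhuis_def
    by (simp only: Z.lb_cong[OF z V(3,4) nj nj'] Z.lb_cong[OF z V(1,2) n n'] Z.lb_cong[OF z V(3,2) nj n'] Z.lb_cong[OF z V(1,4) n nj'])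
  have dK: "Z.dv (tw_vec z k d) jh = Kop (cross3 (d - sd_op ?q k) ?x) (h z) + Kop ?x (Z.dv (tw_vec z k d) h)"
    "Z.dv (tw_vec z k d) jh' = Kop (cross3 (d - sd_op ?q k) ?x) (h' z) + Kop ?x (Z.dv (tw_vec z k d) h')" for k d
    unfolding jh_def[abs_def] jh'_def[abs_def]
    by (simp_all add: Z.dv_Kop[OF z tw_vec_T[OF z] sx] h h' tw_vec_xz[OF z])
  have dC: "Z.dv (tw_vec z k d) jc = cross3 (cross3 (d - sd_op ?q k) ?x) (c z) + cross3 ?x (Z.dv (tw_vec z k d) c)"
    "Z.dv (tw_vec z k d) jc' = cross3 (cross3 (d - sd_op ?q k) ?x) (c' z) + cross3 ?x (Z.dv (tw_vec z k d) c')" for k d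
    unfolding jc_def[abs_def] jc'_def[abs_def]
    by (simp_all add: Z.dv_cross[OF z tw_vec_T[OF z] sx] c c' tw_vec_xz[OF z])
  have jz: "jh z = Kop ?x (h z)" "jc z = cross3 ?x (c z)" "jh' z = Kop ?x (h' z)" "jc' z = cross3 ?x (c' z)"
    by (simp_all add: jh_def jc_def jh'_def jc'_def)
  note B1 = bracket_tw_vec[OF z sj, unfolded dK dC, unfolded jz]
  note B2 = bracket_tw_vec[OF z h c h' c']
  note B3 = bracket_tw_vec[OF z sj(1,2) h' c', unfolded dK dC, unfolded jz]
  note B4 = bracket_tw_vec[OF z h c sj(3,4), unfolded dK dC, unfolded jz]
  have hor: "\<And>e1 e2 e3 e4. (Kop (cross3 (cross3 ?x (c z) - sd_op ?q (Kop ?x (h z))) ?x) (h' z) + Kop ?x e1 -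
        (Kop (cross3 (cross3 ?x (c' z) - sd_op ?q (Kop ?x (h' z))) ?x) (h z) + Kop ?x e2) +
        frame_brk ?q (Kop ?x (h z)) (Kop ?x (h' z))) - (e3 - e4 + frame_brk ?q (h z) (h' z)) -
        Kop ?x (e1 - (Kop (cross3 (c' z - sd_op ?q (h' z)) ?x) (h z) + Kop ?x e4) + frame_brk ?q (Kop ?x (h z)) (h' z)) -
        Kop ?x (Kop (cross3 (c z - sd_op ?q (h z)) ?x) (h' z) + Kop ?x e3 - e2 + frame_brk ?q (h z) (Kop ?x (h' z)))
      = nij_hor ?q ?x (h z) (h' z)"
    unfolding nij_hor_def
    by (rule horizontal_identity[OF x, where omega = "\<lambda>u v. conn_form ?q (frame_vec ?q u) v" and w = "sd_op ?q"])
      (simp_all add: frame_brk_eq q conn_form_Kop frame_vec_T sd_op_def)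
  show ?thesis
    unfolding N B1 B2 B3 B4 ahs_tw_vec[OF z] tw_vec_diff[OF z] hor
    by (rule exI, rule conjI, rule refl, subst vertical_identity[OF x], simp add: nij_ver_def)
qed

text \<open>
  By \<open>nijenhuis_tw_vec\<close> the value of the Nijenhuis tensor depends only on the horizontal parts at \<open>z\<close>, so fields with
  constant \<open>h\<close> and with \<open>c = 0\<close> suffice to test it.
\<close>

lemma nij_zero: assumes z: "z \<in> UZ"
  shows "(\<forall>Y Y'. Z.vf z Y \<and> Z.vf z Y' \<longrightarrow> nij Y Y' z = 0) \<longleftrightarrow>
     (\<forall>u v. nij_hor (fst z) (xz z) u v = 0 \<and> cross3 (nij_ver (fst z) (xz z) u v) (xz z) = 0)"
proof -
  have f0: "tw_vec z h c = 0 \<longleftrightarrow> h = 0 \<and> cross3 c (xz z) = 0" for h c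
  proof -
    have "tw_vec z 0 0 = 0" using tw_vec_diff[OF z, of 0 0 0 0] by simp
    then show ?thesis using tw_vec_eq_iff[OF z, of h c 0 0] by simp
  qed
  show ?thesis
  proof
    assume L: "\<forall>Y Y'. Z.vf z Y \<and> Z.vf z Y' \<longrightarrow> nij Y Y' z = 0"
    show "\<forall>u v. nij_hor (fst z) (xz z) u v = 0 \<and> cross3 (nij_ver (fst z) (xz z) u v) (xz z) = 0"
    proof (intro allI)
      fix u v
      note s = Z.smc_const[OF z]
      have n: "Z.nb z (\<lambda>w. tw_vec w k 0 = tw_vec w k 0)" for k by (rule Z.nb_all[OF z]) simp
      obtain C where "nij (\<lambda>w. tw_vec w u 0) (\<lambda>w. tw_vec w v 0) z = tw_vec z (nij_hor (fst z) (xz z) u v) C"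
        "cross3 C (xz z) = - cross3 (nij_ver (fst z) (xz z) u v) (xz z)"
        using nijenhuis_tw_vec[OF z s s s s n n] by blast
      moreover have "nij (\<lambda>w. tw_vec w u 0) (\<lambda>w. tw_vec w v 0) z = 0"
        using L tw_vec_vf[OF z s s] by blast
      ultimately show "nij_hor (fst z) (xz z) u v = 0 \<and> cross3 (nij_ver (fst z) (xz z) u v) (xz z) = 0"
        using f0 by simp
    qed
  next
    assume R: "\<forall>u v. nij_hor (fst z) (xz z) u v = 0 \<and> cross3 (nij_ver (fst z) (xz z) u v) (xz z) = 0"
    show "\<forall>Y Y'. Z.vf z Y \<and> Z.vf z Y' \<longrightarrow> nij Y Y' z = 0"
    proof (intro allI impI)
      fix Y Y' assume Y: "Z.vf z Y \<and> Z.vf z Y'"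
      obtain h c where hc: "Z.smc z h" "Z.smc z c" "Z.nb z (\<lambda>z. tw_vec z (h z) (c z) = Y z)"
        by (rule vf_tw_vec[OF z conjunct1[OF Y]])
      obtain h' c' where hc': "Z.smc z h'" "Z.smc z c'" "Z.nb z (\<lambda>z. tw_vec z (h' z) (c' z) = Y' z)"
        by (rule vf_tw_vec[OF z conjunct2[OF Y]])
      from nijenhuis_tw_vec[OF z hc(1,2) hc'(1,2) hc(3) hc'(3)] R f0
      show "nij Y Y' z = 0" by auto
    qed
  qed
qed

lemma conn_form_linear_left: assumes q: "q \<in> U" shows "linear (\<lambda>u. conn_form q (frame_vec q u) v)"
proof (rule linearI)
  fix u w c
  show "conn_form q (frame_vec q (u + w)) v = conn_form q (frame_vec q u) v + conn_form q (frame_vec q w) v"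
    using conn_form_linv[OF q frame_vec_T[OF q] frame_vec_T[OF q], of 1 u 1 w v] by (simp add: frame_vec_add fscale_1)
  show "conn_form q (frame_vec q (c *\<^sub>R u)) v = c *\<^sub>R conn_form q (frame_vec q u) v"
    using conn_form_linv[OF q frame_vec_T[OF q] frame_vec_T[OF q], of c u 0 u v] by (simp add: frame_vec_scale fscale_0)
qed

lemma frame_brk_linear_left: assumes q: "q \<in> U" shows "linear (\<lambda>u. frame_brk q u v)"
proof -
  have "(\<lambda>u. frame_brk q u v) = (\<lambda>u. - frame_brk q v u)" using frame_brk_sk[OF q] by blast
  then show ?thesis using linear_compose_neg[OF frame_brk_linear[OF q]] by simp
qed

lemma torsion_form_alt: assumes q: "q \<in> U" shows "torsion_form q u v = conn_form q (frame_vec q u) v - conn_form q (frame_vec q v) u - frame_brk q u v"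
  using frame_brk_eq[OF q, of u v] by simp

lemma torsion_form_linear: assumes q: "q \<in> U" shows "linear (\<lambda>u. torsion_form q u v)" "linear (torsion_form q u)"
proof -
  have 1: "(\<lambda>u. torsion_form q u v) = (\<lambda>u. conn_form q (frame_vec q u) v - conn_form q (frame_vec q v) u - frame_brk q u v)"
    using torsion_form_alt[OF q] by blast
  show "linear (\<lambda>u. torsion_form q u v)" unfolding 1
    by (intro linear_compose_sub conn_form_linear_left conn_form_linear frame_brk_linear_left q)
  have 2: "torsion_form q u = (\<lambda>v. conn_form q (frame_vec q u) v - conn_form q (frame_vec q v) u - frame_brk q u v)"
    using torsion_form_alt[OF q] by blast
  show "linear (torsion_form q u)" unfolding 2
    by (intro linear_compose_sub conn_form_linear_left conn_form_linear frame_brk_linear q)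
qed

lemma torsion_form_skew: assumes q: "q \<in> U" and sk: "skew_symmetric_torsion A g D"
  shows "torsion_form q u v \<bullet> w = - (torsion_form q v u \<bullet> w)" "torsion_form q u v \<bullet> w = - (torsion_form q u w \<bullet> v)"
proof -
  note L = frame_vec_const_vf[OF q] and LT = frame_vec_T[OF q]
  have D: "D q (frame_vec q u) (\<lambda>r. frame_vec r v) \<in> T q" for u v by (rule D_T[OF q LT L])
  have tT: "torsion A D (\<lambda>r. frame_vec r u) (\<lambda>r. frame_vec r v) q \<in> T q" for u v
    unfolding torsion_def by (intro T_vdiff D lb_T[OF q L L])
  have e: "g q (torsion A D (\<lambda>r. frame_vec r u) (\<lambda>r. frame_vec r v) q) (frame_vec q w) = torsion_form q u v \<bullet> w" for u v w
    by (simp add: g_coords q tT LT coords_lin torsion_form_def)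
  have "g q (torsion A D (\<lambda>r. frame_vec r u) (\<lambda>r. frame_vec r v) q) (frame_vec q w) = - g q (torsion A D (\<lambda>r. frame_vec r v) (\<lambda>r. frame_vec r u) q) (frame_vec q w)
    \<and> g q (torsion A D (\<lambda>r. frame_vec r u) (\<lambda>r. frame_vec r v) q) (frame_vec q w) = - g q (torsion A D (\<lambda>r. frame_vec r u) (\<lambda>r. frame_vec r w) q) (frame_vec q v)"
    using sk[unfolded skew_symmetric_torsion_def, rule_format, OF pts[OF q]] L by blast
  then show "torsion_form q u v \<bullet> w = - (torsion_form q v u \<bullet> w)" "torsion_form q u v \<bullet> w = - (torsion_form q u w \<bullet> v)"
    unfolding e by auto
qed

text \<open>
  The horizontal part of the Nijenhuis tensor vanishes identically by \<open>triple_form_type\<close>, and the vertical part is tested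
  for all \<open>x\<close> on the sphere over \<open>q\<close> by \<open>curv_cond_iff\<close>.
\<close>

lemma integrable_at: assumes q: "q \<in> U" and sk: "skew_symmetric_torsion A g D"
  shows "(\<forall>J. (q, J) \<in> twistor_space A g \<longrightarrow> (\<forall>Y Y'. Z.vf (q, J) Y \<and> Z.vf (q, J) Y' \<longrightarrow> nij Y Y' (q, J) = 0))
     \<longleftrightarrow> curv_cond (\<lambda>i j. sd_curv q (axis i 1) (axis j 1))"
proof -
  have mem: "(q, J) \<in> twistor_space A g \<longleftrightarrow> (\<exists>x. x \<bullet> x = 1 \<and> J = sd_endo q x)" for J
    using fibre_iff[OF q] pts[OF q] by (auto simp: twistor_space_def)
  have "(\<forall>J. (q, J) \<in> twistor_space A g \<longrightarrow> (\<forall>Y Y'. Z.vf (q, J) Y \<and> Z.vf (q, J) Y' \<longrightarrow> nij Y Y' (q, J) = 0))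
    \<longleftrightarrow> (\<forall>x. x \<bullet> x = 1 \<longrightarrow> (\<forall>Y Y'. Z.vf (q, sd_endo q x) Y \<and> Z.vf (q, sd_endo q x) Y' \<longrightarrow> nij Y Y' (q, sd_endo q x) = 0))"
    unfolding mem by blast
  also have "\<dots> \<longleftrightarrow> (\<forall>x. x \<bullet> x = 1 \<longrightarrow> (\<forall>u v. cross3 (nij_ver q x u v) x = 0))"
  proof -
    have h0: "nij_hor q x u v = 0" if "x \<bullet> x = 1" for x u v
      unfolding nij_hor_def by (rule triple_form_type[OF torsion_form_linear[OF q] torsion_form_skew[OF q sk] that])
    show ?thesis using nij_zero[OF sd_endo_UZ[OF q]] h0 by (simp add: sd_coords_sd_endo q)
  qed
  also have "\<dots> \<longleftrightarrow> curv_cond (\<lambda>i j. sd_curv q (axis i 1) (axis j 1))"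
    unfolding nij_ver_def by (rule curv_cond_iff[OF sd_curv_linear_left[OF q] sd_curv_linear[OF q] sd_curv_sk[OF q]])
  finally show ?thesis .
qed

end

section \<open>The Levi-Civita connection\<close>

context framed_connection
begin

lemma dv_lin_phi_M: assumes q: "q \<in> U" and v: "v \<in> T q" and h: "smc q h"
  shows "v (\<lambda>r. frame_vec r (h r) (\<lambda>r. \<phi> r $ j)) = frame_vec q (dv v h) (\<lambda>r. \<phi> r $ j) + v (\<lambda>r. frame_vec r (h q) (\<lambda>r. \<phi> r $ j))"
proof -
  let ?e = "\<lambda>i q. E i q (\<lambda>r. \<phi> r $ j)"
  have se: "sm q (?e i)" for i by (intro vf_sm[OF E_vf] q sm_phi)
  have "v (\<lambda>r. frame_vec r (h r) (\<lambda>r. \<phi> r $ j)) = v (\<lambda>r. \<Sum>i\<in>UNIV. h r $ i * ?e i r)"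
    by (simp add: frame_vec_def sum_fun_apply)
  also have "\<dots> = (\<Sum>i\<in>UNIV. v (\<lambda>r. h r $ i * ?e i r))"
    by (rule T_sum[OF q v]) (intro sm_mult q smcD[OF h] se)
  also have "\<dots> = (\<Sum>i\<in>UNIV. h q $ i * v (?e i) + ?e i q * v (\<lambda>r. h r $ i))"
    by (simp add: T_prod[OF v smcD[OF h] se])
  also have "\<dots> = (\<Sum>i\<in>UNIV. h q $ i * v (?e i)) + frame_vec q (dv v h) (\<lambda>r. \<phi> r $ j)"
    by (simp add: sum.distrib frame_vec_def sum_fun_apply mult.commute)
  also have "(\<Sum>i\<in>UNIV. h q $ i * v (?e i)) = v (\<lambda>r. \<Sum>i\<in>UNIV. h q $ i * ?e i r)"
    by (subst T_sum[OF q v]) (auto intro!: sm_mult q sm_const se simp: T_cmult[OF q v se])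
  also have "(\<lambda>r. \<Sum>i\<in>UNIV. h q $ i * ?e i r) = (\<lambda>r. frame_vec r (h q) (\<lambda>r. \<phi> r $ j))"
    by (simp add: frame_vec_def sum_fun_apply)
  finally show ?thesis by simp
qed

lemma coords_smc: "q \<in> U \<Longrightarrow> vf q Y \<Longrightarrow> smc q (\<lambda>r. coords r (Y r))" by (simp add: smc_def coords_sm)

lemma frame_vec_smc_vf: "q \<in> U \<Longrightarrow> smc q f \<Longrightarrow> vf q (\<lambda>r. frame_vec r (f r))" by (intro frame_vec_vf smcD)

lemma lb_lin_fields: assumes q: "q \<in> U" and f: "smc q f" and k: "smc q k"
  shows "coords q (lb (\<lambda>r. frame_vec r (f r)) (\<lambda>r. frame_vec r (k r)) q) =
    dv (frame_vec q (f q)) k - dv (frame_vec q (k q)) f + frame_brk q (f q) (k q)" (is "coords q ?L = ?R")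
proof -
  note V = frame_vec_smc_vf[OF q f] frame_vec_smc_vf[OF q k]
  have "?L = frame_vec q ?R"
  proof (rule T_eqI4[OF q lb_T[OF q V] frame_vec_T[OF q]])
    fix j
    have "frame_vec q (frame_brk q (f q) (k q)) (\<lambda>r. \<phi> r $ j) = lb (\<lambda>r. frame_vec r (f q)) (\<lambda>r. frame_vec r (k q)) q (\<lambda>r. \<phi> r $ j)"
      by (simp add: lb_lin q)
    then show "?L (\<lambda>r. \<phi> r $ j) = frame_vec q ?R (\<lambda>r. \<phi> r $ j)"
      by (simp add: lb_apply sm_phi q dv_lin_phi_M[OF q frame_vec_T[OF q]] f k frame_vec_add frame_vec_diff)
  qed
  then show ?thesis by (simp add: coords_lin q)
qed

lemma coords_lb: assumes q: "q \<in> U" and Y: "vf q Y" and Z: "vf q Z"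
  shows "coords q (lb Y Z q) = dv (Y q) (\<lambda>r. coords r (Z r)) - dv (Z q) (\<lambda>r. coords r (Y r)) + frame_brk q (coords q (Y q)) (coords q (Z q))"
proof -
  have n: "nb q (\<lambda>r. V r = frame_vec r (coords r (V r)))" if "vf q V" for V
    by (rule nb_mono[OF q vf_nbT[OF that]]) (simp add: frame_vec_coords)
  have "lb Y Z q = lb (\<lambda>r. frame_vec r (coords r (Y r))) (\<lambda>r. frame_vec r (coords r (Z r))) q"
    by (rule lb_cong[OF q Y Z n[OF Y] n[OF Z]])
  then show ?thesis using lb_lin_fields[OF q coords_smc[OF q Y] coords_smc[OF q Z]] frame_vec_coords[OF q vf_T[OF q Y]] frame_vec_coords[OF q vf_T[OF q Z]]
    by simp
qed

lemma coords_D': "q \<in> U \<Longrightarrow> v \<in> T q \<Longrightarrow> vf q Y \<Longrightarrow> coords q (D q v Y) = dv v (\<lambda>r. coords r (Y r)) + conn_form q v (coords q (Y q))"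
  by (simp add: coords_D dv_def)

lemma torsion_T: assumes q: "q \<in> U" and Y: "vf q Y" and Z: "vf q Z" shows "torsion A D Y Z q \<in> T q"
  unfolding torsion_def by (intro T_vdiff D_T q vf_T Y Z lb_T)

lemma torsion_torsion_form: assumes q: "q \<in> U" and Y: "vf q Y" and Z: "vf q Z"
  shows "coords q (torsion A D Y Z q) = torsion_form q (coords q (Y q)) (coords q (Z q))"
proof -
  note YT = vf_T[OF q Y] and ZT = vf_T[OF q Z]
  have "coords q (torsion A D Y Z q) = coords q (D q (Y q) Z) - coords q (D q (Z q) Y) - coords q (lb Y Z q)"
    unfolding torsion_def by (simp add: coords_diff q T_vdiff D_T YT ZT Y Z lb_T)
  also have "\<dots> = conn_form q (Y q) (coords q (Z q)) - conn_form q (Z q) (coords q (Y q)) - frame_brk q (coords q (Y q)) (coords q (Z q))"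
    by (simp add: coords_D' coords_lb q YT ZT Y Z)
  also have "\<dots> = torsion_form q (coords q (Y q)) (coords q (Z q))" by (simp add: torsion_form_alt q frame_vec_coords YT ZT)
  finally show ?thesis .
qed

lemma torsion_vf: assumes q: "q \<in> U" and Y: "vf q Y" and Z: "vf q Z" shows "vf q (torsion A D Y Z)"
proof -
  have e: "torsion A D Y Z = (\<lambda>r. D r (Y r) Z - D r (Z r) Y - lb Y Z r)" by (simp add: torsion_def fun_eq_iff)
  show ?thesis unfolding e by (intro vf_diff D_vf lb_vf q Y Z)
qed

end

text \<open>
  The torsion is a tensor but is given as an operator on fields; in \<open>half_torsion_connection\<close> the direction \<open>v\<close>
  therefore has to be extended to some field.
\<close>

definition vext :: "'a atlas4 \<Rightarrow> 'a \<Rightarrow> 'a tvec \<Rightarrow> 'a \<Rightarrow> 'a tvec" where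
  "vext A p v = (SOME V. vfield_at A p V \<and> V p = v)"

text \<open>
  Since the torsion \<open>T\<close> is totally skew-symmetric, \<open>D - T / 2\<close> is again metric, and it is torsion-free because
  \<open>T\<close> is skew in its first two arguments. So the Levi-Civita connection exists without a separate construction.
\<close>

definition half_torsion_connection :: "'a atlas4 \<Rightarrow> 'a connection \<Rightarrow> 'a connection" where
  "half_torsion_connection A D p v Y = D p v Y - (1/2) *\<^sub>F torsion A D (vext A p v) Y p"

context framed_connection
begin

lemma vext: "q \<in> U \<Longrightarrow> v \<in> T q \<Longrightarrow> vf q (vext A q v) \<and> vext A q v q = v"
  unfolding vext_def by (rule someI_ex[OF vf_ext])

abbreviation "half_conn \<equiv> half_torsion_connection A D"

lemma half_conn_T: "q \<in> U \<Longrightarrow> v \<in> T q \<Longrightarrow> vf q Y \<Longrightarrow> half_conn q v Y \<in> T q"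
  unfolding half_torsion_connection_def using vext by (intro T_vdiff T_vscale D_T torsion_T) auto

lemma coords_half_conn: assumes q: "q \<in> U" and v: "v \<in> T q" and Y: "vf q Y"
  shows "coords q (half_conn q v Y) = coords q (D q v Y) - (1/2) *\<^sub>R torsion_form q (coords q v) (coords q (Y q))"
proof -
  have V: "vf q (vext A q v)" "vext A q v q = v" using vext[OF q v] by auto
  show ?thesis unfolding half_torsion_connection_def
    by (simp add: coords_diff coords_scale q D_T v Y T_vscale torsion_T V torsion_torsion_form)
qed

lemma half_conn_field: assumes q: "q \<in> U" and Y: "vf q Y" and Z: "vf q Z"
  shows "half_conn q (Y q) Z = D q (Y q) Z - (1/2) *\<^sub>F torsion A D Y Z q"
proof (rule coords_inj[OF q half_conn_T[OF q vf_T[OF q Y] Z]])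
  show "D q (Y q) Z - (1/2) *\<^sub>F torsion A D Y Z q \<in> T q"
    by (intro T_vdiff T_vscale D_T torsion_T q vf_T Y Z)
  show "coords q (half_conn q (Y q) Z) = coords q (D q (Y q) Z - (1/2) *\<^sub>F torsion A D Y Z q)"
    by (simp add: coords_half_conn q vf_T Y Z coords_diff coords_scale D_T T_vscale torsion_T torsion_torsion_form)
qed

lemma half_conn_at: assumes q: "q \<in> U" and sk: "skew_symmetric_torsion A g D"
  shows "(\<forall>v\<in>T q. \<forall>Y. vf q Y \<longrightarrow> half_conn q v Y \<in> T q) \<and>
     (\<forall>Y. vf q Y \<longrightarrow> linear_map_on (T q) (\<lambda>v. half_conn q v Y)) \<and>
     (\<forall>v\<in>T q. \<forall>Y Z. vf q Y \<and> vf q Z \<longrightarrow> half_conn q v (\<lambda>q. Y q + Z q) = half_conn q v Y + half_conn q v Z) \<and>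
     (\<forall>v\<in>T q. \<forall>f Y. sm q f \<and> vf q Y \<longrightarrow> half_conn q v (\<lambda>q. f q *\<^sub>F Y q) = v f *\<^sub>F Y q + f q *\<^sub>F half_conn q v Y) \<and>
     (\<forall>Y Z. vf q Y \<and> vf q Z \<longrightarrow> vf q (\<lambda>q. half_conn q (Y q) Z))"
    "\<forall>v\<in>T q. \<forall>Y Z. vf q Y \<and> vf q Z \<longrightarrow> v (\<lambda>q. g q (Y q) (Z q)) = g q (half_conn q v Y) (Z q) + g q (Y q) (half_conn q v Z)"
    "\<forall>Y Z. vf q Y \<and> vf q Z \<longrightarrow> torsion A half_conn Y Z q = 0"
proof -
  note tl = torsion_form_linear[OF q] and ts = torsion_form_skew[OF q sk]
  have tadd: "torsion_form q u (v + w) = torsion_form q u v + torsion_form q u w" "torsion_form q u (c *\<^sub>R v) = c *\<^sub>R torsion_form q u v"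
    "torsion_form q (u + v) w = torsion_form q u w + torsion_form q v w" "torsion_form q (c *\<^sub>R u) w = c *\<^sub>R torsion_form q u w" for u v w c
    using linear_add[OF tl(2)] linear_scale[OF tl(2)] linear_add[OF tl(1)] linear_scale[OF tl(1)] by auto
  have tsk: "torsion_form q u v = - torsion_form q v u" for u v using ts(1) by (metis inner_minus_left vector_eq_rdot)
  show "(\<forall>v\<in>T q. \<forall>Y. vf q Y \<longrightarrow> half_conn q v Y \<in> T q) \<and>
     (\<forall>Y. vf q Y \<longrightarrow> linear_map_on (T q) (\<lambda>v. half_conn q v Y)) \<and>
     (\<forall>v\<in>T q. \<forall>Y Z. vf q Y \<and> vf q Z \<longrightarrow> half_conn q v (\<lambda>q. Y q + Z q) = half_conn q v Y + half_conn q v Z) \<and>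
     (\<forall>v\<in>T q. \<forall>f Y. sm q f \<and> vf q Y \<longrightarrow> half_conn q v (\<lambda>q. f q *\<^sub>F Y q) = v f *\<^sub>F Y q + f q *\<^sub>F half_conn q v Y) \<and>
     (\<forall>Y Z. vf q Y \<and> vf q Z \<longrightarrow> vf q (\<lambda>q. half_conn q (Y q) Z))"
  proof (intro conjI ballI allI impI)
    fix v Y assume "v \<in> T q" "vf q Y" then show "half_conn q v Y \<in> T q" by (rule half_conn_T[OF q])
  next
    fix Y assume Y: "vf q Y"
    show "linear_map_on (T q) (\<lambda>v. half_conn q v Y)" unfolding linear_map_on_def
    proof (intro ballI allI)
      fix u v a b assume uv: "u \<in> T q" "v \<in> T q"
      have w: "a *\<^sub>F u + b *\<^sub>F v \<in> T q" by (intro T_intros uv)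
      show "half_conn q (a *\<^sub>F u + b *\<^sub>F v) Y = a *\<^sub>F half_conn q u Y + b *\<^sub>F half_conn q v Y"
        by (rule coords_inj[OF q half_conn_T[OF q w Y]])
          (auto intro!: T_intros half_conn_T q uv Y simp: coords_half_conn w uv Y q coords_add coords_scale T_intros half_conn_T D_linv D_T tadd scaleR_right_diff_distrib scaleR_right_distrib mult.commute)
    qed
  next
    fix v Y Z assume v: "v \<in> T q" and YZ: "vf q Y \<and> vf q Z"
    then have Y: "vf q Y" and Z: "vf q Z" by auto
    note W = vf_add[OF q Y Z]
    show "half_conn q v (\<lambda>q. Y q + Z q) = half_conn q v Y + half_conn q v Z"
      by (rule coords_inj[OF q half_conn_T[OF q v W] T_vadd[OF half_conn_T[OF q v Y] half_conn_T[OF q v Z]]])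
        (simp add: coords_half_conn q v W Y Z D_add coords_add D_T half_conn_T vf_T tadd scaleR_right_distrib)
  next
    fix v f Y assume v: "v \<in> T q" and fY: "sm q f \<and> vf q Y"
    then have f: "sm q f" and Y: "vf q Y" by auto
    note W = vf_scale[OF q f Y] and YT = vf_T[OF q Y]
    show "half_conn q v (\<lambda>q. f q *\<^sub>F Y q) = v f *\<^sub>F Y q + f q *\<^sub>F half_conn q v Y"
      by (rule coords_inj[OF q half_conn_T[OF q v W] T_vadd[OF T_vscale[OF YT] T_vscale[OF half_conn_T[OF q v Y]]]])
        (simp add: coords_half_conn q v W Y D_leib f coords_add coords_scale T_vscale D_T half_conn_T YT tadd scaleR_right_diff_distrib mult.commute)
  next
    fix Y Z assume "vf q Y \<and> vf q Z"
    then have Y: "vf q Y" and Z: "vf q Z" by auto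
    have s: "vf q (\<lambda>r. D r (Y r) Z - (1/2) *\<^sub>F torsion A D Y Z r)"
      by (intro vf_diff vf_scale D_vf sm_const q Y Z torsion_vf)
    show "vf q (\<lambda>r. half_conn r (Y r) Z)"
      by (rule vf_cong[OF q s nb_mono2[OF q vf_nb[OF q Y] vf_nb[OF q Z]]]) (rule half_conn_field[symmetric])
  qed
  show "\<forall>v\<in>T q. \<forall>Y Z. vf q Y \<and> vf q Z \<longrightarrow> v (\<lambda>q. g q (Y q) (Z q)) = g q (half_conn q v Y) (Z q) + g q (Y q) (half_conn q v Z)"
  proof (intro ballI allI impI)
    fix v Y Z assume v: "v \<in> T q" and YZ: "vf q Y \<and> vf q Z"
    then have Y: "vf q Y" and Z: "vf q Z" by auto
    note YT = vf_T[OF q Y] and ZT = vf_T[OF q Z]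
    have "torsion_form q (coords q v) (coords q (Y q)) \<bullet> coords q (Z q) + coords q (Y q) \<bullet> torsion_form q (coords q v) (coords q (Z q)) = 0"
      using ts(2)[of "coords q v" "coords q (Y q)" "coords q (Z q)"] by (simp add: inner_commute)
    then show "v (\<lambda>q. g q (Y q) (Z q)) = g q (half_conn q v Y) (Z q) + g q (Y q) (half_conn q v Z)"
      unfolding D_metric[OF q v Y Z]
      by (simp add: g_coords q D_T v Y Z YT ZT half_conn_T coords_half_conn inner_diff_left inner_diff_right)
  qed
  show "\<forall>Y Z. vf q Y \<and> vf q Z \<longrightarrow> torsion A half_conn Y Z q = 0"
  proof (intro allI impI)
    fix Y Z assume "vf q Y \<and> vf q Z"
    then have Y: "vf q Y" and Z: "vf q Z" by auto
    note YT = vf_T[OF q Y] and ZT = vf_T[OF q Z]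
    have "coords q (torsion A half_conn Y Z q) = coords q (D q (Y q) Z) - (1/2) *\<^sub>R torsion_form q (coords q (Y q)) (coords q (Z q))
       - (coords q (D q (Z q) Y) - (1/2) *\<^sub>R torsion_form q (coords q (Z q)) (coords q (Y q))) - coords q (lb Y Z q)"
      unfolding torsion_def by (simp add: coords_diff q T_vdiff half_conn_T YT ZT Y Z lb_T coords_half_conn)
    also have "\<dots> = coords q (torsion A D Y Z q) - torsion_form q (coords q (Y q)) (coords q (Z q))"
      unfolding torsion_def tsk[of "coords q (Z q)" "coords q (Y q)"]
      by (simp add: coords_diff q T_vdiff D_T YT ZT Y Z lb_T scaleR_left_distrib[symmetric])
    also have "\<dots> = 0" by (simp add: torsion_torsion_form q Y Z)
    finally have "coords q (torsion A half_conn Y Z q) = coords q 0" by (simp add: coords_zero q)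
    moreover have "torsion A half_conn Y Z q \<in> T q" unfolding torsion_def by (intro T_vdiff half_conn_T q YT ZT Y Z lb_T)
    ultimately show "torsion A half_conn Y Z q = 0" using coords_inj[OF q _ T_vzero] by blast
  qed
qed

end

text \<open>
  The Levi-Civita connection is a Hilbert choice, hence all that is known about it follows from the existence of one candidate.
\<close>

lemma levi_civita_exists:
  assumes "oriented_manifold X A" "riemannian_metric A g" "metric_connection A g D" "skew_symmetric_torsion A g D"
  shows "metric_connection A g (levi_civita A g) \<and>
     (\<forall>p\<in>points A. \<forall>Y Z. vfield_at A p Y \<and> vfield_at A p Z \<longrightarrow> torsion A (levi_civita A g) Y Z p = 0)"
  unfolding levi_civita_def
proof (rule someI[where x = "half_torsion_connection A D"], intro conjI ballI)
  have *: "\<exists>U \<phi> E. framed_connection X A U \<phi> g E D \<and> p \<in> U" if p: "p \<in> points A" for p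
  proof -
    obtain U \<phi> E where m: "framed_chart X A U \<phi> g E" "p \<in> U" by (rule framed_chart_ex[OF assms(1,2) p])
    interpret framed_chart X A U \<phi> g E by (rule m(1))
    have "framed_connection X A U \<phi> g E D" by unfold_locales (rule assms(3))
    then show ?thesis using m(2) by blast
  qed
  show "metric_connection A g (half_torsion_connection A D)"
    unfolding metric_connection_def connection_def
  proof (rule conjI, rule ballI)
    fix p assume "p \<in> points A"
    then obtain U \<phi> E where m: "framed_connection X A U \<phi> g E D" "p \<in> U" using * by blast
    show "(\<forall>v\<in>TM A p. \<forall>Y. vfield_at A p Y \<longrightarrow> half_torsion_connection A D p v Y \<in> TM A p) \<and>
     (\<forall>Y. vfield_at A p Y \<longrightarrow> linear_map_on (TM A p) (\<lambda>v. half_torsion_connection A D p v Y)) \<and>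
     (\<forall>v\<in>TM A p. \<forall>Y Z. vfield_at A p Y \<and> vfield_at A p Z \<longrightarrow>
        half_torsion_connection A D p v (\<lambda>q. Y q + Z q) = half_torsion_connection A D p v Y + half_torsion_connection A D p v Z) \<and>
     (\<forall>v\<in>TM A p. \<forall>f Y. smooth_at A p f \<and> vfield_at A p Y \<longrightarrow>
        half_torsion_connection A D p v (\<lambda>q. f q *\<^sub>F Y q) = v f *\<^sub>F Y p + f p *\<^sub>F half_torsion_connection A D p v Y) \<and>
     (\<forall>X Y. vfield_at A p X \<and> vfield_at A p Y \<longrightarrow> vfield_at A p (\<lambda>q. half_torsion_connection A D q (X q) Y))"
      by (rule framed_connection.half_conn_at(1)[OF m assms(4)])
  next
    show "\<forall>p\<in>points A. \<forall>v\<in>TM A p. \<forall>Y Z. vfield_at A p Y \<and> vfield_at A p Z \<longrightarrow>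
        v (\<lambda>q. g q (Y q) (Z q)) = g p (half_torsion_connection A D p v Y) (Z p) + g p (Y p) (half_torsion_connection A D p v Z)"
      using * framed_connection.half_conn_at(2)[OF _ _ assms(4)] by blast
  qed
  fix p assume "p \<in> points A"
  then show "\<forall>Y Z. vfield_at A p Y \<and> vfield_at A p Z \<longrightarrow> torsion A (half_torsion_connection A D) Y Z p = 0"
    using * framed_connection.half_conn_at(3)[OF _ _ assms(4)] by blast
qed

section \<open>Curvature of a metric connection\<close>

text \<open>
  Twice the self-dual part of a skew operator, as in \<open>sd_form\<close>.
\<close>

definition sd_part :: "(real^4 \<Rightarrow> real^4) \<Rightarrow> real^3" where
  "sd_part M = vector [M (axis 1 1) $ 2 + M (axis 3 1) $ 4, M (axis 1 1) $ 3 + M (axis 4 1) $ 2, M (axis 1 1) $ 4 + M (axis 2 1) $ 3]"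

text \<open>
  The projection of the skew operators to their self-dual part is a homomorphism of Lie algebras onto \<open>\<real>\<^sup>3\<close> with the cross product.
\<close>

lemma skew_commutator_cross:
  fixes M N :: "real^4 \<Rightarrow> real^4"
  assumes M: "linear M" "\<And>i j. M (axis i 1) $ j = - (M (axis j 1) $ i)" and N: "linear N" "\<And>i j. N (axis i 1) $ j = - (N (axis j 1) $ i)"
  shows "sd_part (\<lambda>u. M (N u) - N (M u)) = cross3 (sd_part M) (sd_part N)"
proof -
  have e: "L u $ k = (\<Sum>i\<in>UNIV. u $ i * L (axis i 1) $ k)" if "linear L" for L :: "real^4 \<Rightarrow> real^4" and u k
    using arg_cong[OF linear_expand[OF that, of u], of "\<lambda>y. y $ k"] by simp
  have d: "M (axis i 1) $ i = 0" "N (axis i 1) $ i = 0" for i using M(2)[of i i] N(2)[of i i] by auto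
  note s = M(2)[of 2 1] M(2)[of 3 1] M(2)[of 3 2] M(2)[of 4 1] M(2)[of 4 3] M(2)[of 2 4]
     N(2)[of 2 1] N(2)[of 3 1] N(2)[of 3 2] N(2)[of 4 1] N(2)[of 4 3] N(2)[of 2 4]
  have c: "M (N (axis i 1)) $ k = (\<Sum>j\<in>UNIV. N (axis i 1) $ j * M (axis j 1) $ k)"
    "N (M (axis i 1)) $ k = (\<Sum>j\<in>UNIV. M (axis i 1) $ j * N (axis j 1) $ k)" for i k
    by (rule e[OF M(1)], rule e[OF N(1)])
  show ?thesis
    by (simp add: sd_part_def vec_eq_iff[where 'b=3] forall_3 cross_components c sum_4 d s) (simp add: algebra_simps)
qed

context framed_connection
begin

text \<open>
  The connection form with its direction given by components, and \<open>curv_op\<close> below its curvature in the same notation.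
\<close>

definition conn_op :: "'a \<Rightarrow> real^4 \<Rightarrow> real^4 \<Rightarrow> real^4" where "conn_op q u v = conn_form q (frame_vec q u) v"

lemma conn_op_linear: "linear (conn_op q u)" unfolding conn_op_def by (rule conn_form_linear)
lemma conn_op_linear_left: "q \<in> U \<Longrightarrow> linear (\<lambda>u. conn_op q u v)" unfolding conn_op_def by (rule conn_form_linear_left)
lemma conn_op_simps: "q \<in> U \<Longrightarrow> conn_op q (u + v) w = conn_op q u w + conn_op q v w" "q \<in> U \<Longrightarrow> conn_op q (u - v) w = conn_op q u w - conn_op q v w"
  "q \<in> U \<Longrightarrow> conn_op q (c *\<^sub>R u) w = c *\<^sub>R conn_op q u w" "conn_op q u (v + w) = conn_op q u v + conn_op q u w"
  "conn_op q u (v - w) = conn_op q u v - conn_op q u w" "conn_op q u (c *\<^sub>R w) = c *\<^sub>R conn_op q u w" "conn_op q u (- w) = - conn_op q u w"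
  "q \<in> U \<Longrightarrow> conn_op q (- u) w = - conn_op q u w"
  by (simp_all add: linear_add[OF conn_op_linear_left] linear_diff[OF conn_op_linear_left] linear_scale[OF conn_op_linear_left] linear_neg[OF conn_op_linear_left]
    linear_add[OF conn_op_linear] linear_diff[OF conn_op_linear] linear_scale[OF conn_op_linear] linear_neg[OF conn_op_linear])
lemma conn_op_skew: "q \<in> U \<Longrightarrow> conn_op q u v \<bullet> w = - (v \<bullet> conn_op q u w)"
  unfolding conn_op_def by (rule conn_form_skew[OF _ frame_vec_T])
lemma conn_form_conn_op: "q \<in> U \<Longrightarrow> v \<in> T q \<Longrightarrow> conn_form q v u = conn_op q (coords q v) u" by (simp add: conn_op_def frame_vec_coords)

lemma conn_op_expand: assumes q: "q \<in> U"
  shows "conn_op q u v = (\<Sum>i\<in>UNIV. \<Sum>j\<in>UNIV. (u $ i * v $ j) *\<^sub>R conn_op q (axis i 1) (axis j 1))"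
proof -
  have "conn_op q u v = (\<Sum>i\<in>UNIV. u $ i *\<^sub>R conn_op q (axis i 1) v)" by (rule linear_expand[OF conn_op_linear_left[OF q]])
  also have "\<dots> = (\<Sum>i\<in>UNIV. u $ i *\<^sub>R (\<Sum>j\<in>UNIV. v $ j *\<^sub>R conn_op q (axis i 1) (axis j 1)))"
    by (intro sum.cong refl arg_cong[of _ _ "\<lambda>y. _ *\<^sub>R y"] linear_expand[OF conn_op_linear])
  finally show ?thesis by (simp add: scaleR_sum_right)
qed

lemma conn_op_axis_smc: assumes q: "q \<in> U" shows "smc q (\<lambda>r. conn_op r (axis i 1) (axis j 1))"
  unfolding smc_def conn_op_def frame_vec_axis conn_form_axis by (intro allI coords_sm q D_vf E_vf)

lemma conn_op_smc: assumes q: "q \<in> U" and h: "smc q h" and f: "smc q f" shows "smc q (\<lambda>r. conn_op r (h r) (f r))"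
proof -
  have "smc q (\<lambda>r. \<Sum>i\<in>UNIV. \<Sum>j\<in>UNIV. (h r $ i * f r $ j) *\<^sub>R conn_op r (axis i 1) (axis j 1))"
    by (intro smc_sum smc_scale sm_mult q smcD[OF h] smcD[OF f] conn_op_axis_smc)
  then show ?thesis by (rule smc_cong[OF q nb_all[OF q], rotated]) (rule conn_op_expand[symmetric])
qed

lemma dv_conn_op: assumes q: "q \<in> U" and v: "v \<in> T q" and h: "smc q h" and f: "smc q f"
  shows "dv v (\<lambda>r. conn_op r (h r) (f r)) = conn_op q (dv v h) (f q) + conn_op q (h q) (dv v f) + dv v (\<lambda>r. conn_op r (h q) (f q))"
proof -
  let ?e = "\<lambda>i j r. conn_op r (axis i 1) (axis j 1)"
  have E: "dv v (\<lambda>r. conn_op r (h r) (f r)) = (\<Sum>i\<in>UNIV. \<Sum>j\<in>UNIV.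
      (h q $ i * v (\<lambda>r. f r $ j) + f q $ j * v (\<lambda>r. h r $ i)) *\<^sub>R ?e i j q + (h q $ i * f q $ j) *\<^sub>R dv v (?e i j))"
    if h: "smc q h" and f: "smc q f" for h f
  proof -
    have "dv v (\<lambda>r. conn_op r (h r) (f r)) = dv v (\<lambda>r. \<Sum>i\<in>UNIV. \<Sum>j\<in>UNIV. (h r $ i * f r $ j) *\<^sub>R ?e i j r)"
      by (rule dv_cong[OF q v nb_all[OF q]]) (rule conn_op_expand)
    also have "\<dots> = (\<Sum>i\<in>UNIV. dv v (\<lambda>r. \<Sum>j\<in>UNIV. (h r $ i * f r $ j) *\<^sub>R ?e i j r))"
      by (rule dv_sum[OF q v]) (intro smc_sum smc_scale sm_mult q smcD[OF h] smcD[OF f] conn_op_axis_smc)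
    also have "\<dots> = (\<Sum>i\<in>UNIV. \<Sum>j\<in>UNIV. dv v (\<lambda>r. (h r $ i * f r $ j) *\<^sub>R ?e i j r))"
      by (intro sum.cong refl dv_sum[OF q v] smc_scale sm_mult q smcD[OF h] smcD[OF f] conn_op_axis_smc)
    also have "\<dots> = (\<Sum>i\<in>UNIV. \<Sum>j\<in>UNIV. v (\<lambda>r. h r $ i * f r $ j) *\<^sub>R ?e i j q + (h q $ i * f q $ j) *\<^sub>R dv v (?e i j))"
      by (intro sum.cong refl dv_scale[OF q v] sm_mult q smcD[OF h] smcD[OF f] conn_op_axis_smc)
    finally show ?thesis by (simp add: T_prod[OF v smcD[OF h] smcD[OF f]])
  qed
  have c: "conn_op q (dv v h) (f q) = (\<Sum>i\<in>UNIV. \<Sum>j\<in>UNIV. (v (\<lambda>r. h r $ i) * f q $ j) *\<^sub>R ?e i j q)"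
    "conn_op q (h q) (dv v f) = (\<Sum>i\<in>UNIV. \<Sum>j\<in>UNIV. (h q $ i * v (\<lambda>r. f r $ j)) *\<^sub>R ?e i j q)"
    by (subst conn_op_expand[OF q], simp)+
  have d: "dv v (\<lambda>r. conn_op r (h q) (f q)) = (\<Sum>i\<in>UNIV. \<Sum>j\<in>UNIV. (h q $ i * f q $ j) *\<^sub>R dv v (?e i j))"
    using E[OF smc_const[OF q] smc_const[OF q], of "h q" "f q"] by (simp add: T_const[OF q v])
  show ?thesis unfolding E[OF h f] c d
    by (simp add: sum.distrib scaleR_left_distrib mult.commute add_ac)
qed

definition curv_op :: "'a \<Rightarrow> real^4 \<Rightarrow> real^4 \<Rightarrow> real^4 \<Rightarrow> real^4" where
  "curv_op q h k u = dv (frame_vec q h) (\<lambda>r. conn_op r k u) - dv (frame_vec q k) (\<lambda>r. conn_op r h u)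
     + conn_op q h (conn_op q k u) - conn_op q k (conn_op q h u) - conn_op q (frame_brk q h k) u"

text \<open>
  The curvature is tensorial: second derivatives of the components cancel, and what remains depends on the values of the fields only.
\<close>

lemma curvature_curv_op: assumes q: "q \<in> U" and X: "vf q X1" and Y: "vf q X2" and Z: "vf q X3"
  shows "curvature A D X1 X2 X3 q \<in> T q"
    "coords q (curvature A D X1 X2 X3 q) = curv_op q (coords q (X1 q)) (coords q (X2 q)) (coords q (X3 q))"
proof -
  note XT = vf_T[OF q X] and YT = vf_T[OF q Y] and LT = lb_T[OF q X Y]
  note cX = coords_smc[OF q X] and cY = coords_smc[OF q Y] and cZ = coords_smc[OF q Z]
  show "curvature A D X1 X2 X3 q \<in> T q" unfolding curvature_def
    by (intro T_vdiff D_T q XT YT LT D_vf X Y Z)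
  let ?f = "\<lambda>r. coords r (X3 r)" and ?x = "\<lambda>r. coords r (X1 r)" and ?y = "\<lambda>r. coords r (X2 r)"
  have in1: "coords q (D q v (\<lambda>r. D r (W r) X3)) = dv v (\<lambda>r. dv (W r) ?f) + conn_op q (dv v (\<lambda>r. coords r (W r))) (?f q) + conn_op q (coords q (W q)) (dv v ?f)
      + dv v (\<lambda>r. conn_op r (coords q (W q)) (?f q)) + conn_op q (coords q v) (dv (W q) ?f + conn_op q (coords q (W q)) (?f q))"
    if v: "v \<in> T q" and W: "vf q W" for v W
  proof -
    have n: "nb q (\<lambda>r. coords r (D r (W r) X3) = dv (W r) ?f + conn_op r (coords r (W r)) (?f r))"
      by (rule nb_mono2[OF q vf_nb[OF q W] vf_nb[OF q Z]]) (simp add: coords_D' vf_T conn_form_conn_op)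
    have s: "smc q (\<lambda>r. dv (W r) ?f)" by (simp add: smc_def vf_sm[OF W] smcD[OF cZ])
    have e: "coords q (D q (W q) X3) = dv (W q) ?f + conn_op q (coords q (W q)) (?f q)" by (rule nb_at[OF q n])
    have "coords q (D q v (\<lambda>r. D r (W r) X3)) = dv v (\<lambda>r. coords r (D r (W r) X3)) + conn_form q v (coords q (D q (W q) X3))"
      by (rule coords_D'[OF q v D_vf[OF q W Z]])
    also have "dv v (\<lambda>r. coords r (D r (W r) X3)) = dv v (\<lambda>r. dv (W r) ?f + conn_op r (coords r (W r)) (?f r))"
      by (rule dv_cong[OF q v n])
    also have "\<dots> = dv v (\<lambda>r. dv (W r) ?f) + dv v (\<lambda>r. conn_op r (coords r (W r)) (?f r))"
      by (rule dv_add[OF q v s conn_op_smc[OF q coords_smc[OF q W] cZ]])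
    finally show ?thesis unfolding e dv_conn_op[OF q v coords_smc[OF q W] cZ] conn_form_conn_op[OF q v] by simp
  qed
  have l: "dv (lb X1 X2 q) ?f = dv (X1 q) (\<lambda>r. dv (X2 r) ?f) - dv (X2 q) (\<lambda>r. dv (X1 r) ?f)"
    by (simp add: vec_eq_iff lb_apply smcD[OF cZ])
  have in2: "coords q (D q (lb X1 X2 q) X3) = dv (X1 q) (\<lambda>r. dv (X2 r) ?f) - dv (X2 q) (\<lambda>r. dv (X1 r) ?f)
     + conn_op q (dv (X1 q) ?y - dv (X2 q) ?x + frame_brk q (?x q) (?y q)) (?f q)"
    by (simp add: coords_D' q LT Z conn_form_conn_op coords_lb[OF q X Y] l)
  have "coords q (curvature A D X1 X2 X3 q) = coords q (D q (X1 q) (\<lambda>r. D r (X2 r) X3)) - coords q (D q (X2 q) (\<lambda>r. D r (X1 r) X3)) - coords q (D q (lb X1 X2 q) X3)"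
    unfolding curvature_def by (simp add: coords_diff q T_vdiff D_T XT YT LT D_vf X Y Z)
  also have "\<dots> = curv_op q (?x q) (?y q) (?f q)"
    unfolding in1[OF XT Y] in1[OF YT X] in2 curv_op_def frame_vec_coords[OF q XT] frame_vec_coords[OF q YT]
    by (simp add: conn_op_simps q)
  finally show "coords q (curvature A D X1 X2 X3 q) = curv_op q (?x q) (?y q) (?f q)" .
qed

lemma curv_op_skew1: assumes q: "q \<in> U" shows "curv_op q h k u = - curv_op q k h u"
  unfolding curv_op_def using frame_brk_sk[OF q, of h k] by (simp add: conn_op_simps q)

lemma curv_op_skew2: assumes q: "q \<in> U" shows "curv_op q h k u \<bullet> w = - (u \<bullet> curv_op q h k w)"
proof -
  note c = smc_const[OF q] and L = frame_vec_T[OF q]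
  have d: "dv (frame_vec q h) (\<lambda>r. conn_op r k u) \<bullet> w = - (u \<bullet> dv (frame_vec q h) (\<lambda>r. conn_op r k w))" for h k
  proof -
    have so: "smc q (\<lambda>r. conn_op r k u)" for u by (rule conn_op_smc[OF q c c])
    have "frame_vec q h (\<lambda>r. conn_op r k u \<bullet> w) = frame_vec q h (\<lambda>r. - (u \<bullet> conn_op r k w))"
      by (rule T_cong[OF q L nb_all[OF q]]) (rule conn_op_skew)
    also have "\<dots> = - frame_vec q h (\<lambda>r. u \<bullet> conn_op r k w)"
    proof (rule T_minus[OF q L])
      show "sm q (\<lambda>r. u \<bullet> conn_op r k w)" unfolding inner_vec_def inner_real_def
        by (intro sm_sum sm_mult sm_const q smcD[OF so])
    qed
    finally show ?thesis
      by (simp add: T_inner[OF q L so c] T_inner[OF q L c so] dv_const[OF q L])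
  qed
  have o: "conn_op q h (conn_op q k u) \<bullet> w = u \<bullet> conn_op q k (conn_op q h w)" for h k by (simp add: conn_op_skew q)
  show ?thesis unfolding curv_op_def
    by (simp add: inner_add_left inner_diff_left inner_add_right inner_diff_right d o conn_op_skew[OF q, of "frame_brk q h k"])
qed

lemma curv_op_linear: assumes q: "q \<in> U" shows "linear (curv_op q h k)" "linear (\<lambda>k. curv_op q h k u)" "linear (\<lambda>h. curv_op q h k u)"
proof -
  note c = smc_const[OF q] and L = frame_vec_T[OF q]
  have so: "smc q (\<lambda>r. conn_op r k u)" for k u by (rule conn_op_smc[OF q c c])
  have n: "nb q P" if "\<And>r. r \<in> U \<Longrightarrow> P r" for P by (rule nb_all[OF q that])
  have d1: "dv (frame_vec q h) (\<lambda>r. conn_op r k u + conn_op r k w) = dv (frame_vec q h) (\<lambda>r. conn_op r k u) + dv (frame_vec q h) (\<lambda>r. conn_op r k w)"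
    "dv (frame_vec q h) (\<lambda>r. a *\<^sub>R conn_op r k u) = a *\<^sub>R dv (frame_vec q h) (\<lambda>r. conn_op r k u)" for h k u w a
    by (simp_all add: dv_add[OF q L so so] dv_scale[OF q L sm_const[OF q] so] T_const[OF q L])
  show "linear (curv_op q h k)"
    by (rule linearI) (simp_all add: curv_op_def d1 conn_op_simps algebra_simps)
  have d2: "dv (frame_vec q h) (\<lambda>r. conn_op r (u + w) k) = dv (frame_vec q h) (\<lambda>r. conn_op r u k) + dv (frame_vec q h) (\<lambda>r. conn_op r w k)"
    for h k u w
    using dv_cong[OF q L n, of "\<lambda>r. conn_op r (u + w) k" "\<lambda>r. conn_op r u k + conn_op r w k" h]
    by (simp add: conn_op_simps dv_add[OF q L so so])
  have d3: "dv (frame_vec q h) (\<lambda>r. conn_op r (a *\<^sub>R u) k) = a *\<^sub>R dv (frame_vec q h) (\<lambda>r. conn_op r u k)" for h k u a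
    using dv_cong[OF q L n, of "\<lambda>r. conn_op r (a *\<^sub>R u) k" "\<lambda>r. a *\<^sub>R conn_op r u k" h]
    by (simp add: conn_op_simps dv_scale[OF q L sm_const[OF q] so] T_const[OF q L])
  show l2: "linear (\<lambda>k. curv_op q h k u)" for h
    by (rule linearI) (simp_all add: curv_op_def d2 d3 frame_vec_add frame_vec_scale dv_vadd dv_vscale conn_op_simps q linear_add[OF frame_brk_linear[OF q]] linear_scale[OF frame_brk_linear[OF q]] algebra_simps)
  have "(\<lambda>h. curv_op q h k u) = (\<lambda>h. - curv_op q k h u)" using curv_op_skew1[OF q] by blast
  then show "linear (\<lambda>h. curv_op q h k u)" using linear_compose_neg[OF l2] by simp
qed

text \<open>
  The curvature of the bundle of self-dual endomorphisms is the self-dual part of the curvature of the tangent bundle.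
\<close>

lemma curv_op_sd_curv: assumes q: "q \<in> U"
  shows "sd_curv q h k $ 1 = curv_op q h k (axis 1 1) $ 2 + curv_op q h k (axis 3 1) $ 4"
    "sd_curv q h k $ 2 = curv_op q h k (axis 1 1) $ 3 + curv_op q h k (axis 4 1) $ 2"
    "sd_curv q h k $ 3 = curv_op q h k (axis 1 1) $ 4 + curv_op q h k (axis 2 1) $ 3"
proof -
  note c = smc_const[OF q] and L = frame_vec_T[OF q]
  have so: "smc q (\<lambda>r. conn_op r k u)" for k u by (rule conn_op_smc[OF q c c])
  have wn: "sd_op r k = sd_part (conn_op r k)" for r k by (simp add: sd_op_def sd_form_def conn_op_def[abs_def] sd_part_def)
  have sk: "conn_op q k (axis i 1) $ j = - (conn_op q k (axis j 1) $ i)" for k i j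
    using conn_op_skew[OF q, of k "axis i 1" "axis j 1"] by (simp add: inner_axis inner_axis')
  note cr = skew_commutator_cross[OF conn_op_linear sk conn_op_linear sk, of h k, folded wn, symmetric]
  have a: "frame_vec q h (\<lambda>r. conn_op r k u $ i + conn_op r k v $ j) = frame_vec q h (\<lambda>r. conn_op r k u $ i) + frame_vec q h (\<lambda>r. conn_op r k v $ j)" for h k u v i j
    by (rule T_add[OF q L smcD[OF so] smcD[OF so]])
  show "sd_curv q h k $ 1 = curv_op q h k (axis 1 1) $ 2 + curv_op q h k (axis 3 1) $ 4"
    "sd_curv q h k $ 2 = curv_op q h k (axis 1 1) $ 3 + curv_op q h k (axis 4 1) $ 2"
    "sd_curv q h k $ 3 = curv_op q h k (axis 1 1) $ 4 + curv_op q h k (axis 2 1) $ 3"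
    unfolding sd_curv_def cr curv_op_def by (simp_all add: wn sd_part_def a)
qed

text \<open>
  Without torsion the bracket of two fields is \<open>D\<^sub>X Y - D\<^sub>Y X\<close>, and the cyclic sum reduces to the Jacobi identity for brackets of frame fields.
\<close>

lemma curv_op_Bianchi: assumes q: "q \<in> U" and tf: "\<And>r Y Z. r \<in> U \<Longrightarrow> vf r Y \<Longrightarrow> vf r Z \<Longrightarrow> torsion A D Y Z r = 0"
  shows "curv_op q h k u + curv_op q k u h + curv_op q u h k = 0"
proof -
  note c = smc_const[OF q] and L = frame_vec_T[OF q] and V = frame_vec_const_vf[OF q]
  have so: "smc q (\<lambda>r. conn_op r k u)" for k u by (rule conn_op_smc[OF q c c])
  have b: "frame_brk r u v = conn_op r u v - conn_op r v u" if r: "r \<in> U" for r u v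
  proof -
    have "torsion_form r u v = 0" unfolding torsion_form_def tf[OF r frame_vec_const_vf[OF r] frame_vec_const_vf[OF r]] by (rule coords_zero[OF r])
    then show ?thesis by (simp add: frame_brk_eq r conn_op_def)
  qed
  have bs: "smc q (\<lambda>r. frame_brk r u v)" for u v
    by (rule smc_cong[OF q nb_all[OF q] smc_diff[OF q so so]]) (rule b[symmetric])
  have db: "dv (frame_vec q h) (\<lambda>r. frame_brk r k u) = dv (frame_vec q h) (\<lambda>r. conn_op r k u) - dv (frame_vec q h) (\<lambda>r. conn_op r u k)" for h k u
  proof -
    have "dv (frame_vec q h) (\<lambda>r. frame_brk r k u) = dv (frame_vec q h) (\<lambda>r. conn_op r k u - conn_op r u k)"
      by (rule dv_cong[OF q L nb_all[OF q]]) (rule b)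
    then show ?thesis by (simp add: dv_diff[OF q L so so])
  qed
  have J: "coords q (lb (\<lambda>r. frame_vec r h) (lb (\<lambda>r. frame_vec r k) (\<lambda>r. frame_vec r u)) q) = dv (frame_vec q h) (\<lambda>r. frame_brk r k u) + frame_brk q h (frame_brk q k u)" for h k u
  proof -
    have "nb q (\<lambda>r. lb (\<lambda>r. frame_vec r k) (\<lambda>r. frame_vec r u) r = frame_vec r (frame_brk r k u))"
      by (rule nb_all[OF q]) (rule lb_lin)
    then have e: "lb (\<lambda>r. frame_vec r h) (lb (\<lambda>r. frame_vec r k) (\<lambda>r. frame_vec r u)) q = lb (\<lambda>r. frame_vec r h) (\<lambda>r. frame_vec r (frame_brk r k u)) q"
      by (intro lb_cong[OF q V lb_vf[OF q V V]] nb_all[OF q]) (simp_all add: lb_lin)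
    have "coords q (lb (\<lambda>r. frame_vec r h) (\<lambda>r. frame_vec r (frame_brk r k u)) q) = dv (frame_vec q h) (\<lambda>r. frame_brk r k u) - dv (frame_vec q (frame_brk q k u)) (\<lambda>r. h) + frame_brk q h (frame_brk q k u)"
      by (rule lb_lin_fields[OF q c bs])
    then show ?thesis by (simp add: e dv_const[OF q L])
  qed
  have "coords q (lb (\<lambda>r. frame_vec r h) (lb (\<lambda>r. frame_vec r k) (\<lambda>r. frame_vec r u)) q + lb (\<lambda>r. frame_vec r k) (lb (\<lambda>r. frame_vec r u) (\<lambda>r. frame_vec r h)) q
      + lb (\<lambda>r. frame_vec r u) (lb (\<lambda>r. frame_vec r h) (\<lambda>r. frame_vec r k)) q) = 0"
    unfolding lb_jacobi[OF q V V V] by (rule coords_zero[OF q])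
  then have "dv (frame_vec q h) (\<lambda>r. frame_brk r k u) + frame_brk q h (frame_brk q k u) + (dv (frame_vec q k) (\<lambda>r. frame_brk r u h) + frame_brk q k (frame_brk q u h))
    + (dv (frame_vec q u) (\<lambda>r. frame_brk r h k) + frame_brk q u (frame_brk q h k)) = 0"
    by (simp add: coords_add q T_vadd lb_T V lb_vf J)
  then show ?thesis unfolding curv_op_def db b[OF q] by (simp add: conn_op_simps q algebra_simps)
qed

end

section \<open>Algebraic curvature tensors in dimension four\<close>

lemma bilinear_expand:
  fixes F :: "real^'n \<Rightarrow> real^'n \<Rightarrow> real"
  assumes "\<And>v. linear (\<lambda>u. F u v)" "\<And>u. linear (F u)"
  shows "F u v = (\<Sum>i\<in>UNIV. \<Sum>j\<in>UNIV. u $ i * v $ j * F (axis i 1) (axis j 1))"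
proof -
  have "F u v = (\<Sum>i\<in>UNIV. u $ i *\<^sub>R F (axis i 1) v)" by (rule linear_expand[OF assms(1)])
  also have "\<dots> = (\<Sum>i\<in>UNIV. u $ i *\<^sub>R (\<Sum>j\<in>UNIV. v $ j *\<^sub>R F (axis i 1) (axis j 1)))"
    by (intro sum.cong refl arg_cong[of _ _ "\<lambda>y. _ *\<^sub>R y"] linear_expand[OF assms(2)])
  finally show ?thesis by (simp add: sum_distrib_left mult.assoc)
qed

lemma skew_bilinear_expand:
  fixes F :: "real^'n \<Rightarrow> real^'n \<Rightarrow> real"
  assumes l: "\<And>v. linear (\<lambda>u. F u v)" "\<And>u. linear (F u)" and s: "F v u = - F u v"
  shows "(\<Sum>i\<in>UNIV. \<Sum>j\<in>UNIV. (u $ i * v $ j - u $ j * v $ i) * F (axis i 1) (axis j 1)) = 2 * F u v"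
proof -
  have "(\<Sum>i\<in>UNIV. \<Sum>j\<in>UNIV. (u $ i * v $ j - u $ j * v $ i) * F (axis i 1) (axis j 1))
    = (\<Sum>i\<in>UNIV. \<Sum>j\<in>UNIV. u $ i * v $ j * F (axis i 1) (axis j 1)) - (\<Sum>i\<in>UNIV. \<Sum>j\<in>UNIV. v $ i * u $ j * F (axis i 1) (axis j 1))"
  proof -
    have "(\<Sum>i\<in>UNIV. \<Sum>j\<in>UNIV. (u $ i * v $ j - u $ j * v $ i) * F (axis i 1) (axis j 1))
      = (\<Sum>i\<in>UNIV. \<Sum>j\<in>UNIV. u $ i * v $ j * F (axis i 1) (axis j 1) - v $ i * u $ j * F (axis i 1) (axis j 1))"
      by (intro sum.cong refl) (simp add: algebra_simps)
    then show ?thesis by (simp only: sum_subtractf)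
  qed
  also have "\<dots> = F u v - F v u" using bilinear_expand[OF l, of u v] bilinear_expand[OF l, of v u] by simp
  finally show ?thesis using s by simp
qed

text \<open>
  The matrix of an orthonormal basis is orthogonal, hence so is its transpose.
\<close>

lemma trace_orthonormal:
  fixes F :: "real^'n \<Rightarrow> real^'n \<Rightarrow> real" and a :: "'n \<Rightarrow> real^'n"
  assumes l: "\<And>v. linear (\<lambda>u. F u v)" "\<And>u. linear (F u)"
    and o: "\<And>i j. a i \<bullet> a j = (if i = j then 1 else 0)"
  shows "(\<Sum>i\<in>UNIV. F (a i) (a i)) = (\<Sum>i\<in>UNIV. F (axis i 1) (axis i 1))"
proof -
  define M where "M = (\<chi> i j. a i $ j)"
  have "M ** transpose M = mat 1"
    using o by (simp add: vec_eq_iff matrix_matrix_mult_def transpose_def mat_def M_def inner_vec_def)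
  then have "transpose M ** M = mat 1" using matrix_left_right_inverse by blast
  then have t: "(\<Sum>i\<in>UNIV. a i $ k * a i $ l) = (if k = l then 1 else 0)" for k l
    by (simp add: vec_eq_iff matrix_matrix_mult_def transpose_def mat_def M_def)
  have "(\<Sum>i\<in>UNIV. F (a i) (a i)) = (\<Sum>i\<in>UNIV. \<Sum>k\<in>UNIV. \<Sum>l\<in>UNIV. a i $ k * a i $ l * F (axis k 1) (axis l 1))"
    by (intro sum.cong refl bilinear_expand[OF l])
  also have "\<dots> = (\<Sum>k\<in>UNIV. \<Sum>i\<in>UNIV. \<Sum>l\<in>UNIV. a i $ k * a i $ l * F (axis k 1) (axis l 1))" by (rule sum.swap)
  also have "\<dots> = (\<Sum>k\<in>UNIV. \<Sum>l\<in>UNIV. \<Sum>i\<in>UNIV. a i $ k * a i $ l * F (axis k 1) (axis l 1))"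
    by (intro sum.cong refl sum.swap)
  also have "\<dots> = (\<Sum>k\<in>UNIV. \<Sum>l\<in>UNIV. (if k = l then 1 else 0) * F (axis k 1) (axis l 1))"
    by (simp only: sum_distrib_right[symmetric] t)
  also have "\<dots> = (\<Sum>k\<in>UNIV. F (axis k 1) (axis k 1))"
    by (intro sum.cong refl) (simp add: if_distrib[of "\<lambda>x. x * _"] cong: if_cong)
  finally show ?thesis .
qed

text \<open>
  The classical octahedron argument: combine the Bianchi identities for the four choices of the index that is kept in the last place.
\<close>

lemma curvature_pair_symmetry:
  fixes R :: "'i \<Rightarrow> 'i \<Rightarrow> 'i \<Rightarrow> 'i \<Rightarrow> real"
  assumes s1: "\<And>i j k l. R i j k l = - R j i k l" and s2: "\<And>i j k l. R i j k l = - R i j l k"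
    and b: "\<And>i j k l. R i j k l + R j k i l + R k i j l = 0"
  shows "R i j k l = R k l i j"
  using b[of i j k l] b[of j k l i] b[of k l i j] b[of l i j k]
    s2[of i j l k] s2[of j k l i] s2[of k l j i] s2[of l i j k]
    s1[of i k l j] s2[of k i l j] s1[of j l i k] s2[of l j i k]
  by linarith

definition weyl_comp :: "(4 \<Rightarrow> 4 \<Rightarrow> 4 \<Rightarrow> 4 \<Rightarrow> real) \<Rightarrow> 4 \<Rightarrow> 4 \<Rightarrow> 4 \<Rightarrow> 4 \<Rightarrow> real" where
  "weyl_comp R i j k l = (let ricci_form = (\<lambda>j k. \<Sum>i\<in>UNIV. R i j k i); \<delta> = (\<lambda>i j::4. if i = j then 1 else 0) in
     R i j k l - 1/2 * (ricci_form j k * \<delta> i l - ricci_form i k * \<delta> j l + \<delta> j k * ricci_form i l - \<delta> i k * ricci_form j l)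
     + (\<Sum>i\<in>UNIV. ricci_form i i) / 6 * (\<delta> j k * \<delta> i l - \<delta> i k * \<delta> j l))"

text \<open>
  Contract the first pair of indices with the self-dual bivectors. The anti-self-dual part of the second pair gives the trace-free Ricci tensor,
  which the Weyl tensor does not contain; the self-dual part gives the symmetric matrix \<open>B\<close> of \<open>curv_cond\<close> minus its trace part. So these
  components of the Weyl tensor vanish if and only if \<open>B\<close> is a multiple of the identity. The proof expresses everything by
  the independent components of \<open>R\<close>, which \<open>f, e, ps, bi\<close> select by the symmetries and the Bianchi identity.
\<close>

lemma weyl_self_dual_iff:
  fixes R :: "4 \<Rightarrow> 4 \<Rightarrow> 4 \<Rightarrow> 4 \<Rightarrow> real"
  assumes s1: "\<And>i j k l. R i j k l = - R j i k l" and s2: "\<And>i j k l. R i j k l = - R i j l k"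
    and b: "\<And>i j k l. R i j k l + R j k i l + R k i j l = 0"
    and W1: "\<And>i j. W i j $ 1 = R i j 1 2 + R i j 3 4"
    and W2: "\<And>i j. W i j $ 2 = R i j 1 3 + R i j 4 2"
    and W3: "\<And>i j. W i j $ 3 = R i j 1 4 + R i j 2 3"
  shows "(\<forall>k l. weyl_comp R 1 2 k l + weyl_comp R 3 4 k l = 0 \<and> weyl_comp R 1 3 k l + weyl_comp R 4 2 k l = 0 \<and>
     weyl_comp R 1 4 k l + weyl_comp R 2 3 k l = 0) \<longleftrightarrow> curv_cond W"
proof -
  have p: "R i j k l = R k l i j" for i j k l by (rule curvature_pair_symmetry[OF s1 s2 b])
  have z: "R i i k l = 0" "R k l i i = 0" for i k l using s1[of i i k l] s2[of k l i i] by auto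
  have f: "R 2 1 k l = - R 1 2 k l" "R 3 1 k l = - R 1 3 k l" "R 4 1 k l = - R 1 4 k l"
    "R 4 3 k l = - R 3 4 k l" "R 2 4 k l = - R 4 2 k l" "R 3 2 k l = - R 2 3 k l" for k l by (rule s1)+
  have e: "R k l 2 1 = - R k l 1 2" "R k l 3 1 = - R k l 1 3" "R k l 4 1 = - R k l 1 4"
    "R k l 4 3 = - R k l 3 4" "R k l 2 4 = - R k l 4 2" "R k l 3 2 = - R k l 2 3" for k l by (rule s2)+
  have ps: "R 1 3 1 2 = R 1 2 1 3" "R 1 4 1 2 = R 1 2 1 4" "R 3 4 1 2 = R 1 2 3 4" "R 4 2 1 2 = R 1 2 4 2" "R 2 3 1 2 = R 1 2 2 3"
    "R 1 4 1 3 = R 1 3 1 4" "R 3 4 1 3 = R 1 3 3 4" "R 4 2 1 3 = R 1 3 4 2" "R 2 3 1 3 = R 1 3 2 3"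
    "R 3 4 1 4 = R 1 4 3 4" "R 4 2 1 4 = R 1 4 4 2" "R 2 3 1 4 = R 1 4 2 3"
    "R 4 2 3 4 = R 3 4 4 2" "R 2 3 3 4 = R 3 4 2 3" "R 2 3 4 2 = R 4 2 2 3" by (rule p)+
  have bi: "R 1 4 2 3 = - R 1 2 3 4 - R 1 3 4 2"
    using b[of 1 2 3 4] by (simp add: f e ps)
  note rules = z f e ps bi
  define ricci_form where "ricci_form j k = (\<Sum>i\<in>UNIV. R i j k i)" for j k
  define scalar_form where "scalar_form = (\<Sum>i\<in>UNIV. ricci_form i i)"
  have w: "weyl_comp R i j k l = R i j k l - 1/2 * (ricci_form j k * (if i = l then 1 else 0) - ricci_form i k * (if j = l then 1 else 0)
      + (if j = k then 1 else 0) * ricci_form i l - (if i = k then 1 else 0) * ricci_form j l)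
     + scalar_form / 6 * ((if j = k then 1 else 0) * (if i = l then 1 else 0) - (if i = k then 1 else 0) * (if j = l then 1 else 0))" for i j k l
    by (simp add: weyl_comp_def Let_def ricci_form_def scalar_form_def)
  have rc: "ricci_form 1 1 = - R 1 2 1 2 - R 1 3 1 3 - R 1 4 1 4" "ricci_form 2 2 = - R 1 2 1 2 - R 2 3 2 3 - R 4 2 4 2"
    "ricci_form 3 3 = - R 1 3 1 3 - R 2 3 2 3 - R 3 4 3 4" "ricci_form 4 4 = - R 1 4 1 4 - R 4 2 4 2 - R 3 4 3 4"
    "ricci_form 1 2 = - R 1 3 2 3 + R 1 4 4 2" "ricci_form 2 1 = - R 1 3 2 3 + R 1 4 4 2"
    "ricci_form 1 3 = R 1 2 2 3 - R 1 4 3 4" "ricci_form 3 1 = R 1 2 2 3 - R 1 4 3 4"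
    "ricci_form 1 4 = - R 1 2 4 2 + R 1 3 3 4" "ricci_form 4 1 = - R 1 2 4 2 + R 1 3 3 4"
    "ricci_form 2 3 = - R 1 2 1 3 + R 3 4 4 2" "ricci_form 3 2 = - R 1 2 1 3 + R 3 4 4 2"
    "ricci_form 2 4 = - R 1 2 1 4 + R 3 4 2 3" "ricci_form 4 2 = - R 1 2 1 4 + R 3 4 2 3"
    "ricci_form 3 4 = - R 1 3 1 4 + R 4 2 2 3" "ricci_form 4 3 = - R 1 3 1 4 + R 4 2 2 3"
    by (simp_all add: ricci_form_def sum_4 rules)
  have sc: "scalar_form = - 2 * (R 1 2 1 2 + R 1 3 1 3 + R 1 4 1 4 + R 2 3 2 3 + R 4 2 4 2 + R 3 4 3 4)"
    by (simp add: scalar_form_def sum_4 rc)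
  have cc: "curv_cond W \<longleftrightarrow>
     R 1 2 1 2 + 2 * R 1 2 3 4 + R 3 4 3 4 = R 1 3 1 3 + 2 * R 1 3 4 2 + R 4 2 4 2 \<and>
     R 1 3 1 3 + 2 * R 1 3 4 2 + R 4 2 4 2 = R 1 4 1 4 + 2 * R 1 4 2 3 + R 2 3 2 3 \<and>
     R 1 2 1 3 + R 1 2 4 2 + R 1 3 3 4 + R 3 4 4 2 = 0 \<and>
     R 1 2 1 4 + R 1 2 2 3 + R 1 4 3 4 + R 3 4 2 3 = 0 \<and>
     R 1 3 1 4 + R 1 3 2 3 + R 1 4 4 2 + R 4 2 2 3 = 0"
    unfolding curv_cond_def Let_def by (simp add: W1 W2 W3 z f e ps) (auto simp: bi)
  have wk: "weyl_comp R i j l k = - weyl_comp R i j k l" for i j k l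
    unfolding w by (simp only: s2[of i j l k]) (simp only: algebra_simps)
  define P where "P k l \<longleftrightarrow> weyl_comp R 1 2 k l + weyl_comp R 3 4 k l = 0 \<and> weyl_comp R 1 3 k l + weyl_comp R 4 2 k l = 0 \<and>
     weyl_comp R 1 4 k l + weyl_comp R 2 3 k l = 0" for k l
  have Psk: "P k l \<Longrightarrow> P l k" for k l
    unfolding P_def wk[of _ _ l k] by linarith
  have Pd: "P k k" for k
    using wk[of _ _ k k] unfolding P_def by simp
  note ev = w rc sc z f e ps bi
  note eqs = P_def[of 1 2, simplified ev, simplified] P_def[of 1 3, simplified ev, simplified] P_def[of 1 4, simplified ev, simplified]
    P_def[of 3 4, simplified ev, simplified] P_def[of 4 2, simplified ev, simplified] P_def[of 2 3, simplified ev, simplified]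
  have "P 1 2 \<and> P 1 3 \<and> P 1 4 \<and> P 3 4 \<and> P 4 2 \<and> P 2 3 \<longleftrightarrow> curv_cond W"
    unfolding cc eqs bi by argo
  moreover have "(\<forall>k l. P k l) \<longleftrightarrow> P 1 2 \<and> P 1 3 \<and> P 1 4 \<and> P 3 4 \<and> P 4 2 \<and> P 2 3"
    unfolding forall_4 using Psk Pd by blast
  ultimately show ?thesis unfolding P_def[symmetric] by blast
qed

text \<open>
  The Hodge star of \<open>a\<^sub>1 \<and> a\<^sub>2\<close> is \<open>a\<^sub>3 \<and> a\<^sub>4\<close> for every oriented orthonormal basis: complementary minors of a rotation agree.
\<close>

lemma cross_minors_orthonormal:
  fixes a :: "4 \<Rightarrow> real^4"
  assumes o: "\<And>i j. a i \<bullet> a j = (if i = j then 1 else 0)" and d: "det (vector [a 1, a 2, a 3, a 4] :: real^4^4) > 0"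
  defines "m \<equiv> \<lambda>i j. a 1 $ i * a 2 $ j - a 1 $ j * a 2 $ i" and "n \<equiv> \<lambda>i j. a 3 $ i * a 4 $ j - a 3 $ j * a 4 $ i"
  shows "n 3 4 = m 1 2" "n 4 2 = m 1 3" "n 2 3 = m 1 4" "n 1 2 = m 3 4" "n 1 3 = m 4 2" "n 1 4 = m 2 3"
proof -
  define M where "M = (\<chi> i j. a i $ j)"
  have Mv: "M = vector [a 1, a 2, a 3, a 4]" by (simp add: M_def vec_eq_iff[where 'b=4] forall_4)
  have MT: "M ** transpose M = mat 1"
    using o by (simp add: vec_eq_iff matrix_matrix_mult_def transpose_def mat_def M_def inner_vec_def)
  then have TM: "transpose M ** M = mat 1" using matrix_left_right_inverse by blast
  have "det M * det M = 1" using arg_cong[OF MT, of det] by (simp add: det_mul det_I)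
  then have "det M = 1 \<or> det M = -1" by (rule square_eq_1_iff[THEN iffD1])
  then have d1: "det M = 1" using d Mv by auto
  define v :: "real^4" where "v = vector [- det (vector [a 1, a 2, a 3, axis 1 1] :: real^4^4), 0, 0, 0]"
  \<comment> \<open>the generalised cross product of the first three vectors, which is \<open>a 4\<close>\<close>
  define c :: "real^4" where "c = (\<chi> k. det (vector [a 1, a 2, a 3, axis k 1] :: real^4^4))"
  have cu: "c \<bullet> u = det (vector [a 1, a 2, a 3, u] :: real^4^4)" for u
    by (simp add: c_def det_4 inner_vec_def sum_4 axis_def algebra_simps)
  have c0: "c \<bullet> a 1 = 0" "c \<bullet> a 2 = 0" "c \<bullet> a 3 = 0" unfolding cu by (simp_all add: det_4 algebra_simps)
  have c1: "c \<bullet> a 4 = 1" using d1 Mv by (simp add: cu)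
  have "M *v c = axis 4 1"
  proof -
    have "(M *v c) $ i = c \<bullet> a i" for i by (simp add: matrix_vector_mult_def M_def inner_vec_def mult.commute)
    then show ?thesis by (simp add: vec_eq_iff[where 'b=4] forall_4 c0 c1 axis_def)
  qed
  then have "transpose M *v (M *v c) = transpose M *v axis 4 1" by simp
  then have "c = transpose M *v axis 4 1" by (simp add: matrix_vector_mul_assoc TM)
  then have a4: "a 4 = c" by (simp add: vec_eq_iff matrix_vector_mult_def transpose_def M_def axis_def if_distrib[of "\<lambda>x. _ * x"] cong: if_cong)
  have cn: "c $ 1 = - (a 3 $ 2 * m 3 4 - a 3 $ 3 * m 2 4 + a 3 $ 4 * m 2 3)" "c $ 2 = a 3 $ 1 * m 3 4 - a 3 $ 3 * m 1 4 + a 3 $ 4 * m 1 3"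
    "c $ 3 = - (a 3 $ 1 * m 2 4 - a 3 $ 2 * m 1 4 + a 3 $ 4 * m 1 2)" "c $ 4 = a 3 $ 1 * m 2 3 - a 3 $ 2 * m 1 3 + a 3 $ 3 * m 1 2"
    by (simp_all add: c_def det_4 axis_def m_def algebra_simps)
  have mo: "(\<Sum>j\<in>UNIV. m i j * a 3 $ j) = 0" for i
  proof -
    have "(\<Sum>j\<in>UNIV. m i j * a 3 $ j) = a 1 $ i * (a 2 \<bullet> a 3) - a 2 $ i * (a 1 \<bullet> a 3)"
      by (simp add: m_def inner_vec_def sum_4 algebra_simps)
    then show ?thesis by (simp add: o)
  qed
  have ms: "m 2 1 = - m 1 2" "m 3 1 = - m 1 3" "m 4 1 = - m 1 4" "m 3 2 = - m 2 3" "m 4 2 = - m 2 4" "m 4 3 = - m 3 4"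
    "m 1 1 = 0" "m 2 2 = 0" "m 3 3 = 0" "m 4 4 = 0" by (simp_all add: m_def)
  have k1: "m 1 2 * a 3 $ 2 + m 1 3 * a 3 $ 3 + m 1 4 * a 3 $ 4 = 0" using mo[of 1] by (simp add: sum_4 ms)
  have k2: "- m 1 2 * a 3 $ 1 + m 2 3 * a 3 $ 3 + m 2 4 * a 3 $ 4 = 0" using mo[of 2] by (simp add: sum_4 ms)
  have k3: "- m 1 3 * a 3 $ 1 - m 2 3 * a 3 $ 2 + m 3 4 * a 3 $ 4 = 0" using mo[of 3] by (simp add: sum_4 ms)
  have k4: "- m 1 4 * a 3 $ 1 - m 2 4 * a 3 $ 2 - m 3 4 * a 3 $ 3 = 0" using mo[of 4] by (simp add: sum_4 ms)
  have nn: "a 3 $ 1 * a 3 $ 1 + a 3 $ 2 * a 3 $ 2 + a 3 $ 3 * a 3 $ 3 + a 3 $ 4 * a 3 $ 4 = 1"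
    using o[of 3 3] by (simp add: inner_vec_def sum_4)
  show "n 3 4 = m 1 2" unfolding n_def a4 cn using k1 k2 k3 k4 nn by algebra
  show "n 4 2 = m 1 3" unfolding n_def a4 cn using k1 k2 k3 k4 nn by algebra
  show "n 2 3 = m 1 4" unfolding n_def a4 cn using k1 k2 k3 k4 nn by algebra
  show "n 1 2 = m 3 4" unfolding n_def a4 cn using k1 k2 k3 k4 nn by algebra
  show "n 1 3 = m 4 2" unfolding n_def a4 cn ms using k1 k2 k3 k4 nn by algebra
  show "n 1 4 = m 2 3" unfolding n_def a4 cn using k1 k2 k3 k4 nn by algebra
qed

section \<open>Ricci and Weyl tensor in a frame\<close>

locale framed_levi_civita = framed_connection X A U \<phi> g E "levi_civita A g" for X A U \<phi> g E +
  assumes tf: "\<And>r Y Z. r \<in> U \<Longrightarrow> vfield_near A (points A) r Y \<Longrightarrow> vfield_near A (points A) r Z \<Longrightarrow>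
    torsion A (levi_civita A g) Y Z r = 0"
begin

definition riem_form :: "'a \<Rightarrow> real^4 \<Rightarrow> real^4 \<Rightarrow> real^4 \<Rightarrow> real^4 \<Rightarrow> real" where "riem_form q x y z w = curv_op q x y z \<bullet> w"

lemma riem_eq: assumes q: "q \<in> U" and v: "x \<in> T q" "y \<in> T q" "z \<in> T q" "w \<in> T q"
  shows "riem A g q x y z w = riem_form q (coords q x) (coords q y) (coords q z) (coords q w)"
proof -
  have k: "g q (curvature A (levi_civita A g) X1 X2 X3 q) w = riem_form q (coords q (X1 q)) (coords q (X2 q)) (coords q (X3 q)) (coords q w)"
    if "vf q X1" "vf q X2" "vf q X3" for X1 X2 X3
    by (simp add: g_coords q curvature_curv_op that v riem_form_def)
  show ?thesis unfolding riem_def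
  proof (rule the_equality)
    obtain X1 X2 X3 where "vf q X1" "X1 q = x" "vf q X2" "X2 q = y" "vf q X3" "X3 q = z"
      using vf_ext[OF q] v by metis
    then show "\<exists>X Y Z. vf q X \<and> vf q Y \<and> vf q Z \<and> X q = x \<and> Y q = y \<and> Z q = z \<and>
      riem_form q (coords q x) (coords q y) (coords q z) (coords q w) = g q (curvature A (levi_civita A g) X Y Z q) w"
      using k by metis
  qed (use k in metis)
qed

lemma riem_form_lin: assumes q: "q \<in> U"
  shows "riem_form q (x + x') y z w = riem_form q x y z w + riem_form q x' y z w" "riem_form q (c *\<^sub>R x) y z w = c * riem_form q x y z w"
    "riem_form q x (y + y') z w = riem_form q x y z w + riem_form q x y' z w" "riem_form q x (c *\<^sub>R y) z w = c * riem_form q x y z w"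
    "riem_form q x y (z + z') w = riem_form q x y z w + riem_form q x y z' w" "riem_form q x y (c *\<^sub>R z) w = c * riem_form q x y z w"
    "riem_form q x y z (w + w') = riem_form q x y z w + riem_form q x y z w'" "riem_form q x y z (c *\<^sub>R w) = c * riem_form q x y z w"
  using linear_add[OF curv_op_linear(1)[OF q]] linear_add[OF curv_op_linear(2)[OF q]] linear_add[OF curv_op_linear(3)[OF q]]
    linear_scale[OF curv_op_linear(1)[OF q]] linear_scale[OF curv_op_linear(2)[OF q]] linear_scale[OF curv_op_linear(3)[OF q]]
  by (simp_all add: riem_form_def inner_add_left inner_add_right)

definition ricci_form :: "'a \<Rightarrow> real^4 \<Rightarrow> real^4 \<Rightarrow> real" where "ricci_form q y z = (\<Sum>i\<in>UNIV. riem_form q (axis i 1) y z (axis i 1))"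

lemma ricci_form_lin: assumes q: "q \<in> U"
  shows "ricci_form q (y + y') z = ricci_form q y z + ricci_form q y' z" "ricci_form q (c *\<^sub>R y) z = c * ricci_form q y z"
    "ricci_form q y (z + z') = ricci_form q y z + ricci_form q y z'" "ricci_form q y (c *\<^sub>R z) = c * ricci_form q y z"
  by (simp_all add: ricci_form_def riem_form_lin q sum.distrib sum_distrib_left)

definition scalar_form :: "'a \<Rightarrow> real" where "scalar_form q = (\<Sum>i\<in>UNIV. ricci_form q (axis i 1) (axis i 1))"

lemma frame_orthonormal: "q \<in> U \<Longrightarrow> orthonormal_at A g q (\<chi> i. E i q)"
  unfolding orthonormal_iff by (simp add: E_T coords_E inner_axis_axis)

lemma ricci_eq: assumes q: "q \<in> U" and v: "y \<in> T q" "z \<in> T q"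
  shows "ricci A g q y z = ricci_form q (coords q y) (coords q z)"
proof -
  have k: "(\<Sum>i\<in>UNIV. riem A g q (e $ i) y z (e $ i)) = ricci_form q (coords q y) (coords q z)" if "orthonormal_at A g q e" for e
  proof -
    have e: "\<And>i. e $ i \<in> T q" and o: "\<And>i j. coords q (e $ i) \<bullet> coords q (e $ j) = (if i = j then 1 else 0)"
      using that unfolding orthonormal_iff[OF q] by auto
    have "(\<Sum>i\<in>UNIV. riem A g q (e $ i) y z (e $ i)) = (\<Sum>i\<in>UNIV. riem_form q (coords q (e $ i)) (coords q y) (coords q z) (coords q (e $ i)))"
      by (simp add: riem_eq q e v)
    also have "\<dots> = ricci_form q (coords q y) (coords q z)" unfolding ricci_form_def
      by (rule trace_orthonormal[where F = "\<lambda>u v. riem_form q u (coords q y) (coords q z) v" and a = "\<lambda>i. coords q (e $ i)", OF _ _ o])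
        (auto intro!: linearI simp: riem_form_lin q)
    finally show ?thesis .
  qed
  show ?thesis unfolding ricci_def
  proof (rule the_equality)
    show "\<exists>e. orthonormal_at A g q e \<and> ricci_form q (coords q y) (coords q z) = (\<Sum>i\<in>UNIV. riem A g q (e $ i) y z (e $ i))"
      using frame_orthonormal[OF q] k[OF frame_orthonormal[OF q], symmetric] by blast
  qed (auto simp: k)
qed

lemma scalar_eq: assumes q: "q \<in> U" shows "scalar_curvature A g q = scalar_form q"
proof -
  have k: "(\<Sum>i\<in>UNIV. ricci A g q (e $ i) (e $ i)) = scalar_form q" if "orthonormal_at A g q e" for e
  proof -
    have e: "\<And>i. e $ i \<in> T q" and o: "\<And>i j. coords q (e $ i) \<bullet> coords q (e $ j) = (if i = j then 1 else 0)"
      using that unfolding orthonormal_iff[OF q] by auto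
    have "(\<Sum>i\<in>UNIV. ricci A g q (e $ i) (e $ i)) = (\<Sum>i\<in>UNIV. ricci_form q (coords q (e $ i)) (coords q (e $ i)))"
      by (simp add: ricci_eq q e)
    also have "\<dots> = scalar_form q" unfolding scalar_form_def
      by (rule trace_orthonormal[where F = "ricci_form q" and a = "\<lambda>i. coords q (e $ i)", OF _ _ o])
        (auto intro!: linearI simp: ricci_form_lin q)
    finally show ?thesis .
  qed
  show ?thesis unfolding scalar_curvature_def
  proof (rule the_equality)
    show "\<exists>e. orthonormal_at A g q e \<and> scalar_form q = (\<Sum>i\<in>UNIV. ricci A g q (e $ i) (e $ i))"
      using frame_orthonormal[OF q] k[OF frame_orthonormal[OF q], symmetric] by blast
  qed (auto simp: k)
qed

definition weyl_form :: "'a \<Rightarrow> real^4 \<Rightarrow> real^4 \<Rightarrow> real^4 \<Rightarrow> real^4 \<Rightarrow> real" where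
  "weyl_form q x y z w = riem_form q x y z w - 1/2 * (ricci_form q y z * (x \<bullet> w) - ricci_form q x z * (y \<bullet> w) + (y \<bullet> z) * ricci_form q x w - (x \<bullet> z) * ricci_form q y w)
     + scalar_form q / 6 * ((y \<bullet> z) * (x \<bullet> w) - (x \<bullet> z) * (y \<bullet> w))"

lemma weyl_eq: assumes q: "q \<in> U" and v: "x \<in> T q" "y \<in> T q" "z \<in> T q" "w \<in> T q"
  shows "weyl A g q x y z w = weyl_form q (coords q x) (coords q y) (coords q z) (coords q w)"
  unfolding weyl_def weyl_form_def by (simp add: riem_eq ricci_eq scalar_eq g_coords q v)

lemma weyl_form_linear: assumes q: "q \<in> U"
  shows "linear (\<lambda>x. weyl_form q x y z w)" "linear (\<lambda>y. weyl_form q x y z w)" "linear (\<lambda>z. weyl_form q x y z w)" "linear (\<lambda>w. weyl_form q x y z w)"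
proof -
  note s = weyl_form_def riem_form_lin ricci_form_lin q inner_add_left inner_add_right algebra_simps
  show "linear (\<lambda>x. weyl_form q x y z w)" by (rule linearI) (simp_all add: s)
  show "linear (\<lambda>y. weyl_form q x y z w)" by (rule linearI) (simp_all add: s)
  show "linear (\<lambda>z. weyl_form q x y z w)" by (rule linearI) (simp_all add: s)
  show "linear (\<lambda>w. weyl_form q x y z w)" by (rule linearI) (simp_all add: s)
qed

lemma weyl_form_skew: assumes q: "q \<in> U" shows "weyl_form q y x z w = - weyl_form q x y z w" "weyl_form q x y w z = - weyl_form q x y z w"
proof -
  have "riem_form q y x z w = - riem_form q x y z w" using curv_op_skew1[OF q, of y x z] by (simp add: riem_form_def)
  then show "weyl_form q y x z w = - weyl_form q x y z w" unfolding weyl_form_def by (simp add: algebra_simps)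
  have "riem_form q x y w z = - riem_form q x y z w" using curv_op_skew2[OF q, of x y w z] by (simp add: riem_form_def inner_commute)
  then show "weyl_form q x y w z = - weyl_form q x y z w" unfolding weyl_form_def by (simp add: algebra_simps)
qed

lemma weyl_form_comp: assumes q: "q \<in> U"
  shows "weyl_form q (axis i 1) (axis j 1) (axis k 1) (axis l 1) = weyl_comp (\<lambda>i j k l. riem_form q (axis i 1) (axis j 1) (axis k 1) (axis l 1)) i j k l"
  unfolding weyl_form_def weyl_comp_def Let_def scalar_form_def ricci_form_def by (simp add: inner_axis_axis)

text \<open>
  The algebraic criterion \<open>weyl_self_dual_iff\<close> applied to the curvature at \<open>q\<close>; its hypotheses \<open>W1\<close>, \<open>W2\<close>, \<open>W3\<close> are
  \<open>curv_op_sd_curv\<close>.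
\<close>

lemma weyl_sd_curv: assumes q: "q \<in> U"
  shows "(\<forall>k l. (let W = (\<lambda>i j. weyl_form q (axis i 1) (axis j 1) (axis k 1) (axis l 1)) in
      W 1 2 + W 3 4 = 0 \<and> W 1 3 + W 4 2 = 0 \<and> W 1 4 + W 2 3 = 0)) \<longleftrightarrow> curv_cond (\<lambda>i j. sd_curv q (axis i 1) (axis j 1))"
proof -
  let ?R = "\<lambda>i j k l. riem_form q (axis i 1) (axis j 1) (axis k 1) (axis l 1)"
  have s1: "?R i j k l = - ?R j i k l" for i j k l
    using curv_op_skew1[OF q, of "axis i 1" "axis j 1" "axis k 1"] by (simp add: riem_form_def)
  have s2: "?R i j k l = - ?R i j l k" for i j k l
    using curv_op_skew2[OF q, of "axis i 1" "axis j 1" "axis k 1" "axis l 1"] by (simp add: riem_form_def inner_commute)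
  have b: "?R i j k l + ?R j k i l + ?R k i j l = 0" for i j k l
    using arg_cong[OF curv_op_Bianchi[OF q tf, of "axis i 1" "axis j 1" "axis k 1"], of "\<lambda>y. y \<bullet> axis l 1"]
    by (simp add: riem_form_def inner_add_left)
  have o: "sd_curv q (axis i 1) (axis j 1) $ 1 = ?R i j 1 2 + ?R i j 3 4"
    "sd_curv q (axis i 1) (axis j 1) $ 2 = ?R i j 1 3 + ?R i j 4 2"
    "sd_curv q (axis i 1) (axis j 1) $ 3 = ?R i j 1 4 + ?R i j 2 3" for i j
    by (simp_all add: curv_op_sd_curv[OF q] riem_form_def inner_axis)
  show ?thesis unfolding weyl_form_comp[OF q] Let_def by (rule weyl_self_dual_iff[OF s1 s2 b o])
qed

end

section \<open>Bivectors\<close>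

lemma sum_lessThan_add: "(\<Sum>i<n+m. f i) = (\<Sum>i<n. f i) + (\<Sum>i<m. f (n + i))" for f :: "nat \<Rightarrow> 'b::comm_monoid_add" and n m :: nat
  by (induction m) (simp_all add: add.assoc)

lemma wedge_scale: "c *\<^sub>F wedge u v = wedge (c *\<^sub>F u) v"
  by (simp add: wedge_def fun_eq_iff algebra_simps)

context framed_chart
begin

abbreviation "BV q \<equiv> bivectors A q"

lemma BV_wedge: assumes "u \<in> T q" "v \<in> T q" shows "wedge u v \<in> BV q"
proof -
  have "wedge u v = (\<Sum>i<(1::nat). wedge u v)" by simp
  then show ?thesis unfolding bivectors_def mem_Collect_eq using assms
    by (intro exI[of _ "1::nat"] exI[of _ "\<lambda>_. u"] exI[of _ "\<lambda>_. v"]) blast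
qed

lemma BV_E: assumes "\<beta> \<in> BV q"
  obtains n :: nat and x y where "\<forall>i<n. x i \<in> T q \<and> y i \<in> T q" "\<beta> = (\<Sum>i<n. wedge (x i) (y i))"
  using assms unfolding bivectors_def by blast

lemma BV_zero: "0 \<in> BV q"
proof -
  show ?thesis unfolding bivectors_def mem_Collect_eq
    by (intro exI[of _ "0::nat"] exI[of _ "\<lambda>_. 0"]) simp
qed

lemma BV_add: assumes "\<beta> \<in> BV q" "\<gamma> \<in> BV q" shows "\<beta> + \<gamma> \<in> BV q"
proof -
  obtain n :: nat and x y where 1: "\<forall>i<n. x i \<in> T q \<and> y i \<in> T q" "\<beta> = (\<Sum>i<n. wedge (x i) (y i))" by (rule BV_E[OF assms(1)])
  obtain m :: nat and z w where 2: "\<forall>i<m. z i \<in> T q \<and> w i \<in> T q" "\<gamma> = (\<Sum>i<m. wedge (z i) (w i))" by (rule BV_E[OF assms(2)])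
  let ?X = "\<lambda>i. if i < n then x i else z (i - n)" and ?Y = "\<lambda>i. if i < n then y i else w (i - n)"
  have "\<beta> + \<gamma> = (\<Sum>i<n+m. wedge (?X i) (?Y i))" unfolding sum_lessThan_add 1(2) 2(2) by simp
  moreover have "\<forall>i<n+m. ?X i \<in> T q \<and> ?Y i \<in> T q" using 1(1) 2(1) by auto
  ultimately show ?thesis unfolding bivectors_def mem_Collect_eq
    by (intro exI[of _ "n+m"] exI[of _ ?X] exI[of _ ?Y] conjI)
qed

lemma BV_sum: "(\<And>i. i \<in> I \<Longrightarrow> \<beta> i \<in> BV q) \<Longrightarrow> (\<Sum>i\<in>I. \<beta> i) \<in> BV q"
  by (induction I rule: infinite_finite_induct) (auto intro: BV_add BV_zero)

lemma BV_scale: assumes "\<beta> \<in> BV q" shows "c *\<^sub>F \<beta> \<in> BV q"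
proof -
  obtain n :: nat and x y where 1: "\<forall>i<n. x i \<in> T q \<and> y i \<in> T q" "\<beta> = (\<Sum>i<n. wedge (x i) (y i))" by (rule BV_E[OF assms])
  have "c *\<^sub>F \<beta> = (\<Sum>i<n. c *\<^sub>F wedge (x i) (y i))"
    by (simp add: 1(2) fun_eq_iff sum_fun_apply sum_distrib_left)
  also have "\<dots> = (\<Sum>i<n. wedge (c *\<^sub>F x i) (y i))" by (simp only: wedge_scale)
  also have "\<dots> \<in> BV q" by (rule BV_sum) (use 1(1) in \<open>auto intro!: BV_wedge T_vscale\<close>)
  finally show ?thesis .
qed

text \<open>
  A function whose differential at \<open>q\<close> is the \<open>i\<close>-th element of the dual frame. Bivectors are functionals on pairs of functions, and
  evaluating them on such functions gives their components (\<open>bivec_matrix\<close>).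
\<close>

definition dual_fun :: "'a \<Rightarrow> 4 \<Rightarrow> 'a \<Rightarrow> real" where
  "dual_fun q i r = (\<Sum>k\<in>UNIV. matrix_inv ((\<chi> j k. E j q (\<lambda>r. \<phi> r $ k)) :: real^4^4) $ k $ i * \<phi> r $ k)"

lemma dual_fun_dual: assumes q: "q \<in> U" and u: "u \<in> T q" shows "u (dual_fun q i) = coords q u $ i"
proof -
  let ?N = "(\<chi> j k. E j q (\<lambda>r. \<phi> r $ k)) :: real^4^4"
  have "invertible ?N" using E_det[OF q] by (simp add: invertible_det_nz)
  then have inv: "?N ** matrix_inv ?N = mat 1" using someI_ex[of "\<lambda>B. ?N ** B = mat 1 \<and> B ** ?N = mat 1"] unfolding matrix_inv_def invertible_def by blast
  have E: "E j q (dual_fun q i) = (if j = i then 1 else 0)" for j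
  proof -
    have "E j q (dual_fun q i) = (\<Sum>k\<in>UNIV. matrix_inv ?N $ k $ i * E j q (\<lambda>r. \<phi> r $ k))"
      unfolding dual_fun_def[abs_def]
      by (subst T_sum[OF q E_T[OF q]]) (auto intro!: sm_mult q sm_const sm_phi simp: T_cmult[OF q E_T[OF q] sm_phi[OF q]])
    also have "\<dots> = (?N ** matrix_inv ?N) $ j $ i" by (simp add: matrix_matrix_mult_def mult.commute)
    finally show ?thesis unfolding inv by (simp add: mat_def)
  qed
  have "u (dual_fun q i) = frame_vec q (coords q u) (dual_fun q i)" by (simp add: frame_vec_coords q u)
  also have "\<dots> = coords q u $ i" by (simp add: frame_vec_def sum_fun_apply E if_distrib[of "\<lambda>x. _ * x"] cong: if_cong)
  finally show ?thesis .
qed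

definition bivec_matrix :: "'a \<Rightarrow> 'a bivec \<Rightarrow> real^4^4" where "bivec_matrix q \<beta> = (\<chi> i j. \<beta> (dual_fun q i, dual_fun q j))"
definition frame_wedge :: "'a \<Rightarrow> 4 \<Rightarrow> 4 \<Rightarrow> 'a bivec" where "frame_wedge q i j = wedge (E i q) (E j q)"
definition matrix_bivec :: "'a \<Rightarrow> real^4^4 \<Rightarrow> 'a bivec" where "matrix_bivec q b = (\<Sum>i\<in>UNIV. \<Sum>j\<in>UNIV. (b $ i $ j / 2) *\<^sub>F frame_wedge q i j)"
text \<open>
  Skew matrices are the components of bivectors: \<open>bivec_matrix\<close> and \<open>matrix_bivec\<close> are inverse to each other between bivectors and skew matrices.
\<close>

definition skew_mat :: "real^4^4 \<Rightarrow> bool" where "skew_mat b \<longleftrightarrow> (\<forall>i j. b $ j $ i = - (b $ i $ j))"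

lemma skew_matD: "skew_mat b \<Longrightarrow> b $ j $ i = - (b $ i $ j)" unfolding skew_mat_def by blast

lemma bivec_matrix_add: "bivec_matrix q (\<beta> + \<gamma>) = bivec_matrix q \<beta> + bivec_matrix q \<gamma>" by (simp add: bivec_matrix_def vec_eq_iff)
lemma bivec_matrix_scale: "bivec_matrix q (c *\<^sub>F \<beta>) = c *\<^sub>R bivec_matrix q \<beta>" by (simp add: bivec_matrix_def vec_eq_iff)
lemma bivec_matrix_sum: "bivec_matrix q (\<Sum>i\<in>I. \<beta> i) = (\<Sum>i\<in>I. bivec_matrix q (\<beta> i))" by (simp add: bivec_matrix_def vec_eq_iff sum_fun_apply)
lemma matrix_bivec_add: "matrix_bivec q (b + c) = matrix_bivec q b + matrix_bivec q c"
  by (simp add: matrix_bivec_def fun_eq_iff sum_fun_apply sum.distrib[symmetric] add_divide_distrib algebra_simps)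
lemma matrix_bivec_scale: "matrix_bivec q (c *\<^sub>R b) = c *\<^sub>F matrix_bivec q b"
  by (simp add: matrix_bivec_def fun_eq_iff sum_fun_apply sum_distrib_left mult.assoc)
lemma matrix_bivec_zero: "matrix_bivec q 0 = 0"
  by (simp add: matrix_bivec_def fun_eq_iff sum_fun_apply)
lemma matrix_bivec_sum: "matrix_bivec q (\<Sum>i\<in>I. b i) = (\<Sum>i\<in>I. matrix_bivec q (b i))"
  by (induction I rule: infinite_finite_induct) (simp_all add: matrix_bivec_add matrix_bivec_zero)

lemma bivec_matrix_wedge: "q \<in> U \<Longrightarrow> u \<in> T q \<Longrightarrow> v \<in> T q \<Longrightarrow>
   bivec_matrix q (wedge u v) = (\<chi> i j. coords q u $ i * coords q v $ j - coords q u $ j * coords q v $ i)"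
  by (simp add: bivec_matrix_def wedge_def dual_fun_dual)

lemma bivec_matrix_frame_wedge: "q \<in> U \<Longrightarrow> bivec_matrix q (frame_wedge q i j) $ k $ l = (if k = i \<and> l = j then 1 else 0) - (if k = j \<and> l = i then 1 else 0)"
proof -
  assume q: "q \<in> U"
  have "bivec_matrix q (frame_wedge q i j) $ k $ l = axis i 1 $ k * axis j 1 $ l - axis j 1 $ k * axis i 1 $ l"
    by (simp only: frame_wedge_def bivec_matrix_wedge[OF q E_T[OF q] E_T[OF q]] coords_E[OF q] vec_lambda_beta mult.commute[of "axis i 1 $ l"])
  moreover have "(if P then 1 else 0) * (if Q then 1 else 0) = (if P \<and> Q then 1 else 0 :: real)" for P Q by simp
  ultimately show ?thesis by (simp only: axis_def vec_lambda_beta)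
qed

lemma frame_wedge_bivec: "q \<in> U \<Longrightarrow> frame_wedge q i j \<in> BV q" unfolding frame_wedge_def by (intro BV_wedge E_T)
lemma matrix_bivec_BV: "q \<in> U \<Longrightarrow> matrix_bivec q b \<in> BV q" unfolding matrix_bivec_def by (intro BV_sum BV_scale frame_wedge_bivec)

lemma wedge_eq_matrix_bivec: assumes q: "q \<in> U" and u: "u \<in> T q" and v: "v \<in> T q"
  shows "wedge u v = matrix_bivec q (bivec_matrix q (wedge u v))"
proof
  fix p :: "('a \<Rightarrow> real) \<times> ('a \<Rightarrow> real)"
  obtain f h where p: "p = (f, h)" by (cases p)
  let ?a = "coords q u" and ?b = "coords q v"
  have l: "w f = (\<Sum>i\<in>UNIV. coords q w $ i * E i q f)" if "w \<in> T q" for w f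
    using arg_cong[OF frame_vec_coords[OF q that], of "\<lambda>w. w f"] by (simp add: frame_vec_def sum_fun_apply)
  have "wedge u v p = (\<Sum>i\<in>UNIV. \<Sum>j\<in>UNIV. ?a $ i * ?b $ j * (E i q f * E j q h - E i q h * E j q f))"
  proof -
    have "wedge u v p = (\<Sum>i\<in>UNIV. ?a $ i * E i q f) * (\<Sum>j\<in>UNIV. ?b $ j * E j q h)
      - (\<Sum>i\<in>UNIV. ?a $ i * E i q h) * (\<Sum>j\<in>UNIV. ?b $ j * E j q f)"
      by (simp only: p wedge_def prod.case l[OF u, symmetric] l[OF v, symmetric])
    also have "\<dots> = (\<Sum>i\<in>UNIV. \<Sum>j\<in>UNIV. (?a $ i * E i q f) * (?b $ j * E j q h) - (?a $ i * E i q h) * (?b $ j * E j q f))"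
      by (simp only: sum_product sum_subtractf)
    also have "\<dots> = (\<Sum>i\<in>UNIV. \<Sum>j\<in>UNIV. ?a $ i * ?b $ j * (E i q f * E j q h - E i q h * E j q f))"
      by (intro sum.cong refl) (simp add: algebra_simps)
    finally show ?thesis .
  qed
  also have "\<dots> = (\<Sum>i\<in>UNIV. \<Sum>j\<in>UNIV. ?a $ i * ?b $ j * frame_wedge q i j p)"
    by (simp add: p frame_wedge_def wedge_def)
  finally have 1: "wedge u v p = (\<Sum>i\<in>UNIV. \<Sum>j\<in>UNIV. ?a $ i * ?b $ j * frame_wedge q i j p)" .
  have "(\<Sum>i\<in>UNIV. \<Sum>j\<in>UNIV. ?a $ j * ?b $ i * frame_wedge q i j p) = (\<Sum>j\<in>UNIV. \<Sum>i\<in>UNIV. ?a $ j * ?b $ i * frame_wedge q i j p)"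
    by (rule sum.swap)
  also have "\<dots> = (\<Sum>j\<in>UNIV. \<Sum>i\<in>UNIV. - (?a $ j * ?b $ i * frame_wedge q j i p))"
    by (intro sum.cong refl) (simp add: p frame_wedge_def wedge_def algebra_simps)
  also have "\<dots> = - wedge u v p" by (simp add: 1 sum_negf)
  finally have 2: "(\<Sum>i\<in>UNIV. \<Sum>j\<in>UNIV. ?a $ j * ?b $ i * frame_wedge q i j p) = - wedge u v p" .
  have "matrix_bivec q (bivec_matrix q (wedge u v)) p = (\<Sum>i\<in>UNIV. \<Sum>j\<in>UNIV. (?a $ i * ?b $ j - ?a $ j * ?b $ i) / 2 * frame_wedge q i j p)"
    by (simp add: matrix_bivec_def bivec_matrix_wedge q u v sum_fun_apply)
  also have "\<dots> = ((\<Sum>i\<in>UNIV. \<Sum>j\<in>UNIV. ?a $ i * ?b $ j * frame_wedge q i j p) - (\<Sum>i\<in>UNIV. \<Sum>j\<in>UNIV. ?a $ j * ?b $ i * frame_wedge q i j p)) / 2"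
    by (simp add: sum_subtractf[symmetric] sum_divide_distrib algebra_simps diff_divide_distrib)
  finally show "wedge u v p = matrix_bivec q (bivec_matrix q (wedge u v)) p" unfolding 1[symmetric] 2 by simp
qed

lemma BV_matrix_bivec: assumes q: "q \<in> U" and b: "\<beta> \<in> BV q" shows "\<beta> = matrix_bivec q (bivec_matrix q \<beta>)" "skew_mat (bivec_matrix q \<beta>)"
proof -
  obtain n :: nat and x y where 1: "\<forall>i<n. x i \<in> T q \<and> y i \<in> T q" "\<beta> = (\<Sum>i<n. wedge (x i) (y i))" by (rule BV_E[OF b])
  have b0: "\<beta> = (\<Sum>i<n. matrix_bivec q (bivec_matrix q (wedge (x i) (y i))))"
    unfolding 1(2) by (intro sum.cong refl wedge_eq_matrix_bivec[OF q]) (use 1(1) in auto)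
  have "matrix_bivec q (bivec_matrix q \<beta>) = (\<Sum>i<n. matrix_bivec q (bivec_matrix q (wedge (x i) (y i))))"
    unfolding 1(2) by (simp only: bivec_matrix_sum matrix_bivec_sum)
  then show "\<beta> = matrix_bivec q (bivec_matrix q \<beta>)" by (rule trans[OF b0 sym])
  show "skew_mat (bivec_matrix q \<beta>)" unfolding 1(2) skew_mat_def bivec_matrix_sum
    using 1(1) by (auto simp: bivec_matrix_wedge[OF q] sum_negf[symmetric] intro!: sum.cong)
qed

lemma bivec_matrix_matrix_bivec: assumes q: "q \<in> U" and a: "skew_mat b" shows "bivec_matrix q (matrix_bivec q b) = b"
proof -
  have "bivec_matrix q (matrix_bivec q b) $ k $ l = b $ k $ l" for k l
  proof -
    have "bivec_matrix q (matrix_bivec q b) $ k $ l = (\<Sum>i\<in>UNIV. \<Sum>j\<in>UNIV. b $ i $ j / 2 * ((if k = i \<and> l = j then 1 else 0) - (if k = j \<and> l = i then 1 else 0)))"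
      unfolding matrix_bivec_def by (simp add: bivec_matrix_sum bivec_matrix_scale bivec_matrix_frame_wedge q)
    also have "\<dots> = (\<Sum>i\<in>UNIV. \<Sum>j\<in>UNIV. (if k = i then (if l = j then b $ i $ j / 2 else 0) else 0)) - (\<Sum>i\<in>UNIV. \<Sum>j\<in>UNIV. (if l = i then (if k = j then b $ i $ j / 2 else 0) else 0))"
      unfolding sum_subtractf[symmetric] by (intro sum.cong refl) auto
    also have "\<dots> = b $ k $ l / 2 - b $ l $ k / 2"
    proof -
      have s: "(\<Sum>i\<in>UNIV. \<Sum>j\<in>UNIV. (if k = i then (if l = j then b $ i $ j / 2 else 0) else 0)) = b $ k $ l / 2" for k l :: 4
      proof -
        have "(\<Sum>j\<in>UNIV. (if k = i then (if l = j then b $ i $ j / 2 else 0) else 0)) = (if k = i then b $ i $ l / 2 else 0)" for i by simp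
        then show ?thesis by simp
      qed
      show ?thesis unfolding s ..
    qed
    finally show ?thesis using skew_matD[OF a, of k l] by simp
  qed
  then show ?thesis by (simp add: vec_eq_iff)
qed

lemma inner_mat: "(b :: real^4^4) \<bullet> c = (\<Sum>k\<in>UNIV. \<Sum>l\<in>UNIV. b $ k $ l * c $ k $ l)"
  by (simp add: inner_vec_def)

lemma inner_wedge: assumes q: "q \<in> U" and v: "x \<in> T q" "y \<in> T q" "z \<in> T q" "w \<in> T q"
  shows "1/2 * (g q x z * g q y w - g q x w * g q y z) = 1/4 * (bivec_matrix q (wedge x y) \<bullet> bivec_matrix q (wedge z w))"
  unfolding inner_mat bivec_matrix_wedge[OF q v(1,2)] bivec_matrix_wedge[OF q v(3,4)]
  by (simp add: g_coords q v inner_vec_def sum_4) (simp add: algebra_simps)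

lemma bivec_inner_eq: assumes q: "q \<in> U" and b: "\<beta> \<in> BV q" and c: "\<gamma> \<in> BV q"
  shows "bivec_inner A g q \<beta> \<gamma> = 1/4 * (bivec_matrix q \<beta> \<bullet> bivec_matrix q \<gamma>)"
proof -
  have k: "(\<Sum>i<n. \<Sum>j<m. 1/2 * (g q (x i) (z j) * g q (y i) (w j) - g q (x i) (w j) * g q (y i) (z j))) = 1/4 * (bivec_matrix q \<beta> \<bullet> bivec_matrix q \<gamma>)"
    if 1: "\<forall>i<n. x i \<in> T q \<and> y i \<in> T q" "\<beta> = (\<Sum>i<n. wedge (x i) (y i))"
      and 2: "\<forall>j<m. z j \<in> T q \<and> w j \<in> T q" "\<gamma> = (\<Sum>j<m. wedge (z j) (w j))" for n m :: nat and x y z w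
  proof -
    have "(\<Sum>i<n. \<Sum>j<m. 1/2 * (g q (x i) (z j) * g q (y i) (w j) - g q (x i) (w j) * g q (y i) (z j)))
      = (\<Sum>i<n. \<Sum>j<m. 1/4 * (bivec_matrix q (wedge (x i) (y i)) \<bullet> bivec_matrix q (wedge (z j) (w j))))"
      by (intro sum.cong refl inner_wedge q) (use 1(1) 2(1) in auto)
    then show ?thesis unfolding 1(2) 2(2) bivec_matrix_sum inner_sum_left by (simp only: inner_sum_right sum_distrib_left)
  qed
  obtain n :: nat and x y where 1: "\<forall>i<n. x i \<in> T q \<and> y i \<in> T q" "\<beta> = (\<Sum>i<n. wedge (x i) (y i))" by (rule BV_E[OF b])
  obtain m :: nat and z w where 2: "\<forall>i<m. z i \<in> T q \<and> w i \<in> T q" "\<gamma> = (\<Sum>i<m. wedge (z i) (w i))" by (rule BV_E[OF c])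
  show ?thesis unfolding bivec_inner_def
  proof (rule the_equality)
    show "\<exists>(n::nat) x y (m::nat) z w. (\<forall>i<n. x i \<in> T q \<and> y i \<in> T q) \<and> \<beta> = (\<Sum>i<n. wedge (x i) (y i)) \<and>
     (\<forall>j<m. z j \<in> T q \<and> w j \<in> T q) \<and> \<gamma> = (\<Sum>j<m. wedge (z j) (w j)) \<and>
     1/4 * (bivec_matrix q \<beta> \<bullet> bivec_matrix q \<gamma>) = (\<Sum>i<n. \<Sum>j<m. 1/2 * (g q (x i) (z j) * g q (y i) (w j) - g q (x i) (w j) * g q (y i) (z j)))"
      by (intro exI[of _ n] exI[of _ x] exI[of _ y] exI[of _ m] exI[of _ z] exI[of _ w] conjI 1 2 k[OF 1 2, symmetric])
  qed (use k in blast)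
qed

lemma linear_map_sum:
  assumes S: "linear_map_on (BV q) S" and x: "\<And>i. i \<in> I \<Longrightarrow> x i \<in> BV q" and I: "finite I"
  shows "S (\<Sum>i\<in>I. x i) = (\<Sum>i\<in>I. S (x i))"
  using I x
proof (induction I)
  case empty
  have "S (0 *\<^sub>F 0 + 0 *\<^sub>F 0) = 0 *\<^sub>F S 0 + 0 *\<^sub>F S 0" using S BV_zero unfolding linear_map_on_def by blast
  moreover have "(0 *\<^sub>F 0 + 0 *\<^sub>F 0 :: 'a bivec) = 0" by (simp add: fun_eq_iff)
  moreover have "0 *\<^sub>F S 0 + 0 *\<^sub>F S 0 = 0" by (simp add: fun_eq_iff)
  ultimately show ?case by (simp only: sum.empty)
next
  case (insert i I)
  have "S (1 *\<^sub>F x i + 1 *\<^sub>F (\<Sum>i\<in>I. x i)) = 1 *\<^sub>F S (x i) + 1 *\<^sub>F S (\<Sum>i\<in>I. x i)"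
    using S insert BV_sum[of I x q] unfolding linear_map_on_def by blast
  moreover have "1 *\<^sub>F \<beta> = \<beta>" for \<beta> :: "'b \<Rightarrow> real" by (simp add: fun_eq_iff)
  ultimately have "S (x i + (\<Sum>i\<in>I. x i)) = S (x i) + S (\<Sum>i\<in>I. x i)" by (simp add: fscale_def)
  then show ?case using insert by (simp only: sum.insert[OF insert(1,2)] insertI1 insertI2)
qed

lemma linear_map_scale: assumes S: "linear_map_on (BV q) S" and x: "\<beta> \<in> BV q" shows "S (c *\<^sub>F \<beta>) = c *\<^sub>F S \<beta>"
proof -
  have "S (c *\<^sub>F \<beta> + 0 *\<^sub>F \<beta>) = c *\<^sub>F S \<beta> + 0 *\<^sub>F S \<beta>" using S x unfolding linear_map_on_def by blast
  moreover have "c *\<^sub>F \<beta> + 0 *\<^sub>F \<beta> = c *\<^sub>F \<beta>" "c *\<^sub>F S \<beta> + 0 *\<^sub>F S \<beta> = c *\<^sub>F S \<beta>" by (simp_all add: fun_eq_iff)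
  ultimately show ?thesis by (simp only:)
qed

text \<open>
  Uniqueness of linear maps with prescribed values on a spanning set, as needed for the definite descriptions of the Hodge star and of the
  Weyl operator. Outside the space of bivectors both maps have the default value of \<open>\<rightarrow>\<^sub>E\<close>.
\<close>

lemma BV_map_eq:
  assumes q: "q \<in> U" and S: "linear_map_on (BV q) S" "S \<in> BV q \<rightarrow>\<^sub>E BV q" and S': "linear_map_on (BV q) S'" "S' \<in> BV q \<rightarrow>\<^sub>E BV q"
    and e: "\<And>i j. S (frame_wedge q i j) = S' (frame_wedge q i j)"
  shows "S = S'"
proof
  fix \<beta> show "S \<beta> = S' \<beta>"
  proof (cases "\<beta> \<in> BV q")
    case True
    have b: "\<beta> = (\<Sum>i\<in>UNIV. \<Sum>j\<in>UNIV. (bivec_matrix q \<beta> $ i $ j / 2) *\<^sub>F frame_wedge q i j)"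
      using BV_matrix_bivec(1)[OF q True] by (simp add: matrix_bivec_def)
    have m: "M \<beta> = (\<Sum>i\<in>UNIV. \<Sum>j\<in>UNIV. (bivec_matrix q \<beta> $ i $ j / 2) *\<^sub>F M (frame_wedge q i j))" if M: "linear_map_on (BV q) M" for M :: "'a bivec \<Rightarrow> 'a bivec"
    proof -
      have "M \<beta> = M (\<Sum>i\<in>UNIV. \<Sum>j\<in>UNIV. (bivec_matrix q \<beta> $ i $ j / 2) *\<^sub>F frame_wedge q i j)" by (rule arg_cong[OF b])
      also have "\<dots> = (\<Sum>i\<in>UNIV. M (\<Sum>j\<in>UNIV. (bivec_matrix q \<beta> $ i $ j / 2) *\<^sub>F frame_wedge q i j))"
        by (rule linear_map_sum[OF M]) (auto intro!: BV_sum BV_scale frame_wedge_bivec q)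
      also have "\<dots> = (\<Sum>i\<in>UNIV. \<Sum>j\<in>UNIV. M ((bivec_matrix q \<beta> $ i $ j / 2) *\<^sub>F frame_wedge q i j))"
        by (intro sum.cong refl linear_map_sum[OF M]) (auto intro!: BV_scale frame_wedge_bivec q)
      also have "\<dots> = (\<Sum>i\<in>UNIV. \<Sum>j\<in>UNIV. (bivec_matrix q \<beta> $ i $ j / 2) *\<^sub>F M (frame_wedge q i j))"
        by (intro sum.cong refl linear_map_scale[OF M] frame_wedge_bivec q)
      finally show ?thesis .
    qed
    show ?thesis unfolding m[OF S(1)] m[OF S'(1)] e ..
  next
    case False
    then show ?thesis using S(2) S'(2) unfolding PiE_def extensional_def by auto
  qed
qed

lemma matrix_bivec_map:
  assumes q: "q \<in> U" and L: "linear L"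
  shows "(\<lambda>\<beta>\<in>BV q. matrix_bivec q (L (bivec_matrix q \<beta>))) \<in> BV q \<rightarrow>\<^sub>E BV q" "linear_map_on (BV q) (\<lambda>\<beta>\<in>BV q. matrix_bivec q (L (bivec_matrix q \<beta>)))"
  using matrix_bivec_BV[OF q] BV_add BV_scale
  by (auto simp: linear_map_on_def bivec_matrix_add bivec_matrix_scale linear_add[OF L] linear_scale[OF L] matrix_bivec_add matrix_bivec_scale)

section \<open>The Hodge star and the Weyl operator\<close>

definition star_matrix :: "real^4^4 \<Rightarrow> real^4^4" where
  "star_matrix b = vector [vector [0, b$3$4, b$4$2, b$2$3], vector [- b$3$4, 0, b$1$4, - b$1$3],
                    vector [- b$4$2, - b$1$4, 0, b$1$2], vector [- b$2$3, b$1$3, - b$1$2, 0]]"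

lemma star_nth: "star_matrix b $ 1 = vector [0, b$3$4, b$4$2, b$2$3]" "star_matrix b $ 2 = vector [- b$3$4, 0, b$1$4, - b$1$3]"
  "star_matrix b $ 3 = vector [- b$4$2, - b$1$4, 0, b$1$2]" "star_matrix b $ 4 = vector [- b$2$3, b$1$3, - b$1$2, 0]"
  by (simp_all add: star_matrix_def)

lemma star_linear: "linear star_matrix"
  by (rule linearI) (simp_all add: vec_eq_iff[where 'b=4] forall_4 star_nth)

lemma star_skew: "skew_mat (star_matrix b)"
  by (simp add: skew_mat_def forall_4 star_nth)

lemma skew_mat_eqI: assumes a: "skew_mat b" "skew_mat c" and e: "b$1$2 = c$1$2" "b$1$3 = c$1$3" "b$1$4 = c$1$4" "b$3$4 = c$3$4" "b$4$2 = c$4$2" "b$2$3 = c$2$3"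
  shows "b = c"
proof -
  have d: "b $ i $ i = 0" "c $ i $ i = 0" for i using skew_matD[OF a(1), of i i] skew_matD[OF a(2), of i i] by auto
  have s: "b$2$1 = - b$1$2" "b$3$1 = - b$1$3" "b$4$1 = - b$1$4" "b$4$3 = - b$3$4" "b$2$4 = - b$4$2" "b$3$2 = - b$2$3"
     "c$2$1 = - c$1$2" "c$3$1 = - c$1$3" "c$4$1 = - c$1$4" "c$4$3 = - c$3$4" "c$2$4 = - c$4$2" "c$3$2 = - c$2$3"
    by (rule skew_matD[OF a(1)] skew_matD[OF a(2)])+
  show ?thesis using e by (simp add: vec_eq_iff[where 'b=4] forall_4 d s)
qed

lemma wedge_skew: "q \<in> U \<Longrightarrow> u \<in> T q \<Longrightarrow> v \<in> T q \<Longrightarrow> skew_mat (bivec_matrix q (wedge u v))"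
  using BV_matrix_bivec(2) BV_wedge by blast

text \<open>
  The operator \<open>star_matrix\<close> has the required property for all oriented orthonormal bases by \<open>cross_minors_orthonormal\<close>. It is the only one, since the
  even permutations of the frame are such bases and determine the values on all \<open>E\<^sub>i \<and> E\<^sub>j\<close>.
\<close>

lemma hodge_eq: assumes q: "q \<in> U"
  shows "hodge_star A g q = (\<lambda>\<beta>\<in>BV q. matrix_bivec q (star_matrix (bivec_matrix q \<beta>)))" (is "_ = ?H")
proof -
  note H = matrix_bivec_map[OF q star_linear]
  have Hw: "?H (wedge (e $ 1) (e $ 2)) = wedge (e $ 3) (e $ 4)"
    if "orthonormal_at A g q e" "positive_basis A q e" for e
  proof -
    have eT: "\<And>i. e $ i \<in> T q" and o: "\<And>i j. coords q (e $ i) \<bullet> coords q (e $ j) = (if i = j then 1 else 0)"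
      using that(1) unfolding orthonormal_iff[OF q] by auto
    have "frame_mat q e = vector [coords q (e $ 1), coords q (e $ 2), coords q (e $ 3), coords q (e $ 4)]"
      by (simp add: frame_mat_def vec_eq_iff[where 'b=4] forall_4)
    then have d: "det (vector [coords q (e $ 1), coords q (e $ 2), coords q (e $ 3), coords q (e $ 4)] :: real^4^4) > 0"
      using that(2) positive_basis_iff[OF q] by simp
    note m = cross_minors_orthonormal[of "\<lambda>i. coords q (e $ i)", OF o d]
    have "star_matrix (bivec_matrix q (wedge (e $ 1) (e $ 2))) = bivec_matrix q (wedge (e $ 3) (e $ 4))"
      by (rule skew_mat_eqI[OF star_skew wedge_skew[OF q eT eT]])
        (simp_all add: star_nth bivec_matrix_wedge q eT m)
    then show ?thesis using BV_wedge[OF eT eT] wedge_eq_matrix_bivec[OF q eT eT] by simp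
  qed
  show ?thesis unfolding hodge_star_def
  proof (rule the_equality)
    fix S assume S: "S \<in> BV q \<rightarrow>\<^sub>E BV q \<and> linear_map_on (BV q) S \<and>
     (\<forall>e. orthonormal_at A g q e \<and> positive_basis A q e \<longrightarrow> S (wedge (e $ 1) (e $ 2)) = wedge (e $ 3) (e $ 4))"
    then have Sl: "linear_map_on (BV q) S" and Sm: "S \<in> BV q \<rightarrow>\<^sub>E BV q" by auto
    have P: "S (frame_wedge q i j) = ?H (frame_wedge q i j)"
      if ijkl: "(i, j, k, l) \<in> {(1,2,3,4), (1,3,4,2), (1,4,2,3), (3,4,1,2), (4,2,1,3), (2,3,1,4)}" for i j k l :: 4
    proof -
      let ?e = "vector [E i q, E j q, E k q, E l q] :: ('a tvec)^4"
      have o: "orthonormal_at A g q ?e" unfolding orthonormal_iff[OF q] forall_4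
        using ijkl unfolding insert_iff empty_iff prod.inject
        by (elim disjE conjE FalseE) (simp_all add: E_T q coords_E inner_axis_axis)
      have p: "positive_basis A q ?e" unfolding positive_basis_iff[OF q] forall_4 frame_mat_vector
        using ijkl unfolding insert_iff empty_iff prod.inject
        by (elim disjE conjE FalseE) (simp_all add: E_T q coords_E det_4 axis_def)
      show ?thesis using S Hw[OF o p] o p unfolding frame_wedge_def by (metis vector_4)
    qed
    have neg: "M (frame_wedge q j i) = (-1) *\<^sub>F M (frame_wedge q i j)" if "linear_map_on (BV q) M" for M :: "'a bivec \<Rightarrow> 'a bivec" and i j
    proof -
      have "frame_wedge q j i = (-1) *\<^sub>F frame_wedge q i j" by (auto simp: frame_wedge_def wedge_def fun_eq_iff)
      then show ?thesis using linear_map_scale[OF that frame_wedge_bivec[OF q]] by metis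
    qed
    have nS: "S (frame_wedge q j i) = (-1) *\<^sub>F S (frame_wedge q i j)" and nH: "?H (frame_wedge q j i) = (-1) *\<^sub>F ?H (frame_wedge q i j)" for i j
      by (rule neg[OF Sl], rule neg[OF H(2)])
    have dia: "M (frame_wedge q i i) = 0" if "linear_map_on (BV q) M" for M :: "'a bivec \<Rightarrow> 'a bivec" and i
      using neg[OF that, of i i] by (simp add: fun_eq_iff)
    have "\<forall>i j. S (frame_wedge q i j) = ?H (frame_wedge q i j)"
    proof -
      have b: "S (frame_wedge q 1 2) = ?H (frame_wedge q 1 2)" "S (frame_wedge q 1 3) = ?H (frame_wedge q 1 3)" "S (frame_wedge q 1 4) = ?H (frame_wedge q 1 4)"
        "S (frame_wedge q 3 4) = ?H (frame_wedge q 3 4)" "S (frame_wedge q 4 2) = ?H (frame_wedge q 4 2)" "S (frame_wedge q 2 3) = ?H (frame_wedge q 2 3)"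
        using P[of 1 2 3 4] P[of 1 3 4 2] P[of 1 4 2 3] P[of 3 4 1 2] P[of 4 2 1 3] P[of 2 3 1 4] by blast+
      show ?thesis unfolding forall_4
        using b dia[OF Sl] dia[OF H(2)] nS[of 2 1] nS[of 3 1] nS[of 4 1] nS[of 4 3] nS[of 2 4] nS[of 3 2]
          nH[of 2 1] nH[of 3 1] nH[of 4 1] nH[of 4 3] nH[of 2 4] nH[of 3 2]
        by (simp only: simp_thms)
    qed
    then show "S = ?H" using BV_map_eq[OF q Sl Sm H(2,1)] by blast
  qed (use H Hw in blast)
qed

lemma self_dual_iff: assumes q: "q \<in> U"
  shows "\<beta> \<in> self_dual_bivectors A g q \<longleftrightarrow> (\<exists>b. skew_mat b \<and> star_matrix b = b \<and> \<beta> = matrix_bivec q b)"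
proof
  assume "\<beta> \<in> self_dual_bivectors A g q"
  then have b: "\<beta> \<in> BV q" "matrix_bivec q (star_matrix (bivec_matrix q \<beta>)) = \<beta>" unfolding self_dual_bivectors_def hodge_eq[OF q] by auto
  have "star_matrix (bivec_matrix q \<beta>) = bivec_matrix q \<beta>" using arg_cong[OF b(2), of "bivec_matrix q"] bivec_matrix_matrix_bivec[OF q star_skew] by simp
  then show "\<exists>b. skew_mat b \<and> star_matrix b = b \<and> \<beta> = matrix_bivec q b" using BV_matrix_bivec[OF q b(1)] by blast
next
  assume "\<exists>b. skew_mat b \<and> star_matrix b = b \<and> \<beta> = matrix_bivec q b"
  then obtain b where b: "skew_mat b" "star_matrix b = b" "\<beta> = matrix_bivec q b" by blast
  then show "\<beta> \<in> self_dual_bivectors A g q"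
    unfolding self_dual_bivectors_def hodge_eq[OF q] by (simp add: matrix_bivec_BV q bivec_matrix_matrix_bivec)
qed

end

context framed_levi_civita
begin

text \<open>
  The Weyl operator on components. The exchange of \<open>l\<close> and \<open>k\<close> follows the order of arguments in \<open>weyl_operator\<close>.
\<close>

definition weyl_map :: "'a \<Rightarrow> real^4^4 \<Rightarrow> real^4^4" where
  "weyl_map q b = (\<chi> k l. \<Sum>i\<in>UNIV. \<Sum>j\<in>UNIV. b $ i $ j * weyl_form q (axis i 1) (axis j 1) (axis l 1) (axis k 1))"

lemma weyl_map_linear: "linear (weyl_map q)"
  by (rule linearI) (simp_all add: weyl_map_def vec_eq_iff distrib_right sum.distrib sum_distrib_left mult.assoc)

lemma weyl_map_skew: "q \<in> U \<Longrightarrow> skew_mat (weyl_map q b)"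
  unfolding skew_mat_def weyl_map_def vec_lambda_beta sum_negf[symmetric]
  by (intro allI sum.cong refl) (subst weyl_form_skew(2), simp_all)

lemma weyl_map_wedge: assumes q: "q \<in> U" and v: "x \<in> T q" "y \<in> T q"
  shows "weyl_map q (bivec_matrix q (wedge x y)) $ k $ l = 2 * weyl_form q (coords q x) (coords q y) (axis l 1) (axis k 1)"
  unfolding weyl_map_def bivec_matrix_wedge[OF q v] vec_lambda_beta
  by (rule skew_bilinear_expand[where F = "\<lambda>u v. weyl_form q u v (axis l 1) (axis k 1)", OF weyl_form_linear(1)[OF q] weyl_form_linear(2)[OF q] weyl_form_skew(1)[OF q]])

text \<open>
  The inner product of bivectors is a quarter of the inner product of their matrices, while the contractions with \<open>x \<and> y\<close> and
  with \<open>z \<and> w\<close> both count each pair of indices twice.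
\<close>

lemma weyl_operator_eq: assumes q: "q \<in> U"
  shows "weyl_operator A g q = (\<lambda>\<beta>\<in>BV q. matrix_bivec q (weyl_map q (bivec_matrix q \<beta>)))" (is "_ = ?H")
proof -
  note H = matrix_bivec_map[OF q weyl_map_linear]
  have inn: "weyl_map q (bivec_matrix q (wedge x y)) \<bullet> bivec_matrix q (wedge z w) = 4 * weyl A g q x y w z"
    if v: "x \<in> T q" "y \<in> T q" "z \<in> T q" "w \<in> T q" for x y z w
  proof -
    let ?F = "\<lambda>u v. weyl_form q (coords q x) (coords q y) v u"
    have "(\<Sum>k\<in>UNIV. \<Sum>l\<in>UNIV. (coords q z $ k * coords q w $ l - coords q z $ l * coords q w $ k) * ?F (axis k 1) (axis l 1)) = 2 * ?F (coords q z) (coords q w)"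
      by (rule skew_bilinear_expand[where F = ?F, OF weyl_form_linear(4)[OF q] weyl_form_linear(3)[OF q] weyl_form_skew(2)[OF q]])
    moreover have "weyl_map q (bivec_matrix q (wedge x y)) \<bullet> bivec_matrix q (wedge z w) = 2 * (\<Sum>k\<in>UNIV. \<Sum>l\<in>UNIV. (coords q z $ k * coords q w $ l - coords q z $ l * coords q w $ k) * ?F (axis k 1) (axis l 1))"
      unfolding inner_mat weyl_map_wedge[OF q v(1,2)] bivec_matrix_wedge[OF q v(3,4)] vec_lambda_beta
      by (simp only: sum_distrib_left mult.assoc mult.commute[of "weyl_form q (coords q x) (coords q y) _ _"])
    ultimately show ?thesis by (simp add: weyl_eq q v)
  qed
  show ?thesis unfolding weyl_operator_def
  proof (rule the_equality)
    have "bivec_inner A g q (?H (wedge x y)) (wedge z w) = weyl A g q x y w z"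
      if v: "x \<in> T q" "y \<in> T q" "z \<in> T q" "w \<in> T q" for x y z w
      using inn[OF v] v by (simp add: BV_wedge bivec_inner_eq q matrix_bivec_BV bivec_matrix_matrix_bivec weyl_map_skew)
    then show "?H \<in> BV q \<rightarrow>\<^sub>E BV q \<and> linear_map_on (BV q) ?H \<and>
     (\<forall>x\<in>T q. \<forall>y\<in>T q. \<forall>z\<in>T q. \<forall>w\<in>T q. bivec_inner A g q (?H (wedge x y)) (wedge z w) = weyl A g q x y w z)"
      using H by blast
  next
    fix S assume S: "S \<in> BV q \<rightarrow>\<^sub>E BV q \<and> linear_map_on (BV q) S \<and>
     (\<forall>x\<in>T q. \<forall>y\<in>T q. \<forall>z\<in>T q. \<forall>w\<in>T q. bivec_inner A g q (S (wedge x y)) (wedge z w) = weyl A g q x y w z)"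
    then have Sl: "linear_map_on (BV q) S" and Sm: "S \<in> BV q \<rightarrow>\<^sub>E BV q" by auto
    have "S (frame_wedge q i j) = ?H (frame_wedge q i j)" for i j
    proof -
      have SB: "S (frame_wedge q i j) \<in> BV q" using Sm frame_wedge_bivec[OF q] by blast
      let ?s = "bivec_matrix q (S (frame_wedge q i j))"
      have as: "skew_mat ?s" by (rule BV_matrix_bivec(2)[OF q SB])
      have "?s $ k $ l = weyl_map q (bivec_matrix q (frame_wedge q i j)) $ k $ l" for k l
      proof -
        have "1/4 * (?s \<bullet> bivec_matrix q (frame_wedge q k l)) = weyl A g q (E i q) (E j q) (E l q) (E k q)"
          using S SB frame_wedge_bivec[OF q, of k l] bivec_inner_eq[OF q SB frame_wedge_bivec[OF q, of k l]] E_T[OF q] unfolding frame_wedge_def by metis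
        moreover have "?s \<bullet> bivec_matrix q (frame_wedge q k l) = 2 * ?s $ k $ l"
        proof -
          have "?s \<bullet> bivec_matrix q (frame_wedge q k l) = (\<Sum>m\<in>UNIV. \<Sum>n\<in>UNIV. (if m = k then (if n = l then ?s $ m $ n else 0) else 0)) - (\<Sum>m\<in>UNIV. \<Sum>n\<in>UNIV. (if m = l then (if n = k then ?s $ m $ n else 0) else 0))"
            unfolding inner_mat bivec_matrix_frame_wedge[OF q] sum_subtractf[symmetric] by (intro sum.cong refl) auto
          also have "\<dots> = ?s $ k $ l - ?s $ l $ k"
          proof -
            have s: "(\<Sum>m\<in>UNIV. \<Sum>n\<in>UNIV. (if m = k then (if n = l then ?s $ m $ n else 0) else 0)) = ?s $ k $ l" for k l :: 4
            proof -
              have "(\<Sum>n\<in>UNIV. (if m = k then (if n = l then ?s $ m $ n else 0) else 0)) = (if m = k then ?s $ m $ l else 0)" for m by simp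
              then show ?thesis by simp
            qed
            show ?thesis unfolding s ..
          qed
          finally show ?thesis using skew_matD[OF as, of l k] by simp
        qed
        moreover have "weyl_map q (bivec_matrix q (frame_wedge q i j)) $ k $ l = 2 * weyl A g q (E i q) (E j q) (E l q) (E k q)"
          unfolding frame_wedge_def by (simp add: weyl_map_wedge q E_T weyl_eq coords_E)
        ultimately show ?thesis by simp
      qed
      then have "?s = weyl_map q (bivec_matrix q (frame_wedge q i j))" by (simp add: vec_eq_iff)
      then show ?thesis using BV_matrix_bivec(1)[OF q SB] frame_wedge_bivec[OF q] by simp
    qed
    then show "S = ?H" using BV_map_eq[OF q Sl Sm H(2,1)] by blast
  qed
qed

text \<open>
  A self-dual bivector is a combination of \<open>E\<^sub>1 \<and> E\<^sub>2 + E\<^sub>3 \<and> E\<^sub>4\<close> and its two companions, so the Weyl operator vanishes on these bivectors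
  if and only if the left-hand side of \<open>weyl_sd_curv\<close> holds.
\<close>

lemma asd_at: assumes q: "q \<in> U"
  shows "(\<forall>\<beta>\<in>self_dual_bivectors A g q. weyl_operator A g q \<beta> = 0) \<longleftrightarrow> curv_cond (\<lambda>i j. sd_curv q (axis i 1) (axis j 1))"
proof -
  let ?W = "\<lambda>i j k l. weyl_form q (axis i 1) (axis j 1) (axis k 1) (axis l 1)"
  have z: "?W i i k l = 0" for i k l using weyl_form_skew(1)[OF q, of "axis i 1" "axis i 1"] by (metis equal_neg_zero)
  have sk: "?W 2 1 k l = - ?W 1 2 k l" "?W 3 1 k l = - ?W 1 3 k l" "?W 4 1 k l = - ?W 1 4 k l"
     "?W 4 3 k l = - ?W 3 4 k l" "?W 2 4 k l = - ?W 4 2 k l" "?W 3 2 k l = - ?W 2 3 k l" for k l by (rule weyl_form_skew(1)[OF q])+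
  have eq0: "matrix_bivec q b = 0 \<longleftrightarrow> b = 0" if "skew_mat b" for b
  proof
    assume "matrix_bivec q b = 0"
    then have "bivec_matrix q (matrix_bivec q b) = bivec_matrix q (matrix_bivec q 0)" by (simp add: matrix_bivec_zero)
    then show "b = 0" using bivec_matrix_matrix_bivec[OF q that] bivec_matrix_matrix_bivec[OF q, of 0] by (simp add: skew_mat_def)
  qed (simp add: matrix_bivec_zero)
  have "(\<forall>\<beta>\<in>self_dual_bivectors A g q. weyl_operator A g q \<beta> = 0) \<longleftrightarrow> (\<forall>b. skew_mat b \<and> star_matrix b = b \<longrightarrow> weyl_operator A g q (matrix_bivec q b) = 0)"
    unfolding Ball_def self_dual_iff[OF q] by blast
  also have "\<dots> \<longleftrightarrow> (\<forall>b. skew_mat b \<and> star_matrix b = b \<longrightarrow> weyl_map q b = 0)"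
    unfolding weyl_operator_eq[OF q] by (auto simp: matrix_bivec_BV q bivec_matrix_matrix_bivec eq0 weyl_map_skew)
  also have "\<dots> \<longleftrightarrow> (\<forall>k l. ?W 1 2 k l + ?W 3 4 k l = 0 \<and> ?W 1 3 k l + ?W 4 2 k l = 0 \<and> ?W 1 4 k l + ?W 2 3 k l = 0)"
  proof -
    have Wn: "weyl_map q b $ l $ k = 2 * (b$1$2 * (?W 1 2 k l + ?W 3 4 k l) + b$1$3 * (?W 1 3 k l + ?W 4 2 k l) + b$1$4 * (?W 1 4 k l + ?W 2 3 k l))"
      if b: "skew_mat b" "star_matrix b = b" for b k l
    proof -
      have st: "b$3$4 = b$1$2" "b$4$2 = b$1$3" "b$2$3 = b$1$4"
        using arg_cong[OF b(2), of "\<lambda>b. b$1$2"] arg_cong[OF b(2), of "\<lambda>b. b$1$3"] arg_cong[OF b(2), of "\<lambda>b. b$1$4"] by (simp_all add: star_nth)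
      have s: "b$2$1 = - b$1$2" "b$3$1 = - b$1$3" "b$4$1 = - b$1$4" "b$4$3 = - b$1$2" "b$2$4 = - b$1$3" "b$3$2 = - b$1$4"
        using skew_matD[OF b(1)] st by metis+
      show ?thesis unfolding weyl_map_def by (simp add: sum_4 z sk st s algebra_simps)
    qed
    show ?thesis
    proof
      assume L: "\<forall>b. skew_mat b \<and> star_matrix b = b \<longrightarrow> weyl_map q b = 0"
      have B: "s1 * (?W 1 2 k l + ?W 3 4 k l) + s2 * (?W 1 3 k l + ?W 4 2 k l) + s3 * (?W 1 4 k l + ?W 2 3 k l) = 0" for s1 s2 s3 k l
      proof -
        define b :: "real^4^4" where "b = vector [vector [0, s1, s2, s3], vector [-s1, 0, s3, -s2], vector [-s2, -s3, 0, s1], vector [-s3, s2, -s1, 0]]"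
        have b: "skew_mat b" "star_matrix b = b" by (simp_all add: skew_mat_def forall_4 b_def star_matrix_def)
        then have "weyl_map q b $ l $ k = 0" using L by simp
        then show ?thesis unfolding Wn[OF b] by (simp add: b_def)
      qed
      show "\<forall>k l. ?W 1 2 k l + ?W 3 4 k l = 0 \<and> ?W 1 3 k l + ?W 4 2 k l = 0 \<and> ?W 1 4 k l + ?W 2 3 k l = 0"
        using B[of 1 _ _ 0 0] B[of 0 _ _ 1 0] B[of 0 _ _ 0 1] by simp
    next
      assume "\<forall>k l. ?W 1 2 k l + ?W 3 4 k l = 0 \<and> ?W 1 3 k l + ?W 4 2 k l = 0 \<and> ?W 1 4 k l + ?W 2 3 k l = 0"
      then show "\<forall>b. skew_mat b \<and> star_matrix b = b \<longrightarrow> weyl_map q b = 0" using Wn by (simp add: vec_eq_iff)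
    qed
  qed
  also have "\<dots> \<longleftrightarrow> curv_cond (\<lambda>i j. sd_curv q (axis i 1) (axis j 1))"
    using weyl_sd_curv[OF q] by (simp add: Let_def)
  finally show ?thesis .
qed

end

section \<open>Changing the connection\<close>

lemma Kop_inner_Kvec: "Kop y v \<bullet> w = y \<bullet> Kvec v w"
  by (simp add: Kvec_nth vec4 vec3 axis_def algebra_simps)

text \<open>
  The added terms contribute to \<open>B\<close> a multiple of the identity and a skew matrix, as their components show. Nothing else is
  possible, because \<open>\<real>\<^sup>4 \<otimes> \<real>\<^sup>4\<close>, as a representation of the rotation group, does not contain the trace-free symmetric square
  of the self-dual bivectors.
\<close>

lemma curv_cond_shift:
  fixes W :: "4 \<Rightarrow> 4 \<Rightarrow> real^3" and \<eta> :: "4 \<Rightarrow> real^4" and \<theta> :: "real^4"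
  assumes W': "\<And>i j. W' i j = W i j + (Kvec (axis j 1) (\<eta> i) - Kvec (axis i 1) (\<eta> j) + cross3 (Kvec (axis i 1) \<theta>) (Kvec (axis j 1) \<theta>))"
  shows "curv_cond W' \<longleftrightarrow> curv_cond W"
proof -
  have k: "Kvec (axis 1 1) y = vector [y$2, y$3, y$4]" "Kvec (axis 2 1) y = vector [- y$1, - y$4, y$3]"
    "Kvec (axis 3 1) y = vector [y$4, - y$1, - y$2]" "Kvec (axis 4 1) y = vector [- y$3, y$2, - y$1]" for y
    by (simp_all add: vec_eq_iff[where 'b=3] forall_3 Kvec_nth inner_vec_def sum_4 axis_def)
  show ?thesis unfolding curv_cond_def Let_def W' k
    by (simp add: cross_components) (simp add: algebra_simps)
qed

text \<open>
  The connection \<open>D\<close> and, with the prefix \<open>L\<close>, the Levi-Civita connection in the same frame.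
\<close>

locale connection_comparison = framed_connection X A U \<phi> g E D + L: framed_levi_civita X A U \<phi> g E for X A U \<phi> g E D +
  assumes skT: "skew_symmetric_torsion A g D"
begin

definition conn_diff :: "'a \<Rightarrow> real^4 \<Rightarrow> real^4 \<Rightarrow> real^4" where "conn_diff q u v = conn_op q u v - L.conn_op q u v"

lemma L_torsion_form: assumes q: "q \<in> U" shows "L.torsion_form q u v = 0"
  unfolding L.torsion_form_def using L.tf[OF q frame_vec_const_vf[OF q] frame_vec_const_vf[OF q]] by (simp add: coords_zero q)

lemma L_brk_conn_op: "q \<in> U \<Longrightarrow> frame_brk q u v = L.conn_op q u v - L.conn_op q v u"
  using L.torsion_form_alt[of q u v] by (simp add: L_torsion_form L.conn_op_def)

text \<open>
  The argument by which a torsion-free metric connection is unique: the difference is skew in its last two arguments, and its skew part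
  in the first two is the torsion. As the torsion is a three-form, the difference is half of it.
\<close>

lemma conn_diff_torsion_form: assumes q: "q \<in> U" shows "2 *\<^sub>R conn_diff q u v = torsion_form q u v"
proof -
  have sk: "conn_diff q u v \<bullet> w = - (conn_diff q u w \<bullet> v)" for u v w
    using conn_op_skew[OF q, of u v w] L.conn_op_skew[OF q, of u v w]
    by (simp add: conn_diff_def inner_diff_left inner_diff_right inner_commute)
  have t: "torsion_form q u v \<bullet> w = conn_diff q u v \<bullet> w - conn_diff q v u \<bullet> w" for u v w
    using torsion_form_alt[OF q, of u v] L_brk_conn_op[OF q, of u v]
    by (simp add: conn_diff_def conn_op_def inner_diff_left)
  have "2 * (conn_diff q u v \<bullet> w) = torsion_form q u v \<bullet> w" for w
    using t[of u v w] t[of w u v] t[of v w u] sk[of u v w] sk[of v u w] sk[of w u v]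
      torsion_form_skew[OF q skT, of u v w] torsion_form_skew(1)[OF q skT, of w u v] torsion_form_skew(2)[OF q skT, of v w u] by linarith
  then have "\<forall>w. (2 *\<^sub>R conn_diff q u v) \<bullet> w = torsion_form q u v \<bullet> w" by simp
  then show ?thesis by (rule vector_eq_rdot[THEN iffD1])
qed

lemma conn_diff_linear: assumes q: "q \<in> U" shows "linear (\<lambda>u. conn_diff q u v)" "linear (conn_diff q u)"
  unfolding conn_diff_def[abs_def]
  by (intro linear_compose_sub conn_op_linear_left[OF q] L.conn_op_linear_left[OF q]) (intro linear_compose_sub conn_op_linear L.conn_op_linear)

lemma conn_diff_skew: assumes q: "q \<in> U"
  shows "conn_diff q u v \<bullet> w = - (conn_diff q v u \<bullet> w)" "conn_diff q u v \<bullet> w = - (conn_diff q u w \<bullet> v)"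
  using torsion_form_skew[OF q skT, of u v w] by (simp_all add: conn_diff_torsion_form[OF q, symmetric])

text \<open>
  Up to sign, the vector which corresponds to the three-form \<open>conn_diff\<close> under the Hodge star.
\<close>

definition torsion_dual :: "'a \<Rightarrow> real^4" where
  "torsion_dual r = vector [- conn_diff r (axis 2 1) (axis 3 1) $ 4, conn_diff r (axis 1 1) (axis 3 1) $ 4,
     - conn_diff r (axis 1 1) (axis 2 1) $ 4, conn_diff r (axis 1 1) (axis 2 1) $ 3]"

lemma torsion_dual_smc: assumes q: "q \<in> U" shows "smc q torsion_dual"
proof -
  have a: "smc q (\<lambda>r. conn_diff r (axis i 1) (axis j 1))" for i j
    unfolding conn_diff_def by (intro smc_diff q conn_op_axis_smc L.conn_op_axis_smc)
  show ?thesis unfolding smc_def forall_4 torsion_dual_def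
    using smcD[OF a] by (auto intro!: sm_minus q)
qed

lemma sd_op_sdvec: "sd_op r k = sd_part (conn_op r k)" by (simp add: sd_op_def sd_form_def conn_op_def[abs_def] sd_part_def)

text \<open>
  The contraction of \<open>u\<close> with the three-form dual to \<open>\<theta>\<close> is, up to sign, the Hodge dual of \<open>u \<and> \<theta>\<close>, so both have
  the same self-dual part up to sign. The choice of \<open>torsion_dual\<close> makes the sign positive.
\<close>

lemma sd_op_shift: assumes q: "q \<in> U" shows "sd_op q u = L.sd_op q u + Kvec u (torsion_dual q)"
proof -
  have Lw: "L.sd_op q u = sd_part (L.conn_op q u)" by (simp add: L.sd_op_def L.sd_form_def L.conn_op_def[abs_def] sd_part_def)
  have "sd_op q u = L.sd_op q u + sd_part (conn_diff q u)"
    unfolding sd_op_sdvec Lw by (simp add: vec_eq_iff[where 'b=3] forall_3 sd_part_def conn_diff_def)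
  moreover have "sd_part (conn_diff q u) = Kvec u (torsion_dual q)"
  proof -
    define a b c d where ad: "a = conn_diff q (axis 2 1) (axis 3 1) $ 4" "b = conn_diff q (axis 1 1) (axis 3 1) $ 4"
      "c = conn_diff q (axis 1 1) (axis 2 1) $ 4" "d = conn_diff q (axis 1 1) (axis 2 1) $ 3"
    have torsion_dual: "torsion_dual q = vector [- a, b, - c, d]" by (simp only: torsion_dual_def ad)
    note ac = alternating_components[OF conn_diff_linear[OF q] conn_diff_skew[OF q], folded ad]
    show ?thesis
      by (simp add: vec_eq_iff[where 'b=3] forall_3 sd_part_def Kvec_nth inner_vec_def sum_4 torsion_dual ac axis_def)
  qed
  ultimately show ?thesis by simp
qed

lemma dv_Kvec: assumes q: "q \<in> U" and v: "v \<in> T q" and f: "smc q f"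
  shows "dv v (\<lambda>r. Kvec u (f r)) = Kvec u (dv v f)"
proof -
  have "dv v (\<lambda>r. Kvec u (f r)) $ a = Kvec u (dv v f) $ a" for a
  proof -
    have "dv v (\<lambda>r. Kvec u (f r)) $ a = v (\<lambda>r. \<Sum>i\<in>UNIV. Kop (axis a 1) u $ i * f r $ i)"
      by (simp add: Kvec_nth inner_vec_def)
    also have "\<dots> = (\<Sum>i\<in>UNIV. Kop (axis a 1) u $ i * v (\<lambda>r. f r $ i))"
      by (subst T_sum[OF q v]) (auto intro!: sm_mult q sm_const smcD[OF f] simp: T_cmult[OF q v smcD[OF f]])
    finally show ?thesis by (simp add: Kvec_nth inner_vec_def)
  qed
  then show ?thesis by (simp add: vec_eq_iff)
qed

lemma Kvec_smc: assumes q: "q \<in> U" and f: "smc q f" shows "smc q (\<lambda>r. Kvec u (f r))"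
  unfolding smc_def Kvec_nth inner_vec_def by (intro allI) (simp, intro sm_sum sm_mult q sm_const smcD[OF f])

lemma Kvec_conn_op: assumes q: "q \<in> U"
  shows "Kvec (L.conn_op q u v) w = cross3 (L.sd_op q u) (Kvec v w) - Kvec v (L.conn_op q u w)"
proof -
  have "Kvec (L.conn_op q u v) w $ a = (cross3 (L.sd_op q u) (Kvec v w) - Kvec v (L.conn_op q u w)) $ a" for a
  proof -
    have "Kop (axis a 1) (L.conn_op q u v) = L.conn_op q u (Kop (axis a 1) v) - Kop (cross3 (L.sd_op q u) (axis a 1)) v"
      using L.conn_form_Kop[OF q frame_vec_T[OF q], of u "axis a 1" v] by (simp add: L.conn_op_def L.sd_op_def)
    then have "Kvec (L.conn_op q u v) w $ a = - (Kvec v (L.conn_op q u w) $ a) - cross3 (L.sd_op q u) (axis a 1) \<bullet> Kvec v w"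
      by (simp add: Kvec_nth inner_diff_left L.conn_op_skew[OF q] Kop_inner_Kvec)
    moreover have "cross3 (L.sd_op q u) (axis a 1) \<bullet> Kvec v w = - (cross3 (L.sd_op q u) (Kvec v w) $ a)"
      using exhaust_3[of a] by (elim disjE) (simp_all add: vec3 axis_def)
    ultimately show ?thesis by simp
  qed
  then show ?thesis by (simp add: vec_eq_iff)
qed

lemma Kvec_lin: "Kvec u (v + w) = Kvec u v + Kvec u w" "Kvec (u - v) w = Kvec u w - Kvec v w"
  by (simp_all add: vec_eq_iff Kvec_nth inner_add_right Kop_lin inner_diff_left)

text \<open>
  The usual formula for the change of the curvature, \<open>d\<^sup>L \<alpha> + \<alpha> \<times> \<alpha>\<close> with \<open>\<alpha> u = Kvec u \<theta>\<close>. Since \<open>Kvec\<close> is parallel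
  (\<open>Kvec_conn_op\<close>) and \<open>L\<close> is torsion-free, the exterior derivative only sees the covariant derivative \<open>\<eta>\<close> of \<open>\<theta>\<close>.
\<close>

lemma sd_curv_shift: assumes q: "q \<in> U"
  defines "\<eta> \<equiv> \<lambda>u. dv (frame_vec q u) torsion_dual + L.conn_op q u (torsion_dual q)"
  shows "sd_curv q u v = L.sd_curv q u v + (Kvec v (\<eta> u) - Kvec u (\<eta> v) + cross3 (Kvec u (torsion_dual q)) (Kvec v (torsion_dual q)))"
proof -
  have d: "dv (frame_vec q u) (\<lambda>r. sd_op r v) = dv (frame_vec q u) (\<lambda>r. L.sd_op r v) + Kvec v (dv (frame_vec q u) torsion_dual)" for u v
  proof -
    have "dv (frame_vec q u) (\<lambda>r. sd_op r v) = dv (frame_vec q u) (\<lambda>r. L.sd_op r v + Kvec v (torsion_dual r))"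
      by (rule dv_cong[OF q frame_vec_T[OF q] nb_all[OF q]]) (rule sd_op_shift)
    also have "\<dots> = dv (frame_vec q u) (\<lambda>r. L.sd_op r v) + dv (frame_vec q u) (\<lambda>r. Kvec v (torsion_dual r))"
      by (rule dv_add[OF q frame_vec_T[OF q] L.sd_op_smc[OF q] Kvec_smc[OF q torsion_dual_smc[OF q]]])
    finally show ?thesis by (simp only: dv_Kvec[OF q frame_vec_T[OF q] torsion_dual_smc[OF q]])
  qed
  have b: "Kvec (frame_brk q u v) (torsion_dual q) = cross3 (L.sd_op q u) (Kvec v (torsion_dual q)) - Kvec v (L.conn_op q u (torsion_dual q))
      - (cross3 (L.sd_op q v) (Kvec u (torsion_dual q)) - Kvec u (L.conn_op q v (torsion_dual q)))"
    by (simp only: L_brk_conn_op[OF q] Kvec_lin Kvec_conn_op[OF q])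
  have c: "cross3 (L.sd_op q v) (Kvec u (torsion_dual q)) = - cross3 (Kvec u (torsion_dual q)) (L.sd_op q v)" by (rule cross_skew)
  show ?thesis
    unfolding sd_curv_def L.sd_curv_def d sd_op_shift[OF q] b c \<eta>_def Kvec_lin
    by (simp add: cross_add_left cross_add_right algebra_simps)
qed

lemma curv_cond_levi_civita: assumes q: "q \<in> U"
  shows "curv_cond (\<lambda>i j. sd_curv q (axis i 1) (axis j 1)) \<longleftrightarrow> curv_cond (\<lambda>i j. L.sd_curv q (axis i 1) (axis j 1))"
  by (rule curv_cond_shift[of _ _ "\<lambda>i. dv (frame_vec q (axis i 1)) torsion_dual + L.conn_op q (axis i 1) (torsion_dual q)" "torsion_dual q"]) (rule sd_curv_shift[OF q])

end

section \<open>Integrability\<close>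

text \<open>
  Both sides are conditions at each point \<open>p\<close>. Over a framed chart around \<open>p\<close> they are equivalent to \<open>curv_cond\<close> for \<open>D\<close> and
  for the Levi-Civita connection, respectively.
\<close>

theorem theorem1:
  fixes X :: "'a topology"
    and A :: "('a, real^4) chart set"
    and g :: "'a metric"
    and D :: "'a connection"
  assumes "oriented_manifold X A"
    and "riemannian_metric A g"
    and "metric_connection A g D"
    and "skew_symmetric_torsion A g D"
  shows "integrable_acs (endo_atlas A) (twistor_space A g) (ahs_structure A g D)
     \<longleftrightarrow> anti_self_dual A g"
proof -
  let ?N = "\<lambda>z. \<forall>Y Y'. vfield_near (endo_atlas A) (twistor_space A g) z Y \<and> vfield_near (endo_atlas A) (twistor_space A g) z Y' \<longrightarrow>
    nijenhuis (endo_atlas A) (twistor_space A g) (ahs_structure A g D) Y Y' z = 0"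
  note lc = levi_civita_exists[OF assms]
  have pt: "(\<forall>J. (p, J) \<in> twistor_space A g \<longrightarrow> ?N (p, J)) \<longleftrightarrow> (\<forall>\<beta>\<in>self_dual_bivectors A g p. weyl_operator A g p \<beta> = 0)"
    if p: "p \<in> points A" for p
  proof -
    obtain U \<phi> E where m: "framed_chart X A U \<phi> g E" "p \<in> U" by (rule framed_chart_ex[OF assms(1,2) p])
    interpret F: framed_chart X A U \<phi> g E by (rule m(1))
    interpret C: connection_comparison X A U \<phi> g E D
      by unfold_locales (use assms(3,4) lc F.pts in auto)
    show ?thesis
      using C.integrable_at[OF m(2) assms(4)] C.curv_cond_levi_civita[OF m(2)] C.L.asd_at[OF m(2)] by simp
  qed
  have "integrable_acs (endo_atlas A) (twistor_space A g) (ahs_structure A g D)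
     \<longleftrightarrow> (\<forall>p\<in>points A. \<forall>J. (p, J) \<in> twistor_space A g \<longrightarrow> ?N (p, J))"
    unfolding integrable_acs_def by (auto simp: twistor_space_def)
  then show ?thesis unfolding anti_self_dual_def using pt by simp
qed

end
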